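(* Let $(R, {\mathfrak m})$ be a local Cohen--Macaulay ring of dimension $d$ with infinite residue field, $I$ an ${\mathfrak m}$-primary ideal of multiplicity $e$, $f$ an $R$-regular element, and ${\mathcal B}$ a generic $d$-generated ideal in $IT$. Then $$\mathrm{core}(I) = [{\mathcal B} :_T ({\mathcal B} :_T f^e)]_0.$$
   Context: A reduction of an ideal $I$ is an ideal $J \subset I$ with $I^{r+1} = JI^r$ for some $r \ge 0$; $\mathrm{core}(I)$ is the intersection of all reductions of $I$. The multiplicity of the ${\mathfrak m}$-primary ideal $I$ is the Hilbert--Samuel multiplicity $e = e_I(R)$. Generic ideal: write $I=(f_1,\dots,f_n)$, let $X_{jl}$ ($1\le j\le n$, $1\le l\le d$) be variables over $R$ and $T=R[\{X_{jl}\}]$. The $T$-ideal ${\mathcal B}$ generated by $\sum_{j=1}^n X_{jl}f_j$, $1\le l\le d$, is called a generic $d$-generated ideal in $IT$. $T$ is graded with $\deg X_{jl}=1$ and $R$ in degree $0$, and $[\ ]_0$ denotes the degree-zero component of a homogeneous ideal of $T$, i.e. its intersection with $R$.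
   Formalization: The R-regular element f is taken to be a non-zero-divisor that is not a unit (so f lies in the maximal ideal); for a unit f the right-hand side is all of R, while core(I) is a proper ideal, so the formula fails. *)

theory Defs
  imports Complex_Main "HOL-Library.Extended_Nat" "HOL-Algebra.Algebra"
begin

section \<open>Local rings, dimension, depth\<close>

text \<open>Following the usual convention in commutative algebra, local rings are commutative and
  Noetherian.\<close>

definition noetherian_local_ring :: "('a, 'b) ring_scheme \<Rightarrow> 'a set \<Rightarrow> bool" where
  "noetherian_local_ring R M \<longleftrightarrow>
     cring R \<and> noetherian_ring R \<and> maximalideal M R \<and> (\<forall>N. maximalideal N R \<longrightarrow> N = M)"

definition krull_dim :: "('a, 'b) ring_scheme \<Rightarrow> enat" where
  "krull_dim R = Sup {enat n | n. \<exists>P :: nat \<Rightarrow> 'a set.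
     (\<forall>i\<le>n. primeideal (P i) R) \<and> (\<forall>i<n. P i \<subset> P (Suc i))}"

text \<open>As usual, a regular sequence is required to generate a proper ideal.\<close>

definition regular_sequence :: "('a, 'b) ring_scheme \<Rightarrow> 'a list \<Rightarrow> bool" where
  "regular_sequence R xs \<longleftrightarrow>
     set xs \<subseteq> carrier R \<and>
     (\<forall>i<length xs. \<forall>a\<in>carrier R.
        xs ! i \<otimes>\<^bsub>R\<^esub> a \<in> Idl\<^bsub>R\<^esub> (set (take i xs)) \<longrightarrow> a \<in> Idl\<^bsub>R\<^esub> (set (take i xs))) \<and>
     Idl\<^bsub>R\<^esub> (set xs) \<noteq> carrier R"

text \<open>An \<open>R\<close>-regular element is an \<open>R\<close>-regular sequence of length one; in particular it is not
  a unit.\<close>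

definition regular_element :: "('a, 'b) ring_scheme \<Rightarrow> 'a \<Rightarrow> bool" where
  "regular_element R f \<longleftrightarrow> regular_sequence R [f]"

definition depth :: "('a, 'b) ring_scheme \<Rightarrow> 'a set \<Rightarrow> enat" where
  "depth R M = Sup {enat (length xs) | xs. set xs \<subseteq> M \<and> regular_sequence R xs}"

definition cohen_macaulay_local_ring :: "('a, 'b) ring_scheme \<Rightarrow> 'a set \<Rightarrow> bool" where
  "cohen_macaulay_local_ring R M \<longleftrightarrow> noetherian_local_ring R M \<and> depth R M = krull_dim R"


section \<open>Primary ideals, reductions, core\<close>

definition primary_ideal :: "('a, 'b) ring_scheme \<Rightarrow> 'a set \<Rightarrow> bool" where
  "primary_ideal R I \<longleftrightarrow> ideal I R \<and> I \<noteq> carrier R \<and>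
     (\<forall>a\<in>carrier R. \<forall>b\<in>carrier R. a \<otimes>\<^bsub>R\<^esub> b \<in> I \<longrightarrow> a \<in> I \<or> (\<exists>k::nat. b [^]\<^bsub>R\<^esub> k \<in> I))"

definition radical :: "('a, 'b) ring_scheme \<Rightarrow> 'a set \<Rightarrow> 'a set" where
  "radical R I = {a \<in> carrier R. \<exists>k::nat. a [^]\<^bsub>R\<^esub> k \<in> I}"

definition primary_to :: "('a, 'b) ring_scheme \<Rightarrow> 'a set \<Rightarrow> 'a set \<Rightarrow> bool" where
  "primary_to R M I \<longleftrightarrow> primary_ideal R I \<and> radical R I = M"

abbreviation ideal_pow :: "('a, 'b) ring_scheme \<Rightarrow> 'a set \<Rightarrow> nat \<Rightarrow> 'a set" where
  "ideal_pow R I k \<equiv> I [^]\<^bsub>ideals_set R\<^esub> k"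

definition reduction :: "('a, 'b) ring_scheme \<Rightarrow> 'a set \<Rightarrow> 'a set \<Rightarrow> bool" where
  "reduction R I J \<longleftrightarrow> ideal J R \<and> J \<subseteq> I \<and>
     (\<exists>r. ideal_pow R I (r + 1) = J \<cdot>\<^bsub>R\<^esub> ideal_pow R I r)"

definition core :: "('a, 'b) ring_scheme \<Rightarrow> 'a set \<Rightarrow> 'a set" where
  "core R I = \<Inter>{J. reduction R I J}"


section \<open>Hilbert--Samuel multiplicity\<close>

text \<open>The length of a ring as a module over itself. For a quotient ring \<open>R Quot J\<close> this is also
  its length as an \<open>R\<close>-module.\<close>

definition ring_length :: "('a, 'b) ring_scheme \<Rightarrow> enat" where
  "ring_length A = Sup {enat n | n. \<exists>C :: nat \<Rightarrow> 'a set.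
     (\<forall>i\<le>n. ideal (C i) A) \<and> (\<forall>i<n. C i \<subset> C (Suc i))}"

text \<open>\<open>e = lim d! \<lambda>(R/I\<^sup>k) / k\<^sup>d\<close> with \<open>d = dim R\<close>; for \<open>I\<close> primary to the maximal ideal of a
  local ring, the dimension and all lengths are finite.\<close>

definition has_multiplicity :: "('a, 'b) ring_scheme \<Rightarrow> 'a set \<Rightarrow> nat \<Rightarrow> bool" where
  "has_multiplicity R I e \<longleftrightarrow>
     (let d = the_enat (krull_dim R) in
        (\<lambda>k. fact d * real (the_enat (ring_length (R Quot (ideal_pow R I k)))) / real k ^ d)
          \<longlonglongrightarrow> real e)"


section \<open>Polynomial rings and generic ideals\<close>

text \<open>The polynomial ring over \<open>R\<close> in the variables indexed by \<open>V\<close>. Its elements are those of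
  \<^theory>\<open>HOL-Algebra.Indexed_Polynomials\<close>: functions from monomials, which are multisets of indices,
  to coefficients. That theory provides no multiplication, so it is defined here by convolution.\<close>

definition poly_ring_in :: "('a, 'b) ring_scheme \<Rightarrow> 'v set \<Rightarrow> ('v multiset \<Rightarrow> 'a) ring" where
  "poly_ring_in R V =
     \<lparr>carrier = ring.indexed_pset R V (carrier R),
      monoid.mult = (\<lambda>P Q m. \<Oplus>\<^bsub>R\<^esub>k\<in>{k. k \<subseteq># m}. P k \<otimes>\<^bsub>R\<^esub> Q (m - k)),
      one = ring.indexed_const R \<one>\<^bsub>R\<^esub>,
      ring.zero = ring.indexed_const R \<zero>\<^bsub>R\<^esub>,
      ring.add = ring.indexed_padd R\<rparr>"

text \<open>The pair \<open>(j, l)\<close> is the index of the variable \<open>X\<^sub>j\<^sub>l\<close>.\<close>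

definition generic_ring :: "('a, 'b) ring_scheme \<Rightarrow> nat \<Rightarrow> nat \<Rightarrow> ((nat \<times> nat) multiset \<Rightarrow> 'a) ring"
  where "generic_ring R n d = poly_ring_in R ({1..n} \<times> {1..d})"

definition generic_ideal ::
  "('a, 'b) ring_scheme \<Rightarrow> nat \<Rightarrow> (nat \<Rightarrow> 'a) \<Rightarrow> nat \<Rightarrow> ((nat \<times> nat) multiset \<Rightarrow> 'a) set" where
  "generic_ideal R n g d =
     (let T = generic_ring R n d in
      Idl\<^bsub>T\<^esub> ((\<lambda>l. \<Oplus>\<^bsub>T\<^esub>j\<in>{1..n}. ring.indexed_var R (j, l) \<otimes>\<^bsub>T\<^esub> ring.indexed_const R (g j)) ` {1..d}))"

definition colon :: "('a, 'b) ring_scheme \<Rightarrow> 'a set \<Rightarrow> 'a set \<Rightarrow> 'a set" where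
  "colon T J S = {t \<in> carrier T. \<forall>s\<in>S. t \<otimes>\<^bsub>T\<^esub> s \<in> J}"

text \<open>The degree-zero component of a homogeneous ideal \<open>K\<close>, i.e. \<open>K \<inter> R\<close>, as a subset of \<open>R\<close>.\<close>

definition degree_zero_part :: "('a, 'b) ring_scheme \<Rightarrow> ('v multiset \<Rightarrow> 'a) set \<Rightarrow> 'a set" where
  "degree_zero_part R K = {a \<in> carrier R. ring.indexed_const R a \<in> K}"

end

theory Submission
  imports Defs "HOL-Library.Multiset_Order" "HOL-Library.Product_Lexorder"
begin

text \<open>Every reduction of \<open>I\<close> contains one that is generated by \<open>d\<close> elements, hence is the value
  \<open>B(y)\<close> of the generic ideal \<open>B\<close> at a point \<open>y\<close>. Its generators form a system of parameters, so by
  the Cohen--Macaulay property its colength is at most \<open>e\<close>; since the ideals generated by the powers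
  of \<open>f\<close> modulo \<open>B(y)\<close> form a strict chain until they vanish, \<open>f\<^sup>e\<close> lies in \<open>core(I)\<close>.

  The core consists of the \<open>a \<in> R\<close> with \<open>v a \<in> B\<close> for some \<open>v \<in> T\<close> outside the extension of the
  maximal ideal. If there is no such \<open>v\<close>, then \<open>a \<notin> B(y)\<close> at a general point \<open>y\<close>, where \<open>B(y)\<close> is a
  reduction, and such points exist because the residue field is infinite. For the converse, a
  reduction \<open>B(y)\<close> yields, by Nakayama's lemma over \<open>T\<close>, some \<open>u\<close> with \<open>u(y) = 1\<close> for which \<open>u I\<^sup>k \<subseteq> B\<close>
  for some \<open>k\<close>; then \<open>u a\<close> is \<open>I\<close>-torsion modulo \<open>B\<close> and \<open>v u a \<in> B\<close>. By depth sensitivity of the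
  Koszul complex of the generic forms this forces \<open>u a \<in> B\<close>, whence \<open>a \<in> B(y)\<close>.

  In particular \<open>v f\<^sup>e \<in> B\<close> for some such \<open>v\<close>, so \<open>[B : (B : f\<^sup>e)]\<^sub>0\<close> is contained in the core. The other inclusion
  uses depth sensitivity once more, as \<open>B : f\<^sup>e\<close> is \<open>I\<close>-torsion modulo \<open>B\<close> for \<open>R\<close>-regular \<open>f\<close>.\<close>

text \<open>Write \<open>MT\<close> for the extension of the maximal ideal. Multipliers outside
  \<open>MT\<close> stand in for localisation at \<open>MT\<close>: the core is the contraction of
  the localised \<open>B\<close>, and the double colon recovers it because \<open>MT\<close> is the
  only associated prime of \<open>B\<close> that contains \<open>I\<close>. No localisation, primary
  decomposition or homology module is formed; Koszul classes are chains with congruences, so every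
  step is an equation in \<open>R\<close> or \<open>T\<close>. The obstacle is a reduction
  \<open>B(y)\<close> at a special point: a multiplier \<open>v\<close> with \<open>v a\<close> in
  \<open>B\<close> may vanish at \<open>y\<close> modulo \<open>M\<close>, so that evaluation says
  nothing about \<open>a\<close>. Hence \<open>v\<close> has to be cancelled inside
  \<open>T\<close>, which works for elements that are also \<open>I\<close>-torsion modulo
  \<open>B\<close>; the auxiliary \<open>u\<close> with value 1 at \<open>y\<close> provides that
  torsion. The double colon uses of the exponent \<open>e\<close> only that \<open>f^e\<close> lies
  in the core. The number \<open>d\<close> enters twice: as the order of growth of the lengths of
  \<open>R/I^k\<close>, which limits the generators of a small reduction, and as the length of a
  regular sequence, which matches the number of generic forms.\<close>

section \<open>Koszul complexes\<close>

context cring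
begin

section \<open>Ideals generated by a list over a base ideal\<close>

lemma ideal_minus_closed: "ideal A R \<Longrightarrow> a \<in> A \<Longrightarrow> b \<in> A \<Longrightarrow> a \<ominus> b \<in> A"
  by (simp add: a_minus_def additive_subgroup.a_closed additive_subgroup.a_inv_closed ideal.axioms(1))

lemmas ideal_add_closed = additive_subgroup.a_closed[OF ideal.axioms(1)]
lemmas ideal_uminus_closed = additive_subgroup.a_inv_closed[OF ideal.axioms(1)]
lemmas ideal_zero_closed = additive_subgroup.zero_closed[OF ideal.axioms(1)]

text \<open>The ideal generated by \<open>A\<close> and the listed elements, built one element at a
  time: Koszul complexes, composition series and independent families below are all inductions that
  peel off the head.\<close>

fun lin :: "'a list \<Rightarrow> 'a set \<Rightarrow> 'a set" where
  "lin [] A = A"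
| "lin (b # bs) A = {q \<otimes> b \<oplus> r |q r. q \<in> carrier R \<and> r \<in> lin bs A}"

lemma lin_ideal:
  assumes "ideal A R" "set bs \<subseteq> carrier R"
  shows "ideal (lin bs A) R"
  using assms(2)
proof (induction bs)
  case Nil
  then show ?case using assms by simp
next
  case (Cons b bs)
  then have b: "b \<in> carrier R" and I: "ideal (lin bs A) R" by auto
  have c: "x \<in> carrier R" if "x \<in> lin bs A" for x using ideal.Icarr[OF I that] .
  show ?case
  proof (rule idealI)
    show "subgroup (lin (b # bs) A) (add_monoid R)"
    proof (rule add.subgroupI)
      show "lin (b # bs) A \<subseteq> carrier R" using b c by auto
      have "\<zero> \<otimes> b \<oplus> \<zero> \<in> lin (b # bs) A" using ideal_zero_closed[OF I] by auto
      then show "lin (b # bs) A \<noteq> {}" by blast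
    next
      fix x assume "x \<in> lin (b # bs) A"
      then obtain q r where q: "x = q \<otimes> b \<oplus> r" "q \<in> carrier R" "r \<in> lin bs A" by auto
      then have "\<ominus> x = (\<ominus> q) \<otimes> b \<oplus> (\<ominus> r)" using b c by algebra
      then show "\<ominus> x \<in> lin (b # bs) A" using q ideal_uminus_closed[OF I] by auto
    next
      fix x y assume "x \<in> lin (b # bs) A" "y \<in> lin (b # bs) A"
      then obtain q r q' r' where q: "x = q \<otimes> b \<oplus> r" "q \<in> carrier R" "r \<in> lin bs A"
        "y = q' \<otimes> b \<oplus> r'" "q' \<in> carrier R" "r' \<in> lin bs A" by auto
      then have "x \<oplus> y = (q \<oplus> q') \<otimes> b \<oplus> (r \<oplus> r')" using b c by algebra
      then show "x \<oplus> y \<in> lin (b # bs) A" using q ideal_add_closed[OF I] by auto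
    qed
  next
    fix x a assume "x \<in> carrier R" "a \<in> lin (b # bs) A"
    then obtain q r where q: "a = q \<otimes> b \<oplus> r" "q \<in> carrier R" "r \<in> lin bs A" by auto
    then have "x \<otimes> a = (x \<otimes> q) \<otimes> b \<oplus> (x \<otimes> r)" using b c \<open>x \<in> carrier R\<close> by algebra
    then show l: "x \<otimes> a \<in> lin (b # bs) A"
      using q ideal.I_l_closed[OF I] \<open>x \<in> carrier R\<close> by auto
    have "a \<otimes> x = x \<otimes> a" using \<open>x \<in> carrier R\<close> q b c m_comm by auto
    then show "a \<otimes> x \<in> lin (b # bs) A" using l by simp
  qed (rule ring_axioms)
qed

lemma lin_superset:
  assumes "ideal A R" "set bs \<subseteq> carrier R"
  shows "A \<subseteq> lin bs A" "set bs \<subseteq> lin bs A"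
  using assms(2)
proof (induction bs)
  case (Cons b bs)
  { case 1
    show ?case
    proof
      fix x assume "x \<in> A"
      then have "x = \<zero> \<otimes> b \<oplus> x" "x \<in> lin bs A"
        using 1 ideal.Icarr[OF assms(1)] Cons.IH(1) by auto
      then show "x \<in> lin (b # bs) A"
        using zero_closed by (metis (mono_tags, lifting) lin.simps(2) mem_Collect_eq)
    qed
  next
    case 2
    have z: "\<zero> \<in> lin bs A" using ideal_zero_closed[OF lin_ideal[OF assms(1)]] 2 by simp
    have "b = \<one> \<otimes> b \<oplus> \<zero>" using 2 by simp
    then have "b \<in> lin (b # bs) A" using z 2 by (metis (mono_tags, lifting) lin.simps(2) mem_Collect_eq one_closed)
    moreover have "x \<in> lin (b # bs) A" if "x \<in> set bs" for x
    proof -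
      have "x = \<zero> \<otimes> b \<oplus> x" "x \<in> lin bs A" using that 2 Cons.IH(2) by auto
      then show ?thesis using zero_closed by (metis (mono_tags, lifting) lin.simps(2) mem_Collect_eq)
    qed
    ultimately show ?case by auto }
qed auto

lemma lin_minimal:
  assumes "ideal L R" "A \<subseteq> L" "set bs \<subseteq> L"
  shows "lin bs A \<subseteq> L"
  using assms(3)
proof (induction bs)
  case (Cons b bs)
  then have "lin bs A \<subseteq> L" "b \<in> L" by auto
  then have "q \<otimes> b \<oplus> r \<in> L" if "q \<in> carrier R" "r \<in> lin bs A" for q r
    using that ideal_add_closed[OF assms(1)] ideal.I_l_closed[OF assms(1)] by blast
  then show ?case by auto
qed (use assms in simp)

lemma lin_zero_eq_Idl:
  assumes "set bs \<subseteq> carrier R"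
  shows "lin bs {\<zero>} = Idl (set bs)"
proof
  show "lin bs {\<zero>} \<subseteq> Idl (set bs)"
    using genideal_self[OF assms] ideal_zero_closed[OF genideal_ideal[OF assms]]
    by (intro lin_minimal genideal_ideal assms) auto
  show "Idl (set bs) \<subseteq> lin bs {\<zero>}"
    using lin_superset[OF zeroideal assms] lin_ideal[OF zeroideal assms] genideal_minimal by blast
qed

text \<open>A chain over \<open>bs\<close> assigns a coefficient to every subset of the positions of \<open>bs\<close>, encoded by
  its indicator list. Only lists of the length of \<open>bs\<close> matter, and the degree is the number of
  occurrences of \<open>True\<close>. The recursion is that of the mapping cone of multiplication by the head.\<close>

fun kd :: "'a list \<Rightarrow> (bool list \<Rightarrow> 'a) \<Rightarrow> bool list \<Rightarrow> 'a" where
  "kd [] w s = \<zero>"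
| "kd (b # bs) w [] = \<zero>"
| "kd (b # bs) w (False # s) = kd bs (\<lambda>t. w (False # t)) s \<oplus> b \<otimes> w (True # s)"
| "kd (b # bs) w (True # s) = \<ominus> kd bs (\<lambda>t. w (True # t)) s"

abbreviation chain :: "(bool list \<Rightarrow> 'a) \<Rightarrow> bool" where
  "chain w \<equiv> (\<forall>s. w s \<in> carrier R)"

abbreviation kpos :: "'a list \<Rightarrow> nat \<Rightarrow> bool list \<Rightarrow> bool" where
  "kpos bs p s \<equiv> length s = length bs \<and> count_list s True = p"

lemma bool_list_cases:
  obtains "s = []" | t where "s = False # t" | t where "s = True # t"
  by (cases s; cases "hd s"; fastforce)

lemma kd_closed [simp]:
  assumes "set bs \<subseteq> carrier R" "chain w"
  shows "kd bs w s \<in> carrier R"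
  using assms
proof (induction bs arbitrary: w s)
  case (Cons b bs)
  then show ?case by (cases s rule: bool_list_cases) auto
qed simp

lemma kd_add:
  assumes "set bs \<subseteq> carrier R" "chain w" "chain w'"
  shows "kd bs (\<lambda>s. w s \<oplus> w' s) s = kd bs w s \<oplus> kd bs w' s"
  using assms
proof (induction bs arbitrary: w w' s)
  case (Cons b bs)
  have *: "kd bs (\<lambda>t. w (c # t) \<oplus> w' (c # t)) t = kd bs (\<lambda>t. w (c # t)) t \<oplus> kd bs (\<lambda>t. w' (c # t)) t"
    for c t using Cons.IH[of "\<lambda>t. w (c # t)" "\<lambda>t. w' (c # t)"] Cons.prems by auto
  have k: "kd bs (\<lambda>t. w (c # t)) t \<in> carrier R" "kd bs (\<lambda>t. w' (c # t)) t \<in> carrier R" for c t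
    using Cons.prems by auto
  have b: "b \<in> carrier R" "\<And>t. w t \<in> carrier R" "\<And>t. w' t \<in> carrier R" using Cons.prems by auto
  show ?case
    by (cases s rule: bool_list_cases)
       (simp_all add: *, use k b in \<open>simp_all add: r_distr minus_add a_ac\<close>)
qed simp

lemma kd_smult:
  assumes "set bs \<subseteq> carrier R" "chain w" "c \<in> carrier R"
  shows "kd bs (\<lambda>s. c \<otimes> w s) s = c \<otimes> kd bs w s"
  using assms
proof (induction bs arbitrary: w s)
  case (Cons b bs)
  have *: "kd bs (\<lambda>t. c \<otimes> w (d # t)) t = c \<otimes> kd bs (\<lambda>t. w (d # t)) t"
    for d t using Cons.IH[of "\<lambda>t. w (d # t)"] Cons.prems by auto
  have k: "kd bs (\<lambda>t. w (d # t)) t \<in> carrier R" for d t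
    using Cons.prems by auto
  have b: "b \<in> carrier R" "\<And>t. w t \<in> carrier R" using Cons.prems by auto
  show ?case
    by (cases s rule: bool_list_cases)
       (simp_all add: *, use k b assms(3) in \<open>simp_all add: r_distr r_minus m_ac\<close>)
qed simp

lemma kd_uminus:
  assumes "set bs \<subseteq> carrier R" "chain w"
  shows "kd bs (\<lambda>s. \<ominus> w s) s = \<ominus> kd bs w s"
proof -
  have "(\<lambda>s. \<ominus> w s) = (\<lambda>s. (\<ominus> \<one>) \<otimes> w s)" using assms by (auto simp: l_minus)
  then show ?thesis using kd_smult[of bs w "\<ominus> \<one>" s] assms by (simp add: l_minus)
qed

lemma kd_minus:
  assumes "set bs \<subseteq> carrier R" "chain w" "chain w'"
  shows "kd bs (\<lambda>s. w s \<ominus> w' s) s = kd bs w s \<ominus> kd bs w' s"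
  using kd_add[of bs w "\<lambda>s. \<ominus> w' s" s] kd_uminus[of bs w' s] assms by (simp add: a_minus_def)

text \<open>The sign in the \<open>True\<close> clause of \<open>kd\<close> makes the two mixed
  terms cancel; the rest is the induction hypothesis on each half.\<close>

lemma kd_kd:
  assumes "set bs \<subseteq> carrier R" "chain w"
  shows "kd bs (kd bs w) s = \<zero>"
  using assms
proof (induction bs arbitrary: w s)
  case (Cons b bs)
  note c = Cons.prems
  have F: "(\<lambda>t. kd (b # bs) w (False # t)) = (\<lambda>t. kd bs (\<lambda>t. w (False # t)) t \<oplus> b \<otimes> w (True # t))"
    and T: "(\<lambda>t. kd (b # bs) w (True # t)) = (\<lambda>t. \<ominus> kd bs (\<lambda>t. w (True # t)) t)"
    by simp_all
  show ?case
  proof (cases s rule: bool_list_cases)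
    case (2 t)
    have "kd bs (\<lambda>t. kd bs (\<lambda>t. w (False # t)) t \<oplus> b \<otimes> w (True # t)) t =
      kd bs (kd bs (\<lambda>t. w (False # t))) t \<oplus> b \<otimes> kd bs (\<lambda>t. w (True # t)) t"
      using c by (simp add: kd_add kd_smult)
    then show ?thesis using 2 c Cons.IH[of "\<lambda>t. w (False # t)"]
      by (simp add: F r_minus r_neg)
  next
    case (3 t)
    then show ?thesis using c Cons.IH[of "\<lambda>t. w (True # t)"] kd_uminus[of bs "kd bs (\<lambda>t. w (True # t))"]
      by (simp add: T)
  qed simp
qed simp

text \<open>The differential in degree \<open>p\<close> reads only positions of degree
  \<open>Suc p\<close>. Congruences modulo an ideal therefore pass through it, and values at other
  lists never interfere.\<close>

lemma kd_in_ideal: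
  assumes "set bs \<subseteq> carrier R" "chain w" "ideal A R"
    and "\<And>t. kpos bs (Suc p) t \<Longrightarrow> w t \<in> A" and "kpos bs p s"
  shows "kd bs w s \<in> A"
  using assms
proof (induction bs arbitrary: w s p)
  case Nil
  then show ?case by (simp add: ideal_zero_closed)
next
  case (Cons b bs)
  note A = Cons.prems(3)
  show ?case
  proof (cases s rule: bool_list_cases)
    case (2 t)
    have "kd bs (\<lambda>t. w (False # t)) t \<in> A"
      using Cons.prems 2 by (intro Cons.IH[of _ p]) auto
    moreover have "w (True # t) \<in> A" using Cons.prems(4)[of "True # t"] Cons.prems(5) 2 by simp
    ultimately show ?thesis using 2 Cons.prems(1)
      by (auto intro!: ideal_add_closed[OF A] ideal.I_l_closed[OF A])
  next
    case (3 t)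
    then obtain p' where p: "p = Suc p'" using Cons.prems(5) by auto
    have "kd bs (\<lambda>t. w (True # t)) t \<in> A"
      using Cons.prems 3 p by (intro Cons.IH[of _ p']) auto
    then show ?thesis using 3 ideal_uminus_closed[OF A] by auto
  qed (use ideal_zero_closed[OF A] in simp)
qed

section \<open>Cycles and boundaries of the Koszul complex modulo an ideal\<close>

definition kcycle :: "'a list \<Rightarrow> 'a set \<Rightarrow> nat \<Rightarrow> (bool list \<Rightarrow> 'a) \<Rightarrow> bool" where
  "kcycle bs A p w \<longleftrightarrow> chain w \<and> (\<forall>s q. p = Suc q \<longrightarrow> kpos bs q s \<longrightarrow> kd bs w s \<in> A)"

text \<open>Together with \<open>kcycle\<close> this expresses the homology with coefficients in
  \<open>R/A\<close> by chains over \<open>R\<close> and congruences. In degree 0 every chain is a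
  cycle, which is why \<open>kcycle\<close> speaks only of \<open>p = Suc q\<close>.\<close>

definition kbdry :: "'a list \<Rightarrow> 'a set \<Rightarrow> nat \<Rightarrow> (bool list \<Rightarrow> 'a) \<Rightarrow> bool" where
  "kbdry bs A p w \<longleftrightarrow> (\<exists>v. chain v \<and> (\<forall>s. kpos bs p s \<longrightarrow> w s \<ominus> kd bs v s \<in> A))"

lemma kbdry_smult:
  assumes "ideal A R" "set bs \<subseteq> carrier R" "chain w" "c \<in> carrier R" "kbdry bs A p w"
  shows "kbdry bs A p (\<lambda>s. c \<otimes> w s)"
proof -
  obtain v where v: "chain v" "\<And>s. kpos bs p s \<Longrightarrow> w s \<ominus> kd bs v s \<in> A"
    using assms(5) by (auto simp: kbdry_def)
  have "c \<otimes> w s \<ominus> kd bs (\<lambda>s. c \<otimes> v s) s = c \<otimes> (w s \<ominus> kd bs v s)" for s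
  proof -
    have "w s \<in> carrier R" "kd bs v s \<in> carrier R" using assms v by auto
    then show ?thesis unfolding kd_smult[OF assms(2) v(1) assms(4)] using assms(4) by algebra
  qed
  then show ?thesis unfolding kbdry_def
    using v assms(4) ideal.I_l_closed[OF assms(1)] by (intro exI[of _ "\<lambda>s. c \<otimes> v s"]) auto
qed

lemma kbdry_add:
  assumes "ideal A R" "set bs \<subseteq> carrier R" "chain w" "chain w'" "kbdry bs A p w" "kbdry bs A p w'"
  shows "kbdry bs A p (\<lambda>s. w s \<oplus> w' s)"
proof -
  obtain v v' where v: "chain v" "\<And>s. kpos bs p s \<Longrightarrow> w s \<ominus> kd bs v s \<in> A"
    and v': "chain v'" "\<And>s. kpos bs p s \<Longrightarrow> w' s \<ominus> kd bs v' s \<in> A"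
    using assms(5,6) by (auto simp: kbdry_def)
  have "w s \<oplus> w' s \<ominus> kd bs (\<lambda>s. v s \<oplus> v' s) s = (w s \<ominus> kd bs v s) \<oplus> (w' s \<ominus> kd bs v' s)" for s
  proof -
    have "w s \<in> carrier R" "w' s \<in> carrier R" "kd bs v s \<in> carrier R" "kd bs v' s \<in> carrier R"
      using assms v v' by auto
    then show ?thesis unfolding kd_add[OF assms(2) v(1) v'(1)] by algebra
  qed
  then show ?thesis unfolding kbdry_def
    using v v' ideal_add_closed[OF assms(1)] by (intro exI[of _ "\<lambda>s. v s \<oplus> v' s"]) auto
qed

lemma kbdry_mod:
  assumes "ideal A R" "set bs \<subseteq> carrier R" "chain w" "chain w'" "kbdry bs A p w"
    and "\<And>s. kpos bs p s \<Longrightarrow> w' s \<ominus> w s \<in> A"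
  shows "kbdry bs A p w'"
proof -
  obtain v where v: "chain v" "\<And>s. kpos bs p s \<Longrightarrow> w s \<ominus> kd bs v s \<in> A"
    using assms(5) by (auto simp: kbdry_def)
  have "w' s \<ominus> kd bs v s = (w' s \<ominus> w s) \<oplus> (w s \<ominus> kd bs v s)" for s
  proof -
    have "w s \<in> carrier R" "w' s \<in> carrier R" "kd bs v s \<in> carrier R" using assms v by auto
    then show ?thesis by algebra
  qed
  then show ?thesis unfolding kbdry_def
    using v assms(6) ideal_add_closed[OF assms(1)] by (intro exI[of _ v]) auto
qed

text \<open>The all-\<open>False\<close> list is the only position of degree 0, and the differential
  there combines \<open>bs\<close> with the values of degree 1 as coefficients. With
  \<open>lin_kd\<close> this identifies the homology in degree 0 with \<open>R\<close> modulo
  \<open>lin bs A\<close>.\<close>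

lemma kd_replicate_False:
  assumes "ideal A R" "set bs \<subseteq> carrier R" "chain w" "a \<in> A"
  shows "kd bs w (replicate (length bs) False) \<oplus> a \<in> lin bs A"
  using assms(2,3)
proof (induction bs arbitrary: w)
  case Nil
  then show ?case using assms ideal.Icarr by fastforce
next
  case (Cons b bs)
  have a: "a \<in> carrier R" using assms ideal.Icarr by fast
  let ?k = "kd bs (\<lambda>t. w (False # t)) (replicate (length bs) False)"
  let ?w = "w (True # replicate (length bs) False)"
  have "?k \<oplus> a \<in> lin bs A" using Cons.IH[of "\<lambda>t. w (False # t)"] Cons.prems by auto
  moreover have "?k \<oplus> b \<otimes> ?w \<oplus> a = ?w \<otimes> b \<oplus> (?k \<oplus> a)"
    using Cons.prems a by (simp add: a_ac m_ac)
  ultimately show ?case using Cons.prems by auto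
qed

lemma lin_kd:
  assumes "ideal A R" "set bs \<subseteq> carrier R" "x \<in> lin bs A"
  shows "\<exists>v. chain v \<and> x \<ominus> kd bs v (replicate (length bs) False) \<in> A"
  using assms(2,3)
proof (induction bs arbitrary: x)
  case Nil
  then have "x \<in> A" "x \<in> carrier R" using assms(1) ideal.Icarr by fastforce+
  then show ?case by (intro exI[of _ "\<lambda>_. \<zero>"]) (simp add: a_minus_def)
next
  case (Cons b bs)
  then obtain q r where q: "x = q \<otimes> b \<oplus> r" "q \<in> carrier R" "r \<in> lin bs A" by auto
  from Cons.IH[OF _ q(3)] Cons.prems obtain v where
    v: "chain v" "r \<ominus> kd bs v (replicate (length bs) False) \<in> A" by auto
  let ?v = "\<lambda>s. case s of [] \<Rightarrow> \<zero> | c # t \<Rightarrow> if c then q else v t"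
  let ?k = "kd bs v (replicate (length bs) False)"
  have k: "?k \<in> carrier R" using v Cons.prems by simp
  have r: "r \<in> carrier R" using q(3) lin_ideal[OF assms(1)] Cons.prems ideal.Icarr by fastforce
  have "b \<in> carrier R" using Cons.prems by simp
  then have "x \<ominus> (?k \<oplus> b \<otimes> q) = r \<ominus> ?k" unfolding q(1) using q(2) k r by algebra
  then have "x \<ominus> kd (b # bs) ?v (replicate (length (b # bs)) False) \<in> A" using v by simp
  moreover have "chain ?v" using v q by (auto split: list.split)
  ultimately show ?case by blast
qed

lemma kpos_zero: "kpos bs 0 s \<longleftrightarrow> s = replicate (length bs) False"
proof
  show "s = replicate (length bs) False" if "kpos bs 0 s"
  proof -
    have "x = False" if "x \<in> set s" for x
      using \<open>kpos bs 0 s\<close> that count_notin[of True s] by (cases x) (auto simp: count_list_0_iff)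
    then show ?thesis using that by (metis replicate_eqI)
  qed
qed (induction bs arbitrary: s, auto)

lemma kbdry_zero_iff:
  assumes "ideal A R" "set bs \<subseteq> carrier R" "x \<in> carrier R"
  shows "kbdry bs A 0 (\<lambda>_. x) \<longleftrightarrow> x \<in> lin bs A"
proof
  assume "kbdry bs A 0 (\<lambda>_. x)"
  then obtain v where v: "chain v" "x \<ominus> kd bs v (replicate (length bs) False) \<in> A"
    unfolding kbdry_def kpos_zero by blast
  have k: "kd bs v (replicate (length bs) False) \<in> carrier R" using assms v by simp
  have "x = kd bs v (replicate (length bs) False) \<oplus> (x \<ominus> kd bs v (replicate (length bs) False))"
    using k assms(3) by algebra
  then show "x \<in> lin bs A" using kd_replicate_False[OF assms(1,2) v] by simp
next
  assume "x \<in> lin bs A"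
  then show "kbdry bs A 0 (\<lambda>_. x)"
    using lin_kd[OF assms(1,2)] unfolding kbdry_def kpos_zero by blast
qed

text \<open>In use \<open>A'\<close> is \<open>A\<close> plus the multiples of \<open>z\<close>, and
  the connecting map of 0 -> \<open>R/A\<close> -> \<open>R/A\<close> -> \<open>R/A'\<close> -> 0,
  with multiplication by \<open>z\<close> as first map, sends the class of \<open>v\<close> to that
  of \<open>w\<close>. If \<open>v\<close> bounds modulo \<open>A'\<close>, then
  \<open>v - kd u = z y\<close> modulo \<open>A\<close>; the differential of this reads
  \<open>z w = z (kd y)\<close>, and \<open>z\<close> cancels.\<close>

lemma kbdry_descend:
  assumes A: "ideal A R" and A': "ideal A' R" and bs: "set bs \<subseteq> carrier R"
    and w: "chain w" and v: "chain v" and z: "z \<in> carrier R"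
    and dec: "\<And>x. x \<in> A' \<Longrightarrow> \<exists>a\<in>A. \<exists>s\<in>carrier R. x = a \<oplus> z \<otimes> s"
    and reg: "\<And>x. x \<in> carrier R \<Longrightarrow> z \<otimes> x \<in> A \<Longrightarrow> x \<in> A"
    and zw: "\<And>s. kpos bs p s \<Longrightarrow> z \<otimes> w s \<ominus> kd bs v s \<in> A"
    and b: "kbdry bs A' (Suc p) v"
  shows "kbdry bs A p w"
proof -
  obtain u where u: "chain u" "\<And>s. kpos bs (Suc p) s \<Longrightarrow> v s \<ominus> kd bs u s \<in> A'"
    using b by (auto simp: kbdry_def)
  have "\<exists>y\<in>carrier R. kpos bs (Suc p) s \<longrightarrow> v s \<ominus> kd bs u s \<ominus> z \<otimes> y \<in> A" for s
  proof (cases "kpos bs (Suc p) s")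
    case True
    then obtain a y where a: "a \<in> A" "y \<in> carrier R" "v s \<ominus> kd bs u s = a \<oplus> z \<otimes> y"
      using dec u(2) by blast
    have "v s \<ominus> kd bs u s \<ominus> z \<otimes> y = a"
      unfolding a(3) using a(1,2) z ideal.Icarr[OF A a(1)] by algebra
    then show ?thesis using a(1,2) by (intro bexI[of _ y]) auto
  qed (auto intro: exI[of _ \<zero>])
  then obtain y where y: "\<And>s. y s \<in> carrier R"
    "\<And>s. kpos bs (Suc p) s \<Longrightarrow> v s \<ominus> kd bs u s \<ominus> z \<otimes> y s \<in> A" by metis
  have cy: "chain y" using y by simp
  have "w s \<ominus> kd bs y s \<in> A" if s: "kpos bs p s" for s
  proof -
    have "kd bs (\<lambda>s. v s \<ominus> kd bs u s \<ominus> z \<otimes> y s) s \<in> A"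
      by (rule kd_in_ideal[OF bs _ A y(2) s]) (use v u y z bs in auto)
    moreover have "kd bs (\<lambda>s. v s \<ominus> kd bs u s \<ominus> z \<otimes> y s) s = kd bs v s \<ominus> z \<otimes> kd bs y s"
      using v u cy z bs by (simp add: kd_minus kd_smult kd_kd) (simp add: a_minus_def)
    ultimately have "(z \<otimes> w s \<ominus> kd bs v s) \<oplus> (kd bs v s \<ominus> z \<otimes> kd bs y s) \<in> A"
      using zw[OF s] ideal_add_closed[OF A] by simp
    moreover have "(z \<otimes> w s \<ominus> kd bs v s) \<oplus> (kd bs v s \<ominus> z \<otimes> kd bs y s) = z \<otimes> (w s \<ominus> kd bs y s)"
    proof -
      have "kd bs v s \<in> carrier R" "kd bs y s \<in> carrier R" "w s \<in> carrier R"
        using v cy w bs by auto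
      then show ?thesis using z by algebra
    qed
    ultimately show ?thesis using reg w cy bs by simp
  qed
  then show ?thesis unfolding kbdry_def using cy by blast
qed

lemma kcycle_lift:
  assumes "ideal A R" "ideal A' R" "A \<subseteq> A'" "set bs \<subseteq> carrier R" "chain w" "chain v" "z \<in> A'"
    and zw: "\<And>s. kpos bs p s \<Longrightarrow> z \<otimes> w s \<ominus> kd bs v s \<in> A"
  shows "kcycle bs A' (Suc p) v"
proof -
  have "kd bs v s \<in> A'" if s: "kpos bs p s" for s
  proof -
    have c: "kd bs v s \<in> carrier R" "w s \<in> carrier R" "z \<in> carrier R"
      using assms ideal.Icarr[OF assms(2)] by auto
    have "kd bs v s = z \<otimes> w s \<ominus> (z \<otimes> w s \<ominus> kd bs v s)" using c by algebra
    moreover have "z \<otimes> w s \<in> A'" using c assms by (simp add: ideal.I_r_closed)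
    ultimately show ?thesis using zw[OF s] assms(2,3) ideal_minus_closed by (metis subsetD)
  qed
  then show ?thesis using assms by (auto simp: kcycle_def)
qed

text \<open>A regular sequence \<open>z\<close> over \<open>A 0\<close>, recorded by the ideals it
  generates step by step. Stated by membership and decomposition rather than by generators, it
  transfers to a polynomial ring coefficient by coefficient.\<close>

definition regular_flag :: "(nat \<Rightarrow> 'a set) \<Rightarrow> (nat \<Rightarrow> 'a) \<Rightarrow> nat \<Rightarrow> bool" where
  "regular_flag A z q \<longleftrightarrow> (\<forall>i\<le>q. ideal (A i) R) \<and>
     (\<forall>i<q. z i \<in> A (Suc i) \<and> A i \<subseteq> A (Suc i) \<and>
        (\<forall>x\<in>A (Suc i). \<exists>a\<in>A i. \<exists>s\<in>carrier R. x = a \<oplus> z i \<otimes> s) \<and>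
        (\<forall>x\<in>carrier R. z i \<otimes> x \<in> A i \<longrightarrow> x \<in> A i))"

lemma regular_flagD:
  assumes "regular_flag A z q"
  shows "\<And>i. i \<le> q \<Longrightarrow> ideal (A i) R"
    and "\<And>i. i < q \<Longrightarrow> z i \<in> A (Suc i)" and "\<And>i. i < q \<Longrightarrow> A i \<subseteq> A (Suc i)"
    and "\<And>i x. i < q \<Longrightarrow> x \<in> A (Suc i) \<Longrightarrow> \<exists>a\<in>A i. \<exists>s\<in>carrier R. x = a \<oplus> z i \<otimes> s"
    and "\<And>i x. i < q \<Longrightarrow> x \<in> carrier R \<Longrightarrow> z i \<otimes> x \<in> A i \<Longrightarrow> x \<in> A i"
    and "\<And>i. i < q \<Longrightarrow> z i \<in> carrier R"
proof -
  show 1: "\<And>i. i \<le> q \<Longrightarrow> ideal (A i) R" "\<And>i. i < q \<Longrightarrow> z i \<in> A (Suc i)" "\<And>i. i < q \<Longrightarrow> A i \<subseteq> A (Suc i)"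
    "\<And>i x. i < q \<Longrightarrow> x \<in> A (Suc i) \<Longrightarrow> \<exists>a\<in>A i. \<exists>s\<in>carrier R. x = a \<oplus> z i \<otimes> s"
    "\<And>i x. i < q \<Longrightarrow> x \<in> carrier R \<Longrightarrow> z i \<otimes> x \<in> A i \<Longrightarrow> x \<in> A i"
    using assms unfolding regular_flag_def by blast+
  show "z i \<in> carrier R" if "i < q" for i
    using ideal.Icarr[OF 1(1)[of "Suc i"] 1(2)[OF that]] that by simp
qed

lemma kbdry_above_length:
  assumes "length bs < p"
  shows "kbdry bs A p w"
proof -
  have "\<not> kpos bs p s" for s
    using assms count_le_length[of s True] by auto
  then show ?thesis unfolding kbdry_def by (intro exI[of _ "\<lambda>_. \<zero>"]) auto
qed

text \<open>Descending induction on the level \<open>i\<close>. At level \<open>q\<close> the degree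
  exceeds the number of entries of \<open>bs\<close>. At level \<open>i\<close> a class killed by
  \<open>z i\<close> comes from degree \<open>Suc p\<close> at level \<open>Suc i\<close>, where the
  homology vanishes; so \<open>z i\<close> acts injectively, while some power of it kills the
  class.\<close>

theorem koszul_acyclic:
  assumes F: "regular_flag A z q" and bs: "set bs \<subseteq> carrier R" "length bs \<le> q"
    and tors: "\<And>i p w. i < q \<Longrightarrow> kcycle bs (A i) (Suc p) w \<Longrightarrow>
      \<exists>N::nat. kbdry bs (A i) (Suc p) (\<lambda>s. z i [^] N \<otimes> w s)"
    and "i \<le> q" "kcycle bs (A i) p w" "i < p"
  shows "kbdry bs (A i) p w"
  using assms(5-)
proof (induction i arbitrary: p w rule: inc_induct)
  case base
  then show ?case using bs kbdry_above_length[of bs p "A q" w] by simp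
next
  case (step i)
  note D = regular_flagD[OF F]
  have A: "ideal (A i) R" and A': "ideal (A (Suc i)) R" and z: "z i \<in> carrier R"
    using step D by auto
  have one: "kbdry bs (A i) p w" if w: "chain w" and "kbdry bs (A i) p (\<lambda>s. z i \<otimes> w s)" for w
  proof -
    obtain v where v: "chain v" "\<And>s. kpos bs p s \<Longrightarrow> z i \<otimes> w s \<ominus> kd bs v s \<in> A i"
      using \<open>kbdry bs (A i) p (\<lambda>s. z i \<otimes> w s)\<close> by (auto simp: kbdry_def)
    have "kcycle bs (A (Suc i)) (Suc p) v"
      using v step D by (intro kcycle_lift[OF A A' _ bs(1) w v(1)]) auto
    then have "kbdry bs (A (Suc i)) (Suc p) v" using step by auto
    then show ?thesis
      using kbdry_descend[OF A A' bs(1) w v(1) z D(4) D(5)] v(2) step by auto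
  qed
  obtain p' where p': "p = Suc p'" using step.prems by (cases p) auto
  have w: "chain w" using step.prems by (simp add: kcycle_def)
  obtain N :: nat where "kbdry bs (A i) p (\<lambda>s. z i [^] N \<otimes> w s)"
    using tors[of i p' w] step p' by auto
  then show ?case
  proof (induction N)
    case 0
    have "(\<lambda>s. z i [^] (0::nat) \<otimes> w s) = w" using w by auto
    then show ?case using 0 by simp
  next
    case (Suc N)
    have eq: "(\<lambda>s. z i [^] (Suc N) \<otimes> w s) = (\<lambda>s. z i \<otimes> (z i [^] N \<otimes> w s))"
    proof
      fix s
      have "w s \<in> carrier R" "z i [^] N \<in> carrier R" using w z by auto
      then show "z i [^] (Suc N) \<otimes> w s = z i \<otimes> (z i [^] N \<otimes> w s)"
        using z by (simp add: m_ac)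
    qed
    have "kbdry bs (A i) p (\<lambda>s. z i [^] N \<otimes> w s)"
      by (rule one[OF _ Suc.prems[unfolded eq]]) (use w z in simp)
    then show ?case using Suc.IH by simp
  qed
qed

text \<open>Depth sensitivity: an element annihilated modulo \<open>bs\<close> by powers of all \<open>z i\<close> and by
  an element \<open>v\<close> extending the regular flag vanishes, since the class can be pushed up the
  flag to Koszul degree \<open>q\<close>, where there are no boundaries.\<close>

theorem koszul_depth_sensitive:
  assumes F: "regular_flag A z q" and bs: "set bs \<subseteq> carrier R" "length bs = q"
    and acyc: "\<And>i p w. i \<le> q \<Longrightarrow> i < p \<Longrightarrow> kcycle bs (A i) p w \<Longrightarrow> kbdry bs (A i) p w"
    and v: "v \<in> carrier R" "\<And>x. x \<in> carrier R \<Longrightarrow> v \<otimes> x \<in> A q \<Longrightarrow> x \<in> A q"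
    and x: "x \<in> carrier R" "v \<otimes> x \<in> lin bs (A 0)"
    and zx: "\<And>i. i < q \<Longrightarrow> \<exists>N::nat. z i [^] N \<otimes> x \<in> lin bs (A 0)"
  shows "x \<in> lin bs (A 0)"
proof -
  note D = regular_flagD[OF F]
  \<comment> \<open>The classes to be pushed up: of degree \<open>i\<close> at level
    \<open>i\<close>, killed by \<open>v\<close> and by a power of every \<open>z j\<close>. All
    \<open>j\<close> are recorded because later levels use the later members of the flag.\<close>
  define tor where "tor i w \<longleftrightarrow> chain w \<and> kbdry bs (A i) i (\<lambda>s. v \<otimes> w s) \<and>
    (\<forall>j<q. \<exists>N::nat. kbdry bs (A i) i (\<lambda>s. z j [^] N \<otimes> w s))" for i w
  have main: "kbdry bs (A i) i w" if "i \<le> q" "tor i w" for i w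
    using that
  proof (induction i arbitrary: w rule: inc_induct)
    case base
    note A = D(1)[OF order_refl]
    have w: "chain w" using base by (simp add: tor_def)
    obtain u where u: "chain u" "\<And>s. kpos bs q s \<Longrightarrow> v \<otimes> w s \<ominus> kd bs u s \<in> A q"
      using base unfolding tor_def kbdry_def by blast
    have "w s \<ominus> kd bs (\<lambda>_. \<zero>) s \<in> A q" if s: "kpos bs q s" for s
    proof -
      have "kd bs u s \<in> A q"
      proof (rule kd_in_ideal[OF bs(1) u(1) A _ s])
        fix t assume "kpos bs (Suc q) t"
        then show "u t \<in> A q" using bs(2) count_le_length[of t True] by simp
      qed
      moreover have "v \<otimes> w s = (v \<otimes> w s \<ominus> kd bs u s) \<oplus> kd bs u s"
      proof -
        have "kd bs u s \<in> carrier R" "w s \<in> carrier R" using u w bs by auto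
        then show ?thesis using v(1) by algebra
      qed
      ultimately have "v \<otimes> w s \<in> A q" using u(2)[OF s] ideal_add_closed[OF A] by metis
      then have "w s \<in> A q" using v w by auto
      moreover have "kd bs (\<lambda>_. \<zero>) s \<in> A q"
        by (rule kd_in_ideal[OF bs(1) _ A _ s]) (use ideal_zero_closed[OF A] in auto)
      ultimately show ?thesis using ideal_minus_closed[OF A] by simp
    qed
    then show ?case unfolding kbdry_def by (intro exI[of _ "\<lambda>_. \<zero>"]) auto
  next
    case (step i)
    have A: "ideal (A i) R" and A': "ideal (A (Suc i)) R" and z: "z i \<in> carrier R"
      and AA': "A i \<subseteq> A (Suc i)" and zA: "z i \<in> A (Suc i)"
      using step D by auto
    have one: "kbdry bs (A i) i w" if t: "tor i w" and "kbdry bs (A i) i (\<lambda>s. z i \<otimes> w s)" for w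
    proof -
      have w: "chain w" using t by (simp add: tor_def)
      obtain u where u: "chain u" "\<And>s. kpos bs i s \<Longrightarrow> z i \<otimes> w s \<ominus> kd bs u s \<in> A i"
        using \<open>kbdry bs (A i) i (\<lambda>s. z i \<otimes> w s)\<close> by (auto simp: kbdry_def)
      \<comment> \<open>Whatever kills \<open>w\<close> at level \<open>i\<close> kills the lifted
        class \<open>u\<close> at level \<open>Suc i\<close>: if \<open>c w = kd y\<close> modulo
        \<open>A i\<close>, then \<open>c u - z i y\<close> is a cycle modulo \<open>A i\<close> in
        degree \<open>Suc i\<close>, so a boundary by \<open>acyc\<close>, and \<open>z i y\<close>
        is zero modulo \<open>A (Suc i)\<close>.\<close>
      have lift: "kbdry bs (A (Suc i)) (Suc i) (\<lambda>s. c \<otimes> u s)"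
        if c: "c \<in> carrier R" and "kbdry bs (A i) i (\<lambda>s. c \<otimes> w s)" for c
      proof -
        obtain y where y: "chain y" "\<And>s. kpos bs i s \<Longrightarrow> c \<otimes> w s \<ominus> kd bs y s \<in> A i"
          using \<open>kbdry bs (A i) i (\<lambda>s. c \<otimes> w s)\<close> by (auto simp: kbdry_def)
        let ?t = "\<lambda>s. c \<otimes> u s \<ominus> z i \<otimes> y s"
        have ct: "chain ?t" using c u y z by simp
        have "kd bs ?t s \<in> A i" if s: "kpos bs i s" for s
        proof -
          have cc: "kd bs u s \<in> carrier R" "kd bs y s \<in> carrier R" "w s \<in> carrier R"
            using u y w bs by auto
          have "kd bs ?t s = c \<otimes> kd bs u s \<ominus> z i \<otimes> kd bs y s"
            using c u y z bs by (simp add: kd_minus kd_smult)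
          also have "\<dots> = z i \<otimes> (c \<otimes> w s \<ominus> kd bs y s) \<ominus> c \<otimes> (z i \<otimes> w s \<ominus> kd bs u s)"
            using c z cc by algebra
          also have "\<dots> \<in> A i"
            by (intro ideal_minus_closed[OF A] ideal.I_l_closed[OF A] u(2)[OF s] y(2)[OF s] c z)
          finally show ?thesis .
        qed
        then have "kcycle bs (A i) (Suc i) ?t" using ct by (simp add: kcycle_def)
        then have "kbdry bs (A i) (Suc i) ?t" using acyc step by simp
        then have "kbdry bs (A (Suc i)) (Suc i) ?t" using AA' unfolding kbdry_def by blast
        moreover have "c \<otimes> u s \<ominus> ?t s \<in> A (Suc i)" for s
        proof -
          have cc: "u s \<in> carrier R" "y s \<in> carrier R" using u y by auto
          then have "c \<otimes> u s \<ominus> ?t s = y s \<otimes> z i" using c z by algebra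
          then show ?thesis using zA cc by (simp add: ideal.I_l_closed[OF A'])
        qed
        ultimately show ?thesis
          using c u by (intro kbdry_mod[OF A' bs(1) ct, of "\<lambda>s. c \<otimes> u s"]) simp_all
      qed
      have "\<exists>N::nat. kbdry bs (A (Suc i)) (Suc i) (\<lambda>s. z j [^] N \<otimes> u s)" if j: "j < q" for j
      proof -
        obtain N :: nat where "kbdry bs (A i) i (\<lambda>s. z j [^] N \<otimes> w s)"
          using t j unfolding tor_def by blast
        then show ?thesis using lift[of "z j [^] N"] D(6)[OF j] by auto
      qed
      moreover have "kbdry bs (A (Suc i)) (Suc i) (\<lambda>s. v \<otimes> u s)"
        using lift[OF v(1)] t unfolding tor_def by simp
      ultimately have "tor (Suc i) u" using u unfolding tor_def by simp
      then have "kbdry bs (A (Suc i)) (Suc i) u" by (rule step.IH)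
      then show ?thesis
        using kbdry_descend[OF A A' bs(1) w u(1) z D(4) D(5)] u(2) step by auto
    qed
    have w: "chain w" using step.prems by (simp add: tor_def)
    obtain N :: nat where "kbdry bs (A i) i (\<lambda>s. z i [^] N \<otimes> w s)"
      using step unfolding tor_def by blast
    then show ?case
    proof (induction N)
      case 0
      have "(\<lambda>s. z i [^] (0::nat) \<otimes> w s) = w" using w by auto
      then show ?case using 0 by simp
    next
      case (Suc N)
      have eq: "(\<lambda>s. z i [^] (Suc N) \<otimes> w s) = (\<lambda>s. z i \<otimes> (z i [^] N \<otimes> w s))"
      proof
        fix s
        have "w s \<in> carrier R" "z i [^] N \<in> carrier R" using w z by auto
        then show "z i [^] (Suc N) \<otimes> w s = z i \<otimes> (z i [^] N \<otimes> w s)"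
          using z by (simp add: m_ac)
      qed
      have "tor i (\<lambda>s. z i [^] N \<otimes> w s)"
      proof -
        have sw: "(\<lambda>s. c \<otimes> (z i [^] N \<otimes> w s)) = (\<lambda>s. z i [^] N \<otimes> (c \<otimes> w s))" if "c \<in> carrier R" for c
          using w z that by (auto simp: m_lcomm)
        have mult: "kbdry bs (A i) i (\<lambda>s. c \<otimes> (z i [^] N \<otimes> w s))"
          if "c \<in> carrier R" "kbdry bs (A i) i (\<lambda>s. c \<otimes> w s)" for c
          unfolding sw[OF that(1)] by (rule kbdry_smult[OF A bs(1) _ _ that(2)]) (use that w z in auto)
        have "\<exists>M::nat. kbdry bs (A i) i (\<lambda>s. z j [^] M \<otimes> (z i [^] N \<otimes> w s))" if j: "j < q" for j
        proof -
          obtain M :: nat where "kbdry bs (A i) i (\<lambda>s. z j [^] M \<otimes> w s)"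
            using step.prems j unfolding tor_def by blast
          then show ?thesis using mult[of "z j [^] M"] D(6)[OF j] by auto
        qed
        then show ?thesis using mult[OF v(1)] step.prems w z unfolding tor_def by simp
      qed
      then have "kbdry bs (A i) i (\<lambda>s. z i [^] N \<otimes> w s)"
        by (rule one[OF _ Suc.prems[unfolded eq]])
      then show ?case using Suc.IH by simp
    qed
  qed
  note A0 = D(1)[OF le0]
  have "\<exists>N::nat. kbdry bs (A 0) 0 (\<lambda>_. z j [^] N \<otimes> x)" if j: "j < q" for j
    using zx[OF j] kbdry_zero_iff[OF A0 bs(1)] D(6)[OF j] x(1) by auto
  then have "tor 0 (\<lambda>_. x)"
    using x v kbdry_zero_iff[OF A0 bs(1)] unfolding tor_def by auto
  then show ?thesis using main[OF le0] kbdry_zero_iff[OF A0 bs(1) x(1)] by auto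
qed

text \<open>After inverting \<open>c\<close>, the list read from its last entry to its first is a
  regular sequence modulo \<open>A\<close>, up to properness. The power of \<open>c\<close> may
  depend on \<open>x\<close>.\<close>

fun weakly_regular :: "'a \<Rightarrow> 'a set \<Rightarrow> 'a list \<Rightarrow> bool" where
  "weakly_regular c A [] \<longleftrightarrow> True"
| "weakly_regular c A (b # bs) \<longleftrightarrow> weakly_regular c A bs \<and>
     (\<forall>x\<in>carrier R. b \<otimes> x \<in> lin bs A \<longrightarrow> (\<exists>N::nat. c [^] N \<otimes> x \<in> lin bs A))"

text \<open>The vanishing of positive Koszul homology for regular sequences, with powers of
  \<open>c\<close> in place of inverting it. In the mapping cone a cycle has halves
  \<open>w0\<close> and \<open>w1\<close>; the half \<open>w1\<close> is a cycle over
  \<open>bs\<close> of one degree less, and \<open>w0\<close> can be corrected to a cycle once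
  \<open>w1\<close> is bounded.\<close>

theorem koszul_torsion:
  assumes A: "ideal A R" and "set bs \<subseteq> carrier R" and c: "c \<in> carrier R"
    and "weakly_regular c A bs" and "kcycle bs A (Suc p) w"
  shows "\<exists>N::nat. kbdry bs A (Suc p) (\<lambda>s. c [^] N \<otimes> w s)"
  using assms(2,4,5)
proof (induction bs arbitrary: p w)
  case Nil
  then show ?case using kbdry_above_length[of "[]"] by auto
next
  case (Cons b bs)
  have b: "b \<in> carrier R" and bs: "set bs \<subseteq> carrier R" using Cons.prems by auto
  have w: "chain w" and cyc: "\<And>s. kpos (b # bs) p s \<Longrightarrow> kd (b # bs) w s \<in> A"
    using Cons.prems by (auto simp: kcycle_def)
  let ?w0 = "\<lambda>s. w (False # s)" and ?w1 = "\<lambda>s. w (True # s)"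
  have w0: "chain ?w0" and w1: "chain ?w1" using w by auto
  have c0: "kd bs ?w0 s \<oplus> b \<otimes> ?w1 s \<in> A" if "kpos bs p s" for s
    using cyc[of "False # s"] that by simp
  have c1: "kd bs ?w1 s \<in> A" if "kpos bs p' s" "p = Suc p'" for s p'
  proof -
    have "\<ominus> kd bs ?w1 s \<in> A" using cyc[of "True # s"] that by simp
    then have "\<ominus> (\<ominus> kd bs ?w1 s) \<in> A" using ideal_uminus_closed[OF A] by blast
    then show ?thesis using w1 bs by simp
  qed
  \<comment> \<open>Weak regularity of the head enters only for \<open>p = 0\<close>: there
    \<open>b w1\<close> lies in \<open>lin bs A\<close>, so a power of \<open>c\<close> moves
    \<open>w1\<close> into it.\<close>
  have "\<exists>N::nat. kbdry bs A p (\<lambda>s. c [^] N \<otimes> ?w1 s)"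
  proof (cases p)
    case 0
    let ?F = "replicate (length bs) False"
    let ?k = "kd bs ?w0 ?F"
    have k: "?k \<in> carrier R" using w0 bs by simp
    have "kd bs ?w0 ?F \<oplus> b \<otimes> ?w1 ?F \<in> A" using c0[of ?F] kpos_zero[of ?F bs] 0 by simp
    then have "kd bs (\<lambda>s. \<ominus> ?w0 s) ?F \<oplus> (kd bs ?w0 ?F \<oplus> b \<otimes> ?w1 ?F) \<in> lin bs A"
      using w0 by (intro kd_replicate_False[OF A bs]) auto
    moreover have "kd bs (\<lambda>s. \<ominus> ?w0 s) ?F \<oplus> (kd bs ?w0 ?F \<oplus> b \<otimes> ?w1 ?F) = b \<otimes> ?w1 ?F"
      using k b w by (simp add: kd_uminus[OF bs w0] r_neg1)
    ultimately obtain N :: nat where "c [^] N \<otimes> ?w1 ?F \<in> lin bs A"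
      using Cons.prems w by auto
    then have "kbdry bs A 0 (\<lambda>_. c [^] N \<otimes> ?w1 ?F)"
      using kbdry_zero_iff[OF A bs] c w by simp
    then have "kbdry bs A 0 (\<lambda>s. c [^] N \<otimes> ?w1 s)" unfolding kbdry_def kpos_zero by simp
    then show ?thesis using 0 by blast
  next
    case (Suc p')
    then have "kcycle bs A (Suc p') ?w1" using c1 w1 by (simp add: kcycle_def)
    then show ?thesis using Cons.IH[OF bs] Cons.prems Suc by simp
  qed
  then obtain N :: nat and u where u: "chain u"
    and uN: "\<And>s. kpos bs p s \<Longrightarrow> c [^] N \<otimes> ?w1 s \<ominus> kd bs u s \<in> A"
    unfolding kbdry_def by blast
  \<comment> \<open>With \<open>c^N w1 = kd u\<close> modulo \<open>A\<close>, adding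
    \<open>b u\<close> to \<open>c^N w0\<close> compensates the cone term \<open>b w1\<close>, so
    that \<open>y\<close> is a cycle over the shorter list.\<close>
  define y where "y = (\<lambda>s. c [^] N \<otimes> ?w0 s \<oplus> b \<otimes> u s)"
  have cN: "c [^] N \<in> carrier R" using c by simp
  have y: "chain y" using w0 u b cN by (simp add: y_def)
  have kdy: "kd bs y s = c [^] N \<otimes> kd bs ?w0 s \<oplus> b \<otimes> kd bs u s" for s
    using w0 u b cN bs by (simp add: y_def kd_add kd_smult)
  have id: "N \<otimes> k \<oplus> b \<otimes> v = N \<otimes> (k \<oplus> b \<otimes> x) \<ominus> b \<otimes> (N \<otimes> x \<ominus> v)"
    if "N \<in> carrier R" "k \<in> carrier R" "v \<in> carrier R" "x \<in> carrier R" for N k v x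
    using that b by algebra
  have "kd bs y s \<in> A" if s: "kpos bs p s" for s
  proof -
    have cc: "kd bs ?w0 s \<in> carrier R" "kd bs u s \<in> carrier R" "?w1 s \<in> carrier R"
      using w0 u w bs by auto
    have "kd bs y s = c [^] N \<otimes> (kd bs ?w0 s \<oplus> b \<otimes> ?w1 s) \<ominus> b \<otimes> (c [^] N \<otimes> ?w1 s \<ominus> kd bs u s)"
      unfolding kdy by (rule id) (use cc cN b in auto)
    also have "\<dots> \<in> A"
      by (intro ideal_minus_closed[OF A] ideal.I_l_closed[OF A] uN[OF s] c0[OF s] cN b)
    finally show ?thesis .
  qed
  then have "kcycle bs A (Suc p) y" using y by (simp add: kcycle_def)
  then obtain M :: nat and x where x: "chain x"
    and xM: "\<And>s. kpos bs (Suc p) s \<Longrightarrow> c [^] M \<otimes> y s \<ominus> kd bs x s \<in> A"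
    using Cons.IH[OF bs] Cons.prems unfolding kbdry_def by (metis weakly_regular.simps(2))
  have cM: "c [^] M \<in> carrier R" using c by simp
  \<comment> \<open>The bounding chain: \<open>x\<close> bounds \<open>c^M y\<close> on the
    \<open>False\<close> half, and the \<open>True\<close> half carries \<open>-c^M u\<close>, which
    removes the correction \<open>b u\<close> again.\<close>
  define t where "t = (\<lambda>s. case s of [] \<Rightarrow> \<zero> | d # r \<Rightarrow> if d then \<ominus> (c [^] M \<otimes> u r) else x r)"
  have t: "chain t" using u x cM by (auto simp: t_def split: list.split)
  have tF: "(\<lambda>r. t (False # r)) = x" and tT: "(\<lambda>r. t (True # r)) = (\<lambda>r. \<ominus> (c [^] M \<otimes> u r))"
    by (simp_all add: t_def)
  have "c [^] (M + N) \<otimes> w s \<ominus> kd (b # bs) t s \<in> A" if s: "kpos (b # bs) (Suc p) s" for s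
  proof (cases s rule: bool_list_cases)
    case (2 r)
    then have r: "kpos bs (Suc p) r" using s by simp
    have cc: "kd bs x r \<in> carrier R" "u r \<in> carrier R" "w s \<in> carrier R" using x u w bs by auto
    have "c [^] (M + N) \<otimes> w s \<ominus> kd (b # bs) t s =
      (c [^] M \<otimes> c [^] N) \<otimes> w s \<ominus> (kd bs x r \<oplus> b \<otimes> \<ominus> (c [^] M \<otimes> u r))"
      using 2 c by (simp add: tF nat_pow_mult) (simp add: t_def)
    also have "\<dots> = c [^] M \<otimes> y r \<ominus> kd bs x r"
      unfolding y_def using 2 cc cM cN b by algebra
    finally show ?thesis using xM[OF r] by simp
  next
    case (3 r)
    then have r: "kpos bs p r" using s by simp
    have cc: "kd bs u r \<in> carrier R" "w s \<in> carrier R" using u w bs by auto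
    have "kd bs (\<lambda>r. \<ominus> (c [^] M \<otimes> u r)) r = \<ominus> (c [^] M \<otimes> kd bs u r)"
      using u cM bs by (simp add: kd_uminus kd_smult)
    then have "c [^] (M + N) \<otimes> w s \<ominus> kd (b # bs) t s =
      (c [^] M \<otimes> c [^] N) \<otimes> w s \<ominus> (\<ominus> (\<ominus> (c [^] M \<otimes> kd bs u r)))"
      using 3 c by (simp add: tT nat_pow_mult)
    also have "\<dots> = c [^] M \<otimes> (c [^] N \<otimes> w s \<ominus> kd bs u r)"
      using cc cM cN by algebra
    also have "\<dots> \<in> A" using uN[OF r] 3 cM by (simp add: ideal.I_l_closed[OF A])
    finally show ?thesis .
  qed (use s in simp)
  then show ?case unfolding kbdry_def using t by blast
qed

text \<open>The contraction of the Koszul complex by the \<open>i\<close>-th unit vector.\<close>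

fun ke :: "nat \<Rightarrow> (bool list \<Rightarrow> 'a) \<Rightarrow> bool list \<Rightarrow> 'a" where
  "ke i w [] = \<zero>"
| "ke 0 w (False # s) = \<zero>"
| "ke 0 w (True # s) = w (False # s)"
| "ke (Suc i) w (False # s) = ke i (\<lambda>t. w (False # t)) s"
| "ke (Suc i) w (True # s) = \<ominus> ke i (\<lambda>t. w (True # t)) s"

lemma ke_closed [simp]: "chain w \<Longrightarrow> ke i w s \<in> carrier R"
  by (induction i w s rule: ke.induct) auto

lemma ke_add: "chain w \<Longrightarrow> chain w' \<Longrightarrow> ke i (\<lambda>s. w s \<oplus> w' s) s = ke i w s \<oplus> ke i w' s"
proof (induction i w s arbitrary: w' rule: ke.induct)
  case (5 i w s)
  then show ?case using 5(1)[of "\<lambda>t. w' (True # t)"] by (simp add: minus_add)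
qed auto

lemma ke_smult: "chain w \<Longrightarrow> c \<in> carrier R \<Longrightarrow> ke i (\<lambda>s. c \<otimes> w s) s = c \<otimes> ke i w s"
  by (induction i w s rule: ke.induct) (auto simp: r_minus)

lemma ke_uminus: "chain w \<Longrightarrow> ke i (\<lambda>s. \<ominus> w s) s = \<ominus> ke i w s"
  by (induction i w s rule: ke.induct) auto

lemma kd_zero [simp]: "set bs \<subseteq> carrier R \<Longrightarrow> kd bs (\<lambda>_. \<zero>) s = \<zero>"
  using kd_smult[of bs "\<lambda>_. \<zero>" \<zero> s] by simp

text \<open>At the head position the cone term supplies \<open>b w\<close>; at later positions the
  sign in \<open>ke\<close> makes contraction anticommute with the cone term, which leaves the
  formula for the shorter list.\<close>

lemma kd_ke:
  assumes "set bs \<subseteq> carrier R" "chain w" "i < length bs" "length s = length bs"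
  shows "kd bs (ke i w) s \<oplus> ke i (kd bs w) s = (bs ! i) \<otimes> w s"
  using assms
proof (induction bs arbitrary: i w s)
  case Nil
  then show ?case by simp
next
  case (Cons b bs)
  have b: "b \<in> carrier R" and bs: "set bs \<subseteq> carrier R" using Cons.prems by auto
  let ?w0 = "\<lambda>s. w (False # s)" and ?w1 = "\<lambda>s. w (True # s)"
  have w0: "chain ?w0" and w1: "chain ?w1" using Cons.prems by auto
  have wc: "\<And>s. w s \<in> carrier R" using Cons.prems by auto
  show ?case
  proof (cases i)
    case 0
    show ?thesis
    proof (cases s rule: bool_list_cases)
      case (2 r)
      then show ?thesis using 0 wc b bs by simp
    next
      case (3 r)
      have k: "kd bs ?w0 r \<in> carrier R" using w0 bs by simp
      show ?thesis using 0 3 wc[of s] k b by (simp add: r_neg1)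
    qed (use Cons.prems in simp)
  next
    case (Suc j)
    have j: "j < length bs" using Cons.prems Suc by simp
    have IH: "kd bs (ke j v) r \<oplus> ke j (kd bs v) r = (bs ! j) \<otimes> v r"
      if "chain v" "length r = length bs" for v r using Cons.IH[OF bs that(1) j that(2)] .
    have bj: "bs ! j \<in> carrier R" using bs j by auto
    show ?thesis
    proof (cases s rule: bool_list_cases)
      case (2 r)
      have r: "length r = length bs" using Cons.prems 2 by simp
      have 1: "kd (b # bs) (ke i w) s = kd bs (ke j ?w0) r \<oplus> b \<otimes> \<ominus> (ke j ?w1 r)"
        using 2 Suc by simp
      have "ke i (kd (b # bs) w) s = ke j (\<lambda>t. kd bs ?w0 t \<oplus> b \<otimes> w (True # t)) r"
        using 2 Suc by simp
      also have "\<dots> = ke j (kd bs ?w0) r \<oplus> b \<otimes> ke j ?w1 r"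
        using w0 w1 wc b bs by (simp add: ke_add ke_smult)
      finally have eq2: "ke i (kd (b # bs) w) s = ke j (kd bs ?w0) r \<oplus> b \<otimes> ke j ?w1 r" .
      have "kd (b # bs) (ke i w) s \<oplus> ke i (kd (b # bs) w) s = kd bs (ke j ?w0) r \<oplus> ke j (kd bs ?w0) r"
      proof -
        have "kd bs (ke j ?w0) r \<in> carrier R" "ke j ?w1 r \<in> carrier R" "ke j (kd bs ?w0) r \<in> carrier R"
          using w0 w1 bs by auto
        moreover have "k \<oplus> b \<otimes> \<ominus> x \<oplus> (l \<oplus> b \<otimes> x) = k \<oplus> l"
          if "k \<in> carrier R" "x \<in> carrier R" "l \<in> carrier R" for k x l
          using that b by algebra
        ultimately show ?thesis unfolding 1 eq2 by blast
      qed
      then show ?thesis using IH[OF w0 r] 2 Suc by simp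
    next
      case (3 r)
      have r: "length r = length bs" using Cons.prems 3 by simp
      have 1: "kd (b # bs) (ke i w) s = \<ominus> kd bs (\<lambda>t. \<ominus> ke j ?w1 t) r"
        using 3 Suc by simp
      have 2: "ke i (kd (b # bs) w) s = \<ominus> ke j (\<lambda>t. \<ominus> kd bs ?w1 t) r"
        using 3 Suc by simp
      show ?thesis unfolding 1 2 using IH[OF w1 r] w1 bs 3 Suc by (simp add: kd_uminus ke_uminus)
    qed (use Cons.prems in simp)
  qed
qed

lemma ke_in_ideal:
  assumes "ideal A R" "i < length bs" "kpos bs p s"
    and "\<And>t q. p = Suc q \<Longrightarrow> kpos bs q t \<Longrightarrow> w t \<in> A"
  shows "ke i w s \<in> A"
  using assms(2-)
proof (induction bs arbitrary: i p w s)
  case (Cons b bs)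
  have IH: "ke j v r \<in> A"
    if "j < length bs" "kpos bs m r" "\<And>t q. m = Suc q \<Longrightarrow> kpos bs q t \<Longrightarrow> v t \<in> A" for j m v r
    using that by (rule Cons.IH)
  show ?case
  proof (cases s rule: bool_list_cases)
    case (2 r)
    show ?thesis
    proof (cases i)
      case (Suc j)
      have "ke j (\<lambda>t. w (False # t)) r \<in> A"
        using Cons.prems 2 Suc by (intro IH[of j r p]) auto
      then show ?thesis using 2 Suc by simp
    qed (use 2 ideal_zero_closed[OF assms(1)] in simp)
  next
    case (3 r)
    then obtain q where q: "p = Suc q" "kpos bs q r" using Cons.prems by auto
    show ?thesis
    proof (cases i)
      case 0
      then show ?thesis using 3 q Cons.prems(3)[of q "False # r"] by simp
    next
      case (Suc j)
      have "ke j (\<lambda>t. w (True # t)) r \<in> A"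
        using Cons.prems(1) 3 Suc q Cons.prems(3) by (intro IH[of j r q]) auto
      then show ?thesis using 3 Suc ideal_uminus_closed[OF assms(1)] by simp
    qed
  qed (use Cons.prems in simp)
qed simp

text \<open>Each entry of \<open>bs\<close> annihilates the homology: contraction at its position is
  the bounding chain, and the other term of the homotopy formula vanishes modulo \<open>A\<close> on
  a cycle.\<close>

lemma koszul_homotopy:
  assumes A: "ideal A R" and bs: "set bs \<subseteq> carrier R" and w: "kcycle bs A p w" and b: "b \<in> set bs"
  shows "kbdry bs A p (\<lambda>s. b \<otimes> w s)"
proof -
  obtain i where i: "i < length bs" "bs ! i = b" using b by (auto simp: in_set_conv_nth)
  have cw: "chain w" using w by (simp add: kcycle_def)
  have "b \<otimes> w s \<ominus> kd bs (ke i w) s \<in> A" if s: "kpos bs p s" for s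
  proof -
    have e: "ke i (kd bs w) s \<in> A"
      by (rule ke_in_ideal[OF A i(1) s]) (use w in \<open>auto simp: kcycle_def\<close>)
    have c: "kd bs (ke i w) s \<in> carrier R" "ke i (kd bs w) s \<in> carrier R" "w s \<in> carrier R"
      using cw bs by auto
    have "b \<otimes> w s = kd bs (ke i w) s \<oplus> ke i (kd bs w) s"
      using kd_ke[OF bs cw i(1), of s] s i by simp
    then have "b \<otimes> w s \<ominus> kd bs (ke i w) s = ke i (kd bs w) s" using c by algebra
    then show ?thesis using e by simp
  qed
  then show ?thesis unfolding kbdry_def using cw by (intro exI[of _ "ke i w"]) auto
qed

end

section \<open>Polynomial rings\<close>

lemma finite_submultisets [simp]: "finite {k. k \<subseteq># m}"
proof (induction m)
  case (add x m)
  have "{k. k \<subseteq># add_mset x m} \<subseteq> {k. k \<subseteq># m} \<union> add_mset x ` {k. k \<subseteq># m}"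
  proof
    fix k assume k: "k \<in> {k. k \<subseteq># add_mset x m}"
    show "k \<in> {k. k \<subseteq># m} \<union> add_mset x ` {k. k \<subseteq># m}"
    proof (cases "x \<in># k")
      case True
      then have "k = add_mset x (k - {#x#})" by simp
      moreover have "k - {#x#} \<subseteq># m"
        using k by (simp add: subset_eq_diff_conv)
      ultimately show ?thesis by blast
    next
      case False
      have "k \<subseteq># m"
      proof (rule mset_subset_eqI)
        fix a
        show "count k a \<le> count m a"
          using mset_subset_eq_count[of k "add_mset x m" a] k False
          by (cases "a = x") (auto simp: not_in_iff)
      qed
      then show ?thesis by simp
    qed
  qed
  then show ?case using add finite_subset by blast
qed simp

lemma subset_add_single_iff:
  assumes "i \<notin># k" shows "k \<subseteq># add_mset i m \<longleftrightarrow> k \<subseteq># m"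
proof
  assume "k \<subseteq># add_mset i m"
  show "k \<subseteq># m"
  proof (rule mset_subset_eqI)
    fix a
    show "count k a \<le> count m a"
      using mset_subset_eq_count[OF \<open>k \<subseteq># add_mset i m\<close>, of a] assms
      by (cases "a = i") (auto simp: not_in_iff)
  qed
qed (metis add_mset_add_single subset_mset.add_increasing2 mset_subset_eq_add_left subset_mset.order_trans)

context cring
begin

lemma finsum_single:
  assumes "finite A" "i \<in> A" "\<And>j. j \<in> A \<Longrightarrow> j \<noteq> i \<Longrightarrow> f j = \<zero>" "f i \<in> carrier R"
  shows "(\<Oplus>j\<in>A. f j) = f i"
proof -
  have "(\<Oplus>j\<in>A. f j) = (\<Oplus>j\<in>{i}. f j)"
  proof (rule add.finprod_mono_neutral_cong_right)
    show "f \<in> A \<rightarrow> carrier R" using assms(3,4) by (metis Pi_I zero_closed)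
  qed (use assms in auto)
  then show ?thesis using assms by simp
qed

text \<open>The product of \<open>poly_ring_in\<close> without its set of variables. A multiset has
  finitely many submultisets, so the sum makes sense for arbitrary coefficient functions, and
  commutativity and distributivity are proved in that generality.\<close>

definition pconv :: "('v multiset \<Rightarrow> 'a) \<Rightarrow> ('v multiset \<Rightarrow> 'a) \<Rightarrow> 'v multiset \<Rightarrow> 'a" where
  "pconv P Q m = (\<Oplus>k\<in>{k. k \<subseteq># m}. P k \<otimes> Q (m - k))"

lemma carrier_coeff_D: "carrier_coeff P \<Longrightarrow> P m \<in> carrier R"
  by (simp add: carrier_coeff_def)

lemma const_carrier_coeff [simp]: "c \<in> carrier R \<Longrightarrow> carrier_coeff (indexed_const c)"
  by (simp add: carrier_coeff_def indexed_const_def)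

lemma pconv_carrier_coeff [simp]:
  "carrier_coeff P \<Longrightarrow> carrier_coeff Q \<Longrightarrow> carrier_coeff (pconv P Q)"
  unfolding carrier_coeff_def pconv_def by (auto intro!: finsum_closed)

lemma pconv_comm:
  fixes P Q :: "'v multiset \<Rightarrow> 'a"
  assumes "carrier_coeff P" "carrier_coeff Q"
  shows "pconv P Q = pconv Q P"
proof
  fix m :: "'v multiset"
  let ?S = "{k. k \<subseteq># m}"
  have dd: "m - (m - k) = k" if "k \<subseteq># m" for k
    using mset_subset_eq_count[OF that] by (intro multiset_eqI) simp
  have inj: "inj_on (\<lambda>k. m - k) ?S"
    by (intro inj_onI) (metis dd mem_Collect_eq)
  have im: "(\<lambda>k. m - k) ` ?S = ?S"
  proof
    show "?S \<subseteq> (\<lambda>k. m - k) ` ?S"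
    proof
      fix k assume "k \<in> ?S"
      then have "k = m - (m - k)" "m - k \<in> ?S" by (auto simp: dd)
      then show "k \<in> (\<lambda>k. m - k) ` ?S" by blast
    qed
  qed auto
  have "pconv P Q m = (\<Oplus>k\<in>(\<lambda>k. m - k) ` ?S. P k \<otimes> Q (m - k))"
    unfolding im pconv_def ..
  also have "\<dots> = (\<Oplus>k\<in>?S. P (m - k) \<otimes> Q (m - (m - k)))"
    using assms inj by (intro add.finprod_reindex) (auto simp: carrier_coeff_def)
  also have "\<dots> = (\<Oplus>k\<in>?S. Q k \<otimes> P (m - k))"
    using assms by (intro finsum_cong') (auto simp: carrier_coeff_def dd m_comm)
  finally show "pconv P Q m = pconv Q P m" unfolding pconv_def .
qed

lemma pconv_padd:
  assumes "carrier_coeff P" "carrier_coeff Q" "carrier_coeff S"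
  shows "pconv P (indexed_padd Q S) = indexed_padd (pconv P Q) (pconv P S)"
proof
  fix m
  have "(\<Oplus>k\<in>{k. k \<subseteq># m}. P k \<otimes> (Q (m - k) \<oplus> S (m - k))) =
    (\<Oplus>k\<in>{k. k \<subseteq># m}. P k \<otimes> Q (m - k) \<oplus> P k \<otimes> S (m - k))"
    using assms by (intro finsum_cong') (auto simp: carrier_coeff_def r_distr)
  then show "pconv P (indexed_padd Q S) m = indexed_padd (pconv P Q) (pconv P S) m"
    using assms by (simp add: pconv_def indexed_padd_def finsum_addf carrier_coeff_def)
qed

lemma pconv_const:
  assumes "carrier_coeff P" "c \<in> carrier R"
  shows "pconv P (indexed_const c) = (\<lambda>m. c \<otimes> P m)"
proof
  fix m
  have "(\<Oplus>k\<in>{k. k \<subseteq># m}. P k \<otimes> indexed_const c (m - k)) = P m \<otimes> indexed_const c (m - m)"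
  proof (rule finsum_single)
    fix j assume "j \<in> {k. k \<subseteq># m}" "j \<noteq> m"
    then have "m - j \<noteq> {#}" by (auto simp: Diff_eq_empty_iff_mset subset_mset.antisym)
    then show "P j \<otimes> indexed_const c (m - j) = \<zero>"
      using assms by (simp add: indexed_const_def carrier_coeff_def)
  qed (use assms in \<open>auto simp: indexed_const_def carrier_coeff_def\<close>)
  then show "pconv P (indexed_const c) m = c \<otimes> P m"
    using assms by (simp add: pconv_def indexed_const_def carrier_coeff_def m_comm)
qed

lemma pconv_pmult:
  assumes "carrier_coeff P" "carrier_coeff Q"
  shows "pconv P (indexed_pmult Q i) = indexed_pmult (pconv P Q) i"
proof
  fix m
  show "pconv P (indexed_pmult Q i) m = indexed_pmult (pconv P Q) i m"
  proof (cases "i \<in># m")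
    case True
    then obtain m' where m: "m = add_mset i m'" by (metis insert_DiffM)
    have *: "P k \<otimes> indexed_pmult Q i (m - k) = \<zero>" if "k \<subseteq># m" "\<not> k \<subseteq># m'" for k
    proof -
      have "i \<notin># m - k"
      proof
        assume i: "i \<in># m - k"
        have "k \<subseteq># m'"
        proof (rule mset_subset_eqI)
          fix a
          show "count k a \<le> count m' a"
            using mset_subset_eq_count[OF that(1), of a] i unfolding m
            by (cases "a = i") (auto simp: in_diff_count)
        qed
        then show False using that by simp
      qed
      then show ?thesis using assms by (simp add: indexed_pmult_def carrier_coeff_def)
    qed
    have "pconv P (indexed_pmult Q i) m = (\<Oplus>k\<in>{k. k \<subseteq># m'}. P k \<otimes> Q (m' - k))"
      unfolding pconv_def
    proof (rule add.finprod_mono_neutral_cong_right)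
      show "{k. k \<subseteq># m'} \<subseteq> {k. k \<subseteq># m}"
        unfolding m by (auto intro: subset_mset.order_trans)
      show "(\<lambda>k. P k \<otimes> indexed_pmult Q i (m - k)) \<in> {k. k \<subseteq># m} \<rightarrow> carrier R"
        using assms indexed_pmult_in_carrier[OF assms(2)] by (auto simp: carrier_coeff_def)
      fix k assume "k \<in> {k. k \<subseteq># m'}"
      then have "k \<subseteq># m'" by simp
      then have "i \<in># m - k" "m - k - {#i#} = m' - k"
        using mset_subset_eq_count[of k m'] unfolding m
        by (auto simp: in_diff_count le_imp_less_Suc intro!: multiset_eqI)
      then show "P k \<otimes> indexed_pmult Q i (m - k) = P k \<otimes> Q (m' - k)"
        by (simp add: indexed_pmult_def)
    qed (use * in auto)
    then show ?thesis unfolding m by (simp add: indexed_pmult_def pconv_def)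
  next
    case False
    have "P k \<otimes> indexed_pmult Q i (m - k) = \<zero>" for k
    proof -
      have "i \<notin># m - k" using False by (meson in_diffD)
      then show ?thesis using assms by (simp add: indexed_pmult_def carrier_coeff_def)
    qed
    then show ?thesis using False by (simp add: pconv_def indexed_pmult_def)
  qed
qed

abbreviation pset :: "'v set \<Rightarrow> ('v multiset \<Rightarrow> 'a) set" where
  "pset V \<equiv> indexed_pset V (carrier R)"

lemma pset_carrier_coeff [simp, intro]: "P \<in> pset V \<Longrightarrow> carrier_coeff P"
  using indexed_pset_in_carrier by blast

lemma pset_coeff [simp]: "P \<in> pset V \<Longrightarrow> P m \<in> carrier R"
  by (rule carrier_coeff_D) auto

lemma pset_scale:
  assumes "P \<in> pset V" "c \<in> carrier R"
  shows "(\<lambda>m. c \<otimes> P m) \<in> pset V"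
  using assms(1)
proof (induction rule: indexed_pset.induct)
  case (indexed_const k)
  then have eq: "(\<lambda>m. c \<otimes> indexed_const k m) = indexed_const (c \<otimes> k)"
    using assms by (auto simp: indexed_const_def)
  show ?case unfolding eq
    by (rule indexed_pset.indexed_const) (use assms indexed_const in simp)
next
  case (indexed_padd P Q)
  then have eq: "(\<lambda>m. c \<otimes> indexed_padd P Q m) = indexed_padd (\<lambda>m. c \<otimes> P m) (\<lambda>m. c \<otimes> Q m)"
    using assms by (auto simp: indexed_padd_def r_distr)
  show ?case unfolding eq by (rule indexed_pset.indexed_padd) (use indexed_padd in auto)
next
  case (indexed_pmult P i)
  then have eq: "(\<lambda>m. c \<otimes> indexed_pmult P i m) = indexed_pmult (\<lambda>m. c \<otimes> P m) i"
    using assms by (auto simp: indexed_pmult_def)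
  show ?case unfolding eq by (rule indexed_pset.indexed_pmult) (use indexed_pmult in auto)
qed

lemma pconv_closed [simp]:
  assumes "P \<in> pset V" "Q \<in> pset V"
  shows "pconv P Q \<in> pset V"
  using assms(2)
proof (induction rule: indexed_pset.induct)
  case (indexed_const k)
  then show ?case using pset_scale[OF assms(1)] assms by (simp add: pconv_const pset_carrier_coeff)
next
  case (indexed_padd Q S)
  then show ?case using assms(1) pconv_padd[of P Q S]
    by (auto intro!: indexed_pset.indexed_padd dest: pset_carrier_coeff)
next
  case (indexed_pmult Q i)
  then show ?case using assms(1) pconv_pmult[of P Q i]
    by (auto intro!: indexed_pset.indexed_pmult dest: pset_carrier_coeff)
qed

text \<open>Induction over the way \<open>S\<close> is generated, from constants by sums and
  multiplication by variables, replaces the reindexing of a double sum.\<close>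

lemma pconv_assoc:
  assumes "P \<in> pset V" "Q \<in> pset V" "S \<in> pset V"
  shows "pconv (pconv P Q) S = pconv P (pconv Q S)"
  using assms(3)
proof (induction rule: indexed_pset.induct)
  case (indexed_const c)
  have PQ: "carrier_coeff P" "carrier_coeff Q" using assms by auto
  have "pconv P (\<lambda>m. c \<otimes> Q m) m = c \<otimes> pconv P Q m" for m
  proof -
    have "(\<Oplus>k\<in>{k. k \<subseteq># m}. P k \<otimes> (c \<otimes> Q (m - k))) = (\<Oplus>k\<in>{k. k \<subseteq># m}. c \<otimes> (P k \<otimes> Q (m - k)))"
      using PQ indexed_const by (intro finsum_cong') (auto simp: carrier_coeff_def m_lcomm)
    then show ?thesis using PQ indexed_const
      by (simp add: pconv_def finsum_rdistr carrier_coeff_def)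
  qed
  then show ?case using PQ indexed_const by (simp add: pconv_const)
next
  case (indexed_padd S S')
  have "carrier_coeff P" "carrier_coeff Q" "carrier_coeff S" "carrier_coeff S'"
    using assms indexed_padd by auto
  then show ?case using indexed_padd by (simp add: pconv_padd)
next
  case (indexed_pmult S i)
  have "carrier_coeff P" "carrier_coeff Q" "carrier_coeff S"
    using assms indexed_pmult by auto
  then show ?case using indexed_pmult by (simp add: pconv_pmult)
qed

abbreviation PR :: "'v set \<Rightarrow> ('v multiset \<Rightarrow> 'a) ring" where
  "PR V \<equiv> poly_ring_in R V"

lemma PR_simps:
  "carrier (PR V) = pset V" "monoid.mult (PR V) = pconv" "one (PR V) = indexed_const \<one>"
  "ring.zero (PR V) = indexed_const \<zero>" "ring.add (PR V) = indexed_padd"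
  by (auto simp: poly_ring_in_def pconv_def fun_eq_iff)

lemma PR_cring: "cring (PR V)"
proof (rule cringI)
  show "abelian_group (PR V)"
  proof (rule abelian_groupI)
    fix P assume P: "P \<in> carrier (PR V)"
    then have c: "carrier_coeff P" by (auto simp: PR_simps)
    show "\<exists>Q\<in>carrier (PR V). Q \<oplus>\<^bsub>PR V\<^esub> P = \<zero>\<^bsub>PR V\<^esub>"
    proof
      show "(\<lambda>m. (\<ominus> \<one>) \<otimes> P m) \<in> carrier (PR V)"
        unfolding PR_simps by (rule pset_scale) (use P in \<open>auto simp: PR_simps\<close>)
      show "(\<lambda>m. (\<ominus> \<one>) \<otimes> P m) \<oplus>\<^bsub>PR V\<^esub> P = \<zero>\<^bsub>PR V\<^esub>"
        using c by (auto simp: PR_simps indexed_padd_def indexed_const_def carrier_coeff_def l_minus l_neg)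
    qed
  next
    fix P Q assume "P \<in> carrier (PR V)" "Q \<in> carrier (PR V)"
    then show "P \<oplus>\<^bsub>PR V\<^esub> Q \<in> carrier (PR V)"
      by (simp add: PR_simps indexed_pset.indexed_padd)
  next
    show "\<zero>\<^bsub>PR V\<^esub> \<in> carrier (PR V)"
      by (simp add: PR_simps indexed_pset.indexed_const)
  qed (auto simp: PR_simps indexed_padd_def a_ac indexed_const_def fun_eq_iff)
  show "Group.comm_monoid (PR V)"
  proof (rule comm_monoidI)
    fix P assume P: "P \<in> carrier (PR V)"
    then have c: "carrier_coeff P" "carrier_coeff (indexed_const \<one>)"
      by (auto simp: PR_simps carrier_coeff_def indexed_const_def)
    show "\<one>\<^bsub>PR V\<^esub> \<otimes>\<^bsub>PR V\<^esub> P = P"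
      using c by (simp add: PR_simps pconv_comm[OF c(2,1)] pconv_const carrier_coeff_def)
  qed (auto simp: PR_simps pconv_assoc intro: indexed_pset.indexed_const pconv_comm)
  fix P Q S assume "P \<in> carrier (PR V)" "Q \<in> carrier (PR V)" "S \<in> carrier (PR V)"
  then have c: "carrier_coeff P" "carrier_coeff Q" "carrier_coeff S" by (auto simp: PR_simps)
  then show "(P \<oplus>\<^bsub>PR V\<^esub> Q) \<otimes>\<^bsub>PR V\<^esub> S = P \<otimes>\<^bsub>PR V\<^esub> S \<oplus>\<^bsub>PR V\<^esub> Q \<otimes>\<^bsub>PR V\<^esub> S"
    by (simp add: PR_simps pconv_padd pconv_comm[of _ S] indexed_padd_in_carrier)
qed

lemma PR_const_closed [simp]: "c \<in> carrier R \<Longrightarrow> indexed_const c \<in> carrier (PR V)"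
  by (auto simp: PR_simps intro: indexed_pset.indexed_const)

lemma PR_pmult_eq:
  assumes "P \<in> carrier (PR V)"
  shows "P \<otimes>\<^bsub>PR V\<^esub> indexed_var i = indexed_pmult P i"
proof -
  have c: "carrier_coeff P" "carrier_coeff (indexed_const \<one>)"
    using assms by (auto simp: PR_simps carrier_coeff_def indexed_const_def)
  have "P = (\<lambda>m. \<one> \<otimes> P m)" using c by (auto simp: carrier_coeff_def)
  then have "pconv P (indexed_const \<one>) = P" using c by (simp add: pconv_const)
  then show ?thesis using c(1) by (simp add: PR_simps indexed_var_def pconv_pmult)
qed

lemma PR_var_closed [simp]: "i \<in> V \<Longrightarrow> indexed_var i \<in> carrier (PR V)"
  unfolding indexed_var_def by (auto simp: PR_simps intro: indexed_pset.intros)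

lemma PR_const_mult:
  assumes "P \<in> carrier (PR V)" "c \<in> carrier R"
  shows "indexed_const c \<otimes>\<^bsub>PR V\<^esub> P = (\<lambda>m. c \<otimes> P m)"
    and "P \<otimes>\<^bsub>PR V\<^esub> indexed_const c = (\<lambda>m. c \<otimes> P m)"
proof -
  have c: "carrier_coeff P" "carrier_coeff (indexed_const c)"
    using assms by (auto simp: PR_simps carrier_coeff_def indexed_const_def)
  then show "indexed_const c \<otimes>\<^bsub>PR V\<^esub> P = (\<lambda>m. c \<otimes> P m)"
    and "P \<otimes>\<^bsub>PR V\<^esub> indexed_const c = (\<lambda>m. c \<otimes> P m)"
    using assms by (auto simp: PR_simps pconv_comm[OF c(2,1)] pconv_const)
qed

lemma PR_add_coeff: "(P \<oplus>\<^bsub>PR V\<^esub> Q) m = P m \<oplus> Q m"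
  by (simp add: PR_simps indexed_padd_def)

lemma PR_zero_coeff: "\<zero>\<^bsub>PR V\<^esub> m = \<zero>"
  by (simp add: PR_simps indexed_const_def)

lemma PR_uminus_coeff:
  assumes "P \<in> carrier (PR V)"
  shows "(\<ominus>\<^bsub>PR V\<^esub> P) m = \<ominus> P m"
proof -
  interpret T: cring "PR V" by (rule PR_cring)
  have "P m \<oplus> (\<ominus>\<^bsub>PR V\<^esub> P) m = \<zero>"
    using T.r_neg[OF assms] PR_add_coeff PR_zero_coeff by metis
  moreover have "P m \<in> carrier R" "(\<ominus>\<^bsub>PR V\<^esub> P) m \<in> carrier R"
    using assms T.a_inv_closed[OF assms] by (auto simp: PR_simps)
  ultimately show ?thesis using add.inv_equality[of "(\<ominus>\<^bsub>PR V\<^esub> P) m" "P m"] a_comm by simp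
qed

lemma PR_minus_coeff:
  assumes "P \<in> carrier (PR V)" "Q \<in> carrier (PR V)"
  shows "(P \<ominus>\<^bsub>PR V\<^esub> Q) m = P m \<ominus> Q m"
  using assms by (simp add: a_minus_def PR_add_coeff PR_uminus_coeff)

lemma PR_mult_coeff: "(P \<otimes>\<^bsub>PR V\<^esub> Q) m = (\<Oplus>k\<in>{k. k \<subseteq># m}. P k \<otimes> Q (m - k))"
  by (simp add: PR_simps pconv_def)

lemma PR_one: "\<one>\<^bsub>PR V\<^esub> = indexed_const \<one>"
  by (simp add: PR_simps)

lemma indexed_const_hom: "indexed_const \<in> ring_hom R (PR V)"
proof (rule ring_hom_memI)
  fix x y assume "x \<in> carrier R" "y \<in> carrier R"
  then show "indexed_const (x \<otimes> y) = indexed_const x \<otimes>\<^bsub>PR V\<^esub> indexed_const y"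
    unfolding PR_const_mult(1)[OF PR_const_closed[OF \<open>y \<in> carrier R\<close>] \<open>x \<in> carrier R\<close>]
    by (auto simp: indexed_const_def)
qed (auto simp: PR_one PR_simps(5) indexed_padd_const)

definition mterm :: "'a \<Rightarrow> 'v multiset \<Rightarrow> 'v multiset \<Rightarrow> 'a" where
  "mterm c m = (\<lambda>k. if k = m then c else \<zero>)"

lemma mterm_closed:
  fixes V :: "'v set"
  assumes "c \<in> carrier R" "set_mset m \<subseteq> V"
  shows "mterm c m \<in> pset V"
  using assms(2)
proof (induction m)
  case empty
  have eq: "mterm c ({#} :: 'v multiset) = indexed_const c"
    by (auto simp: mterm_def indexed_const_def)
  show ?case unfolding eq by (rule indexed_pset.indexed_const) (rule assms(1))
next
  case (add i m)
  have "mterm c (add_mset i m) = indexed_pmult (mterm c m) i"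
    by (auto simp: mterm_def indexed_pmult_def fun_eq_iff)
  then show ?case using add by (auto intro: indexed_pset.indexed_pmult)
qed

lemma pset_support:
  assumes "P \<in> pset V"
  shows "finite {m. P m \<noteq> \<zero>}" "P m \<noteq> \<zero> \<Longrightarrow> set_mset m \<subseteq> V"
proof -
  have "finite {m. P m \<noteq> \<zero>} \<and> (\<forall>m. P m \<noteq> \<zero> \<longrightarrow> set_mset m \<subseteq> V)"
    using assms
  proof (induction rule: indexed_pset.induct)
    case (indexed_const k)
    have "{m. indexed_const k m \<noteq> \<zero>} \<subseteq> {{#}}" by (auto simp: indexed_const_def)
    then show ?case by (auto simp: indexed_const_def intro: finite_subset)
  next
    case (indexed_padd P Q)
    have "indexed_padd P Q m = \<zero>" if "P m = \<zero>" "Q m = \<zero>" for m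
      using that by (simp add: indexed_padd_def)
    then have "{m. indexed_padd P Q m \<noteq> \<zero>} \<subseteq> {m. P m \<noteq> \<zero>} \<union> {m. Q m \<noteq> \<zero>}" by blast
    then show ?case using indexed_padd by (auto intro: finite_subset)
  next
    case (indexed_pmult P i)
    have "{m. indexed_pmult P i m \<noteq> \<zero>} \<subseteq> add_mset i ` {m. P m \<noteq> \<zero>}"
      by (auto simp: indexed_pmult_def image_iff split: if_splits) (metis insert_DiffM)
    then have "finite {m. indexed_pmult P i m \<noteq> \<zero>}"
      using indexed_pmult by (auto intro: finite_subset)
    moreover have "set_mset m \<subseteq> V" if "indexed_pmult P i m \<noteq> \<zero>" for m
    proof -
      have "i \<in># m" "P (m - {#i#}) \<noteq> \<zero>" using that by (auto simp: indexed_pmult_def split: if_splits)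
      then have "set_mset (m - {#i#}) \<subseteq> V" using indexed_pmult by auto
      moreover have "set_mset m = insert i (set_mset (m - {#i#}))"
        by (metis \<open>i \<in># m\<close> insert_DiffM set_mset_add_mset_insert)
      ultimately show ?thesis using indexed_pmult by auto
    qed
    ultimately show ?case by blast
  qed
  then show "finite {m. P m \<noteq> \<zero>}" "P m \<noteq> \<zero> \<Longrightarrow> set_mset m \<subseteq> V" by auto
qed

text \<open>A polynomial is the finite sum of its terms. Applied with \<open>L\<close> the carrier
  in \<open>pset_iff\<close> and with \<open>L\<close> an ideal in
  \<open>coeff_ideal_minimal\<close>.\<close>

lemma pset_subset_ideal_aux:
  assumes "finite A" "\<And>m. P m \<noteq> \<zero> \<Longrightarrow> m \<in> A" "\<And>m. P m \<in> carrier R"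
    and L: "\<And>Q S. Q \<in> L \<Longrightarrow> S \<in> L \<Longrightarrow> indexed_padd Q S \<in> L" "indexed_const \<zero> \<in> L"
    and t: "\<And>m. P m \<noteq> \<zero> \<Longrightarrow> mterm (P m) m \<in> L"
  shows "P \<in> L"
  using assms(1-3) t
proof (induction A arbitrary: P)
  case empty
  then have "P = indexed_const \<zero>" by (auto simp: indexed_const_def)
  then show ?case using L by simp
next
  case (insert m A)
  let ?Q = "\<lambda>k. if k = m then \<zero> else P k"
  have Q: "?Q \<in> L"
  proof (rule insert.IH)
    show "k \<in> A" if "?Q k \<noteq> \<zero>" for k using that insert.prems(1)[of k] by (auto split: if_splits)
    show "?Q k \<in> carrier R" for k using insert.prems(2) by simp
    show "mterm (?Q k) k \<in> L" if "?Q k \<noteq> \<zero>" for k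
      using that insert.prems(3)[of k] by (cases "k = m") auto
  qed
  show ?case
  proof (cases "P m = \<zero>")
    case True
    then have "?Q = P" by auto
    then show ?thesis using Q by simp
  next
    case False
    have "P = indexed_padd ?Q (mterm (P m) m)"
      using insert.prems by (auto simp: indexed_padd_def mterm_def)
    then show ?thesis using Q L(1) insert.prems(3)[OF False] by metis
  qed
qed

lemma pset_iff:
  "P \<in> pset V \<longleftrightarrow> (\<forall>m. P m \<in> carrier R) \<and> finite {m. P m \<noteq> \<zero>} \<and> (\<forall>m. P m \<noteq> \<zero> \<longrightarrow> set_mset m \<subseteq> V)"
proof
  assume *: "(\<forall>m. P m \<in> carrier R) \<and> finite {m. P m \<noteq> \<zero>} \<and> (\<forall>m. P m \<noteq> \<zero> \<longrightarrow> set_mset m \<subseteq> V)"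
  show "P \<in> pset V"
    by (rule pset_subset_ideal_aux[of "{m. P m \<noteq> \<zero>}"])
       (use * in \<open>auto intro: indexed_pset.intros mterm_closed\<close>)
qed (use pset_support pset_coeff in \<open>blast\<close>)

lemma finsum_in_ideal:
  assumes "ideal A R" "\<And>i. i \<in> S \<Longrightarrow> f i \<in> A"
  shows "(\<Oplus>i\<in>S. f i) \<in> A"
  using assms(2)
proof (induction S rule: infinite_finite_induct)
  case (insert i S)
  have "f j \<in> carrier R" if "j \<in> insert i S" for j
    using insert.prems[OF that] ideal.Icarr[OF assms(1)] by simp
  then show ?case
    using insert ideal_add_closed[OF assms(1)] by (subst finsum_insert) auto
qed (use ideal_zero_closed[OF assms(1)] in auto)

subsection \<open>Extended ideals\<close>

text \<open>The extension of \<open>A\<close> to the polynomial ring, described by coefficients;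
  \<open>coeff_ideal_minimal\<close> shows that the constants from \<open>A\<close> generate
  it.\<close>

definition coeff_ideal :: "'v set \<Rightarrow> 'a set \<Rightarrow> ('v multiset \<Rightarrow> 'a) set" where
  "coeff_ideal V A = {P \<in> carrier (PR V). \<forall>m. P m \<in> A}"

lemma PR_coeff [simp]: "P \<in> carrier (PR V) \<Longrightarrow> P m \<in> carrier R"
  by (simp add: PR_simps)

lemma coeff_ideal_ideal:
  assumes A: "ideal A R"
  shows "ideal (coeff_ideal V A) (PR V)"
proof -
  interpret T: cring "PR V" by (rule PR_cring)
  show ?thesis
  proof (rule idealI)
    show "subgroup (coeff_ideal V A) (add_monoid (PR V))"
    proof (rule T.add.subgroupI)
      have "\<zero>\<^bsub>PR V\<^esub> \<in> coeff_ideal V A"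
        using ideal_zero_closed[OF A] T.zero_closed by (simp add: coeff_ideal_def PR_zero_coeff)
      then show "coeff_ideal V A \<noteq> {}" by blast
    qed (auto simp: coeff_ideal_def PR_add_coeff PR_uminus_coeff ideal_add_closed[OF A] ideal_uminus_closed[OF A])
    fix P Q assume P: "P \<in> coeff_ideal V A" and Q: "Q \<in> carrier (PR V)"
    have "(Q \<otimes>\<^bsub>PR V\<^esub> P) m \<in> A" for m
      unfolding PR_mult_coeff
      using P Q by (intro finsum_in_ideal[OF A] ideal.I_l_closed[OF A]) (auto simp: coeff_ideal_def)
    then show QP: "Q \<otimes>\<^bsub>PR V\<^esub> P \<in> coeff_ideal V A" using P Q by (simp add: coeff_ideal_def)
    then show "P \<otimes>\<^bsub>PR V\<^esub> Q \<in> coeff_ideal V A"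
      using P Q T.m_comm[of P Q] by (simp add: coeff_ideal_def)
  qed (rule T.ring_axioms)
qed

lemma const_mem_coeff_ideal:
  assumes "ideal A R" "a \<in> A"
  shows "indexed_const a \<in> coeff_ideal V A"
  using assms ideal_zero_closed[OF assms(1)] ideal.Icarr[OF assms]
  by (simp add: coeff_ideal_def) (simp add: indexed_const_def)

lemma coeff_ideal_minimal:
  assumes A: "ideal A R" and L: "ideal L (PR V)" "indexed_const ` A \<subseteq> L"
  shows "coeff_ideal V A \<subseteq> L"
proof
  interpret T: cring "PR V" by (rule PR_cring)
  fix P assume P: "P \<in> coeff_ideal V A"
  then have P': "P \<in> pset V" by (simp add: coeff_ideal_def PR_simps)
  show "P \<in> L"
  proof (rule pset_subset_ideal_aux[of "{m. P m \<noteq> \<zero>}"])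
    show "indexed_padd Q S \<in> L" if "Q \<in> L" "S \<in> L" for Q S
      using T.ideal_add_closed[OF L(1)] that by (simp add: PR_simps)
    show "indexed_const \<zero> \<in> L" using T.ideal_zero_closed[OF L(1)] by (simp add: PR_simps)
    fix m assume m: "P m \<noteq> \<zero>"
    have t: "mterm \<one> m \<in> carrier (PR V)"
      unfolding PR_simps by (rule mterm_closed) (use pset_support(2)[OF P' m] in auto)
    have "mterm (P m) m = mterm \<one> m \<otimes>\<^bsub>PR V\<^esub> indexed_const (P m)"
      using PR_const_mult(2)[OF t, of "P m"] P by (auto simp: mterm_def coeff_ideal_def)
    moreover have "indexed_const (P m) \<in> L" using P L(2) by (auto simp: coeff_ideal_def)
    ultimately show "mterm (P m) m \<in> L" using ideal.I_l_closed[OF L(1)] t by metis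
  qed (use P' pset_support(1) in auto)
qed

lemma coeff_ideal_decomp:
  assumes "\<And>x. x \<in> A' \<Longrightarrow> \<exists>a\<in>A. \<exists>s\<in>carrier R. x = a \<oplus> z \<otimes> s"
    and A: "ideal A R" and z: "z \<in> carrier R" and P: "P \<in> coeff_ideal V A'"
  shows "\<exists>Q\<in>coeff_ideal V A. \<exists>S\<in>carrier (PR V). P = Q \<oplus>\<^bsub>PR V\<^esub> indexed_const z \<otimes>\<^bsub>PR V\<^esub> S"
proof -
  \<comment> \<open>Each coefficient is split separately; the choice \<open>a = s = \<zero>\<close>
    wherever \<open>P\<close> vanishes keeps both supports finite.\<close>
  have "\<exists>a s. a \<in> A \<and> s \<in> carrier R \<and> P m = a \<oplus> z \<otimes> s \<and> (P m = \<zero> \<longrightarrow> a = \<zero> \<and> s = \<zero>)" for m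
  proof (cases "P m = \<zero>")
    case True
    then show ?thesis using ideal_zero_closed[OF A] z by (intro exI[of _ \<zero>]) simp
  next
    case False
    then show ?thesis using assms(1)[of "P m"] P by (auto simp: coeff_ideal_def)
  qed
  then obtain a s where as: "\<And>m. a m \<in> A" "\<And>m. s m \<in> carrier R" "\<And>m. P m = a m \<oplus> z \<otimes> s m"
    "\<And>m. P m = \<zero> \<Longrightarrow> a m = \<zero> \<and> s m = \<zero>" by metis
  have P': "P \<in> pset V" using P by (simp add: coeff_ideal_def PR_simps)
  have ac: "a m \<in> carrier R" for m using as(1) ideal.Icarr[OF A] by simp
  have "finite {m. a m \<noteq> \<zero>}" "finite {m. s m \<noteq> \<zero>}"
    using as(4) by (auto intro!: finite_subset[OF _ pset_support(1)[OF P']])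
  then have a: "a \<in> carrier (PR V)" and s: "s \<in> carrier (PR V)"
    using ac as(2,4) pset_support(2)[OF P'] unfolding PR_simps pset_iff by blast+
  have "P = a \<oplus>\<^bsub>PR V\<^esub> indexed_const z \<otimes>\<^bsub>PR V\<^esub> s"
    unfolding PR_const_mult(1)[OF s z] by (auto simp: PR_add_coeff as(3))
  then show ?thesis using a s as(1) by (auto simp: coeff_ideal_def)
qed

lemma regular_flag_PR:
  assumes F: "regular_flag A z q"
  shows "cring.regular_flag (PR V) (\<lambda>i. coeff_ideal V (A i)) (\<lambda>i. indexed_const (z i)) q"
proof -
  interpret T: cring "PR V" by (rule PR_cring)
  note D = regular_flagD[OF F]
  show ?thesis
    unfolding T.regular_flag_def
  proof (intro conjI allI impI ballI)
    fix i assume "i \<le> q"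
    then show "ideal (coeff_ideal V (A i)) (PR V)" using D(1) coeff_ideal_ideal by blast
  next
    fix i assume i: "i < q"
    show "indexed_const (z i) \<in> coeff_ideal V (A (Suc i))"
      using D(1,2) i by (intro const_mem_coeff_ideal) auto
    show "coeff_ideal V (A i) \<subseteq> coeff_ideal V (A (Suc i))"
      using D(3)[OF i] by (auto simp: coeff_ideal_def)
    show "\<exists>a\<in>coeff_ideal V (A i). \<exists>s\<in>carrier (PR V). x = a \<oplus>\<^bsub>PR V\<^esub> indexed_const (z i) \<otimes>\<^bsub>PR V\<^esub> s"
      if "x \<in> coeff_ideal V (A (Suc i))" for x
      using D(1)[of i] D(4)[OF i] D(6)[OF i] i that by (intro coeff_ideal_decomp) auto
    show "x \<in> coeff_ideal V (A i)"
      if x: "x \<in> carrier (PR V)" and "indexed_const (z i) \<otimes>\<^bsub>PR V\<^esub> x \<in> coeff_ideal V (A i)" for x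
      using that(2) D(5)[OF i] x unfolding PR_const_mult(1)[OF x D(6)[OF i]]
      by (auto simp: coeff_ideal_def)
  qed
qed

subsection \<open>Division by a variable\<close>

text \<open>Division by the variable \<open>i\<close>, discarding the terms free of it. It is linear
  over polynomials free of \<open>i\<close> (\<open>shift_mult\<close>), and some iterate kills any
  given polynomial (\<open>shift_nilpotent\<close>).\<close>

definition shift :: "'v \<Rightarrow> ('v multiset \<Rightarrow> 'a) \<Rightarrow> 'v multiset \<Rightarrow> 'a" where
  "shift i P = (\<lambda>m. P (add_mset i m))"

lemma shift_closed [simp]:
  assumes "P \<in> carrier (PR V)"
  shows "shift i P \<in> carrier (PR V)"
proof -
  have P: "P \<in> pset V" using assms by (simp add: PR_simps)
  have "add_mset i ` {m. shift i P m \<noteq> \<zero>} \<subseteq> {m. P m \<noteq> \<zero>}" by (auto simp: shift_def)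
  then have "finite (add_mset i ` {m. shift i P m \<noteq> \<zero>})"
    using pset_support(1)[OF P] finite_subset by blast
  then have fin: "finite {m. shift i P m \<noteq> \<zero>}"
    by (rule finite_imageD) (simp add: inj_on_def)
  moreover have "set_mset m \<subseteq> V" if "shift i P m \<noteq> \<zero>" for m
    using pset_support(2)[OF P, of "add_mset i m"] that by (auto simp: shift_def)
  moreover have "shift i P m \<in> carrier R" for m using assms by (simp add: shift_def)
  ultimately show ?thesis using fin unfolding PR_simps pset_iff by blast
qed

lemma shift_add: "shift i (P \<oplus>\<^bsub>PR V\<^esub> Q) = shift i P \<oplus>\<^bsub>PR V\<^esub> shift i Q"
  by (auto simp: shift_def PR_simps indexed_padd_def)

lemma shift_coeff_ideal: "P \<in> coeff_ideal V A \<Longrightarrow> shift i P \<in> coeff_ideal V A"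
  by (auto simp: coeff_ideal_def) (simp add: shift_def)

lemma shift_mult:
  assumes "P \<in> carrier (PR V)" "Q \<in> carrier (PR V)" "index_free Q i"
  shows "shift i (Q \<otimes>\<^bsub>PR V\<^esub> P) = Q \<otimes>\<^bsub>PR V\<^esub> shift i P"
proof
  fix m
  have "(Q \<otimes>\<^bsub>PR V\<^esub> P) (add_mset i m) = (\<Oplus>k\<in>{k. k \<subseteq># m}. Q k \<otimes> P (add_mset i (m - k)))"
    unfolding PR_mult_coeff
  proof (rule add.finprod_mono_neutral_cong_right)
    show "{k. k \<subseteq># m} \<subseteq> {k. k \<subseteq># add_mset i m}"
      by (auto intro: subset_mset.order_trans)
    fix k assume k: "k \<in> {k. k \<subseteq># add_mset i m} - {k. k \<subseteq># m}"
    then have "i \<in># k" using subset_add_single_iff[of i k m] by auto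
    then show "Q k \<otimes> P (add_mset i m - k) = \<zero>"
      using assms by (simp add: index_free_def)
  next
    fix k assume "k \<in> {k. k \<subseteq># m}"
    then have "add_mset i m - k = add_mset i (m - k)"
      using mset_subset_eq_count[of k m] by (intro multiset_eqI) (auto simp: Suc_diff_le)
    then show "Q k \<otimes> P (add_mset i m - k) = Q k \<otimes> P (add_mset i (m - k))" by simp
  qed (use assms in auto)
  then show "shift i (Q \<otimes>\<^bsub>PR V\<^esub> P) m = (Q \<otimes>\<^bsub>PR V\<^esub> shift i P) m"
    by (simp add: shift_def PR_mult_coeff)
qed

lemma shift_var:
  assumes "P \<in> carrier (PR V)"
  shows "shift i (P \<otimes>\<^bsub>PR V\<^esub> indexed_var i) = P"
  unfolding PR_pmult_eq[OF assms] by (auto simp: shift_def indexed_pmult_def)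

lemma shift_nilpotent:
  assumes "P \<in> carrier (PR V)"
  shows "\<exists>k. (shift i ^^ k) P = \<zero>\<^bsub>PR V\<^esub>"
proof -
  have sh: "(shift i ^^ k) P m = P (m + replicate_mset k i)" for k m
    by (induction k arbitrary: m) (auto simp: shift_def)
  have fin: "finite ((\<lambda>m. count m i) ` {m. P m \<noteq> \<zero>})"
    using assms pset_support(1) by (auto simp: PR_simps)
  obtain k where k: "\<And>m. P m \<noteq> \<zero> \<Longrightarrow> count m i < k"
    using finite_nat_set_iff_bounded[THEN iffD1, OF fin] by auto
  have "P (m + replicate_mset k i) = \<zero>" for m
    using k[of "m + replicate_mset k i"] by auto
  then show ?thesis by (intro exI[of _ k]) (auto simp: sh PR_zero_coeff)
qed

lemma shift_lin:
  assumes "set bs \<subseteq> carrier (PR V)" "\<And>b. b \<in> set bs \<Longrightarrow> index_free b i" "ideal A R"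
    and "P \<in> cring.lin (PR V) bs (coeff_ideal V A)"
  shows "shift i P \<in> cring.lin (PR V) bs (coeff_ideal V A)"
proof -
  interpret T: cring "PR V" by (rule PR_cring)
  show ?thesis
    using assms(1,2,4)
  proof (induction bs arbitrary: P)
    case Nil
    then show ?case using shift_coeff_ideal by simp
  next
    case (Cons b bs)
    then obtain q r where q: "P = q \<otimes>\<^bsub>PR V\<^esub> b \<oplus>\<^bsub>PR V\<^esub> r" "q \<in> carrier (PR V)"
      "r \<in> T.lin bs (coeff_ideal V A)" by auto
    have "shift i (q \<otimes>\<^bsub>PR V\<^esub> b) = shift i q \<otimes>\<^bsub>PR V\<^esub> b"
      using Cons.prems q shift_mult[of q V b i] by (simp add: T.m_comm)
    then have "shift i P = shift i q \<otimes>\<^bsub>PR V\<^esub> b \<oplus>\<^bsub>PR V\<^esub> shift i r"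
      unfolding q shift_add by simp
    moreover have "shift i r \<in> T.lin bs (coeff_ideal V A)" using Cons q by simp
    moreover have "shift i q \<in> carrier (PR V)" using q(2) by simp
    ultimately show ?case unfolding T.lin.simps by blast
  qed
qed

text \<open>Let \<open>w_k\<close> be the \<open>k\<close>-fold shift of \<open>w\<close>. The ideal
  is stable under the shift because \<open>bs\<close> is free of the variable, so \<open>b w\<close>
  yields \<open>c w_k + g w_(k+1)\<close> in it for every \<open>k\<close>. As
  \<open>w_K = 0\<close> for some \<open>K\<close>, multiplying by \<open>c\<close> and descending
  gives \<open>c^j w_(K-j)\<close> in the ideal, finally \<open>c^K w\<close>.\<close>

lemma linear_in_variable_weakly_regular:
  assumes bs: "set bs \<subseteq> carrier (PR V)" "\<And>b. b \<in> set bs \<Longrightarrow> index_free b i"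
    and A: "ideal A R" and c: "c \<in> carrier R" and i: "i \<in> V"
    and g: "g \<in> carrier (PR V)" "index_free g i"
    and b: "b = indexed_var i \<otimes>\<^bsub>PR V\<^esub> indexed_const c \<oplus>\<^bsub>PR V\<^esub> g"
    and w: "w \<in> carrier (PR V)" "b \<otimes>\<^bsub>PR V\<^esub> w \<in> cring.lin (PR V) bs (coeff_ideal V A)"
  shows "\<exists>N::nat. indexed_const c [^]\<^bsub>PR V\<^esub> N \<otimes>\<^bsub>PR V\<^esub> w \<in> cring.lin (PR V) bs (coeff_ideal V A)"
proof -
  interpret T: cring "PR V" by (rule PR_cring)
  let ?L = "T.lin bs (coeff_ideal V A)" and ?c = "indexed_const c"
  have L: "ideal ?L (PR V)" using T.lin_ideal[OF coeff_ideal_ideal[OF A] bs(1)] .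
  have cc: "?c \<in> carrier (PR V)" using c by simp
  have wk: "(shift i ^^ k) w \<in> carrier (PR V)" for k using w by (induction k) auto
  have free: "index_free ?c i" by (simp add: index_free_def indexed_const_def)
  have var: "indexed_var i \<in> carrier (PR V)" using i by simp
  have rel: "?c \<otimes>\<^bsub>PR V\<^esub> (shift i ^^ k) w \<oplus>\<^bsub>PR V\<^esub> g \<otimes>\<^bsub>PR V\<^esub> (shift i ^^ Suc k) w \<in> ?L" for k
  proof (induction k)
    case 0
    have "b \<otimes>\<^bsub>PR V\<^esub> w = (?c \<otimes>\<^bsub>PR V\<^esub> w) \<otimes>\<^bsub>PR V\<^esub> indexed_var i \<oplus>\<^bsub>PR V\<^esub> g \<otimes>\<^bsub>PR V\<^esub> w"
      unfolding b using cc w(1) g(1) var by algebra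
    then have "shift i (b \<otimes>\<^bsub>PR V\<^esub> w) = ?c \<otimes>\<^bsub>PR V\<^esub> w \<oplus>\<^bsub>PR V\<^esub> g \<otimes>\<^bsub>PR V\<^esub> shift i w"
      using cc w(1) g by (simp add: shift_add shift_var shift_mult)
    then show ?case using shift_lin[OF bs A w(2)] by simp
  next
    case (Suc k)
    have "shift i (?c \<otimes>\<^bsub>PR V\<^esub> (shift i ^^ k) w \<oplus>\<^bsub>PR V\<^esub> g \<otimes>\<^bsub>PR V\<^esub> (shift i ^^ Suc k) w) =
      ?c \<otimes>\<^bsub>PR V\<^esub> (shift i ^^ Suc k) w \<oplus>\<^bsub>PR V\<^esub> g \<otimes>\<^bsub>PR V\<^esub> (shift i ^^ Suc (Suc k)) w"
      using cc wk[of k] wk[of "Suc k"] g free by (simp add: shift_add shift_mult)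
    then show ?case using shift_lin[OF bs A Suc.IH] by simp
  qed
  obtain K where K: "(shift i ^^ K) w = \<zero>\<^bsub>PR V\<^esub>" using shift_nilpotent[OF w(1)] by blast
  have "?c [^]\<^bsub>PR V\<^esub> j \<otimes>\<^bsub>PR V\<^esub> (shift i ^^ (K - j)) w \<in> ?L" if "j \<le> K" for j
    using that
  proof (induction j)
    case 0
    then show ?case using K T.ideal_zero_closed[OF L] by simp
  next
    case (Suc j)
    let ?u = "(shift i ^^ (K - Suc j)) w" and ?v = "(shift i ^^ (K - j)) w" and ?cj = "?c [^]\<^bsub>PR V\<^esub> j"
    have Kj: "Suc (K - Suc j) = K - j" using Suc by simp
    have "?c \<otimes>\<^bsub>PR V\<^esub> ?u \<oplus>\<^bsub>PR V\<^esub> g \<otimes>\<^bsub>PR V\<^esub> ?v \<in> ?L" using rel[of "K - Suc j"] unfolding Kj .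
    then have "?cj \<otimes>\<^bsub>PR V\<^esub> (?c \<otimes>\<^bsub>PR V\<^esub> ?u \<oplus>\<^bsub>PR V\<^esub> g \<otimes>\<^bsub>PR V\<^esub> ?v) \<ominus>\<^bsub>PR V\<^esub> g \<otimes>\<^bsub>PR V\<^esub> (?cj \<otimes>\<^bsub>PR V\<^esub> ?v) \<in> ?L"
      by (rule T.ideal_minus_closed[OF L ideal.I_l_closed[OF L] ideal.I_l_closed[OF L _ g(1)]])
         (use Suc cc in auto)
    moreover have "?cj \<otimes>\<^bsub>PR V\<^esub> (?c \<otimes>\<^bsub>PR V\<^esub> ?u \<oplus>\<^bsub>PR V\<^esub> g \<otimes>\<^bsub>PR V\<^esub> ?v) \<ominus>\<^bsub>PR V\<^esub> g \<otimes>\<^bsub>PR V\<^esub> (?cj \<otimes>\<^bsub>PR V\<^esub> ?v)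
      = (?cj \<otimes>\<^bsub>PR V\<^esub> ?c) \<otimes>\<^bsub>PR V\<^esub> ?u"
    proof -
      have id: "x \<otimes>\<^bsub>PR V\<^esub> (y \<otimes>\<^bsub>PR V\<^esub> u \<oplus>\<^bsub>PR V\<^esub> g \<otimes>\<^bsub>PR V\<^esub> v) \<ominus>\<^bsub>PR V\<^esub> g \<otimes>\<^bsub>PR V\<^esub> (x \<otimes>\<^bsub>PR V\<^esub> v) = (x \<otimes>\<^bsub>PR V\<^esub> y) \<otimes>\<^bsub>PR V\<^esub> u"
        if "x \<in> carrier (PR V)" "y \<in> carrier (PR V)" "u \<in> carrier (PR V)" "v \<in> carrier (PR V)" for x y u v
        using that g(1) by algebra
      show ?thesis by (rule id) (use cc wk in auto)
    qed
    ultimately show ?case by simp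
  qed
  from this[of K] show ?thesis by auto
qed

end

subsection \<open>Zero divisors modulo extended ideals\<close>

text \<open>A leading-term argument in the style of Dedekind-Mertens and McCoy, by induction on the
  number of coefficients of \<open>P\<close> outside \<open>A\<close>; the multiset order is
  compatible with addition. Unless every coefficient of \<open>v\<close> carries \<open>P\<close>
  into the extension of \<open>A\<close>, the largest offending one gives a multiple of
  \<open>P\<close> with fewer coefficients outside \<open>A\<close>.\<close>

lemma (in cring) unit_coeff_regular:
  fixes V :: "'v :: linorder set"
  assumes A: "ideal A R" and v: "v \<in> carrier (PR V)" "v m0 \<in> Units R"
    and P: "P \<in> carrier (PR V)" "v \<otimes>\<^bsub>PR V\<^esub> P \<in> coeff_ideal V A"
  shows "P \<in> coeff_ideal V A"
  using P
proof (induction "card {m. P m \<notin> A}" arbitrary: P rule: less_induct)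
  case less
  interpret T: cring "PR V" by (rule PR_cring)
  note P = less.prems(1)
  have P': "P \<in> pset V" and v': "v \<in> pset V" using P v by (auto simp: PR_simps)
  have finP: "finite {m. P m \<notin> A}"
    by (rule finite_subset[OF _ pset_support(1)[OF P']]) (use ideal_zero_closed[OF A] in auto)
  show ?case
  proof (cases "{m. P m \<notin> A} = {}")
    case True
    then show ?thesis using P by (auto simp: coeff_ideal_def)
  next
    case ne: False
    define x where "x = Max {m. P m \<notin> A}"
    have x: "P x \<notin> A" "\<And>m. x < m \<Longrightarrow> P m \<in> A"
      using Max_in[OF finP ne] Max_ge[OF finP] unfolding x_def by (auto simp: not_less[symmetric])
    \<comment> \<open>The monomials of \<open>v\<close> whose coefficient does not carry all of
      \<open>P\<close> into \<open>A\<close>. For \<open>n\<close> maximal in \<open>U\<close> and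
      \<open>x\<close> the last coefficient of \<open>P\<close> outside \<open>A\<close>, every
      other summand at \<open>n + x\<close> has its first index beyond \<open>n\<close> or its
      second beyond \<open>x\<close>, so it lies in \<open>A\<close>, and hence
      \<open>v n \<otimes> P x\<close> does.\<close>
    define U where "U = {n. \<exists>m. v n \<otimes> P m \<notin> A}"
    have "U \<subseteq> {n. v n \<noteq> \<zero>}" unfolding U_def using P ideal_zero_closed[OF A] by auto
    then have finU: "finite U" using pset_support(1)[OF v'] finite_subset by blast
    have "U = {}"
    proof (rule ccontr)
      assume neU: "U \<noteq> {}"
      define n where "n = Max U"
      have n: "n \<in> U" "\<And>k. n < k \<Longrightarrow> k \<notin> U"
        using Max_in[OF finU neU] Max_ge[OF finU] unfolding n_def by (auto simp: not_less[symmetric])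
      have "(v \<otimes>\<^bsub>PR V\<^esub> P) (n + x) \<in> A" using less.prems(2) by (simp add: coeff_ideal_def)
      let ?t = "\<lambda>k. v k \<otimes> P (n + x - k)"
      have tc: "?t k \<in> carrier R" for k using v P by auto
      have eq: "{k. k \<subseteq># n + x} = insert n ({k. k \<subseteq># n + x} - {n})" by auto
      have sum: "(v \<otimes>\<^bsub>PR V\<^esub> P) (n + x) = ?t n \<oplus> (\<Oplus>k\<in>{k. k \<subseteq># n + x} - {n}. ?t k)"
        unfolding PR_mult_coeff by (subst eq, subst finsum_insert) (use tc v P in auto)
      have rest: "(\<Oplus>k\<in>{k. k \<subseteq># n + x} - {n}. ?t k) \<in> A"
      proof (rule finsum_in_ideal[OF A])
        fix k assume k: "k \<in> {k. k \<subseteq># n + x} - {n}"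
        then have e: "k + (n + x - k) = n + x" by simp
        consider "n < k" | "k < n" using k by fastforce
        then show "?t k \<in> A"
        proof cases
          case 1
          then show ?thesis using n(2) by (auto simp: U_def)
        next
          case 2
          have "x < n + x - k"
          proof (rule ccontr)
            assume "\<not> x < n + x - k"
            then have "k + (n + x - k) < n + x" using 2 by (intro add_less_le_mono) auto
            then show False using e by simp
          qed
          then show ?thesis using x(2) v by (intro ideal.I_l_closed[OF A]) auto
        qed
      qed
      let ?r = "\<Oplus>k\<in>{k. k \<subseteq># n + x} - {n}. ?t k"
      have rc: "?r \<in> carrier R" using tc by (intro finsum_closed) blast
      have "y \<oplus> z \<ominus> z = y" if "y \<in> carrier R" "z \<in> carrier R" for y z
        using that by algebra
      from this[OF tc[of n] rc] have "?t n \<in> A"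
        using ideal_minus_closed[OF A \<open>(v \<otimes>\<^bsub>PR V\<^esub> P) (n + x) \<in> A\<close> rest] unfolding sum by simp
      then have top: "v n \<otimes> P x \<in> A" by simp
      let ?Q = "indexed_const (v n) \<otimes>\<^bsub>PR V\<^esub> P"
      have vn: "v n \<in> carrier R" using v by simp
      have Q: "?Q = (\<lambda>m. v n \<otimes> P m)" using PR_const_mult(1)[OF P vn] .
      have "{m. ?Q m \<notin> A} \<subset> {m. P m \<notin> A}"
        unfolding Q using top x(1) vn ideal.I_l_closed[OF A] by blast
      then have "card {m. ?Q m \<notin> A} < card {m. P m \<notin> A}" using finP by (rule psubset_card_mono[rotated])
      moreover have "v \<otimes>\<^bsub>PR V\<^esub> ?Q \<in> coeff_ideal V A"
      proof -
        have "v \<otimes>\<^bsub>PR V\<^esub> ?Q = indexed_const (v n) \<otimes>\<^bsub>PR V\<^esub> (v \<otimes>\<^bsub>PR V\<^esub> P)"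
          using v P vn by (intro T.m_lcomm) auto
        then show ?thesis
          using ideal.I_l_closed[OF coeff_ideal_ideal[OF A] less.prems(2), of "indexed_const (v n)"] vn by simp
      qed
      moreover have "?Q \<in> carrier (PR V)" using P vn by simp
      ultimately have "?Q \<in> coeff_ideal V A" using less.hyps by blast
      then show False using n(1) unfolding Q by (auto simp: U_def coeff_ideal_def)
    qed
    then have "v m0 \<otimes> P m \<in> A" for m unfolding U_def by blast
    moreover have "P m = inv (v m0) \<otimes> (v m0 \<otimes> P m)" for m
      using v P by (simp add: m_assoc[symmetric])
    ultimately have "P m \<in> A" for m using v ideal.I_l_closed[OF A] by (metis Units_inv_closed)
    then show ?thesis using P by (simp add: coeff_ideal_def)
  qed
qed

context cring
begin

subsection \<open>Evaluation\<close>

definition mon :: "('v \<Rightarrow> 'a) \<Rightarrow> 'v multiset \<Rightarrow> 'a" where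
  "mon x m = (\<Otimes>i\<in>set_mset m. x i [^] count m i)"

lemma mon_superset:
  assumes "finite S" "set_mset m \<subseteq> S" "\<And>i. i \<in> S \<Longrightarrow> x i \<in> carrier R"
  shows "mon x m = (\<Otimes>i\<in>S. x i [^] count m i)"
  unfolding mon_def
proof (rule finprod_mono_neutral_cong_left)
  fix i assume "i \<in> S - set_mset m"
  then show "x i [^] count m i = \<one>" by (simp add: not_in_iff)
qed (use assms in auto)

lemma mon_closed [simp]: "(\<And>i. i \<in># m \<Longrightarrow> x i \<in> carrier R) \<Longrightarrow> mon x m \<in> carrier R"
  by (auto simp: mon_def intro!: finprod_closed)

lemma mon_empty [simp]: "mon x {#} = \<one>"
  by (simp add: mon_def)

lemma mon_single [simp]: "x i \<in> carrier R \<Longrightarrow> mon x {#i#} = x i"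
  by (simp add: mon_def)

lemma mon_add:
  assumes "\<And>i. i \<in># m \<Longrightarrow> x i \<in> carrier R" "\<And>i. i \<in># m' \<Longrightarrow> x i \<in> carrier R"
  shows "mon x (m + m') = mon x m \<otimes> mon x m'"
proof -
  let ?S = "set_mset m \<union> set_mset m'"
  have x: "x i \<in> carrier R" if "i \<in> ?S" for i using assms that by auto
  have "mon x (m + m') = (\<Otimes>i\<in>?S. x i [^] count (m + m') i)"
    using x by (intro mon_superset) auto
  also have "\<dots> = (\<Otimes>i\<in>?S. x i [^] count m i \<otimes> x i [^] count m' i)"
    by (rule finprod_cong') (use x in \<open>auto simp: nat_pow_mult\<close>)
  also have "\<dots> = (\<Otimes>i\<in>?S. x i [^] count m i) \<otimes> (\<Otimes>i\<in>?S. x i [^] count m' i)"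
    using x by (intro finprod_multf) auto
  also have "\<dots> = mon x m \<otimes> mon x m'"
    using x mon_superset[of ?S m x] mon_superset[of ?S m' x] by auto
  finally show ?thesis .
qed

lemma mon_add_mset:
  assumes "\<And>j. j \<in># add_mset i m \<Longrightarrow> x j \<in> carrier R"
  shows "mon x (add_mset i m) = mon x m \<otimes> x i"
  using mon_add[of m x "{#i#}"] assms by simp

lemma mon_cong: "(\<And>i. i \<in># m \<Longrightarrow> x i = y i) \<Longrightarrow> (\<And>i. i \<in># m \<Longrightarrow> x i \<in> carrier R) \<Longrightarrow> mon x m = mon y m"
  unfolding mon_def by (intro finprod_cong') auto

definition peval :: "('v \<Rightarrow> 'a) \<Rightarrow> ('v multiset \<Rightarrow> 'a) \<Rightarrow> 'a" where
  "peval x P = (\<Oplus>m\<in>{m. P m \<noteq> \<zero>}. P m \<otimes> mon x m)"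

lemma peval_superset:
  assumes "finite S" "\<And>m. P m \<noteq> \<zero> \<Longrightarrow> m \<in> S" "\<And>m. P m \<in> carrier R" "\<And>i. x i \<in> carrier R"
  shows "peval x P = (\<Oplus>m\<in>S. P m \<otimes> mon x m)"
  unfolding peval_def
  by (rule add.finprod_mono_neutral_cong_left) (use assms in auto)

lemma peval_closed [simp]:
  assumes "P \<in> carrier (PR V)" "\<And>i. x i \<in> carrier R"
  shows "peval x P \<in> carrier R"
  unfolding peval_def using assms by (auto intro!: finsum_closed)

lemma peval_in_ideal:
  assumes "ideal A R" "P \<in> coeff_ideal V A" "\<And>i. x i \<in> carrier R"
  shows "peval x P \<in> A"
  unfolding peval_def
  using assms by (intro finsum_in_ideal ideal.I_r_closed[OF assms(1)]) (auto simp: coeff_ideal_def)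

lemma peval_const [simp]:
  assumes "c \<in> carrier R" "\<And>i. x i \<in> carrier R"
  shows "peval x (indexed_const c) = c"
proof -
  have "peval x (indexed_const c) = (\<Oplus>m\<in>{{#}}. indexed_const c m \<otimes> mon x m)"
    using assms by (intro peval_superset) (auto simp: indexed_const_def split: if_splits)
  then show ?thesis using assms by (simp add: indexed_const_def)
qed

lemma peval_add:
  assumes "P \<in> carrier (PR V)" "Q \<in> carrier (PR V)" "\<And>i. x i \<in> carrier R"
  shows "peval x (P \<oplus>\<^bsub>PR V\<^esub> Q) = peval x P \<oplus> peval x Q"
proof -
  interpret T: cring "PR V" by (rule PR_cring)
  have PQ: "P \<in> pset V" "Q \<in> pset V" using assms by (auto simp: PR_simps)
  let ?S = "{m. P m \<noteq> \<zero>} \<union> {m. Q m \<noteq> \<zero>}"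
  have S: "finite ?S" using pset_support(1) PQ by auto
  have c: "P m \<in> carrier R" "Q m \<in> carrier R" "mon x m \<in> carrier R" for m using assms by auto
  have "peval x (P \<oplus>\<^bsub>PR V\<^esub> Q) = (\<Oplus>m\<in>?S. (P m \<oplus> Q m) \<otimes> mon x m)"
    using S c assms(3) by (subst peval_superset[of ?S]) (auto simp: PR_add_coeff)
  also have "\<dots> = (\<Oplus>m\<in>?S. P m \<otimes> mon x m \<oplus> Q m \<otimes> mon x m)"
    using c by (intro finsum_cong') (auto simp: l_distr)
  also have "\<dots> = (\<Oplus>m\<in>?S. P m \<otimes> mon x m) \<oplus> (\<Oplus>m\<in>?S. Q m \<otimes> mon x m)"
    using c by (intro finsum_addf) auto
  also have "\<dots> = peval x P \<oplus> peval x Q"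
    using S c assms(3) peval_superset[of ?S P x] peval_superset[of ?S Q x] by auto
  finally show ?thesis .
qed

lemma peval_pmult:
  assumes "P \<in> carrier (PR V)" "\<And>i. x i \<in> carrier R"
  shows "peval x (indexed_pmult P i) = peval x P \<otimes> x i"
proof -
  have P: "P \<in> pset V" using assms by (simp add: PR_simps)
  let ?S = "{m. P m \<noteq> \<zero>}"
  have S: "finite ?S" using pset_support(1)[OF P] .
  have c: "P m \<in> carrier R" "mon x m \<in> carrier R" for m using assms by auto
  have "peval x (indexed_pmult P i) = (\<Oplus>m\<in>add_mset i ` ?S. indexed_pmult P i m \<otimes> mon x m)"
  proof (rule peval_superset)
    fix m assume "indexed_pmult P i m \<noteq> \<zero>"
    then have "i \<in># m" "m - {#i#} \<in> ?S" by (auto simp: indexed_pmult_def split: if_splits)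
    then show "m \<in> add_mset i ` ?S" by (metis image_eqI insert_DiffM)
  qed (use S assms c in \<open>auto simp: indexed_pmult_def\<close>)
  also have "\<dots> = (\<Oplus>m\<in>?S. indexed_pmult P i (add_mset i m) \<otimes> mon x (add_mset i m))"
    using c by (intro add.finprod_reindex) (auto simp: indexed_pmult_def inj_on_def assms(2))
  also have "\<dots> = (\<Oplus>m\<in>?S. P m \<otimes> mon x m \<otimes> x i)"
    using c assms(2) by (intro finsum_cong') (auto simp: indexed_pmult_def mon_add_mset m_assoc)
  also have "\<dots> = peval x P \<otimes> x i"
    unfolding peval_def using S c assms(2) by (subst finsum_ldistr) auto
  finally show ?thesis .
qed

lemma peval_mult:
  assumes P: "P \<in> carrier (PR V)" and Q: "Q \<in> carrier (PR V)" and x: "\<And>i. x i \<in> carrier R"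
  shows "peval x (P \<otimes>\<^bsub>PR V\<^esub> Q) = peval x P \<otimes> peval x Q"
proof -
  interpret T: cring "PR V" by (rule PR_cring)
  have "Q \<in> pset V" using Q by (simp add: PR_simps)
  then show ?thesis
  proof (induction rule: indexed_pset.induct)
    case (indexed_const k)
    have p: "peval x P \<in> carrier R" using P x by simp
    have "peval x (indexed_const k \<otimes>\<^bsub>PR V\<^esub> P) = (\<Oplus>m\<in>{m. P m \<noteq> \<zero>}. k \<otimes> (P m \<otimes> mon x m))"
      unfolding PR_const_mult(1)[OF P indexed_const]
      using P x indexed_const pset_support(1)[of P V]
      by (subst peval_superset[of "{m. P m \<noteq> \<zero>}"]) (auto simp: PR_simps m_assoc intro!: finsum_cong')
    also have "\<dots> = k \<otimes> peval x P"
      unfolding peval_def using P x indexed_const pset_support(1)[of P V]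
      by (subst finsum_rdistr) (auto simp: PR_simps)
    finally show ?case using P x indexed_const p T.m_comm[of P "indexed_const k"] by (simp add: m_comm)
  next
    case (indexed_padd Q S)
    then have QS: "Q \<in> carrier (PR V)" "S \<in> carrier (PR V)" by (auto simp: PR_simps)
    then have "P \<otimes>\<^bsub>PR V\<^esub> (Q \<oplus>\<^bsub>PR V\<^esub> S) = P \<otimes>\<^bsub>PR V\<^esub> Q \<oplus>\<^bsub>PR V\<^esub> P \<otimes>\<^bsub>PR V\<^esub> S"
      using P T.r_distr by blast
    then have "peval x (P \<otimes>\<^bsub>PR V\<^esub> (Q \<oplus>\<^bsub>PR V\<^esub> S)) = peval x P \<otimes> peval x (Q \<oplus>\<^bsub>PR V\<^esub> S)"
      using indexed_padd.IH P QS x by (simp add: peval_add[of _ V] r_distr[OF peval_closed peval_closed peval_closed])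
    then show ?case by (simp add: PR_simps)
  next
    case (indexed_pmult Q i)
    then have Q: "Q \<in> carrier (PR V)" by (auto simp: PR_simps)
    have "P \<otimes>\<^bsub>PR V\<^esub> indexed_pmult Q i = indexed_pmult (P \<otimes>\<^bsub>PR V\<^esub> Q) i"
      using P Q by (simp add: PR_simps pconv_pmult)
    then show ?case
      using indexed_pmult.IH P Q x peval_pmult[of "P \<otimes>\<^bsub>PR V\<^esub> Q" V x i] peval_pmult[OF Q x]
        m_assoc[OF peval_closed[OF P x] peval_closed[OF Q x] x] by simp
  qed
qed

lemma peval_hom:
  assumes "\<And>i. x i \<in> carrier R"
  shows "peval x \<in> ring_hom (PR V) R"
  by (rule ring_hom_memI) (use assms in \<open>simp_all add: PR_one peval_add peval_mult\<close>)

lemma peval_var [simp]: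
  assumes "\<And>i. x i \<in> carrier R"
  shows "peval x (indexed_var i) = x i"
proof -
  have "indexed_const \<one> \<in> carrier (PR {i})" by simp
  from peval_pmult[OF this assms] show ?thesis using assms by (simp add: indexed_var_def)
qed

lemma peval_cong:
  assumes "P \<in> carrier (PR V)" "\<And>i. i \<in> V \<Longrightarrow> x i = y i" "\<And>i. x i \<in> carrier R"
  shows "peval x P = peval y P"
proof -
  have "mon x m = mon y m" if "P m \<noteq> \<zero>" for m
    using pset_support(2)[of P V m] assms that by (intro mon_cong) (auto simp: PR_simps)
  note eq = this
  have c: "P m \<otimes> mon x m \<in> carrier R" for m using assms by simp
  show ?thesis unfolding peval_def
  proof (rule finsum_cong')
    show "(\<lambda>m. P m \<otimes> mon y m) \<in> {m. P m \<noteq> \<zero>} \<rightarrow> carrier R" 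
    proof
      fix m assume "m \<in> {m. P m \<noteq> \<zero>}"
      then show "P m \<otimes> mon y m \<in> carrier R" using eq[of m] c[of m] by simp
    qed
  qed (use eq in auto)
qed

subsection \<open>Non-vanishing points\<close>

fun horner :: "'a list \<Rightarrow> 'a \<Rightarrow> 'a" where
  "horner [] r = \<zero>"
| "horner (a # as) r = a \<oplus> r \<otimes> horner as r"

lemma horner_closed [simp]: "set as \<subseteq> carrier R \<Longrightarrow> r \<in> carrier R \<Longrightarrow> horner as r \<in> carrier R"
  by (induction as) auto

text \<open>Ruffini's rule: the coefficients of the quotient by \<open>X - s\<close>, lowest first
  as in \<open>horner\<close>.\<close>

fun hdiv :: "'a list \<Rightarrow> 'a \<Rightarrow> 'a list" where
  "hdiv [] s = []"
| "hdiv [a] s = []"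
| "hdiv (a # as) s = horner as s # hdiv as s"

lemma hdiv_closed: "set as \<subseteq> carrier R \<Longrightarrow> s \<in> carrier R \<Longrightarrow> set (hdiv as s) \<subseteq> carrier R"
  by (induction as s rule: hdiv.induct) auto

lemma length_hdiv: "length (hdiv as s) = length as - 1"
  by (induction as s rule: hdiv.induct) auto

lemma horner_hdiv:
  assumes "set as \<subseteq> carrier R" "s \<in> carrier R" "r \<in> carrier R"
  shows "horner as r \<ominus> horner as s = (r \<ominus> s) \<otimes> horner (hdiv as s) r"
  using assms
proof (induction as s rule: hdiv.induct)
  case (3 a b as s)
  let ?as = "b # as"
  have c: "a \<in> carrier R" "r \<in> carrier R" "s \<in> carrier R" using 3 by auto
  have d: "horner ?as r \<in> carrier R" "horner ?as s \<in> carrier R" "horner (hdiv ?as s) r \<in> carrier R"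
    using 3 hdiv_closed[of ?as s] by (intro horner_closed; simp)+
  have IH: "horner ?as r \<ominus> horner ?as s = (r \<ominus> s) \<otimes> horner (hdiv ?as s) r" using 3 by auto
  have "horner (a # ?as) r \<ominus> horner (a # ?as) s =
    a \<oplus> r \<otimes> horner ?as r \<ominus> (a \<oplus> s \<otimes> horner ?as s)" by simp
  also have "\<dots> = r \<otimes> (horner ?as r \<ominus> horner ?as s) \<oplus> (r \<ominus> s) \<otimes> horner ?as s"
    using c d by algebra
  also have "\<dots> = (r \<ominus> s) \<otimes> (horner ?as s \<oplus> r \<otimes> horner (hdiv ?as s) r)"
    unfolding IH using c d by algebra
  finally show ?case by simp
qed (simp_all add: a_minus_def r_neg)

text \<open>Every coefficient but the constant one is a quotient coefficient minus \<open>s\<close>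
  times the next quotient coefficient.\<close>

lemma hdiv_in_ideal:
  assumes "ideal A R" "set as \<subseteq> carrier R" "s \<in> carrier R" "set (hdiv as s) \<subseteq> A"
  shows "set (tl as) \<subseteq> A"
  using assms(2-)
proof (induction as s rule: hdiv.induct)
  case (3 a b as s)
  have t: "set as \<subseteq> A" using 3 by simp
  have "horner cs s \<in> A" if "set cs \<subseteq> A" for cs
    using that 3 by (induction cs)
      (auto intro: ideal_zero_closed[OF assms(1)] ideal_add_closed[OF assms(1)] ideal.I_l_closed[OF assms(1)])
  then have h: "s \<otimes> horner as s \<in> A" using t 3 ideal.I_l_closed[OF assms(1)] by auto
  have "b \<oplus> s \<otimes> horner as s \<in> A" using 3 by simp
  then have "b \<oplus> s \<otimes> horner as s \<ominus> s \<otimes> horner as s \<in> A" using h ideal_minus_closed[OF assms(1)] by blast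
  moreover have "b \<oplus> s \<otimes> horner as s \<ominus> s \<otimes> horner as s = b"
  proof -
    have "b \<in> carrier R" "s \<otimes> horner as s \<in> carrier R" using 3 by auto
    then show ?thesis by algebra
  qed
  ultimately show ?case using t by simp
qed auto

text \<open>A polynomial over the domain \<open>R/M\<close> with infinitely many roots is zero:
  dividing by \<open>X - s\<close> for one root \<open>s\<close> leaves the other points as roots,
  since the differences \<open>r \<ominus> s\<close> are not in the prime \<open>M\<close>.\<close>

lemma horner_vanishing:
  assumes "primeideal M R" "infinite S" "S \<subseteq> carrier R"
    and "\<And>r s. r \<in> S \<Longrightarrow> s \<in> S \<Longrightarrow> r \<ominus> s \<in> M \<Longrightarrow> r = s"
    and "set as \<subseteq> carrier R" "\<And>r. r \<in> S \<Longrightarrow> horner as r \<in> M"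
  shows "set as \<subseteq> M"
  using assms(2-)
proof (induction "length as" arbitrary: as S rule: less_induct)
  case less
  have M: "ideal M R" using assms(1) primeideal.axioms(1) by blast
  obtain s where s: "s \<in> S" using less.prems(1) by (metis finite.emptyI ex_in_conv)
  show ?case
  proof (cases as)
    case (Cons a as')
    have "set (hdiv as s) \<subseteq> M"
    proof (rule less.hyps)
      show "length (hdiv as s) < length as" using Cons by (simp add: length_hdiv)
      show "infinite (S - {s})" using less.prems(1) by simp
      show "S - {s} \<subseteq> carrier R" "\<And>r r'. r \<in> S - {s} \<Longrightarrow> r' \<in> S - {s} \<Longrightarrow> r \<ominus> r' \<in> M \<Longrightarrow> r = r'"
        using less.prems by auto
      show "set (hdiv as s) \<subseteq> carrier R" using hdiv_closed less.prems s by blast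
      fix r assume r: "r \<in> S - {s}"
      have rs: "r \<in> carrier R" "s \<in> carrier R" using r s less.prems by auto
      have "horner as r \<ominus> horner as s \<in> M"
        using r s less.prems(5) ideal_minus_closed[OF M] by simp
      then have "(r \<ominus> s) \<otimes> horner (hdiv as s) r \<in> M"
        using horner_hdiv[OF less.prems(4) rs(2,1)] by simp
      moreover have "r \<ominus> s \<notin> M" using less.prems(3) r s by blast
      moreover have "horner (hdiv as s) r \<in> carrier R"
        using hdiv_closed[OF less.prems(4) rs(2)] rs by simp
      ultimately show "horner (hdiv as s) r \<in> M"
        using primeideal.I_prime[OF assms(1)] rs by blast
    qed
    then have t: "set as' \<subseteq> M" using hdiv_in_ideal[OF M less.prems(4), of s] s less.prems(2) Cons by auto
    have "horner cs s \<in> M" if "set cs \<subseteq> M" for cs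
      using that s less.prems(2) by (induction cs)
        (auto intro: ideal_zero_closed[OF M] ideal_add_closed[OF M] ideal.I_l_closed[OF M])
    then have h: "s \<otimes> horner as' s \<in> M" using t s less.prems(2) ideal.I_l_closed[OF M] by auto
    have ha: "a \<oplus> s \<otimes> horner as' s \<in> M" using less.prems(5)[OF s] Cons by simp
    have c: "a \<in> carrier R" "s \<otimes> horner as' s \<in> carrier R" using less.prems s Cons by auto
    have "a = a \<oplus> s \<otimes> horner as' s \<ominus> s \<otimes> horner as' s" using c by algebra
    then have "a \<in> M" using ideal_minus_closed[OF M ha h] by simp
    then show ?thesis using t Cons by simp
  qed simp
qed

definition drop_var :: "'v \<Rightarrow> ('v multiset \<Rightarrow> 'a) \<Rightarrow> 'v multiset \<Rightarrow> 'a" where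
  "drop_var i P = (\<lambda>m. if i \<in># m then \<zero> else P m)"

lemma drop_var_closed:
  assumes "P \<in> carrier (PR V)"
  shows "drop_var i P \<in> carrier (PR (V - {i}))"
proof -
  have P: "P \<in> pset V" using assms by (simp add: PR_simps)
  have "finite {m. drop_var i P m \<noteq> \<zero>}"
    by (rule finite_subset[OF _ pset_support(1)[OF P]]) (auto simp: drop_var_def)
  moreover have "set_mset m \<subseteq> V - {i}" if "drop_var i P m \<noteq> \<zero>" for m
    using that pset_support(2)[OF P, of m] by (auto simp: drop_var_def split: if_splits)
  moreover have "drop_var i P m \<in> carrier R" for m using assms by (simp add: drop_var_def)
  ultimately show ?thesis unfolding PR_simps pset_iff by blast
qed

lemma PR_mono: "V \<subseteq> W \<Longrightarrow> P \<in> carrier (PR V) \<Longrightarrow> P \<in> carrier (PR W)"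
  unfolding PR_simps pset_iff by blast

text \<open>The coefficients of \<open>P\<close> as a polynomial in the variable \<open>i\<close>,
  lowest first; the list is complete once the \<open>k\<close>-fold shift of \<open>P\<close> is
  zero.\<close>

fun var_parts :: "'v \<Rightarrow> nat \<Rightarrow> ('v multiset \<Rightarrow> 'a) \<Rightarrow> ('v multiset \<Rightarrow> 'a) list" where
  "var_parts i 0 P = []"
| "var_parts i (Suc k) P = drop_var i P # var_parts i k (shift i P)"

lemma peval_var_parts:
  assumes "P \<in> carrier (PR V)" "i \<in> V" "\<And>i. x i \<in> carrier R" "(shift i ^^ k) P = \<zero>\<^bsub>PR V\<^esub>"
  shows "peval x P = horner (map (peval x) (var_parts i k P)) (x i)"
  using assms(1,4)
proof (induction k arbitrary: P)
  case 0
  then show ?case using peval_const[of \<zero> x] assms(3) by (simp add: PR_simps)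
next
  case (Suc k)
  have d: "drop_var i P \<in> carrier (PR V)" by (rule PR_mono[OF _ drop_var_closed[OF Suc.prems(1)]]) blast
  have s: "shift i P \<in> carrier (PR V)" using Suc.prems by simp
  have m: "indexed_pmult (shift i P) i \<in> carrier (PR V)"
    using s assms(2) by (simp add: PR_simps indexed_pset.indexed_pmult)
  have "P = drop_var i P \<oplus>\<^bsub>PR V\<^esub> indexed_pmult (shift i P) i"
    using Suc.prems(1) by (auto simp: PR_add_coeff drop_var_def indexed_pmult_def shift_def)
  then have "peval x P = peval x (drop_var i P) \<oplus> peval x (indexed_pmult (shift i P) i)"
    using peval_add[OF d m assms(3)] by (rule ssubst[where P="\<lambda>Q. peval x Q = _"])
  also have "peval x (indexed_pmult (shift i P) i) = x i \<otimes> peval x (shift i P)"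
    using peval_pmult[OF s assms(3)] peval_closed[OF s assms(3)] assms(3) by (simp add: m_comm)
  also have "peval x (shift i P) = horner (map (peval x) (var_parts i k (shift i P))) (x i)"
    by (rule Suc.IH[OF s]) (use Suc.prems(2) in \<open>simp add: funpow_Suc_right del: funpow.simps\<close>)
  finally show ?case by simp
qed

lemma var_parts_closed:
  "P \<in> carrier (PR V) \<Longrightarrow> Q \<in> set (var_parts i k P) \<Longrightarrow> Q \<in> carrier (PR (V - {i}))"
  by (induction k arbitrary: P) (auto intro: drop_var_closed shift_closed)

lemma var_parts_coeff:
  "(shift i ^^ k) P = (\<lambda>_. \<zero>) \<Longrightarrow> P m \<noteq> \<zero> \<Longrightarrow> \<exists>Q\<in>set (var_parts i k P). \<exists>m'. Q m' = P m"
proof (induction k arbitrary: P m)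
  case (Suc k)
  show ?case
  proof (cases "i \<in># m")
    case True
    then have e: "shift i P (m - {#i#}) = P m" by (simp add: shift_def)
    have "\<exists>Q\<in>set (var_parts i k (shift i P)). \<exists>m'. Q m' = shift i P (m - {#i#})"
      using Suc.prems e by (intro Suc.IH) (auto simp: funpow_swap1)
    then show ?thesis using e by auto
  next
    case False
    then have "drop_var i P m = P m" by (simp add: drop_var_def)
    then show ?thesis by auto
  qed
qed simp

text \<open>Induction on the variables: some coefficient with respect to \<open>i\<close> is nonzero
  modulo \<open>M\<close>; the other variables are fixed at a point where its value stays outside
  \<open>M\<close>, and the value for \<open>i\<close> is found in an infinite set \<open>S\<close>
  of representatives of distinct residue classes.\<close>

lemma exists_nonvanishing_point:
  fixes V :: "'v set"
  assumes M: "primeideal M R" and inf: "infinite (carrier (R Quot M))"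
    and "finite V" "P \<in> carrier (PR V)" "P m \<notin> M"
  shows "\<exists>x. (\<forall>i. x i \<in> carrier R) \<and> peval x P \<notin> M"
proof -
  have MI: "ideal M R" using M primeideal.axioms(1) by blast
  have "\<forall>c\<in>carrier (R Quot M). \<exists>r\<in>carrier R. c = M +> r"
    by (auto simp: FactRing_def A_RCOSETS_def')
  then obtain rep where rep: "\<And>c. c \<in> carrier (R Quot M) \<Longrightarrow> rep c \<in> carrier R \<and> c = M +> rep c"
    by metis
  define S where "S = rep ` carrier (R Quot M)"
  have "inj_on rep (carrier (R Quot M))" by (rule inj_onI) (metis rep)
  then have S: "infinite S" "S \<subseteq> carrier R" using inf rep finite_imageD by (auto simp: S_def)
  have S': "r = s" if "r \<in> S" "s \<in> S" "r \<ominus> s \<in> M" for r s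
  proof -
    obtain c d where cd: "c \<in> carrier (R Quot M)" "d \<in> carrier (R Quot M)" "r = rep c" "s = rep d"
      using \<open>r \<in> S\<close> \<open>s \<in> S\<close> by (auto simp: S_def)
    then have "M +> r = M +> s"
      using quotient_eq_iff_same_a_r_cos[OF MI] that(3) rep by metis
    then show ?thesis using cd rep by metis
  qed
  show ?thesis using assms(3-)
  proof (induction V arbitrary: P m rule: finite_induct)
    case empty
    have "P \<in> pset {}" using empty by (simp add: PR_simps)
    then have z: "P k = \<zero>" if "k \<noteq> {#}" for k using pset_support(2) that by fastforce
    then have "m = {#}" using empty ideal_zero_closed[OF MI] by metis
    moreover have "P = indexed_const (P {#})" using z by (auto simp: indexed_const_def)
    ultimately have "peval (\<lambda>_. \<zero>) P \<notin> M"
      using peval_const[of "P {#}" "\<lambda>_. \<zero>"] empty PR_coeff[OF empty(1), of "{#}"]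
      by (metis zero_closed)
    then show ?case by (intro exI[of _ "\<lambda>_. \<zero>"]) simp
  next
    case (insert i V)
    obtain k where k: "(shift i ^^ k) P = \<zero>\<^bsub>PR (insert i V)\<^esub>"
      using shift_nilpotent[OF insert.prems(1)] by blast
    have "P m \<noteq> \<zero>" using insert.prems ideal_zero_closed[OF MI] by metis
    moreover have "(shift i ^^ k) P = (\<lambda>_. \<zero>)" using k by (auto simp: PR_zero_coeff)
    ultimately obtain Q m' where Q: "Q \<in> set (var_parts i k P)" "Q m' = P m"
      using var_parts_coeff by metis
    have cl: "Q \<in> carrier (PR V)" if "Q \<in> set (var_parts i k P)" for Q
      using var_parts_closed[OF insert.prems(1) that] insert.hyps by simp
    have "Q m' \<notin> M" using Q insert.prems by simp
    then obtain x where x: "\<And>j. x j \<in> carrier R" "peval x Q \<notin> M"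
      using insert.IH[OF cl[OF Q(1)]] by blast
    let ?as = "map (peval x) (var_parts i k P)"
    have "\<not> set ?as \<subseteq> M" using Q(1) x(2) by auto
    moreover have "set ?as \<subseteq> carrier R" using peval_closed[OF cl x(1)] by auto
    ultimately obtain r where r: "r \<in> S" "horner ?as r \<notin> M"
      using horner_vanishing[OF M S] S' by blast
    let ?y = "x(i := r)"
    have y: "?y j \<in> carrier R" for j using x r S by auto
    have "peval ?y Q = peval x Q" if "Q \<in> set (var_parts i k P)" for Q
      using insert.hyps by (intro peval_cong[OF cl[OF that]] y) auto
    then have e: "map (peval ?y) (var_parts i k P) = ?as" by simp
    have "peval ?y P = horner (map (peval ?y) (var_parts i k P)) (?y i)"
      by (rule peval_var_parts[OF insert.prems(1) _ _ k]) (use y in simp_all)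
    then have "peval ?y P \<notin> M" using r unfolding e by simp
    then show ?case using y by blast
  qed
qed

subsection \<open>Nakayama's lemma\<close>

text \<open>The \<open>N\<close>-combinations of the list plus \<open>W\<close>. Keeping the
  coefficients visible, instead of using an ideal product, lets one generator be eliminated at a
  time.\<close>

fun nlin :: "'a set \<Rightarrow> 'a list \<Rightarrow> 'a set \<Rightarrow> 'a set" where
  "nlin N [] W = W"
| "nlin N (z # zs) W = {q \<otimes> z \<oplus> r |q r. q \<in> N \<and> r \<in> nlin N zs W}"

lemma nlin_subset:
  "ideal N R \<Longrightarrow> ideal W R \<Longrightarrow> set zs \<subseteq> carrier R \<Longrightarrow> nlin N zs W \<subseteq> carrier R"
proof (induction zs)
  case (Cons z zs)
  then show ?case using ideal.Icarr by fastforce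
qed (auto dest: ideal.Icarr)

lemma nlin_add:
  assumes N: "ideal N R" and W: "ideal W R" and W': "ideal W' R" "W \<subseteq> W'"
    and "set zs \<subseteq> carrier R" "x \<in> nlin N zs W" "y \<in> nlin N zs W'"
  shows "x \<oplus> y \<in> nlin N zs W'"
  using assms(5-)
proof (induction zs arbitrary: x y)
  case Nil
  then show ?case using W'(2) ideal_add_closed[OF W'(1)] by auto
next
  case (Cons z zs)
  obtain q r q' r' where q: "x = q \<otimes> z \<oplus> r" "q \<in> N" "r \<in> nlin N zs W"
    "y = q' \<otimes> z \<oplus> r'" "q' \<in> N" "r' \<in> nlin N zs W'" using Cons.prems by auto
  have "r \<in> carrier R" "r' \<in> carrier R" "q \<in> carrier R" "q' \<in> carrier R" "z \<in> carrier R"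
    using q nlin_subset[OF N W] nlin_subset[OF N W'(1)] Cons.prems ideal.Icarr[OF N] by auto
  then have "x \<oplus> y = (q \<oplus> q') \<otimes> z \<oplus> (r \<oplus> r')" unfolding q by algebra
  moreover have "q \<oplus> q' \<in> N" "r \<oplus> r' \<in> nlin N zs W'" using q Cons ideal_add_closed[OF N] by auto
  ultimately show ?case unfolding nlin.simps by blast
qed

lemma nlin_base:
  assumes N: "ideal N R" and W: "ideal W R" and "set zs \<subseteq> carrier R"
  shows "W \<subseteq> nlin N zs W"
  using assms(3)
proof (induction zs)
  case (Cons z zs)
  show ?case
  proof
    fix w assume w: "w \<in> W"
    then have "w = \<zero> \<otimes> z \<oplus> w" "w \<in> nlin N zs W" using Cons ideal.Icarr[OF W] by auto
    then show "w \<in> nlin N (z # zs) W" using ideal_zero_closed[OF N] by auto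
  qed
qed simp

lemma nlin_lin:
  assumes N: "ideal N R" and W: "ideal W R" and "set zs \<subseteq> carrier R" "i \<in> N" "x \<in> lin zs {\<zero>}"
  shows "i \<otimes> x \<in> nlin N zs W"
  using assms(3,5)
proof (induction zs arbitrary: x)
  case Nil
  then show ?case using ideal_zero_closed[OF W] assms(4) ideal.Icarr[OF N] by simp
next
  case (Cons z zs)
  then obtain q r where q: "x = q \<otimes> z \<oplus> r" "q \<in> carrier R" "r \<in> lin zs {\<zero>}" by auto
  have "r \<in> carrier R" "z \<in> carrier R" "i \<in> carrier R"
    using q(3) lin_ideal[OF zeroideal] Cons.prems(1) ideal.Icarr assms(4) N by fastforce+
  then have "i \<otimes> x = (i \<otimes> q) \<otimes> z \<oplus> i \<otimes> r" unfolding q(1) using q(2) by algebra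
  moreover have "i \<otimes> q \<in> N" using ideal.I_r_closed[OF N assms(4) q(2)] .
  ultimately show ?case using Cons q(3) by auto
qed

lemma nlin_ideal_prod:
  assumes N: "ideal N R" and W: "ideal W R" and zs: "set zs \<subseteq> carrier R"
    and "x \<in> N \<cdot> (Idl (set zs))"
  shows "x \<in> nlin N zs W"
  using assms(4)
proof (induction rule: ideal_prod.induct)
  case (prod i j)
  then show ?case using nlin_lin[OF N W zs] lin_zero_eq_Idl[OF zs] by simp
next
  case (sum s1 s2)
  then show ?case using nlin_add[OF N W W order_refl zs] by blast
qed

text \<open>Elimination instead of a determinant. Working modulo the head \<open>z0\<close> gives a
  multiplier \<open>s\<close> for the tail; then \<open>s z0\<close> is an \<open>N\<close>-multiple
  of \<open>z0\<close> modulo \<open>W\<close>, which yields a second multiplier \<open>s1\<close>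
  for \<open>z0\<close>. The product \<open>s1 \<otimes> s\<close> serves the whole list.\<close>

lemma nakayama_list:
  assumes N: "ideal N R" and "ideal W R" and "set zs \<subseteq> carrier R"
    and "\<And>z. z \<in> set zs \<Longrightarrow> z \<in> nlin N zs W"
  shows "\<exists>s\<in>carrier R. s \<ominus> \<one> \<in> N \<and> (\<forall>z\<in>set zs. s \<otimes> z \<in> W)"
  using assms(2-)
proof (induction zs arbitrary: W)
  case Nil
  show ?case using ideal_zero_closed[OF N] by (intro bexI[of _ \<one>]) (auto simp: a_minus_def r_neg)
next
  case (Cons z0 zs)
  note W = Cons.prems(1)
  have z0: "z0 \<in> carrier R" and zs: "set zs \<subseteq> carrier R" using Cons.prems by auto
  define W' where "W' = lin [z0] W"
  have W': "ideal W' R" and WW': "W \<subseteq> W'"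
    using lin_ideal[OF W, of "[z0]"] lin_superset(1)[OF W, of "[z0]"] z0 by (auto simp: W'_def)
  have nz: "q \<otimes> z0 \<in> W'" if "q \<in> carrier R" for q
  proof -
    have "q \<otimes> z0 = q \<otimes> z0 \<oplus> \<zero>" using that z0 by simp
    then show ?thesis using that ideal_zero_closed[OF W] unfolding W'_def lin.simps by blast
  qed
  have "z \<in> nlin N zs W'" if z: "z \<in> set zs" for z
  proof -
    obtain q r where q: "z = q \<otimes> z0 \<oplus> r" "q \<in> N" "r \<in> nlin N zs W"
      using Cons.prems(3)[of z] z by auto
    have c: "q \<in> carrier R" "r \<in> carrier R" using q ideal.Icarr[OF N] nlin_subset[OF N W zs] by auto
    have "q \<otimes> z0 \<in> nlin N zs W'" using nz[OF c(1)] nlin_base[OF N W' zs] by blast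
    then have "r \<oplus> q \<otimes> z0 \<in> nlin N zs W'" using nlin_add[OF N W W' WW' zs q(3)] by blast
    then show ?thesis using c z0 q(1) by (simp add: a_comm)
  qed
  then obtain s where s: "s \<in> carrier R" "s \<ominus> \<one> \<in> N" "\<And>z. z \<in> set zs \<Longrightarrow> s \<otimes> z \<in> W'"
    using Cons.IH[OF W' zs] by blast
  \<comment> \<open>\<open>s\<close> moves each tail generator into the multiples of
    \<open>z0\<close> plus \<open>W\<close>, and the coefficients from \<open>N\<close> stay in
    front.\<close>
  have push: "\<exists>q\<in>N. \<exists>w\<in>W. s \<otimes> r = q \<otimes> z0 \<oplus> w" if "r \<in> nlin N ys W" "set ys \<subseteq> set zs" for r ys
    using that
  proof (induction ys arbitrary: r)
    case Nil
    then have "s \<otimes> r \<in> W" "r \<in> carrier R" using s ideal.I_l_closed[OF W] ideal.Icarr[OF W] by auto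
    then show ?case using ideal_zero_closed[OF N] z0 s
      by (intro bexI[of _ \<zero>] bexI[of _ "s \<otimes> r"]) auto
  next
    case (Cons y ys)
    then obtain q r' where q: "r = q \<otimes> y \<oplus> r'" "q \<in> N" "r' \<in> nlin N ys W" by auto
    obtain p w where p: "p \<in> N" "w \<in> W" "s \<otimes> r' = p \<otimes> z0 \<oplus> w"
      using Cons.IH[OF q(3)] Cons.prems(2) by auto
    have "s \<otimes> y \<in> W'" using s Cons by auto
    then obtain a b where a: "s \<otimes> y = a \<otimes> z0 \<oplus> b" "a \<in> carrier R" "b \<in> W" by (auto simp: W'_def)
    have c: "q \<in> carrier R" "p \<in> carrier R" "w \<in> carrier R" "b \<in> carrier R" "y \<in> carrier R" "r' \<in> carrier R"
      using q p a Cons.prems zs ideal.Icarr[OF N] ideal.Icarr[OF W] nlin_subset[OF N W, of ys] by auto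
    have "s \<otimes> r = q \<otimes> (s \<otimes> y) \<oplus> s \<otimes> r'" unfolding q(1) using c s(1) by algebra
    also have "\<dots> = (q \<otimes> a \<oplus> p) \<otimes> z0 \<oplus> (q \<otimes> b \<oplus> w)" unfolding a(1) p(3) using c a z0 by algebra
    finally have "s \<otimes> r = (q \<otimes> a \<oplus> p) \<otimes> z0 \<oplus> (q \<otimes> b \<oplus> w)" .
    moreover have "q \<otimes> a \<oplus> p \<in> N" using q p a ideal.I_r_closed[OF N] ideal_add_closed[OF N] by auto
    moreover have "q \<otimes> b \<oplus> w \<in> W" using c p a ideal.I_l_closed[OF W] ideal_add_closed[OF W] by auto
    ultimately show ?case by blast
  qed
  obtain q r where q: "z0 = q \<otimes> z0 \<oplus> r" "q \<in> N" "r \<in> nlin N zs W" using Cons.prems(3)[of z0] by auto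
  obtain p w where p: "p \<in> N" "w \<in> W" "s \<otimes> r = p \<otimes> z0 \<oplus> w" using push[OF q(3)] by auto
  have c: "q \<in> carrier R" "p \<in> carrier R" "w \<in> carrier R" "r \<in> carrier R"
    using q p ideal.Icarr[OF N] ideal.Icarr[OF W] nlin_subset[OF N W zs] by auto
  define s1 where "s1 = s \<ominus> s \<otimes> q \<ominus> p"
  have s1: "s1 \<in> carrier R" using s c by (simp add: s1_def)
  have "s \<otimes> z0 = s \<otimes> (q \<otimes> z0 \<oplus> r)" using q(1) by simp
  also have "\<dots> = s \<otimes> q \<otimes> z0 \<oplus> s \<otimes> r" using s c z0 by algebra
  finally have e: "s \<otimes> z0 = s \<otimes> q \<otimes> z0 \<oplus> (p \<otimes> z0 \<oplus> w)" unfolding p(3) .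
  have "s1 \<otimes> z0 = s \<otimes> z0 \<ominus> s \<otimes> q \<otimes> z0 \<ominus> p \<otimes> z0" unfolding s1_def using s(1) c z0 by algebra
  also have "\<dots> = w" unfolding e using s(1) c z0 by algebra
  finally have w1: "s1 \<otimes> z0 \<in> W" using p by simp
  have "s1 \<ominus> \<one> = (s \<ominus> \<one>) \<ominus> s \<otimes> q \<ominus> p" unfolding s1_def using s(1) c by algebra
  then have n1: "s1 \<ominus> \<one> \<in> N" using s q p ideal_minus_closed[OF N] ideal.I_l_closed[OF N] by simp
  have "s1 \<otimes> s \<ominus> \<one> = s1 \<otimes> (s \<ominus> \<one>) \<oplus> (s1 \<ominus> \<one>)" using s(1) s1 by algebra
  then have n2: "s1 \<otimes> s \<ominus> \<one> \<in> N" using n1 s s1 ideal_add_closed[OF N] ideal.I_l_closed[OF N] by simp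
  have "s1 \<otimes> s \<otimes> z \<in> W" if z: "z \<in> set (z0 # zs)" for z
  proof (cases "z = z0")
    case True
    then have "s1 \<otimes> s \<otimes> z = s \<otimes> (s1 \<otimes> z0)" using s(1) s1 z0 by (simp add: m_ac)
    then show ?thesis using w1 s ideal.I_l_closed[OF W] by simp
  next
    case False
    then have "z \<in> set zs" using z by simp
    then obtain a b where a: "s \<otimes> z = a \<otimes> z0 \<oplus> b" "a \<in> carrier R" "b \<in> W"
      using s(3)[of z] unfolding W'_def lin.simps by blast
    have cz: "z \<in> carrier R" "b \<in> carrier R" using \<open>z \<in> set zs\<close> zs a ideal.Icarr[OF W] by auto
    have "s1 \<otimes> s \<otimes> z = s1 \<otimes> (s \<otimes> z)" using s s1 cz by (simp add: m_assoc)
    also have "\<dots> = a \<otimes> (s1 \<otimes> z0) \<oplus> s1 \<otimes> b" unfolding a(1) using a(2) cz s1 z0 by algebra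
    finally have "s1 \<otimes> s \<otimes> z = a \<otimes> (s1 \<otimes> z0) \<oplus> s1 \<otimes> b" .
    moreover have "a \<otimes> (s1 \<otimes> z0) \<in> W" using ideal.I_l_closed[OF W w1 a(2)] .
    moreover have "s1 \<otimes> b \<in> W" using ideal.I_l_closed[OF W a(3) s1] .
    ultimately show ?thesis using ideal_add_closed[OF W] by metis
  qed
  then show ?case using n2 s s1 by (intro bexI[of _ "s1 \<otimes> s"]) auto
qed

text \<open>The multiplier stays in the conclusion because two rings use it: in the local ring with
  \<open>N = M\<close> it is a unit, and over \<open>T\<close> with \<open>N\<close> the kernel of
  evaluation at a point it has value 1 there.\<close>

theorem nakayama:
  assumes N: "ideal N R" and W: "ideal W R" and Z: "finite Z" "Z \<subseteq> carrier R"
    and "\<And>z. z \<in> Z \<Longrightarrow> z \<in> W <+> N \<cdot> (Idl Z)"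
  shows "\<exists>s\<in>carrier R. s \<ominus> \<one> \<in> N \<and> (\<forall>z\<in>Z. s \<otimes> z \<in> W)"
proof -
  obtain zs where zs: "set zs = Z" using Z(1) finite_list by blast
  have "z \<in> nlin N zs W" if z: "z \<in> set zs" for z
  proof -
    obtain w y where w: "w \<in> W" "y \<in> N \<cdot> (Idl (set zs))" "z = w \<oplus> y"
      using assms(5)[of z] z unfolding zs[symmetric] set_add_def' by blast
    then have "w \<in> nlin N zs W" "y \<in> nlin N zs W"
      using nlin_base[OF N W] nlin_ideal_prod[OF N W] Z zs by auto
    then show ?thesis using nlin_add[OF N W W order_refl] w(3) Z zs by auto
  qed
  then show ?thesis using nakayama_list[OF N W, of zs] Z zs by auto
qed

lemma power_sum_in_ideal:
  assumes A: "ideal A R" and "x \<in> carrier R" "y \<in> carrier R" "a \<in> carrier R"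
    and "x [^] (m::nat) \<otimes> a \<in> A" "y [^] (n::nat) \<otimes> a \<in> A"
  shows "(x \<oplus> y) [^] (m + n) \<otimes> a \<in> A"
  using assms(4-)
proof (induction "m + n" arbitrary: m n a)
  case 0
  then show ?case by simp
next
  case (Suc k)
  note xy = assms(2,3)
  show ?case
  proof (cases "m = 0 \<or> n = 0")
    case True
    then have "a \<in> A" using Suc.prems by auto
    then show ?thesis using xy by (intro ideal.I_l_closed[OF A]) auto
  next
    case False
    then obtain m' n' where mn: "m = Suc m'" "n = Suc n'" by (meson not0_implies_Suc)
    have k: "k = m' + n" "k = m + n'" using Suc.hyps(2) mn by auto
    have "(x \<oplus> y) [^] (m' + n) \<otimes> (x \<otimes> a) \<in> A"
    proof (rule Suc.hyps(1)[OF k(1)])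
      show "x [^] m' \<otimes> (x \<otimes> a) \<in> A" using Suc.prems mn xy by (simp add: m_assoc)
      have "y [^] n \<otimes> (x \<otimes> a) = x \<otimes> (y [^] n \<otimes> a)" using Suc.prems xy by (simp add: m_lcomm)
      then show "y [^] n \<otimes> (x \<otimes> a) \<in> A" using Suc.prems xy ideal.I_l_closed[OF A] by simp
    qed (use Suc.prems xy in auto)
    moreover have "(x \<oplus> y) [^] (m + n') \<otimes> (y \<otimes> a) \<in> A"
    proof (rule Suc.hyps(1)[OF k(2)])
      show "y [^] n' \<otimes> (y \<otimes> a) \<in> A" using Suc.prems mn xy by (simp add: m_assoc)
      have "x [^] m \<otimes> (y \<otimes> a) = y \<otimes> (x [^] m \<otimes> a)" using Suc.prems xy by (simp add: m_lcomm)
      then show "x [^] m \<otimes> (y \<otimes> a) \<in> A" using Suc.prems xy ideal.I_l_closed[OF A] by simp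
    qed (use Suc.prems xy in auto)
    ultimately have "(x \<oplus> y) [^] k \<otimes> (x \<otimes> a) \<oplus> (x \<oplus> y) [^] k \<otimes> (y \<otimes> a) \<in> A"
      using k ideal_add_closed[OF A] by simp
    moreover have "z \<otimes> (x \<otimes> a) \<oplus> z \<otimes> (y \<otimes> a) = z \<otimes> (x \<oplus> y) \<otimes> a" if "z \<in> carrier R" for z
      using that xy Suc.prems(1) by algebra
    ultimately have "(x \<oplus> y) [^] k \<otimes> (x \<oplus> y) \<otimes> a \<in> A" using xy by simp
    then show ?thesis using Suc.hyps(2) xy by (metis nat_pow_Suc)
  qed
qed

text \<open>Torsion by powers, once checked on generators, holds on the ideal they generate. For
  \<open>a = \<one>\<close> this is the radical of \<open>A\<close>.\<close>

lemma power_torsion_ideal: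
  assumes A: "ideal A R" and a: "a \<in> carrier R"
  shows "ideal {x \<in> carrier R. \<exists>N::nat. x [^] N \<otimes> a \<in> A} R"
proof (rule idealI)
  have mult: "\<exists>N::nat. (y \<otimes> x) [^] N \<otimes> a \<in> A" if "x \<in> carrier R" "y \<in> carrier R" "x [^] (N::nat) \<otimes> a \<in> A" for x y N
  proof -
    have "(y \<otimes> x) [^] N \<otimes> a = y [^] N \<otimes> (x [^] N \<otimes> a)"
      using that a by (simp add: nat_pow_distrib m_assoc)
    then show ?thesis using that ideal.I_l_closed[OF A] by (metis nat_pow_closed)
  qed
  show "subgroup {x \<in> carrier R. \<exists>N::nat. x [^] N \<otimes> a \<in> A} (add_monoid R)"
  proof (rule add.subgroupI)
    have "\<zero> [^] (1::nat) \<otimes> a \<in> A" using a ideal_zero_closed[OF A] by simp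
    then show "{x \<in> carrier R. \<exists>N::nat. x [^] N \<otimes> a \<in> A} \<noteq> {}" by blast
    fix x assume "x \<in> {x \<in> carrier R. \<exists>N::nat. x [^] N \<otimes> a \<in> A}"
    then show "\<ominus> x \<in> {x \<in> carrier R. \<exists>N::nat. x [^] N \<otimes> a \<in> A}"
      using mult[of x "\<ominus> \<one>"] by (auto simp: l_minus)
  next
    fix x y assume "x \<in> {x \<in> carrier R. \<exists>N::nat. x [^] N \<otimes> a \<in> A}" "y \<in> {x \<in> carrier R. \<exists>N::nat. x [^] N \<otimes> a \<in> A}"
    then show "x \<oplus> y \<in> {x \<in> carrier R. \<exists>N::nat. x [^] N \<otimes> a \<in> A}"
      using power_sum_in_ideal[OF A _ _ a] by blast
  qed auto
  fix x y assume x: "x \<in> {x \<in> carrier R. \<exists>N::nat. x [^] N \<otimes> a \<in> A}" and y: "y \<in> carrier R"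
  then show "y \<otimes> x \<in> {x \<in> carrier R. \<exists>N::nat. x [^] N \<otimes> a \<in> A}" using mult by auto
  then show "x \<otimes> y \<in> {x \<in> carrier R. \<exists>N::nat. x [^] N \<otimes> a \<in> A}" using x y m_comm by auto
qed (rule ring_axioms)

end

section \<open>Generic ideals\<close>

text \<open>Keeps the index sets \<open>{1..n}\<close> from being rewritten to \<open>{Suc 0..n}\<close>.\<close>

declare One_nat_def [simp del]

context cring
begin

text \<open>The annihilator of a Koszul class; being an ideal, it is controlled by what generators
  do to the class.\<close>

lemma kbdry_ideal:
  assumes A: "ideal A R" and bs: "set bs \<subseteq> carrier R" and w: "chain w"
  shows "ideal {c \<in> carrier R. kbdry bs A p (\<lambda>s. c \<otimes> w s)} R" (is "ideal ?C R")
proof (rule idealI)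
  have mult: "y \<otimes> x \<in> ?C" if "x \<in> ?C" "y \<in> carrier R" for x y
  proof -
    have "kbdry bs A p (\<lambda>s. y \<otimes> (x \<otimes> w s))"
      by (rule kbdry_smult[OF A bs, of "\<lambda>s. x \<otimes> w s"]) (use that w in auto)
    moreover have "(\<lambda>s. y \<otimes> (x \<otimes> w s)) = (\<lambda>s. (y \<otimes> x) \<otimes> w s)"
      using that w by (auto simp: m_assoc)
    ultimately show ?thesis using that by auto
  qed
  show "subgroup ?C (add_monoid R)"
  proof (rule add.subgroupI)
    have "kbdry bs A p (\<lambda>s. \<zero> \<otimes> w s)"
      unfolding kbdry_def using w bs ideal_zero_closed[OF A]
      by (intro exI[of _ "\<lambda>_. \<zero>"]) (auto simp: a_minus_def)
    then show "?C \<noteq> {}" by blast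
  next
    fix x assume x: "x \<in> ?C"
    then show "\<ominus> x \<in> ?C" using mult[OF x, of "\<ominus> \<one>"] by (auto simp: l_minus)
  next
    fix x y assume "x \<in> ?C" "y \<in> ?C"
    then have c: "x \<in> carrier R" "y \<in> carrier R" "kbdry bs A p (\<lambda>s. x \<otimes> w s)" "kbdry bs A p (\<lambda>s. y \<otimes> w s)"
      by auto
    have "kbdry bs A p (\<lambda>s. x \<otimes> w s \<oplus> y \<otimes> w s)"
      by (rule kbdry_add[OF A bs _ _ c(3,4)]) (use w c in auto)
    moreover have "(\<lambda>s. x \<otimes> w s \<oplus> y \<otimes> w s) = (\<lambda>s. (x \<oplus> y) \<otimes> w s)"
      using c w by (auto simp: l_distr)
    ultimately show "x \<oplus> y \<in> ?C" using c by auto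
  qed auto
  fix x y assume x: "x \<in> ?C" and y: "y \<in> carrier R"
  show "y \<otimes> x \<in> ?C" by (rule mult[OF x y])
  then show "x \<otimes> y \<in> ?C" using m_comm[of x y] x y by simp
qed (rule ring_axioms)

text \<open>If \<open>f t\<close> lies in the ideal of \<open>bs\<close>, its coefficients form a Koszul cycle modulo \<open>f\<close>.\<close>

lemma weakly_regular_torsion:
  assumes bs: "set bs \<subseteq> carrier R" and c: "c \<in> carrier R" and t: "t \<in> carrier R"
    and f: "f \<in> carrier R" "\<And>x. x \<in> carrier R \<Longrightarrow> f \<otimes> x = \<zero> \<Longrightarrow> x = \<zero>"
    and A: "ideal A R" "f \<in> A" "\<And>a. a \<in> A \<Longrightarrow> \<exists>s\<in>carrier R. a = f \<otimes> s"
    and wr: "weakly_regular c A bs" and ft: "f \<otimes> t \<in> lin bs {\<zero>}"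
  shows "\<exists>N::nat. c [^] N \<otimes> t \<in> lin bs {\<zero>}"
proof -
  let ?F = "replicate (length bs) False"
  obtain v where v: "chain v" "f \<otimes> t \<ominus> kd bs v ?F \<in> {\<zero>}"
    using lin_kd[OF zeroideal bs ft] by blast
  have k: "kd bs v ?F \<in> carrier R" using v bs by simp
  have "kd bs v ?F = f \<otimes> t \<ominus> (f \<otimes> t \<ominus> kd bs v ?F)" using k f t by algebra
  then have kv: "kd bs v ?F = f \<otimes> t" using v(2) f t by (simp add: a_minus_def)
  have "kcycle bs A (Suc 0) v"
    using v kv kpos_zero[of _ bs] A(2) t ideal.I_r_closed[OF A(1)] by (auto simp: kcycle_def)
  then obtain N :: nat and x where x: "chain x"
    "\<And>s. kpos bs (Suc 0) s \<Longrightarrow> c [^] N \<otimes> v s \<ominus> kd bs x s \<in> A"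
    using koszul_torsion[OF A(1) bs c wr] unfolding kbdry_def by blast
  have "\<exists>y\<in>carrier R. kpos bs (Suc 0) s \<longrightarrow> c [^] N \<otimes> v s \<ominus> kd bs x s = f \<otimes> y" for s
    using x(2)[of s] A(3) by blast
  then obtain y where y: "\<And>s. y s \<in> carrier R"
    "\<And>s. kpos bs (Suc 0) s \<Longrightarrow> c [^] N \<otimes> v s \<ominus> kd bs x s = f \<otimes> y s" by metis
  have cN: "c [^] N \<in> carrier R" using c by simp
  have cy: "chain y" using y by simp
  have ky: "kd bs y ?F \<in> carrier R" using cy bs by simp
  \<comment> \<open>Modulo \<open>f\<close> the cycle \<open>v\<close> bounds up to
    \<open>c^N\<close>, so \<open>c^N v = kd x + f y\<close> in degree 1. The differential of this
    equation is \<open>c^N f t = f (kd y)\<close>, and \<open>f\<close> cancels.\<close>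
  have "kd bs (\<lambda>s. c [^] N \<otimes> v s \<ominus> kd bs x s \<ominus> f \<otimes> y s) ?F \<in> {\<zero>}"
  proof (rule kd_in_ideal[OF bs _ zeroideal])
    show "chain (\<lambda>s. c [^] N \<otimes> v s \<ominus> kd bs x s \<ominus> f \<otimes> y s)" using cN v x y f bs by simp
    show "kpos bs 0 ?F" using kpos_zero[of ?F bs] by simp
    show "c [^] N \<otimes> v s \<ominus> kd bs x s \<ominus> f \<otimes> y s \<in> {\<zero>}" if "kpos bs (Suc 0) s" for s
      using y(2)[OF that] y(1)[of s] f by (simp add: a_minus_def r_neg)
  qed
  moreover have "kd bs (\<lambda>s. c [^] N \<otimes> v s \<ominus> kd bs x s \<ominus> f \<otimes> y s) ?F
    = c [^] N \<otimes> (f \<otimes> t) \<ominus> \<zero> \<ominus> f \<otimes> kd bs y ?F"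
    using cN v x cy f bs by (simp add: kd_minus kd_smult kd_kd kv)
  ultimately have "c [^] N \<otimes> (f \<otimes> t) \<ominus> \<zero> \<ominus> f \<otimes> kd bs y ?F = \<zero>" by simp
  moreover have "n \<otimes> (f \<otimes> t) \<ominus> \<zero> \<ominus> f \<otimes> u = f \<otimes> (n \<otimes> t \<ominus> u)"
    if "n \<in> carrier R" "u \<in> carrier R" for n u using that f(1) t by algebra
  ultimately have z: "c [^] N \<otimes> t \<ominus> kd bs y ?F = \<zero>" using f(2) cN ky t by simp
  have "c [^] N \<otimes> t = kd bs y ?F \<oplus> (c [^] N \<otimes> t \<ominus> kd bs y ?F)"
  proof -
    have "n = u \<oplus> (n \<ominus> u)" if "n \<in> carrier R" "u \<in> carrier R" for n u using that by algebra
    from this[of "c [^] N \<otimes> t" "kd bs y ?F"] show ?thesis using cN t ky by simp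
  qed
  then have "c [^] N \<otimes> t = kd bs y ?F \<oplus> \<zero>" unfolding z .
  then show ?thesis using kd_replicate_False[OF zeroideal bs cy, of \<zero>] by (metis singletonI)
qed

lemma const_vimage_ideal:
  assumes "ideal L (PR V)"
  shows "ideal {c \<in> carrier R. indexed_const c \<in> L} R"
proof -
  interpret T: cring "PR V" by (rule PR_cring)
  note h = ring_hom_add[OF indexed_const_hom[where V = V]] ring_hom_mult[OF indexed_const_hom[where V = V]]
  show ?thesis
  proof (rule idealI)
    show "subgroup {c \<in> carrier R. indexed_const c \<in> L} (add_monoid R)"
    proof (rule add.subgroupI)
      have "indexed_const \<zero> \<in> L" using T.ideal_zero_closed[OF assms] by (simp add: PR_simps)
      then show "{c \<in> carrier R. indexed_const c \<in> L} \<noteq> {}" by blast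
    next
      fix x assume x: "x \<in> {c \<in> carrier R. indexed_const c \<in> L}"
      have "\<ominus> x = (\<ominus> \<one>) \<otimes> x" using x by (simp add: l_minus)
      then have "indexed_const (\<ominus> x) = indexed_const (\<ominus> \<one>) \<otimes>\<^bsub>PR V\<^esub> indexed_const x"
        using h(2)[of "\<ominus> \<one>" x] x by simp
      then show "\<ominus> x \<in> {c \<in> carrier R. indexed_const c \<in> L}"
        using x ideal.I_l_closed[OF assms, of "indexed_const x" "indexed_const (\<ominus> \<one>)"] by simp
    next
      fix x y assume "x \<in> {c \<in> carrier R. indexed_const c \<in> L}" "y \<in> {c \<in> carrier R. indexed_const c \<in> L}"
      then show "x \<oplus> y \<in> {c \<in> carrier R. indexed_const c \<in> L}"
        using T.ideal_add_closed[OF assms, of "indexed_const x" "indexed_const y"] h(1)[of x y]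
        by simp
    qed auto
    fix x y assume "x \<in> {c \<in> carrier R. indexed_const c \<in> L}" "y \<in> carrier R"
    then show "y \<otimes> x \<in> {c \<in> carrier R. indexed_const c \<in> L}" "x \<otimes> y \<in> {c \<in> carrier R. indexed_const c \<in> L}"
      using ideal.I_l_closed[OF assms, of "indexed_const x" "indexed_const y"]
        ideal.I_r_closed[OF assms, of "indexed_const x" "indexed_const y"] h(2)[of x y] h(2)[of y x] by simp_all
  qed (rule ring_axioms)
qed

lemma const_pow:
  assumes "c \<in> carrier R"
  shows "indexed_const c [^]\<^bsub>PR V\<^esub> (N::nat) = indexed_const (c [^] N)"
proof -
  interpret T: cring "PR V" by (rule PR_cring)
  show ?thesis
  proof (induction N)
    case (Suc N)
    then show ?case using assms ring_hom_mult[OF indexed_const_hom[where V = V], of "c [^] N" c] by simp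
  qed (simp add: PR_one)
qed

lemma coeff_ideal_zero: "coeff_ideal V {\<zero>} = {\<zero>\<^bsub>PR V\<^esub>}"
proof -
  interpret T: cring "PR V" by (rule PR_cring)
  show ?thesis using T.zero_closed by (auto simp: coeff_ideal_def PR_zero_coeff fun_eq_iff)
qed

section \<open>Generic forms and torsion modulo the ideal they generate\<close>

definition gform :: "nat \<Rightarrow> nat \<Rightarrow> (nat \<Rightarrow> 'a) \<Rightarrow> nat \<Rightarrow> (nat \<times> nat) multiset \<Rightarrow> 'a" where
  "gform n d g l = (\<Oplus>\<^bsub>PR ({1..n} \<times> {1..d})\<^esub>j\<in>{1..n}.
     indexed_var (j, l) \<otimes>\<^bsub>PR ({1..n} \<times> {1..d})\<^esub> indexed_const (g j))"

abbreviation gforms :: "nat \<Rightarrow> nat \<Rightarrow> (nat \<Rightarrow> 'a) \<Rightarrow> ((nat \<times> nat) multiset \<Rightarrow> 'a) list" where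
  "gforms n d g \<equiv> map (gform n d g) [1..<Suc d]"

lemma generic_ideal_eq: "generic_ideal R n g d = Idl\<^bsub>PR ({1..n} \<times> {1..d})\<^esub> (set (gforms n d g))"
proof -
  have "set [1..<Suc d] = {1..d}" by auto
  then show ?thesis
    unfolding generic_ideal_def generic_ring_def Let_def gform_def by simp
qed

lemma var_const_coeff:
  assumes "i \<in> V" "c \<in> carrier R"
  shows "(indexed_var i \<otimes>\<^bsub>PR V\<^esub> indexed_const c) m = (if m = {#i#} then c else \<zero>)"
proof -
  have "indexed_var i m = (if m = {#i#} then \<one> else \<zero>)"
    by (auto simp: indexed_var_def indexed_pmult_def indexed_const_def)
       (metis add_mset_remove_trivial insert_DiffM)+
  then show ?thesis using assms by (simp add: PR_const_mult(2)[OF PR_var_closed])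
qed

lemma index_free_finsum:
  assumes "finite S" "\<And>j. j \<in> S \<Longrightarrow> h j \<in> carrier (PR V)" "\<And>j. j \<in> S \<Longrightarrow> index_free (h j) i"
  shows "index_free (\<Oplus>\<^bsub>PR V\<^esub>j\<in>S. h j) i"
proof -
  interpret T: cring "PR V" by (rule PR_cring)
  show ?thesis using assms
  proof (induction S rule: finite_induct)
    case empty
    then show ?case by (simp add: index_free_def PR_zero_coeff)
  next
    case (insert j S)
    then have "(\<Oplus>\<^bsub>PR V\<^esub>j\<in>insert j S. h j) = h j \<oplus>\<^bsub>PR V\<^esub> (\<Oplus>\<^bsub>PR V\<^esub>j\<in>S. h j)"
      by (intro T.finsum_insert) auto
    moreover have "index_free (\<Oplus>\<^bsub>PR V\<^esub>j\<in>S. h j) i" "index_free (h j) i" using insert by auto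
    ultimately show ?case by (simp add: index_free_def PR_add_coeff)
  qed
qed

lemma index_free_var_const:
  "i \<in> V \<Longrightarrow> c \<in> carrier R \<Longrightarrow> i' \<noteq> i \<Longrightarrow> index_free (indexed_var i \<otimes>\<^bsub>PR V\<^esub> indexed_const c) i'"
  by (auto simp: index_free_def var_const_coeff)

lemma gform_term_closed:
  assumes "g \<in> {1..n} \<rightarrow> carrier R" "j \<in> {1..n}" "l \<in> {1..d}"
  shows "indexed_var (j, l) \<otimes>\<^bsub>PR ({1..n} \<times> {1..d})\<^esub> indexed_const (g j) \<in> carrier (PR ({1..n} \<times> {1..d}))"
proof -
  interpret T: cring "PR ({1..n} \<times> {1..d})" by (rule PR_cring)
  show ?thesis using assms by (intro T.m_closed PR_var_closed PR_const_closed) auto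
qed

lemma gform_closed:
  assumes "g \<in> {1..n} \<rightarrow> carrier R" "l \<in> {1..d}"
  shows "gform n d g l \<in> carrier (PR ({1..n} \<times> {1..d}))"
proof -
  interpret T: cring "PR ({1..n} \<times> {1..d})" by (rule PR_cring)
  show ?thesis unfolding gform_def
    using gform_term_closed[OF assms(1) _ assms(2)] by (intro T.finsum_closed) blast
qed

lemma gform_index_free:
  assumes "g \<in> {1..n} \<rightarrow> carrier R" "l \<in> {1..d}" "l' \<noteq> l"
  shows "index_free (gform n d g l) (j, l')"
  unfolding gform_def
  using assms gform_term_closed[OF assms(1) _ assms(2)]
  by (intro index_free_finsum index_free_var_const) auto

lemma gform_split:
  assumes g: "g \<in> {1..n} \<rightarrow> carrier R" and l: "l \<in> {1..d}" and j: "j \<in> {1..n}"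
  obtains h where "h \<in> carrier (PR ({1..n} \<times> {1..d}))" "index_free h (j, l)"
    "gform n d g l = indexed_var (j, l) \<otimes>\<^bsub>PR ({1..n} \<times> {1..d})\<^esub> indexed_const (g j)
       \<oplus>\<^bsub>PR ({1..n} \<times> {1..d})\<^esub> h"
proof -
  interpret T: cring "PR ({1..n} \<times> {1..d})" by (rule PR_cring)
  let ?t = "\<lambda>j. indexed_var (j, l) \<otimes>\<^bsub>PR ({1..n} \<times> {1..d})\<^esub> indexed_const (g j)"
  let ?h = "\<Oplus>\<^bsub>PR ({1..n} \<times> {1..d})\<^esub>i\<in>{1..n} - {j}. ?t i"
  have t: "?t i \<in> carrier (PR ({1..n} \<times> {1..d}))" if "i \<in> {1..n}" for i
    using gform_term_closed[OF g that l] .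
  have "{1..n} = insert j ({1..n} - {j})" using j by auto
  then have "gform n d g l = (\<Oplus>\<^bsub>PR ({1..n} \<times> {1..d})\<^esub>i\<in>insert j ({1..n} - {j}). ?t i)"
    unfolding gform_def by simp
  also have "\<dots> = ?t j \<oplus>\<^bsub>PR ({1..n} \<times> {1..d})\<^esub> ?h"
    using t j by (intro T.finsum_insert) auto
  finally have "gform n d g l = ?t j \<oplus>\<^bsub>PR ({1..n} \<times> {1..d})\<^esub> ?h" .
  moreover have "?h \<in> carrier (PR ({1..n} \<times> {1..d}))" using t by (intro T.finsum_closed) auto
  moreover have "index_free ?h (j, l)"
    using t g l by (intro index_free_finsum index_free_var_const) auto
  ultimately show thesis using that by blast
qed

text \<open>The form number \<open>l\<close> is linear in the variable \<open>(j, l)\<close> with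
  coefficient \<open>g j\<close>, and no other form involves that variable. So every
  \<open>g j\<close> can play the part of \<open>c\<close>, modulo any extended ideal.\<close>

lemma gforms_weakly_regular:
  assumes g: "g \<in> {1..n} \<rightarrow> carrier R" and j: "j \<in> {1..n}" and A: "ideal A R"
  shows "cring.weakly_regular (PR ({1..n} \<times> {1..d})) (indexed_const (g j))
    (coeff_ideal ({1..n} \<times> {1..d}) A) (gforms n d g)"
proof -
  interpret T: cring "PR ({1..n} \<times> {1..d})" by (rule PR_cring)
  have "T.weakly_regular (indexed_const (g j)) (coeff_ideal ({1..n} \<times> {1..d}) A) (map (gform n d g) ls)"
    if "distinct ls" "set ls \<subseteq> {1..d}" for ls
    using that
  proof (induction ls)
    case (Cons l ls)
    have l: "l \<in> {1..d}" "l \<notin> set ls" "set ls \<subseteq> {1..d}" using Cons.prems by auto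
    obtain h where h: "h \<in> carrier (PR ({1..n} \<times> {1..d}))" "index_free h (j, l)"
      "gform n d g l = indexed_var (j, l) \<otimes>\<^bsub>PR ({1..n} \<times> {1..d})\<^esub> indexed_const (g j)
       \<oplus>\<^bsub>PR ({1..n} \<times> {1..d})\<^esub> h"
      using gform_split[OF g l(1) j] by blast
    have "\<exists>N::nat. indexed_const (g j) [^]\<^bsub>PR ({1..n} \<times> {1..d})\<^esub> N \<otimes>\<^bsub>PR ({1..n} \<times> {1..d})\<^esub> x
      \<in> T.lin (map (gform n d g) ls) (coeff_ideal ({1..n} \<times> {1..d}) A)"
      if x: "x \<in> carrier (PR ({1..n} \<times> {1..d}))" "gform n d g l \<otimes>\<^bsub>PR ({1..n} \<times> {1..d})\<^esub> x
        \<in> T.lin (map (gform n d g) ls) (coeff_ideal ({1..n} \<times> {1..d}) A)" for x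
    proof (rule linear_in_variable_weakly_regular[OF _ _ A _ _ h x])
      show "set (map (gform n d g) ls) \<subseteq> carrier (PR ({1..n} \<times> {1..d}))"
        using gform_closed[OF g] l by auto
      show "index_free b (j, l)" if "b \<in> set (map (gform n d g) ls)" for b
      proof -
        obtain l' where l': "b = gform n d g l'" "l' \<in> set ls" using \<open>b \<in> _\<close> by auto
        then have "l' \<in> {1..d}" "l \<noteq> l'" using l by auto
        then show ?thesis unfolding l'(1) by (rule gform_index_free[OF g])
      qed
    qed (use j l g in auto)
    then show ?case using Cons by simp
  qed simp
  from this[of "[1..<Suc d]"] show ?thesis by (simp del: upt_Suc add: atLeastLessThanSuc_atLeastAtMost)
qed

lemma gforms_closed:
  "g \<in> {1..n} \<rightarrow> carrier R \<Longrightarrow> set (gforms n d g) \<subseteq> carrier (PR ({1..n} \<times> {1..d}))"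
  using gform_closed by auto

lemma generic_ideal_lin:
  assumes "g \<in> {1..n} \<rightarrow> carrier R"
  shows "generic_ideal R n g d =
    cring.lin (PR ({1..n} \<times> {1..d})) (gforms n d g) (coeff_ideal ({1..n} \<times> {1..d}) {\<zero>})"
proof -
  interpret T: cring "PR ({1..n} \<times> {1..d})" by (rule PR_cring)
  show ?thesis unfolding generic_ideal_eq coeff_ideal_zero
    using T.lin_zero_eq_Idl[OF gforms_closed[OF assms]] by simp
qed

text \<open>The generic forms stay weakly regular modulo the extension of \<open>(f)\<close>, so
  \<open>weakly_regular_torsion\<close> applies over \<open>T\<close>. It is used with the
  \<open>e\<close>-th power of the given regular element in place of \<open>f\<close>.\<close>

lemma generic_torsion:
  assumes g: "g \<in> {1..n} \<rightarrow> carrier R" and j: "j \<in> {1..n}"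
    and f: "f \<in> carrier R" "\<And>x. x \<in> carrier R \<Longrightarrow> f \<otimes> x = \<zero> \<Longrightarrow> x = \<zero>"
    and t: "t \<in> carrier (PR ({1..n} \<times> {1..d}))"
    and ft: "t \<otimes>\<^bsub>PR ({1..n} \<times> {1..d})\<^esub> indexed_const f \<in> generic_ideal R n g d"
  shows "\<exists>N::nat. indexed_const (g j) [^]\<^bsub>PR ({1..n} \<times> {1..d})\<^esub> N \<otimes>\<^bsub>PR ({1..n} \<times> {1..d})\<^esub> t
    \<in> generic_ideal R n g d"
proof -
  let ?V = "{1..n} \<times> {1..d}"
  interpret T: cring "PR ?V" by (rule PR_cring)
  have I: "ideal (PIdl f) R" using cgenideal_ideal[OF f(1)] .
  have fI: "f \<in> PIdl f" using cgenideal_self[OF f(1)] .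
  have gj: "g j \<in> carrier R" using g j by auto
  show ?thesis unfolding generic_ideal_lin[OF g] coeff_ideal_zero
  proof (rule T.weakly_regular_torsion)
    show "indexed_const f \<in> coeff_ideal ?V (PIdl f)" by (rule const_mem_coeff_ideal[OF I fI])
    show "T.weakly_regular (indexed_const (g j)) (coeff_ideal ?V (PIdl f)) (gforms n d g)"
      by (rule gforms_weakly_regular[OF g j I])
    show "x = \<zero>\<^bsub>PR ?V\<^esub>" if x: "x \<in> carrier (PR ?V)" "indexed_const f \<otimes>\<^bsub>PR ?V\<^esub> x = \<zero>\<^bsub>PR ?V\<^esub>" for x
    proof
      fix m
      have "f \<otimes> x m = \<zero>" using x(2) PR_const_mult(1)[OF x(1) f(1)] PR_zero_coeff by metis
      then show "x m = \<zero>\<^bsub>PR ?V\<^esub> m" using f(2) x(1) by (simp add: PR_zero_coeff)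
    qed
    show "\<exists>s\<in>carrier (PR ?V). a = indexed_const f \<otimes>\<^bsub>PR ?V\<^esub> s" if a: "a \<in> coeff_ideal ?V (PIdl f)" for a
    proof -
      have dec: "\<exists>a\<in>{\<zero>}. \<exists>s\<in>carrier R. y = a \<oplus> f \<otimes> s" if y: "y \<in> PIdl f" for y
        using y f(1) by (auto simp: cgenideal_def m_comm)
      obtain Q S where "Q \<in> coeff_ideal ?V {\<zero>}" "S \<in> carrier (PR ?V)"
        "a = Q \<oplus>\<^bsub>PR ?V\<^esub> indexed_const f \<otimes>\<^bsub>PR ?V\<^esub> S"
        using coeff_ideal_decomp[of "PIdl f" "{\<zero>}" f a ?V] dec zeroideal f(1) a by blast
      then show ?thesis using f(1) unfolding coeff_ideal_zero by (intro bexI[of _ S]) auto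
    qed
    show "indexed_const f \<otimes>\<^bsub>PR ?V\<^esub> t \<in> T.lin (gforms n d g) {\<zero>\<^bsub>PR ?V\<^esub>}"
      using ft t f(1) unfolding generic_ideal_lin[OF g] coeff_ideal_zero by (simp add: T.m_comm)
  qed (use gforms_closed[OF g] gj f t coeff_ideal_ideal[OF I] in auto)
qed

text \<open>The multiplier \<open>v\<close> is regular modulo every extended ideal, so it prolongs the extension of the
  flag to \<open>T\<close> and depth sensitivity applies to the \<open>d\<close> generic forms.\<close>

theorem generic_unmixed:
  assumes g: "g \<in> {1..n} \<rightarrow> carrier R"
    and F: "regular_flag A z d" "A 0 = {\<zero>}"
    and zI: "\<And>i. i < d \<Longrightarrow> \<exists>k::nat. z i [^] k \<in> Idl (g ` {1..n})"
    and v: "v \<in> carrier (PR ({1..n} \<times> {1..d}))" "v m0 \<in> Units R"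
    and x: "x \<in> carrier (PR ({1..n} \<times> {1..d}))"
      "v \<otimes>\<^bsub>PR ({1..n} \<times> {1..d})\<^esub> x \<in> generic_ideal R n g d"
      "\<And>j. j \<in> {1..n} \<Longrightarrow> \<exists>N::nat. indexed_const (g j) [^]\<^bsub>PR ({1..n} \<times> {1..d})\<^esub> N
        \<otimes>\<^bsub>PR ({1..n} \<times> {1..d})\<^esub> x \<in> generic_ideal R n g d"
  shows "x \<in> generic_ideal R n g d"
proof -
  let ?V = "{1..n} \<times> {1..d}"
  interpret T: cring "PR ?V" by (rule PR_cring)
  note D = regular_flagD[OF F(1)]
  note bs = gforms_closed[OF g, of d]
  have gc: "g ` {1..n} \<subseteq> carrier R" using g by auto
  \<comment> \<open>Some power of \<open>z i\<close> lies in the ideal of the \<open>g j\<close>, so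
    an ideal \<open>C\<close> of \<open>T\<close> that contains a power of every \<open>g j\<close>
    contains a power of \<open>z i\<close>. Below, \<open>C\<close> is the annihilator of a Koszul
    class, and then the colon of the generic ideal by \<open>x\<close>.\<close>
  have radical: "\<exists>N::nat. indexed_const (z i) [^]\<^bsub>PR ?V\<^esub> N \<in> C"
    if C: "ideal C (PR ?V)" and i: "i < d"
      and gC: "\<And>j. j \<in> {1..n} \<Longrightarrow> \<exists>N::nat. indexed_const (g j) [^]\<^bsub>PR ?V\<^esub> N \<in> C" for C i
  proof -
    let ?L = "{y \<in> carrier (PR ?V). \<exists>N::nat. y [^]\<^bsub>PR ?V\<^esub> N \<otimes>\<^bsub>PR ?V\<^esub> \<one>\<^bsub>PR ?V\<^esub> \<in> C}"
    have L: "ideal {c \<in> carrier R. indexed_const c \<in> ?L} R"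
      by (intro const_vimage_ideal[where V = ?V] T.power_torsion_ideal C) simp
    have "g ` {1..n} \<subseteq> {c \<in> carrier R. indexed_const c \<in> ?L}"
      using gC gc by fastforce
    then have "Idl (g ` {1..n}) \<subseteq> {c \<in> carrier R. indexed_const c \<in> ?L}"
      by (rule genideal_minimal[OF L])
    then obtain k N :: nat where "indexed_const (z i [^] k) [^]\<^bsub>PR ?V\<^esub> N \<otimes>\<^bsub>PR ?V\<^esub> \<one>\<^bsub>PR ?V\<^esub> \<in> C"
      using zI[OF i] by blast
    then have "indexed_const (z i) [^]\<^bsub>PR ?V\<^esub> (k * N) \<in> C"
      using D(6)[OF i] by (simp add: const_pow nat_pow_pow)
    then show ?thesis by blast
  qed
  have F': "T.regular_flag (\<lambda>i. coeff_ideal ?V (A i)) (\<lambda>i. indexed_const (z i)) d"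
    by (rule regular_flag_PR[OF F(1)])
  have acyc: "T.kbdry (gforms n d g) (coeff_ideal ?V (A i)) p w"
    if "i \<le> d" "i < p" "T.kcycle (gforms n d g) (coeff_ideal ?V (A i)) p w" for i p w
  proof (rule T.koszul_acyclic[OF F' bs _ _ that(1,3,2)])
    show "length (gforms n d g) \<le> d" by simp
    fix i p w assume i: "i < d" and cyc: "T.kcycle (gforms n d g) (coeff_ideal ?V (A i)) (Suc p) w"
    have Ai: "ideal (A i) R" using D(1) i by simp
    have w: "T.chain w" using cyc by (simp add: T.kcycle_def)
    let ?C = "{c \<in> carrier (PR ?V). T.kbdry (gforms n d g) (coeff_ideal ?V (A i)) (Suc p) (\<lambda>s. c \<otimes>\<^bsub>PR ?V\<^esub> w s)}"
    have "\<exists>N::nat. indexed_const (z i) [^]\<^bsub>PR ?V\<^esub> N \<in> ?C"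
    proof (rule radical[OF _ i])
      show "ideal ?C (PR ?V)" by (rule T.kbdry_ideal[OF coeff_ideal_ideal[OF Ai] bs w])
      fix j assume j: "j \<in> {1..n}"
      then have "g j \<in> carrier R" using g by auto
      then show "\<exists>N::nat. indexed_const (g j) [^]\<^bsub>PR ?V\<^esub> N \<in> ?C"
        using T.koszul_torsion[OF coeff_ideal_ideal[OF Ai] bs _ gforms_weakly_regular[OF g j Ai] cyc]
        by simp
    qed
    then show "\<exists>N::nat. T.kbdry (gforms n d g) (coeff_ideal ?V (A i)) (Suc p)
      (\<lambda>s. indexed_const (z i) [^]\<^bsub>PR ?V\<^esub> N \<otimes>\<^bsub>PR ?V\<^esub> w s)" by blast
  qed
  have G: "generic_ideal R n g d = T.lin (gforms n d g) (coeff_ideal ?V (A 0))"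
    using generic_ideal_lin[OF g] F(2) by simp
  have GI: "ideal (generic_ideal R n g d) (PR ?V)"
    unfolding G by (intro T.lin_ideal[OF coeff_ideal_ideal bs] D(1)) simp
  have "x \<in> T.lin (gforms n d g) (coeff_ideal ?V (A 0))"
  proof (rule T.koszul_depth_sensitive[OF F' bs _ acyc v(1) _ x(1) x(2)[unfolded G]])
    show "length (gforms n d g) = d" by simp
    show "y \<in> coeff_ideal ?V (A d)" if "y \<in> carrier (PR ?V)" "v \<otimes>\<^bsub>PR ?V\<^esub> y \<in> coeff_ideal ?V (A d)" for y
      using unit_coeff_regular[OF D(1)[OF order_refl] v that] .
    fix i assume i: "i < d"
    let ?C = "{c \<in> carrier (PR ?V). c \<otimes>\<^bsub>PR ?V\<^esub> x \<in> generic_ideal R n g d}"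
    have "\<exists>N::nat. indexed_const (z i) [^]\<^bsub>PR ?V\<^esub> N \<in> ?C"
    proof (rule radical[OF _ i])
      have "?C = {c \<in> carrier (PR ?V). x \<otimes>\<^bsub>PR ?V\<^esub> c \<in> generic_ideal R n g d}"
        using x(1) T.m_comm by auto
      then show "ideal ?C (PR ?V)"
        using ideal.helper_max_prime[OF GI T.is_cring x(1)] by simp
      fix j assume j: "j \<in> {1..n}"
      then have "g j \<in> carrier R" using g by auto
      then show "\<exists>N::nat. indexed_const (g j) [^]\<^bsub>PR ?V\<^esub> N \<in> ?C"
        using x(3)[OF j] by simp
    qed
    then show "\<exists>N::nat. indexed_const (z i) [^]\<^bsub>PR ?V\<^esub> N \<otimes>\<^bsub>PR ?V\<^esub> x \<in> T.lin (gforms n d g) (coeff_ideal ?V (A 0))"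
      unfolding G by blast
  qed
  then show ?thesis unfolding G .
qed

end

section \<open>Length over a local ring\<close>

locale local_noetherian_ring = cring +
  fixes M
  assumes noetherian: "noetherian_ring R"
    and maximal: "maximalideal M R"
    and unique: "maximalideal N R \<Longrightarrow> N = M"
begin

lemma M_ideal: "ideal M R" and M_prime: "primeideal M R"
  using maximal maximalideal.axioms(1) maximalideal_prime by blast+

lemma M_proper: "\<one> \<notin> M"
  using maximal maximalideal.I_notcarr ideal.one_imp_carrier[OF M_ideal] by blast

lemma exists_maximal_ideal_in:
  assumes "F \<noteq> {}" "\<And>J. J \<in> F \<Longrightarrow> ideal J R"
  shows "\<exists>J\<in>F. \<forall>K\<in>F. J \<subseteq> K \<longrightarrow> K = J"
proof (rule subset_Zorn_nonempty[OF assms(1)])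
  fix CC assume "CC \<noteq> {}" and c: "subset.chain F CC"
  moreover have "subset.chain {I. ideal I R} CC"
    using c assms(2) unfolding pred_on.chain_def by blast
  ultimately have "\<Union>CC \<in> CC" using noetherian_ring.ideal_chain_is_trivial[OF noetherian] by blast
  then show "\<Union>CC \<in> F" using c unfolding pred_on.chain_def by blast
qed

lemma proper_ideal_subset_M:
  assumes "ideal J R" "\<one> \<notin> J"
  shows "J \<subseteq> M"
proof -
  let ?F = "{K. ideal K R \<and> J \<subseteq> K \<and> \<one> \<notin> K}"
  obtain K where K: "K \<in> ?F" "\<And>L. L \<in> ?F \<Longrightarrow> K \<subseteq> L \<Longrightarrow> L = K"
  proof -
    have "J \<in> ?F" using assms by simp
    then have "?F \<noteq> {}" by blast
    then show ?thesis using exists_maximal_ideal_in[of ?F] that by (metis (mono_tags, lifting) mem_Collect_eq)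
  qed
  have "maximalideal K R"
  proof (rule maximalidealI)
    show "ideal K R" "carrier R \<noteq> K" using K by auto
    fix L assume L: "ideal L R" "K \<subseteq> L" "L \<subseteq> carrier R"
    show "L = K \<or> L = carrier R"
    proof (cases "\<one> \<in> L")
      case True
      then show ?thesis using ideal.one_imp_carrier[OF L(1)] by blast
    next
      case False
      then show ?thesis using K L by blast
    qed
  qed
  then show ?thesis using unique K(1) by blast
qed

lemma unit_iff_notin_M:
  assumes "x \<in> carrier R"
  shows "x \<in> Units R \<longleftrightarrow> x \<notin> M"
proof
  assume "x \<in> Units R"
  then show "x \<notin> M" using M_proper ideal.I_r_closed[OF M_ideal, of x "inv x"] by auto
next
  assume "x \<notin> M"
  then have "\<not> PIdl x \<subseteq> M" using cgenideal_self[OF assms] by blast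
  then have "\<one> \<in> PIdl x" using proper_ideal_subset_M[OF cgenideal_ideal[OF assms]] by blast
  then obtain y where "y \<in> carrier R" "\<one> = y \<otimes> x" by (auto simp: cgenideal_def)
  then show "x \<in> Units R" using assms unit_factor[of x y] m_comm Units_one_closed by metis
qed

lemma ideal_finite_generators:
  assumes "ideal J R"
  obtains Z where "finite Z" "Z \<subseteq> carrier R" "J = Idl Z"
  using noetherian_ring.finetely_gen[OF noetherian assms] by blast

text \<open>Generators of \<open>M\<close> are handled one at a time: multiplying \<open>s\<close>
  by the highest power of \<open>c\<close> that keeps it outside \<open>S\<close> makes
  \<open>c\<close> kill it modulo \<open>S\<close> and preserves what the earlier generators
  do.\<close>

lemma exists_socle_element:
  assumes S: "ideal S R" "\<one> \<notin> S" and nil: "\<And>m. m \<in> M \<Longrightarrow> \<exists>N::nat. m [^] N \<in> S"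
  shows "\<exists>s\<in>carrier R - S. \<forall>m\<in>M. m \<otimes> s \<in> S"
proof -
  obtain Z where Z: "finite Z" "Z \<subseteq> carrier R" "M = Idl Z"
    using ideal_finite_generators[OF M_ideal] .
  have "\<exists>s\<in>carrier R - S. \<forall>m\<in>Y. m \<otimes> s \<in> S" if "finite Y" "Y \<subseteq> M" for Y
    using that
  proof (induction Y rule: finite_induct)
    case empty
    then show ?case using S by auto
  next
    case (insert c Y)
    then obtain s where s: "s \<in> carrier R" "s \<notin> S" "\<And>m. m \<in> Y \<Longrightarrow> m \<otimes> s \<in> S" by auto
    have c: "c \<in> carrier R" using insert ideal.Icarr[OF M_ideal] by auto
    obtain N :: nat where "c [^] N \<in> S" using nil[of c] insert by auto
    then have ex: "c [^] N \<otimes> s \<in> S" using s ideal.I_r_closed[OF S(1)] by simp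
    define N0 where "N0 = (LEAST N::nat. c [^] N \<otimes> s \<in> S)"
    have N0: "c [^] N0 \<otimes> s \<in> S" unfolding N0_def using ex by (rule LeastI)
    then have "N0 \<noteq> 0" using s by (auto intro: gr0I)
    then obtain N1 where N1: "N0 = Suc N1" using not0_implies_Suc by blast
    have "c [^] N1 \<otimes> s \<notin> S"
      using not_less_Least[of N1 "\<lambda>N. c [^] N \<otimes> s \<in> S"] N1 unfolding N0_def by simp
    moreover have "c \<otimes> (c [^] N1 \<otimes> s) \<in> S"
      using N0 c s unfolding N1 by (simp add: m_ac)
    moreover have "m \<otimes> (c [^] N1 \<otimes> s) \<in> S" if "m \<in> Y" for m
    proof -
      have "m \<in> carrier R" using that insert.prems ideal.Icarr[OF M_ideal] by auto
      then have "m \<otimes> (c [^] N1 \<otimes> s) = c [^] N1 \<otimes> (m \<otimes> s)" using c s by (simp add: m_lcomm)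
      then show ?thesis using s(3)[OF that] c ideal.I_l_closed[OF S(1)] by simp
    qed
    ultimately show ?case using c s by (intro bexI[of _ "c [^] N1 \<otimes> s"]) auto
  qed
  then obtain s where s: "s \<in> carrier R - S" "\<And>m. m \<in> Z \<Longrightarrow> m \<otimes> s \<in> S"
    using Z genideal_self[OF Z(2)] by metis
  have "M \<subseteq> {m \<in> carrier R. s \<otimes> m \<in> S}"
    unfolding Z(3)
  proof (rule genideal_minimal)
    show "ideal {m \<in> carrier R. s \<otimes> m \<in> S} R"
      using ideal.helper_max_prime[OF S(1) is_cring] s(1) by blast
    show "Z \<subseteq> {m \<in> carrier R. s \<otimes> m \<in> S}"
    proof
      fix m assume "m \<in> Z"
      then show "m \<in> {m \<in> carrier R. s \<otimes> m \<in> S}"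
        using Z(2) s m_comm[of s m] by auto
    qed
  qed
  then have "m \<otimes> s \<in> S" if "m \<in> M" for m
    using that s m_comm[of s m] by auto
  then show ?thesis using s by blast
qed

text \<open>Read from the end of the list, an ascending chain of ideals above \<open>K\<close>, each
  step a copy of the residue field spanned by \<open>s\<close>. The generators give every layer an
  explicit coordinate.\<close>

fun comp_series :: "'a set \<Rightarrow> 'a list \<Rightarrow> bool" where
  "comp_series K [] \<longleftrightarrow> True"
| "comp_series K (s # ss) \<longleftrightarrow> comp_series K ss \<and> s \<in> carrier R - lin ss K \<and> (\<forall>m\<in>M. m \<otimes> s \<in> lin ss K)"

lemma comp_series_carrier: "comp_series K ss \<Longrightarrow> set ss \<subseteq> carrier R"
  by (induction ss) auto

text \<open>Among the ideals reached by such series there is a maximal one, as \<open>R\<close> is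
  Noetherian; were it proper, a socle element modulo it would extend the series.\<close>

lemma exists_comp_series:
  assumes K: "ideal K R" and nil: "\<And>m. m \<in> M \<Longrightarrow> \<exists>N::nat. m [^] N \<in> K"
  shows "\<exists>ss. comp_series K ss \<and> lin ss K = carrier R"
proof -
  let ?F = "{lin ss K |ss. comp_series K ss}"
  have I: "ideal (lin ss K) R" if "comp_series K ss" for ss
    using lin_ideal[OF K] comp_series_carrier[OF that] by blast
  have "?F \<noteq> {}" by (auto intro: exI[of _ "[]"])
  then have "\<exists>J\<in>?F. \<forall>L\<in>?F. J \<subseteq> L \<longrightarrow> L = J"
    by (rule exists_maximal_ideal_in) (use I in blast)
  then obtain J where JF: "J \<in> ?F \<and> (\<forall>L\<in>?F. J \<subseteq> L \<longrightarrow> L = J)"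
    unfolding Bex_def by (rule exE)
  have J: "J \<in> ?F" by (rule conjunct1[OF JF])
  have max: "L = J" if "L \<in> ?F" "J \<subseteq> L" for L
    by (rule mp[OF bspec[OF conjunct2[OF JF] that(1)] that(2)])
  from J obtain ss where ss: "J = lin ss K" "comp_series K ss" by blast
  have KJ: "K \<subseteq> J" using lin_superset(1)[OF K comp_series_carrier[OF ss(2)]] ss by simp
  have "\<one> \<in> J"
  proof (rule ccontr)
    assume "\<one> \<notin> J"
    then obtain s where s: "s \<in> carrier R - J" "\<forall>m\<in>M. m \<otimes> s \<in> J"
      using exists_socle_element[of J] I[OF ss(2)] nil KJ ss(1) by blast
    then have c: "comp_series K (s # ss)" using ss by simp
    have sub: "set (s # ss) \<subseteq> carrier R" using comp_series_carrier[OF c] .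
    have "s \<in> lin (s # ss) K" using lin_superset(2)[OF K sub] by simp
    moreover have "J \<subseteq> lin (s # ss) K"
      unfolding ss(1) by (rule lin_minimal) (use I[OF c] lin_superset[OF K sub] in auto)
    then have "lin (s # ss) K = J" using max c by blast
    ultimately show False using s by blast
  qed
  then show ?thesis using ideal.one_imp_carrier[OF I[OF ss(2)]] ss by blast
qed

text \<open>For an ideal \<open>C\<close> above \<open>K\<close> inside the top of the series this
  is the length of \<open>C/K\<close>, counted as the number of layers that \<open>C\<close> meets
  nontrivially. It bounds chains of ideals directly, in place of the Jordan-Hoelder theorem.\<close>

fun jumps :: "'a set \<Rightarrow> 'a list \<Rightarrow> 'a set \<Rightarrow> nat" where
  "jumps K [] C = 0"
| "jumps K (s # ss) C = jumps K ss (C \<inter> lin ss K) + (if C \<subseteq> lin ss K then 0 else 1)"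

lemma jumps_le: "jumps K ss C \<le> length ss"
  by (induction ss arbitrary: C) (auto simp: le_SucI)

text \<open>The delicate case is that both ideals leave \<open>lin ss K\<close>: then
  \<open>C\<close> contains some \<open>y = u s + r\<close> with \<open>u\<close> a unit, each
  element of \<open>C'\<close> can be moved into \<open>lin ss K\<close> by a multiple of
  \<open>y\<close>, and equal intersections would force \<open>C = C'\<close>.\<close>

lemma jumps_strict:
  assumes K: "ideal K R" and "comp_series K ss" "ideal C R" "ideal C' R" "K \<subseteq> C" "C \<subset> C'"
    "C' \<subseteq> lin ss K"
  shows "jumps K ss C < jumps K ss C'"
  using assms(2-)
proof (induction ss arbitrary: C C')
  case Nil
  then show ?case by auto
next
  case (Cons s ss)
  let ?S = "lin ss K"
  have ss: "set ss \<subseteq> carrier R" and s: "s \<in> carrier R" "\<And>m. m \<in> M \<Longrightarrow> m \<otimes> s \<in> ?S" and cs: "comp_series K ss"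
    using Cons.prems comp_series_carrier[of K ss] by auto
  have S: "ideal ?S R" using lin_ideal[OF K ss] .
  have KS: "K \<subseteq> ?S" using lin_superset(1)[OF K ss] .
  note C = Cons.prems(2,3)
  have D: "ideal (C \<inter> ?S) R" "ideal (C' \<inter> ?S) R" using i_intersect[OF _ S] C by auto
  have IH: "jumps K ss (C \<inter> ?S) < jumps K ss (C' \<inter> ?S)" if "C \<inter> ?S \<subset> C' \<inter> ?S"
    using Cons.IH[OF cs D _ that] Cons.prems(4) KS by auto
  have IH': "jumps K ss (C \<inter> ?S) \<le> jumps K ss (C' \<inter> ?S)"
  proof (cases "C \<inter> ?S = C' \<inter> ?S")
    case False
    then have "C \<inter> ?S \<subset> C' \<inter> ?S" using Cons.prems(5) by blast
    then show ?thesis using IH by simp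
  qed simp
  show ?case
  proof (cases "C' \<subseteq> ?S")
    case True
    then have "C \<inter> ?S = C" "C' \<inter> ?S = C'" "C \<subseteq> ?S" using Cons.prems by auto
    then show ?thesis using IH True Cons.prems(5) by auto
  next
    case C'S: False
    show ?thesis
    proof (cases "C \<subseteq> ?S")
      case True
      then show ?thesis using IH' C'S by simp
    next
      case False
      then obtain y where y: "y \<in> C" "y \<notin> ?S" by blast
      have "y \<in> lin (s # ss) K" using y Cons.prems by blast
      then obtain u r where u: "y = u \<otimes> s \<oplus> r" "u \<in> carrier R" "r \<in> ?S" by auto
      have "u \<notin> M" using u y s ideal_add_closed[OF S] by auto
      then have uU: "u \<in> Units R" using unit_iff_notin_M u by blast
      have "C \<inter> ?S \<noteq> C' \<inter> ?S"
      proof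
        assume e: "C \<inter> ?S = C' \<inter> ?S"
        have "x \<in> C" if x: "x \<in> C'" for x
        proof -
          have "x \<in> lin (s # ss) K" using x Cons.prems by blast
          then obtain q r' where q: "x = q \<otimes> s \<oplus> r'" "q \<in> carrier R" "r' \<in> ?S" by auto
          have rc: "r \<in> carrier R" "r' \<in> carrier R" "inv u \<in> carrier R"
            using u q ideal.Icarr[OF S] uU by auto
          define v where "v = q \<otimes> inv u"
          have v: "v \<in> carrier R" using rc q by (simp add: v_def)
          have vu: "v \<otimes> u = q" using rc q uU u by (simp add: v_def m_assoc)
          have vy: "v \<otimes> y \<in> C" using ideal.I_l_closed[OF C(1) y(1) v] .
          have "x \<ominus> v \<otimes> y = r' \<ominus> v \<otimes> r"
            unfolding q(1) u(1) vu[symmetric] using v rc s(1) u(2) by algebra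
          then have "x \<ominus> v \<otimes> y \<in> ?S"
            using u q v ideal_minus_closed[OF S] ideal.I_l_closed[OF S] by simp
          moreover have "x \<ominus> v \<otimes> y \<in> C'"
            using x vy Cons.prems(5) ideal_minus_closed[OF C(2)] by blast
          ultimately have xy: "x \<ominus> v \<otimes> y \<in> C" using e by blast
          have "a = (a \<ominus> b) \<oplus> b" if "a \<in> carrier R" "b \<in> carrier R" for a b using that by algebra
          then have "x = (x \<ominus> v \<otimes> y) \<oplus> v \<otimes> y"
            using ideal.Icarr[OF C(2) x] ideal.Icarr[OF C(1) vy] by blast
          then show ?thesis using ideal_add_closed[OF C(1) xy vy] by simp
        qed
        then show False using Cons.prems(5) by blast
      qed
      then have "C \<inter> ?S \<subset> C' \<inter> ?S" using Cons.prems(5) by blast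
      then show ?thesis using IH False C'S by simp
    qed
  qed
qed

section \<open>Lower bounds for lengths by chains of ideals\<close>

definition length_ge :: "'a set \<Rightarrow> 'a set \<Rightarrow> nat \<Rightarrow> bool" where
  "length_ge A B n \<longleftrightarrow> (\<exists>C. (\<forall>i\<le>n. ideal (C i) R) \<and> (\<forall>i<n. C i \<subset> C (Suc i)) \<and> A \<subseteq> C 0 \<and> C n \<subseteq> B)"

lemma length_ge_0: "ideal A R \<Longrightarrow> A \<subseteq> B \<Longrightarrow> length_ge A B 0"
  unfolding length_ge_def by (intro exI[of _ "\<lambda>_. A"]) auto

lemma length_ge_mono: "length_ge A B n \<Longrightarrow> A' \<subseteq> A \<Longrightarrow> B \<subseteq> B' \<Longrightarrow> length_ge A' B' n"
  unfolding length_ge_def by blast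

lemma length_ge_Suc:
  assumes "length_ge A B n" "ideal B' R" "B \<subset> B'"
  shows "length_ge A B' (Suc n)"
proof -
  obtain C where C: "\<And>i. i \<le> n \<Longrightarrow> ideal (C i) R" "\<And>i. i < n \<Longrightarrow> C i \<subset> C (Suc i)" "A \<subseteq> C 0" "C n \<subseteq> B"
    using assms(1) unfolding length_ge_def by blast
  let ?C = "\<lambda>i. if i \<le> n then C i else B'"
  have "\<forall>i\<le>Suc n. ideal (?C i) R" using C(1) assms(2) by auto
  moreover have "\<forall>i<Suc n. ?C i \<subset> ?C (Suc i)"
    using C(2,4) assms(3) by (auto simp: less_Suc_eq)
  ultimately show ?thesis unfolding length_ge_def using C(3) by (intro exI[of _ ?C]) auto
qed

lemma length_ge_trans:
  assumes "length_ge A B n" "length_ge B D m"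
  shows "length_ge A D (n + m)"
proof -
  obtain C where C: "\<And>i. i \<le> m \<Longrightarrow> ideal (C i) R" "\<And>i. i < m \<Longrightarrow> C i \<subset> C (Suc i)" "B \<subseteq> C 0" "C m \<subseteq> D"
    using assms(2) unfolding length_ge_def by blast
  have "length_ge A (C i) (n + i)" if "i \<le> m" for i
    using that
  proof (induction i)
    case 0
    then show ?case using length_ge_mono[OF assms(1)] C(3) by simp
  next
    case (Suc i)
    then show ?case using length_ge_Suc[of A "C i" "n + i" "C (Suc i)"] C by simp
  qed
  then show ?thesis using length_ge_mono C(4) by blast
qed

lemma length_ge_le_comp_series:
  assumes "ideal K R" "comp_series K ss" "lin ss K = carrier R" "length_ge K (carrier R) n"
  shows "n \<le> length ss"
proof -
  obtain C where C: "\<And>i. i \<le> n \<Longrightarrow> ideal (C i) R" "\<And>i. i < n \<Longrightarrow> C i \<subset> C (Suc i)" "K \<subseteq> C 0" "C n \<subseteq> carrier R"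
    using assms(4) unfolding length_ge_def by blast
  have "K \<subseteq> C i \<and> i \<le> jumps K ss (C i)" if "i \<le> n" for i
    using that
  proof (induction i)
    case (Suc i)
    have "C (Suc i) \<subseteq> carrier R" using ideal.Icarr[OF C(1)[OF Suc.prems]] by (rule subsetI)
    then have "jumps K ss (C i) < jumps K ss (C (Suc i))"
      using Suc C by (intro jumps_strict[OF assms(1,2)]) (auto simp: assms(3))
    then show ?case using Suc C(2)[of i] by auto
  qed (use C(3) in simp)
  then show ?thesis using jumps_le[of K ss "C n"] by force
qed

lemma ring_length_quotient:
  assumes K: "ideal K R"
  shows "ring_length (R Quot K) = Sup {enat n | n. length_ge K (carrier R) n}"
proof -
  note bij = quot_ideal_correspondence[OF K]
  have "(\<exists>C :: nat \<Rightarrow> 'a set set. (\<forall>i\<le>n. ideal (C i) (R Quot K)) \<and> (\<forall>i<n. C i \<subset> C (Suc i)))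
    \<longleftrightarrow> length_ge K (carrier R) n" for n
  proof
    assume "\<exists>C :: nat \<Rightarrow> 'a set set. (\<forall>i\<le>n. ideal (C i) (R Quot K)) \<and> (\<forall>i<n. C i \<subset> C (Suc i))"
    then obtain C :: "nat \<Rightarrow> 'a set set" where C: "\<And>i. i \<le> n \<Longrightarrow> ideal (C i) (R Quot K)" "\<And>i. i < n \<Longrightarrow> C i \<subset> C (Suc i)"
      by blast
    have "\<exists>J. ideal J R \<and> K \<subseteq> J \<and> (i \<le> n \<longrightarrow> C i = (+>) K ` J)" for i
    proof (cases "i \<le> n")
      case True
      then have "C i \<in> (\<lambda>J. (+>) K ` J) ` {J. ideal J R \<and> K \<subseteq> J}"
        using bij C(1) unfolding bij_betw_def by blast
      then show ?thesis by blast
    qed (use K in auto)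
    then obtain J where J: "\<And>i. ideal (J i) R" "\<And>i. K \<subseteq> J i" "\<And>i. i \<le> n \<Longrightarrow> C i = (+>) K ` J i"
      by metis
    have "J i \<subset> J (Suc i)" if i: "i < n" for i
    proof -
      have e: "(+>) K ` J i \<subset> (+>) K ` J (Suc i)" using C(2)[OF i] J(3) i by simp
      have "x \<in> J (Suc i)" if x: "x \<in> J i" for x
      proof -
        obtain y where y: "y \<in> J (Suc i)" "K +> x = K +> y" using e x by blast
        have c: "x \<in> carrier R" "y \<in> carrier R" using ideal.Icarr[OF J(1) x] ideal.Icarr[OF J(1) y(1)] .
        then have xy: "x \<ominus> y \<in> J (Suc i)"
          using quotient_eq_iff_same_a_r_cos[OF K] y J(2) by blast
        have "x = (x \<ominus> y) \<oplus> y" using c by algebra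
        then show ?thesis using ideal_add_closed[OF J(1) xy y(1)] by simp
      qed
      then show ?thesis using e by blast
    qed
    then show "length_ge K (carrier R) n"
      unfolding length_ge_def using J(1,2) ideal.Icarr[OF J(1)[of n]] by (intro exI[of _ J]) auto
  next
    assume "length_ge K (carrier R) n"
    then obtain C where C: "\<And>i. i \<le> n \<Longrightarrow> ideal (C i) R" "\<And>i. i < n \<Longrightarrow> C i \<subset> C (Suc i)" "K \<subseteq> C 0"
      unfolding length_ge_def by blast
    have KC: "K \<subseteq> C i" if "i \<le> n" for i
      using that by (induction i) (use C in \<open>auto simp: Suc_le_eq dest: order.strict_implies_order\<close>)
    have "(+>) K ` C i \<subset> (+>) K ` C (Suc i)" if i: "i < n" for i
    proof -
      have "(+>) K ` C i \<noteq> (+>) K ` C (Suc i)"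
        using bij_betw_imp_inj_on[OF bij] C(1)[of i] C(1)[of "Suc i"] KC[of i] KC[of "Suc i"] C(2)[OF i] i
        unfolding inj_on_def by (metis (mono_tags, lifting) Suc_leI less_imp_le_nat mem_Collect_eq psubset_eq)
      then show ?thesis using C(2)[OF i] by blast
    qed
    moreover have "ideal ((+>) K ` C i) (R Quot K)" if "i \<le> n" for i
      using ring_ideal_imp_quot_ideal[OF K C(1)[OF that]] .
    ultimately show "\<exists>C :: nat \<Rightarrow> 'a set set. (\<forall>i\<le>n. ideal (C i) (R Quot K)) \<and> (\<forall>i<n. C i \<subset> C (Suc i))"
      by (intro exI[of _ "\<lambda>i. (+>) K ` C i"]) blast
  qed
  then show ?thesis unfolding ring_length_def by simp
qed

text \<open>\<open>the_enat\<close> is meaningful only for finite values; the composition series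
  first shows that the length is finite.\<close>

lemma length_ge_le_ring_length:
  assumes K: "ideal K R" and nil: "\<And>m. m \<in> M \<Longrightarrow> \<exists>N::nat. m [^] N \<in> K"
    and "length_ge K (carrier R) n"
  shows "n \<le> the_enat (ring_length (R Quot K))"
proof -
  obtain ss where ss: "comp_series K ss" "lin ss K = carrier R"
    using exists_comp_series[OF K nil] by blast
  have "ring_length (R Quot K) \<le> enat (length ss)"
    unfolding ring_length_quotient[OF K]
    using length_ge_le_comp_series[OF K ss] by (intro Sup_least) auto
  then obtain l where l: "ring_length (R Quot K) = enat l" using enat_ile by blast
  have "enat n \<le> ring_length (R Quot K)"
    unfolding ring_length_quotient[OF K] using assms(3) by (intro Sup_upper) auto
  then show ?thesis using l by simp
qed

subsection \<open>Generic membership\<close>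

text \<open>\<open>MT\<close> is prime: a coefficient outside \<open>M\<close> is a unit, so
  \<open>unit_coeff_regular\<close> applies with \<open>A = M\<close>.\<close>

lemma notin_coeff_ideal_M_mult:
  fixes V :: "'v :: linorder set"
  assumes "u \<in> carrier (PR V) - coeff_ideal V M" "v \<in> carrier (PR V) - coeff_ideal V M"
  shows "u \<otimes>\<^bsub>PR V\<^esub> v \<in> carrier (PR V) - coeff_ideal V M"
proof -
  interpret T: cring "PR V" by (rule PR_cring)
  obtain m where "u m \<notin> M" using assms(1) by (auto simp: coeff_ideal_def)
  then have "u m \<in> Units R" using unit_iff_notin_M[of "u m"] assms(1) PR_coeff[of u V m] by blast
  then show ?thesis using unit_coeff_regular[OF M_ideal, of u V m v] assms by auto
qed

text \<open>Generic Gaussian elimination along a composition series: a multiplier outside \<open>M T\<close> becomes a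
  unit at a general point.\<close>

lemma generic_membership:
  fixes V :: "'v :: linorder set"
  assumes K: "ideal K R" and "comp_series K ss" and "ideal B (PR V)"
    and "coeff_ideal V K \<subseteq> B" "B \<subseteq> coeff_ideal V (lin ss K)" "p \<in> coeff_ideal V (lin ss K)"
  shows "(\<exists>u\<in>carrier (PR V) - coeff_ideal V M. u \<otimes>\<^bsub>PR V\<^esub> p \<in> B) \<or>
    (\<exists>u\<in>carrier (PR V) - coeff_ideal V M. \<forall>x. (\<forall>i. x i \<in> carrier R) \<longrightarrow> peval x u \<notin> M \<longrightarrow>
      (\<forall>b\<in>B. peval x b \<noteq> peval x p))"
  using assms(2-)
proof (induction ss arbitrary: B p)
  case Nil
  interpret T: cring "PR V" by (rule PR_cring)
  have "p \<in> B" "p \<in> carrier (PR V)" using Nil by (auto simp: coeff_ideal_def)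
  moreover have "\<one>\<^bsub>PR V\<^esub> \<notin> coeff_ideal V M"
    using M_proper by (auto simp: coeff_ideal_def PR_one indexed_const_def)
  ultimately show ?case by (intro disjI1 bexI[of _ "\<one>\<^bsub>PR V\<^esub>"]) auto
next
  case (Cons s ss)
  interpret T: cring "PR V" by (rule PR_cring)
  let ?S = "lin ss K"
  let ?U = "carrier (PR V) - coeff_ideal V M"
  have ss: "set ss \<subseteq> carrier R" and s: "s \<in> carrier R" "s \<notin> ?S" "\<And>m. m \<in> M \<Longrightarrow> m \<otimes> s \<in> ?S"
    and cs: "comp_series K ss"
    using Cons.prems comp_series_carrier[of K ss] by auto
  have S: "ideal ?S R" using lin_ideal[OF K ss] .
  have cS: "ideal (coeff_ideal V ?S) (PR V)" using coeff_ideal_ideal[OF S] .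
  have KS: "K \<subseteq> ?S" using lin_superset(1)[OF K ss] .
  note B = Cons.prems(2)
  have sc: "indexed_const s \<in> carrier (PR V)" using s by simp
  have dec: "\<exists>Q\<in>coeff_ideal V ?S. \<exists>w\<in>carrier (PR V). y = Q \<oplus>\<^bsub>PR V\<^esub> indexed_const s \<otimes>\<^bsub>PR V\<^esub> w"
    if "y \<in> coeff_ideal V (lin (s # ss) K)" for y
  proof (rule coeff_ideal_decomp[OF _ S s(1) that])
    fix x assume "x \<in> lin (s # ss) K"
    then obtain q r where q: "x = q \<otimes> s \<oplus> r" "q \<in> carrier R" "r \<in> ?S" by auto
    then have "x = r \<oplus> s \<otimes> q" using s ideal.Icarr[OF S q(3)] by (simp add: m_comm a_comm)
    then show "\<exists>a\<in>?S. \<exists>t\<in>carrier R. x = a \<oplus> s \<otimes> t" using q by blast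
  qed
  have sM: "indexed_const s \<otimes>\<^bsub>PR V\<^esub> w \<in> coeff_ideal V ?S" if "w \<in> coeff_ideal V M" for w
  proof -
    have w: "w \<in> carrier (PR V)" "\<And>m. w m \<in> M" using that by (auto simp: coeff_ideal_def)
    have "s \<otimes> w m \<in> ?S" for m using s(3)[OF w(2)] s(1) w(1) m_comm[of s "w m"] by simp
    moreover have "indexed_const s \<otimes>\<^bsub>PR V\<^esub> w \<in> carrier (PR V)" using w sc by simp
    ultimately show ?thesis unfolding coeff_ideal_def PR_const_mult(1)[OF w(1) s(1)] by simp
  qed
  have evS: "peval x Q \<in> ?S" if "Q \<in> coeff_ideal V ?S" "\<And>i. x i \<in> carrier R" for x Q
    using peval_in_ideal[OF S that] .
  have ev_dec: "peval x (Q \<oplus>\<^bsub>PR V\<^esub> indexed_const s \<otimes>\<^bsub>PR V\<^esub> w) = peval x Q \<oplus> s \<otimes> peval x w"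
    if "Q \<in> coeff_ideal V ?S" "w \<in> carrier (PR V)" "\<And>i. x i \<in> carrier R" for x Q w
    using that sc s by (simp add: peval_add[of _ V] peval_mult[of _ V] coeff_ideal_def)
  have unit_cancel: "a \<in> M" if "a \<in> carrier R" "s \<otimes> a \<in> ?S" for a
  proof (rule ccontr)
    assume "a \<notin> M"
    then have a: "a \<in> Units R" using unit_iff_notin_M that by blast
    have "s = inv a \<otimes> (s \<otimes> a)" using a that(1) s(1) by (simp add: m_lcomm)
    then show False using ideal.I_l_closed[OF S that(2), of "inv a"] a s(2) by simp
  qed
  obtain p' w where p: "p' \<in> coeff_ideal V ?S" "w \<in> carrier (PR V)"
    "p = p' \<oplus>\<^bsub>PR V\<^esub> indexed_const s \<otimes>\<^bsub>PR V\<^esub> w" using dec[OF Cons.prems(5)] by blast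
  have p'c: "p' \<in> carrier (PR V)" using p by (simp add: coeff_ideal_def)
  show ?case
  proof (cases "B \<subseteq> coeff_ideal V ?S")
    \<comment> \<open>No pivot in the layer of \<open>s\<close>: either the component
      \<open>w\<close> of \<open>p\<close> is zero modulo \<open>M\<close> and \<open>p\<close>
      descends to the lower layers, or \<open>w\<close> is nonzero modulo \<open>M\<close> at a
      general point, where \<open>p\<close> then differs from every value of
      \<open>B\<close>.\<close>
    case True
    show ?thesis
    proof (cases "w \<in> coeff_ideal V M")
      case wM: True
      have "p \<in> coeff_ideal V ?S"
        unfolding p(3) using T.ideal_add_closed[OF cS p(1) sM[OF wM]] .
      then show ?thesis using Cons.IH[OF cs B Cons.prems(3) True] by blast
    next
      case False
      have "peval x b \<noteq> peval x p" if x: "\<And>i. x i \<in> carrier R" and w: "peval x w \<notin> M" and b: "b \<in> B" for x b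
      proof
        assume "peval x b = peval x p"
        then have "peval x p' \<oplus> s \<otimes> peval x w \<in> ?S"
          using evS[OF subsetD[OF True b], of x] ev_dec[OF p(1,2), of x] x p(3) by simp
        then have "peval x p' \<oplus> s \<otimes> peval x w \<ominus> peval x p' \<in> ?S"
          using evS[OF p(1), of x] x ideal_minus_closed[OF S] by blast
        moreover have "peval x p' \<oplus> s \<otimes> peval x w \<ominus> peval x p' = s \<otimes> peval x w"
        proof -
          have "peval x p' \<in> carrier R" "peval x w \<in> carrier R" using x p p'c by auto
          then show ?thesis using s(1) by algebra
        qed
        ultimately show False using unit_cancel[of "peval x w"] w x p(2) by simp
      qed
      then show ?thesis using False p(2) by (intro disjI2 bexI[of _ w]) auto
    qed
  next
    case False
    \<comment> \<open>A pivot: the component \<open>u\<close> of \<open>\<beta>\<close> in the layer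
      of \<open>s\<close> lies outside \<open>MT\<close>. Cross-multiplication by \<open>u\<close>
      and \<open>w\<close> takes \<open>p\<close> out of the layer, and the problem passes to
      \<open>B'\<close>, the part of \<open>B\<close> in the lower layers.\<close>
    then obtain \<beta> where \<beta>: "\<beta> \<in> B" "\<beta> \<notin> coeff_ideal V ?S" by blast
    obtain \<beta>' u where \<beta>': "\<beta>' \<in> coeff_ideal V ?S" "u \<in> carrier (PR V)"
      "\<beta> = \<beta>' \<oplus>\<^bsub>PR V\<^esub> indexed_const s \<otimes>\<^bsub>PR V\<^esub> u" using dec \<beta>(1) Cons.prems(4) by blast
    have uM: "u \<in> ?U"
      using \<beta>(2) \<beta>' sM[of u] T.ideal_add_closed[OF cS] by auto
    have \<beta>'c: "\<beta>' \<in> carrier (PR V)" using \<beta>' by (simp add: coeff_ideal_def)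
    have \<beta>c: "\<beta> \<in> carrier (PR V)" using \<beta>(1) ideal.Icarr[OF B] by simp
    define B' where "B' = B \<inter> coeff_ideal V ?S"
    have B': "ideal B' (PR V)" unfolding B'_def using T.i_intersect[OF B cS] .
    have elim: "u \<otimes>\<^bsub>PR V\<^esub> (Q \<oplus>\<^bsub>PR V\<^esub> indexed_const s \<otimes>\<^bsub>PR V\<^esub> h) \<ominus>\<^bsub>PR V\<^esub> h \<otimes>\<^bsub>PR V\<^esub> \<beta> \<in> coeff_ideal V ?S"
      if Q: "Q \<in> coeff_ideal V ?S" and h: "h \<in> carrier (PR V)" for Q h
    proof -
      have Qc: "Q \<in> carrier (PR V)" using Q by (simp add: coeff_ideal_def)
      have "u \<otimes>\<^bsub>PR V\<^esub> (Q \<oplus>\<^bsub>PR V\<^esub> indexed_const s \<otimes>\<^bsub>PR V\<^esub> h) \<ominus>\<^bsub>PR V\<^esub> h \<otimes>\<^bsub>PR V\<^esub> \<beta>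
        = u \<otimes>\<^bsub>PR V\<^esub> Q \<ominus>\<^bsub>PR V\<^esub> h \<otimes>\<^bsub>PR V\<^esub> \<beta>'"
        unfolding \<beta>'(3) using Qc h sc \<beta>'c \<beta>'(2) by algebra
      then show ?thesis
        using T.ideal_minus_closed[OF cS ideal.I_l_closed[OF cS Q \<beta>'(2)] ideal.I_l_closed[OF cS \<beta>'(1) h]] by simp
    qed
    define p1 where "p1 = u \<otimes>\<^bsub>PR V\<^esub> p \<ominus>\<^bsub>PR V\<^esub> w \<otimes>\<^bsub>PR V\<^esub> \<beta>"
    have pc: "p \<in> carrier (PR V)" using p p'c sc by simp
    have p1: "p1 \<in> coeff_ideal V ?S" unfolding p1_def p(3) by (rule elim[OF p(1,2)])
    have "coeff_ideal V K \<subseteq> B'" using Cons.prems(3) KS by (auto simp: B'_def coeff_ideal_def)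
    then consider (mem) v where "v \<in> ?U" "v \<otimes>\<^bsub>PR V\<^esub> p1 \<in> B'"
      | (gen) v where "v \<in> ?U" "\<And>x b. (\<And>i. x i \<in> carrier R) \<Longrightarrow> peval x v \<notin> M \<Longrightarrow> b \<in> B' \<Longrightarrow> peval x b \<noteq> peval x p1"
      using Cons.IH[OF cs B' _ _ p1] unfolding B'_def by blast
    then show ?thesis
    proof cases
      case mem
      have vc: "v \<in> carrier (PR V)" using mem by simp
      have "v \<otimes>\<^bsub>PR V\<^esub> u \<otimes>\<^bsub>PR V\<^esub> p = v \<otimes>\<^bsub>PR V\<^esub> p1 \<oplus>\<^bsub>PR V\<^esub> (v \<otimes>\<^bsub>PR V\<^esub> w) \<otimes>\<^bsub>PR V\<^esub> \<beta>"
        unfolding p1_def using vc \<beta>'(2) pc p(2) \<beta>c by algebra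
      also have "\<dots> \<in> B"
        using mem \<beta>(1) vc p(2) T.ideal_add_closed[OF B] ideal.I_l_closed[OF B] by (auto simp: B'_def)
      finally show ?thesis using notin_coeff_ideal_M_mult[OF mem(1) uM] by blast
    next
      case gen
      have vc: "v \<in> carrier (PR V)" using gen by simp
      have "peval x b \<noteq> peval x p"
        if x: "\<And>i. x i \<in> carrier R" and vu: "peval x (v \<otimes>\<^bsub>PR V\<^esub> u) \<notin> M" and b: "b \<in> B" for x b
      proof
        assume eq: "peval x b = peval x p"
        obtain b' h where b': "b' \<in> coeff_ideal V ?S" "h \<in> carrier (PR V)"
          "b = b' \<oplus>\<^bsub>PR V\<^esub> indexed_const s \<otimes>\<^bsub>PR V\<^esub> h" using dec b Cons.prems(4) by blast
        have bc: "b \<in> carrier (PR V)" using b ideal.Icarr[OF B] by simp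
        have b'c: "b' \<in> carrier (PR V)" using b' by (simp add: coeff_ideal_def)
        have ev: "peval x y \<in> carrier R" if "y \<in> carrier (PR V)" for y using that x by simp
        have vM: "peval x v \<notin> M"
          using vu peval_mult[OF vc \<beta>'(2) x] ideal.I_r_closed[OF M_ideal _ ev[OF \<beta>'(2)]] by auto
        \<comment> \<open>If \<open>b\<close> and \<open>p\<close> agree at \<open>x\<close>, their
          components differ there by \<open>\<mu>\<close>, and \<open>s \<mu>\<close> lies in
          \<open>lin ss K\<close>, so \<open>\<mu> \<in> M\<close>. Hence the correction
          \<open>\<mu> \<beta>\<close> in \<open>?y\<close> stays in \<open>B'\<close>, while it
          gives \<open>?y\<close> the same value at \<open>x\<close> as \<open>p1\<close>.\<close>
        define \<mu> where "\<mu> = peval x h \<ominus> peval x w"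
        have \<mu>c: "\<mu> \<in> carrier R" using ev b'(2) p(2) by (simp add: \<mu>_def)
        have "peval x b' \<oplus> s \<otimes> peval x h = peval x p' \<oplus> s \<otimes> peval x w"
          using eq ev_dec[OF b'(1,2), of x] ev_dec[OF p(1,2), of x] x b'(3) p(3) by simp
        then have "s \<otimes> \<mu> = peval x p' \<ominus> peval x b'"
        proof -
          assume e: "peval x b' \<oplus> s \<otimes> peval x h = peval x p' \<oplus> s \<otimes> peval x w"
          have c: "peval x b' \<in> carrier R" "peval x h \<in> carrier R" "peval x p' \<in> carrier R" "peval x w \<in> carrier R"
            using ev b'c b'(2) p'c p(2) by auto
          have "s \<otimes> \<mu> = (peval x b' \<oplus> s \<otimes> peval x h) \<ominus> peval x b' \<ominus> s \<otimes> peval x w"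
            unfolding \<mu>_def using c s(1) by algebra
          also have "\<dots> = peval x p' \<ominus> peval x b'" unfolding e using c s(1) by algebra
          finally show ?thesis .
        qed
        then have \<mu>M: "\<mu> \<in> M"
          using unit_cancel[OF \<mu>c] ideal_minus_closed[OF S evS[OF p(1), of x] evS[OF b'(1), of x]] x by simp
        let ?c = "indexed_const \<mu>"
        have \<mu>cc: "?c \<in> carrier (PR V)" using \<mu>c by simp
        let ?y = "u \<otimes>\<^bsub>PR V\<^esub> b \<ominus>\<^bsub>PR V\<^esub> h \<otimes>\<^bsub>PR V\<^esub> \<beta> \<oplus>\<^bsub>PR V\<^esub> ?c \<otimes>\<^bsub>PR V\<^esub> \<beta>"
        have "?c \<otimes>\<^bsub>PR V\<^esub> \<beta> \<in> coeff_ideal V ?S"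
        proof -
          have "?c \<in> coeff_ideal V M" by (rule const_mem_coeff_ideal[OF M_ideal \<mu>M])
          then have "?c \<otimes>\<^bsub>PR V\<^esub> u \<in> coeff_ideal V M"
            using ideal.I_r_closed[OF coeff_ideal_ideal[OF M_ideal]] \<beta>'(2) by blast
          then have "?c \<otimes>\<^bsub>PR V\<^esub> \<beta>' \<oplus>\<^bsub>PR V\<^esub> indexed_const s \<otimes>\<^bsub>PR V\<^esub> (?c \<otimes>\<^bsub>PR V\<^esub> u) \<in> coeff_ideal V ?S"
            using sM T.ideal_add_closed[OF cS] ideal.I_l_closed[OF cS \<beta>'(1) \<mu>cc] by blast
          moreover have "?c \<otimes>\<^bsub>PR V\<^esub> \<beta> = ?c \<otimes>\<^bsub>PR V\<^esub> \<beta>' \<oplus>\<^bsub>PR V\<^esub> indexed_const s \<otimes>\<^bsub>PR V\<^esub> (?c \<otimes>\<^bsub>PR V\<^esub> u)"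
            unfolding \<beta>'(3) using \<mu>cc \<beta>'c \<beta>'(2) sc by algebra
          ultimately show ?thesis by simp
        qed
        moreover have "u \<otimes>\<^bsub>PR V\<^esub> b \<ominus>\<^bsub>PR V\<^esub> h \<otimes>\<^bsub>PR V\<^esub> \<beta> \<in> coeff_ideal V ?S"
          unfolding b'(3) by (rule elim[OF b'(1,2)])
        ultimately have "?y \<in> coeff_ideal V ?S" using T.ideal_add_closed[OF cS] by blast
        moreover have "?y \<in> B"
          using ideal.I_l_closed[OF B b \<beta>'(2)] ideal.I_l_closed[OF B \<beta>(1) b'(2)] ideal.I_l_closed[OF B \<beta>(1) \<mu>cc]
          by (intro T.ideal_add_closed[OF B] T.ideal_minus_closed[OF B])
        ultimately have "?y \<in> B'" by (simp add: B'_def)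
        moreover have "peval x ?y = peval x p1"
        proof -
          interpret h: ring_hom_cring "PR V" R "peval x"
            by unfold_locales (rule peval_hom[OF x])
          have minus: "peval x (y \<ominus>\<^bsub>PR V\<^esub> z) = peval x y \<ominus> peval x z"
            if "y \<in> carrier (PR V)" "z \<in> carrier (PR V)" for y z using that by (simp add: a_minus_def)
          have c: "peval x b \<in> carrier R" "peval x u \<in> carrier R" "peval x h \<in> carrier R"
            "peval x \<beta> \<in> carrier R" "peval x w \<in> carrier R"
            using ev bc \<beta>'(2) b'(2) \<beta>c p(2) by auto
          have "peval x ?y = peval x u \<otimes> peval x b \<ominus> peval x h \<otimes> peval x \<beta> \<oplus> \<mu> \<otimes> peval x \<beta>"
            using bc \<beta>'(2) b'(2) \<beta>c \<mu>cc \<mu>c x by (simp add: minus)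
          also have "\<dots> = peval x u \<otimes> peval x b \<ominus> peval x w \<otimes> peval x \<beta>"
            unfolding \<mu>_def using c by algebra
          also have "\<dots> = peval x p1" unfolding p1_def eq using pc \<beta>'(2) p(2) \<beta>c by (simp add: minus)
          finally show ?thesis .
        qed
        ultimately show False using gen(2)[OF x vM] by blast
      qed
      then show ?thesis using notin_coeff_ideal_M_mult[OF gen(1) uM] by blast
    qed
  qed
qed

end

section \<open>Reductions\<close>

no_notation Sum_Type.Plus (infixr \<open><+>\<close> 65)

context cring
begin

definition ipow :: "'a set \<Rightarrow> nat \<Rightarrow> 'a set" where
  "ipow J k = ideal_pow R J k"

lemma ideals_comm_monoid: "comm_monoid (ideals_set R)"
  by (rule ideals_set_is_comm_monoid)

lemma ipow_ideal [simp]: "ideal J R \<Longrightarrow> ideal (ipow J k) R"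
  using monoid.nat_pow_closed[OF comm_monoid.axioms(1)[OF ideals_comm_monoid], of J k]
  by (simp add: ideals_set_def ipow_def)

lemma ipow_0 [simp]: "ipow J 0 = carrier R"
  by (simp add: ideals_set_def ipow_def)

lemma ipow_Suc: "ipow J (Suc k) = ipow J k \<cdot> J"
  by (simp add: ideals_set_def ipow_def)

lemma reduction_iff:
  "reduction R I J \<longleftrightarrow> ideal J R \<and> J \<subseteq> I \<and> (\<exists>r. ipow I (Suc r) = J \<cdot> ipow I r)"
  by (simp only: reduction_def ipow_def Suc_eq_plus1)

lemma ipow_Suc': "ideal J R \<Longrightarrow> ipow J (Suc k) = J \<cdot> ipow J k"
  using ipow_Suc ideal_prod_commute ipow_ideal by metis

lemma ipow_add: "ideal J R \<Longrightarrow> ipow J (k + l) = ipow J k \<cdot> ipow J l"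
  using monoid.nat_pow_mult[OF comm_monoid.axioms(1)[OF ideals_comm_monoid], of J k l]
  by (simp add: ideals_set_def ipow_def)

lemma ipow_1 [simp]: "ideal J R \<Longrightarrow> ipow J (Suc 0) = J"
  using ipow_Suc'[of J 0] ideal_prod_one[of J] by simp

lemma ideal_prod_subset:
  assumes K: "ideal K R" and "\<And>i j. i \<in> A \<Longrightarrow> j \<in> B \<Longrightarrow> i \<otimes> j \<in> K"
  shows "A \<cdot> B \<subseteq> K"
proof
  fix x assume "x \<in> A \<cdot> B"
  then show "x \<in> K"
    by (induction rule: ideal_prod.induct) (use assms(2) ideal_add_closed[OF K] in auto)
qed

lemma colon_ideal:
  assumes "ideal K R" "j \<in> carrier R"
  shows "ideal {x \<in> carrier R. x \<otimes> j \<in> K} R"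
proof -
  have "{x \<in> carrier R. x \<otimes> j \<in> K} = {x \<in> carrier R. j \<otimes> x \<in> K}" using m_comm assms(2) by auto
  then show ?thesis using ideal.helper_max_prime[OF assms(1) is_cring assms(2)] by simp
qed

lemma Idl_prod_subset:
  assumes K: "ideal K R" and S: "S \<subseteq> carrier R" and B: "B \<subseteq> carrier R"
    and "\<And>i j. i \<in> S \<Longrightarrow> j \<in> B \<Longrightarrow> i \<otimes> j \<in> K"
  shows "(Idl S) \<cdot> B \<subseteq> K"
proof (rule ideal_prod_subset[OF K])
  fix i j assume i: "i \<in> Idl S" and j: "j \<in> B"
  have "S \<subseteq> {x \<in> carrier R. x \<otimes> j \<in> K}" using assms(4)[OF _ j] S by auto
  then have "Idl S \<subseteq> {x \<in> carrier R. x \<otimes> j \<in> K}"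
    using genideal_minimal[OF colon_ideal[OF K]] j B by blast
  then show "i \<otimes> j \<in> K" using i by blast
qed

lemma ideal_prod_mono: "A \<subseteq> A' \<Longrightarrow> B \<subseteq> B' \<Longrightarrow> A \<cdot> B \<subseteq> A' \<cdot> B'"
proof
  fix x assume "A \<subseteq> A'" "B \<subseteq> B'" "x \<in> A \<cdot> B"
  from this(3) show "x \<in> A' \<cdot> B'"
    by (induction rule: ideal_prod.induct)
       (use \<open>A \<subseteq> A'\<close> \<open>B \<subseteq> B'\<close> in \<open>auto intro: ideal_prod.intros\<close>)
qed

lemma ideal_prod_le: "ideal A R \<Longrightarrow> ideal B R \<Longrightarrow> A \<cdot> B \<subseteq> A" "ideal A R \<Longrightarrow> ideal B R \<Longrightarrow> A \<cdot> B \<subseteq> B"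
  using ideal_prod_inter by blast+

lemma ipow_mono: "ideal J R \<Longrightarrow> k \<le> l \<Longrightarrow> ipow J l \<subseteq> ipow J k"
  using ipow_add[of J k "l - k"] ideal_prod_le(1)[of "ipow J k" "ipow J (l - k)"] by simp

lemma ideal_carrier: "ideal J R \<Longrightarrow> J \<subseteq> carrier R"
  by (simp add: additive_subgroup.a_subset ideal.axioms(1))

lemma pow_mem_ipow: "ideal J R \<Longrightarrow> x \<in> J \<Longrightarrow> x [^] k \<in> ipow J k"
  by (induction k) (auto simp: ipow_Suc intro: ideal_prod.prod dest: ideal.Icarr)

lemma mon_mem_ipow:
  assumes J: "ideal J R" and "\<And>i. i \<in># m \<Longrightarrow> a i \<in> J"
  shows "mon a m \<in> ipow J (size m)"
  using assms(2)
proof (induction m)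
  case (add i m)
  have "mon a (add_mset i m) = mon a m \<otimes> a i"
    using add.prems ideal.Icarr[OF J] by (intro mon_add_mset) auto
  then show ?case using add by (simp add: ipow_Suc ideal_prod.prod)
qed simp

text \<open>A power of an ideal is generated by monomials in the generators: one factor is peeled
  off at a time, and its generator is stored in the multiset \<open>m\<close>.\<close>

lemma Idl_ipow_subset:
  assumes K: "ideal K R" and a: "\<And>i. a i \<in> carrier R"
    and "\<And>m. set_mset m \<subseteq> A \<Longrightarrow> size m = k \<Longrightarrow> mon a m \<in> K"
  shows "ipow (Idl (a ` A)) k \<subseteq> K"
proof -
  have S: "a ` A \<subseteq> carrier R" using a by auto
  have J: "ideal (Idl (a ` A)) R" by (rule genideal_ideal[OF S])
  have "ipow (Idl (a ` A)) l \<subseteq> {x \<in> carrier R. x \<otimes> mon a m \<in> K}"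
    if "set_mset m \<subseteq> A" "size m + l = k" for l m
    using that
  proof (induction l arbitrary: m)
    case 0
    then show ?case using assms(3)[of m] a ideal.I_l_closed[OF K] by auto
  next
    case (Suc l)
    have mc: "mon a m \<in> carrier R" using a by simp
    show ?case unfolding ipow_Suc'[OF J]
    proof (rule Idl_prod_subset[OF colon_ideal[OF K mc] S])
      show "ipow (Idl (a ` A)) l \<subseteq> carrier R" using ideal_carrier[OF ipow_ideal[OF J]] .
      fix i j assume "i \<in> a ` A" and j: "j \<in> ipow (Idl (a ` A)) l"
      then obtain t where t: "t \<in> A" "i = a t" by blast
      have jc: "j \<in> carrier R" using j ideal_carrier[OF ipow_ideal[OF J]] by blast
      have "j \<otimes> mon a (add_mset t m) \<in> K"
        using Suc.IH[of "add_mset t m"] Suc.prems t j by auto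
      moreover have "mon a (add_mset t m) = mon a m \<otimes> a t" using a by (intro mon_add_mset) auto
      ultimately have "i \<otimes> j \<otimes> mon a m \<in> K" using jc mc a t by (simp add: m_ac)
      then show "i \<otimes> j \<in> {x \<in> carrier R. x \<otimes> mon a m \<in> K}" using jc a t by simp
    qed
  qed
  from this[of "{#}" k] show ?thesis by auto
qed

lemma reduction_ipow:
  assumes I: "ideal I R" and J: "ideal J R" and "ipow I (Suc r) = J \<cdot> ipow I r"
  shows "ipow I (Suc r + k) = J \<cdot> ipow I (r + k)" "ipow I (r + k) = ipow J k \<cdot> ipow I r"
proof -
  show 1: "ipow I (Suc r + k) = J \<cdot> ipow I (r + k)" for k
    using ipow_add[OF I, of "Suc r" k] ipow_add[OF I, of r k] assms ideal_prod_assoc by simp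
  show "ipow I (r + k) = ipow J k \<cdot> ipow I r"
  proof (induction k)
    case 0
    then show ?case using ideal_prod_commute[OF oneideal ipow_ideal[OF I]] ideal_prod_one[OF ipow_ideal[OF I]]
      by simp
  next
    case (Suc k)
    have "ipow I (r + Suc k) = J \<cdot> (ipow J k \<cdot> ipow I r)" using 1[of k] Suc by simp
    also have "\<dots> = (J \<cdot> ipow J k) \<cdot> ipow I r" using ideal_prod_assoc[OF J ipow_ideal[OF J] ipow_ideal[OF I]] by simp
    finally show ?case using ipow_Suc'[OF J] by simp
  qed
qed

lemma mon_scale:
  assumes "\<And>i. z i \<in> carrier R" "c \<in> carrier R"
  shows "mon (\<lambda>i. z i \<otimes> c) m = mon z m \<otimes> c [^] size m"
proof (induction m)
  case (add i m)
  have "mon (\<lambda>i. z i \<otimes> c) (add_mset i m) = mon (\<lambda>i. z i \<otimes> c) m \<otimes> (z i \<otimes> c)"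
    "mon z (add_mset i m) = mon z m \<otimes> z i"
    using assms by (auto intro!: mon_add_mset)
  then show ?case using add assms by (simp add: m_ac)
qed simp

text \<open>The factors \<open>a i\<close> are replaced by \<open>w i a0\<close> one after another;
  each replacement changes the product by an element of \<open>J'\<close> times the \<open>k\<close>
  remaining factors, which all lie in \<open>I\<close>.\<close>

lemma mon_congruence:
  assumes I: "ideal I R" and J': "ideal J' R" "J' \<subseteq> I" and a: "\<And>i. a i \<in> I" and w: "\<And>i. w i \<in> carrier R"
    and a0: "a0 \<in> I" and "\<And>i. i \<in> A \<Longrightarrow> a i \<ominus> w i \<otimes> a0 \<in> J'"
    and "set_mset m \<subseteq> A" "size m = Suc k"
  shows "mon a m \<ominus> mon w m \<otimes> a0 [^] size m \<in> J' \<cdot> ipow I k"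
  using assms(8,9)
proof (induction m arbitrary: k)
  case (add i m)
  have ac: "\<And>i. a i \<in> carrier R" "a0 \<in> carrier R" using a a0 ideal.Icarr[OF I] by auto
  have k: "k = size m" using add.prems by simp
  have e: "mon a (add_mset i m) = mon a m \<otimes> a i" "mon w (add_mset i m) = mon w m \<otimes> w i"
    using ac w by (auto intro!: mon_add_mset)
  have id: "x \<otimes> y \<ominus> (u \<otimes> v) \<otimes> (p \<otimes> q) = x \<otimes> (y \<ominus> v \<otimes> q) \<oplus> (v \<otimes> q) \<otimes> (x \<ominus> u \<otimes> p)"
    if "x \<in> carrier R" "y \<in> carrier R" "u \<in> carrier R" "v \<in> carrier R" "p \<in> carrier R" "q \<in> carrier R"
    for x y u v p q using that by algebra
  have "mon a (add_mset i m) \<ominus> mon w (add_mset i m) \<otimes> a0 [^] size (add_mset i m)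
    = mon a m \<otimes> (a i \<ominus> w i \<otimes> a0) \<oplus> (w i \<otimes> a0) \<otimes> (mon a m \<ominus> mon w m \<otimes> a0 [^] size m)"
    unfolding e using id[of "mon a m" "a i" "mon w m" "w i" "a0 [^] size m" a0] ac w by simp
  moreover have P: "ideal (J' \<cdot> ipow I k) R" using ideal_prod_is_ideal J' I by simp
  moreover have "mon a m \<otimes> (a i \<ominus> w i \<otimes> a0) \<in> J' \<cdot> ipow I k"
  proof -
    have "(a i \<ominus> w i \<otimes> a0) \<otimes> mon a m \<in> J' \<cdot> ipow I k"
      unfolding k using add.prems(1) assms(7) a by (intro ideal_prod.prod mon_mem_ipow[OF I]) auto
    then show ?thesis using ac w by (simp add: m_comm)
  qed
  moreover have "(w i \<otimes> a0) \<otimes> (mon a m \<ominus> mon w m \<otimes> a0 [^] size m) \<in> J' \<cdot> ipow I k"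
  proof (cases "size m")
    case 0
    then show ?thesis using w ac ideal_zero_closed[OF P] by (simp add: a_minus_def r_neg)
  next
    case (Suc k')
    have "mon a m \<ominus> mon w m \<otimes> a0 [^] size m \<in> J' \<cdot> ipow I k'" using add Suc by auto
    moreover have "w i \<otimes> a0 \<in> I" using ideal.I_l_closed[OF I a0 w] .
    ultimately have "(mon a m \<ominus> mon w m \<otimes> a0 [^] size m) \<otimes> (w i \<otimes> a0) \<in> (J' \<cdot> ipow I k') \<cdot> I"
      by (rule ideal_prod.prod)
    moreover have "(J' \<cdot> ipow I k') \<cdot> I = J' \<cdot> ipow I k"
      unfolding k Suc ipow_Suc using ideal_prod_assoc[OF J'(1) ipow_ideal[OF I] I] .
    ultimately show ?thesis using w ac by (simp add: m_comm)
  qed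
  ultimately show ?case using ideal_add_closed[OF P] by simp
qed simp

end

section \<open>Nakayama's lemma in the local ring, and dropping a generator of a reduction\<close>

context local_noetherian_ring
begin

lemma nakayama_local:
  assumes J: "ideal J R" and W: "ideal W R" and "J \<subseteq> W <+> M \<cdot> J"
  shows "J \<subseteq> W"
proof -
  obtain Z where Z: "finite Z" "Z \<subseteq> carrier R" "J = Idl Z" using ideal_finite_generators[OF J] .
  have "Z \<subseteq> J" using Z genideal_self by blast
  then obtain s where s: "s \<in> carrier R" "s \<ominus> \<one> \<in> M" "\<And>z. z \<in> Z \<Longrightarrow> s \<otimes> z \<in> W"
    using nakayama[OF M_ideal W Z(1,2)] assms(3) Z(3) by blast
  have "s \<notin> M"
  proof
    assume "s \<in> M"
    then have "s \<ominus> (s \<ominus> \<one>) \<in> M" using s ideal_minus_closed[OF M_ideal] by blast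
    moreover have "s \<ominus> (s \<ominus> \<one>) = \<one>" using s(1) by algebra
    ultimately show False using M_proper by simp
  qed
  then have u: "s \<in> Units R" using unit_iff_notin_M s by blast
  have "z \<in> W" if "z \<in> Z" for z
  proof -
    have "z \<in> carrier R" using that Z by blast
    then have "inv s \<otimes> (s \<otimes> z) = z" using u m_assoc[of "inv s" s z] s(1) by simp
    then show ?thesis using ideal.I_l_closed[OF W s(3)[OF that], of "inv s"] u by (metis Units_inv_closed)
  qed
  then show ?thesis using Z(3) genideal_minimal[OF W] by blast
qed

text \<open>A linear change of generators makes the form monic in the dropped generator.\<close>

lemma reduction_drop_generator:
  assumes inf: "infinite (carrier (R Quot M))"
    and I: "ideal I R" "I \<subseteq> M" and A: "finite A" and a: "\<And>i. a i \<in> I"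
    and red: "reduction R I (Idl (a ` A))"
    and P: "P \<in> carrier (PR A)" "\<And>m. P m \<noteq> \<zero> \<Longrightarrow> size m = D" "P m0 \<notin> M"
      "peval a P \<in> M \<cdot> ipow I D"
  obtains i0 a' where "i0 \<in> A" "\<And>i. a' i \<in> I" "reduction R I (Idl (a' ` (A - {i0})))"
    "Idl (a' ` (A - {i0})) \<subseteq> Idl (a ` A)"
proof -
  have ac: "a i \<in> carrier R" for i using a ideal.Icarr[OF I(1)] by auto
  \<comment> \<open>The hypotheses make \<open>P\<close> a nonzero form that is a relation in the
    fibre ring, the sum of the \<open>I^k / M I^k\<close>. As in Noether normalisation, a point
    where \<open>P\<close> does not vanish modulo \<open>M\<close> provides the linear
    change.\<close>
  obtain z where z: "\<And>i. z i \<in> carrier R" "peval z P \<notin> M"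
    using exists_nonvanishing_point[OF M_prime inf A P(1,3)] by blast
  have P': "P \<in> pset A" using P by (simp add: PR_simps)
  have IpD: "ideal (ipow I k) R" for k using I(1) by simp
  obtain D' where D': "D = Suc D'"
  proof (cases D)
    case 0
    have "P m = \<zero>" if "m \<noteq> {#}" for m using P(2)[of m] that 0 by auto
    then have eq: "P = indexed_const (P {#})" by (auto simp: indexed_const_def)
    have p0: "P {#} \<in> carrier R" using P(1) by simp
    have "P {#} \<in> M"
      using P(4) peval_const[OF p0, of a] ac eq ideal_prod_le(1)[OF M_ideal IpD] by auto
    then have "peval z P \<in> M" using peval_const[OF p0, of z] z(1) eq by simp
    then show ?thesis using z(2) by simp
  qed (use that in blast)
  have "\<exists>i0\<in>A. z i0 \<notin> M"
  proof (rule ccontr)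
    assume "\<not> (\<exists>i0\<in>A. z i0 \<notin> M)"
    then have zM: "z i \<in> M" if "i \<in> A" for i using that by blast
    have "peval z P \<in> M" unfolding peval_def
    proof (rule finsum_in_ideal[OF M_ideal])
      fix m assume "m \<in> {m. P m \<noteq> \<zero>}"
      then have m: "P m \<noteq> \<zero>" by simp
      then have "m \<noteq> {#}" using P(2)[of m] D' by auto
      then obtain i m' where m': "m = add_mset i m'" by (metis multiset_cases)
      then have "z i \<in> M" using zM pset_support(2)[OF P' m] by auto
      moreover have "mon z m = mon z m' \<otimes> z i" unfolding m' using z by (intro mon_add_mset) auto
      ultimately have "mon z m \<in> M" using z ideal.I_l_closed[OF M_ideal] by simp
      then show "P m \<otimes> mon z m \<in> M" using P(1) ideal.I_l_closed[OF M_ideal] by simp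
    qed
    then show False using z(2) by simp
  qed
  then obtain i0 where i0: "i0 \<in> A" "z i0 \<notin> M" by blast
  have zU: "z i0 \<in> Units R" using unit_iff_notin_M i0 z by blast
  define \<zeta> where "\<zeta> = inv (z i0)"
  have \<zeta>: "\<zeta> \<in> carrier R" "\<zeta> \<in> Units R" "z i0 \<otimes> \<zeta> = \<one>" using zU by (auto simp: \<zeta>_def)
  \<comment> \<open>\<open>z\<close> is scaled so that its coordinate at \<open>i0\<close> becomes
    1; by homogeneity \<open>P\<close> still takes a unit value at \<open>w\<close>. Then
    \<open>a' i0\<close> is zero, and \<open>J\<close> lies in \<open>J'\<close> plus the multiples
    of \<open>a0\<close>.\<close>
  define w where "w i = z i \<otimes> \<zeta>" for i
  have w: "w i \<in> carrier R" for i using z \<zeta> by (simp add: w_def)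
  define a0 where "a0 = a i0"
  have a0: "a0 \<in> I" "a0 \<in> carrier R" using a ac by (auto simp: a0_def)
  define a' where "a' i = a i \<ominus> w i \<otimes> a0" for i
  have a'I: "a' i \<in> I" for i
    unfolding a'_def using a a0 w ideal_minus_closed[OF I(1)] ideal.I_l_closed[OF I(1)] by simp
  have a'c: "a' i \<in> carrier R" for i using a'I ideal.Icarr[OF I(1)] by auto
  define J where "J = Idl (a ` A)"
  define J' where "J' = Idl (a' ` (A - {i0}))"
  have aA: "a ` A \<subseteq> carrier R" and aA': "a' ` (A - {i0}) \<subseteq> carrier R" using ac a'c by auto
  have J: "ideal J R" and J': "ideal J' R" unfolding J_def J'_def using genideal_ideal[OF aA] genideal_ideal[OF aA'] .
  have aJ: "a i \<in> J" if "i \<in> A" for i using genideal_self[OF aA] that by (auto simp: J_def)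
  have a'J': "a' i \<in> J'" if "i \<in> A - {i0}" for i using genideal_self[OF aA'] that by (auto simp: J'_def)
  have JI: "J \<subseteq> I" unfolding J_def by (rule genideal_minimal[OF I(1)]) (use a in auto)
  have J'J: "J' \<subseteq> J" unfolding J'_def
  proof (rule genideal_minimal[OF J])
    show "a' ` (A - {i0}) \<subseteq> J"
      unfolding a'_def a0_def using aJ i0 w ideal_minus_closed[OF J] ideal.I_l_closed[OF J] by auto
  qed
  have J'I: "J' \<subseteq> I" using J'J JI by blast
  have aw: "a i \<ominus> w i \<otimes> a0 \<in> J'" if "i \<in> A" for i
  proof (cases "i = i0")
    case True
    then have "a i \<ominus> w i \<otimes> a0 = \<zero>" using \<zeta>(3) ac by (simp add: w_def a0_def a_minus_def r_neg)
    then show ?thesis using ideal_zero_closed[OF J'] by simp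
  next
    case False
    then show ?thesis using a'J' that by (auto simp: a'_def)
  qed
  define Y0 where "Y0 = set_add R (J' \<cdot> ipow I D') (M \<cdot> ipow I D)"
  have JI': "ideal (J' \<cdot> ipow I k) R" and MI: "ideal (M \<cdot> ipow I k) R" for k
    using ideal_prod_is_ideal J' M_ideal IpD by auto
  have Y0: "ideal Y0 R" unfolding Y0_def by (rule add_ideals[OF JI' MI])
  have Y01: "J' \<cdot> ipow I D' \<subseteq> Y0" and Y02: "M \<cdot> ipow I D \<subseteq> Y0"
  proof -
    have "x \<oplus> \<zero> \<in> Y0" if "x \<in> J' \<cdot> ipow I D'" for x
      unfolding Y0_def set_add_def' using that ideal_zero_closed[OF MI] by blast
    then show "J' \<cdot> ipow I D' \<subseteq> Y0" using ideal.Icarr[OF JI'] by fastforce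
    have "\<zero> \<oplus> x \<in> Y0" if "x \<in> M \<cdot> ipow I D" for x
      unfolding Y0_def set_add_def' using that ideal_zero_closed[OF JI'] by blast
    then show "M \<cdot> ipow I D \<subseteq> Y0" using ideal.Icarr[OF MI] by fastforce
  qed
  let ?S = "{m. P m \<noteq> \<zero>}"
  have pw: "peval w P = peval z P \<otimes> \<zeta> [^] D"
  proof -
    have "peval w P = (\<Oplus>m\<in>?S. (P m \<otimes> mon z m) \<otimes> \<zeta> [^] D)"
      unfolding peval_def
    proof (rule finsum_cong')
      fix m assume "m \<in> ?S"
      then show "P m \<otimes> mon w m = (P m \<otimes> mon z m) \<otimes> \<zeta> [^] D"
        using P(1,2) z(1) \<zeta>(1) mon_scale[of z \<zeta> m] by (simp add: w_def[abs_def] m_assoc)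
    qed (use P(1) z \<zeta> in auto)
    then show ?thesis unfolding peval_def
      using finsum_ldistr[OF pset_support(1)[OF P'], of "\<zeta> [^] D" "\<lambda>m. P m \<otimes> mon z m"] P(1) z \<zeta> by simp
  qed
  \<comment> \<open>Modulo \<open>J'\<close> every \<open>a i\<close> with \<open>i \<in> A\<close>
    is \<open>w i a0\<close>, so the value of \<open>P\<close> at \<open>a\<close> becomes its value
    at \<open>w\<close> times the \<open>D\<close>-th power of \<open>a0\<close>. The former lies in
    \<open>M I^D\<close>, and so the power of \<open>a0\<close> lies in \<open>Y0\<close>.\<close>
  have "peval a P \<ominus> peval w P \<otimes> a0 [^] D \<in> Y0"
  proof -
    have c: "P m \<otimes> mon a m \<in> carrier R" "P m \<otimes> mon w m \<in> carrier R" "a0 [^] D \<in> carrier R" for m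
      using P(1) ac w a0 by auto
    have "peval w P \<otimes> a0 [^] D = (\<Oplus>m\<in>?S. P m \<otimes> mon w m \<otimes> a0 [^] D)"
      unfolding peval_def using finsum_ldistr[OF pset_support(1)[OF P'] c(3), of "\<lambda>m. P m \<otimes> mon w m"] c by simp
    moreover have "(\<Oplus>m\<in>?S. P m \<otimes> mon a m) =
      (\<Oplus>m\<in>?S. (P m \<otimes> mon a m \<ominus> P m \<otimes> mon w m \<otimes> a0 [^] D) \<oplus> P m \<otimes> mon w m \<otimes> a0 [^] D)"
    proof (rule finsum_cong')
      fix m
      have "x = (x \<ominus> y) \<oplus> y" if "x \<in> carrier R" "y \<in> carrier R" for x y using that by algebra
      then show "P m \<otimes> mon a m = (P m \<otimes> mon a m \<ominus> P m \<otimes> mon w m \<otimes> a0 [^] D) \<oplus> P m \<otimes> mon w m \<otimes> a0 [^] D"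
        using c by simp
    qed (use c in auto)
    moreover have "\<dots> = (\<Oplus>m\<in>?S. P m \<otimes> mon a m \<ominus> P m \<otimes> mon w m \<otimes> a0 [^] D)
        \<oplus> (\<Oplus>m\<in>?S. P m \<otimes> mon w m \<otimes> a0 [^] D)"
      using c by (intro finsum_addf) auto
    ultimately have "peval a P = (\<Oplus>m\<in>?S. P m \<otimes> mon a m \<ominus> P m \<otimes> mon w m \<otimes> a0 [^] D)
        \<oplus> peval w P \<otimes> a0 [^] D"
      unfolding peval_def by simp
    moreover have d: "(\<Oplus>m\<in>?S. P m \<otimes> mon a m \<ominus> P m \<otimes> mon w m \<otimes> a0 [^] D) \<in> Y0"
    proof (rule finsum_in_ideal[OF Y0])
      fix m assume "m \<in> ?S"
      then have m: "P m \<noteq> \<zero>" by simp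
      have "mon a m \<ominus> mon w m \<otimes> a0 [^] size m \<in> J' \<cdot> ipow I D'"
        by (rule mon_congruence[OF I(1) J' J'I a w a0(1) aw]) (use pset_support(2)[OF P' m] P(2)[OF m] D' in auto)
      then have "P m \<otimes> (mon a m \<ominus> mon w m \<otimes> a0 [^] D) \<in> Y0"
        using Y01 P(1) P(2)[OF m] ideal.I_l_closed[OF Y0] by auto
      moreover have "p \<otimes> (x \<ominus> y \<otimes> v) = p \<otimes> x \<ominus> p \<otimes> y \<otimes> v"
        if "p \<in> carrier R" "x \<in> carrier R" "y \<in> carrier R" "v \<in> carrier R" for p x y v using that by algebra
      ultimately show "P m \<otimes> mon a m \<ominus> P m \<otimes> mon w m \<otimes> a0 [^] D \<in> Y0"
        using P(1) ac w c(3) by simp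
    qed
    moreover have "peval w P \<otimes> a0 [^] D \<in> carrier R" using P(1) w c(3) peval_closed by simp
    moreover have "(x \<oplus> y) \<ominus> y = x" if "x \<in> carrier R" "y \<in> carrier R" for x y using that by algebra
    ultimately show ?thesis using ideal.Icarr[OF Y0 d] by simp
  qed
  moreover have "peval a P \<in> Y0" using P(4) Y02 by blast
  ultimately have "peval a P \<ominus> (peval a P \<ominus> peval w P \<otimes> a0 [^] D) \<in> Y0"
    using ideal_minus_closed[OF Y0] by blast
  moreover have pc: "peval w P \<in> carrier R" "peval a P \<in> carrier R" using P(1) w ac by simp_all
  moreover have "x \<ominus> (x \<ominus> y) = y" if "x \<in> carrier R" "y \<in> carrier R" for x y using that by algebra
  ultimately have pY: "peval w P \<otimes> a0 [^] D \<in> Y0" using a0 by simp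
  have "peval w P \<in> Units R"
  proof -
    have "peval z P \<in> Units R" using unit_iff_notin_M z P(1) by simp
    then show ?thesis unfolding pw using \<zeta>(2) by (intro Units_m_closed Units_pow_closed)
  qed
  then have "a0 [^] D = inv (peval w P) \<otimes> (peval w P \<otimes> a0 [^] D)"
    using a0 m_assoc[of "inv (peval w P)" "peval w P" "a0 [^] D"] pc(1) by simp
  then have a0Y0: "a0 [^] D \<in> Y0"
    using ideal.I_l_closed[OF Y0 pY, of "inv (peval w P)"] \<open>peval w P \<in> Units R\<close> by simp
  obtain r where r: "ipow I (Suc r) = J \<cdot> ipow I r" using red unfolding reduction_iff J_def by auto
  have JJ': "\<exists>x\<in>J'. \<exists>q\<in>carrier R. j = x \<oplus> q \<otimes> a0" if "j \<in> J" for j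
  proof -
    have I2: "ideal (J' <+> PIdl a0) R" using add_ideals[OF J' cgenideal_ideal[OF a0(2)]] .
    have "a i \<in> J' <+> PIdl a0" if "i \<in> A" for i
    proof -
      have "a i = (a i \<ominus> w i \<otimes> a0) \<oplus> w i \<otimes> a0"
      proof -
        have "x = (x \<ominus> y) \<oplus> y" if "x \<in> carrier R" "y \<in> carrier R" for x y using that by algebra
        then show ?thesis using ac w a0 by simp
      qed
      moreover have "w i \<otimes> a0 \<in> PIdl a0" using w by (auto simp: cgenideal_def)
      ultimately show ?thesis using aw[OF that] unfolding set_add_def' by blast
    qed
    then have "J \<subseteq> J' <+> PIdl a0" unfolding J_def by (intro genideal_minimal[OF I2]) auto
    then show ?thesis using that unfolding set_add_def' cgenideal_def by blast
  qed
  \<comment> \<open>Iterating \<open>I^(r+1) = J I^r\<close>, with \<open>J\<close> inside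
    \<open>J'\<close> plus the multiples of \<open>a0\<close>, leaves only a pure power of
    \<open>a0\<close> outside \<open>J'\<close>. For the exponent \<open>D\<close> that power lies
    in \<open>Y0\<close>, and Nakayama's lemma removes the term with \<open>M\<close>.\<close>
  have key: "ipow I (r + Suc k) \<subseteq> J' \<cdot> ipow I (r + k) <+> (PIdl (a0 [^] Suc k)) \<cdot> ipow I r" for k
  proof (induction k)
    case 0
    let ?Y = "J' \<cdot> ipow I r <+> (PIdl (a0 [^] Suc 0)) \<cdot> ipow I r"
    have Y1: "ideal ((PIdl (a0 [^] Suc 0)) \<cdot> ipow I r) R"
      using ideal_prod_is_ideal cgenideal_ideal a0 IpD by simp
    have Y: "ideal ?Y R" by (rule add_ideals[OF JI' Y1])
    have "J \<cdot> ipow I r \<subseteq> ?Y"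
    proof (rule ideal_prod_subset[OF Y])
      fix i j assume i: "i \<in> J" and j: "j \<in> ipow I r"
      have jc: "j \<in> carrier R" using ideal.Icarr[OF IpD j] .
      obtain x q where x: "x \<in> J'" "q \<in> carrier R" "i = x \<oplus> q \<otimes> a0" using JJ'[OF i] by blast
      have xc: "x \<in> carrier R" using ideal.Icarr[OF J' x(1)] .
      have "i \<otimes> j = x \<otimes> j \<oplus> (q \<otimes> a0) \<otimes> j" unfolding x(3) using x(2) xc jc a0(2) by algebra
      moreover have "x \<otimes> j \<in> J' \<cdot> ipow I r" using x j by (intro ideal_prod.prod)
      moreover have "(q \<otimes> a0) \<otimes> j \<in> (PIdl (a0 [^] Suc 0)) \<cdot> ipow I r"
        using x(2) j a0(2) by (intro ideal_prod.prod) (auto simp: cgenideal_def)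
      ultimately show "i \<otimes> j \<in> ?Y" unfolding set_add_def' by blast
    qed
    then show ?case using r by simp
  next
    case (Suc k)
    let ?Y = "J' \<cdot> ipow I (r + Suc k) <+> (PIdl (a0 [^] Suc (Suc k))) \<cdot> ipow I r"
    have Y1: "ideal ((PIdl (a0 [^] l)) \<cdot> ipow I r) R" for l :: nat
      using ideal_prod_is_ideal cgenideal_ideal a0 IpD by simp
    have Y: "ideal ?Y R" by (rule add_ideals[OF JI' Y1])
    have YJ: "J' \<cdot> ipow I (r + Suc k) \<subseteq> ?Y"
    proof
      fix x assume x: "x \<in> J' \<cdot> ipow I (r + Suc k)"
      then have "x = x \<oplus> \<zero>" using ideal.Icarr[OF JI'] by simp
      then show "x \<in> ?Y" using x ideal_zero_closed[OF Y1] unfolding set_add_def' by blast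
    qed
    have YP: "(PIdl (a0 [^] Suc (Suc k))) \<cdot> ipow I r \<subseteq> ?Y"
    proof
      fix x assume x: "x \<in> (PIdl (a0 [^] Suc (Suc k))) \<cdot> ipow I r"
      then have "x = \<zero> \<oplus> x" using ideal.Icarr[OF Y1 x] by simp
      then show "x \<in> ?Y" using x ideal_zero_closed[OF JI'] unfolding set_add_def' by blast
    qed
    have "J \<cdot> ipow I (r + Suc k) \<subseteq> ?Y"
    proof (rule ideal_prod_subset[OF Y])
      fix i j assume i: "i \<in> J" and j: "j \<in> ipow I (r + Suc k)"
      have jc: "j \<in> carrier R" using ideal.Icarr[OF IpD j] .
      obtain x q where x: "x \<in> J'" "q \<in> carrier R" "i = x \<oplus> q \<otimes> a0" using JJ'[OF i] by blast
      have xc: "x \<in> carrier R" using ideal.Icarr[OF J' x(1)] .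
      obtain u v where uv: "u \<in> J' \<cdot> ipow I (r + k)" "v \<in> (PIdl (a0 [^] Suc k)) \<cdot> ipow I r" "j = u \<oplus> v"
        using Suc.IH j unfolding set_add_def' by blast
      have uc: "u \<in> carrier R" "v \<in> carrier R" using ideal.Icarr[OF JI' uv(1)] ideal.Icarr[OF Y1 uv(2)] .
      have "i \<otimes> j = x \<otimes> j \<oplus> (q \<otimes> (a0 \<otimes> u) \<oplus> q \<otimes> (a0 \<otimes> v))"
        unfolding x(3) uv(3) using x(2) xc uc a0(2) by algebra
      moreover have "x \<otimes> j \<in> ?Y" using YJ ideal_prod.prod[OF x(1) j, of R] by blast
      moreover have "q \<otimes> (a0 \<otimes> u) \<in> ?Y"
      proof -
        have "u \<otimes> a0 \<in> (J' \<cdot> ipow I (r + k)) \<cdot> I" by (rule ideal_prod.prod[OF uv(1) a0(1)])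
        moreover have "(J' \<cdot> ipow I (r + k)) \<cdot> I = J' \<cdot> ipow I (r + Suc k)"
          using ideal_prod_assoc[OF J' IpD I(1)] ipow_Suc[of I "r + k"] by simp
        ultimately have "a0 \<otimes> u \<in> ?Y" using YJ uc a0 by (simp add: m_comm subset_iff)
        then show ?thesis using ideal.I_l_closed[OF Y _ x(2)] by blast
      qed
      moreover have "q \<otimes> (a0 \<otimes> v) \<in> ?Y"
      proof -
        have "(PIdl (a0 [^] Suc k)) \<cdot> ipow I r \<subseteq> {y \<in> carrier R. y \<otimes> a0 \<in> ?Y}"
        proof (rule ideal_prod_subset[OF colon_ideal[OF Y a0(2)]])
          fix s t assume s: "s \<in> PIdl (a0 [^] Suc k)" and t: "t \<in> ipow I r"
          obtain p where p: "p \<in> carrier R" "s = p \<otimes> a0 [^] Suc k" using s by (auto simp: cgenideal_def)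
          have tc: "t \<in> carrier R" using ideal.Icarr[OF IpD t] .
          have "s \<otimes> t \<otimes> a0 = (p \<otimes> a0 [^] Suc (Suc k)) \<otimes> t"
            unfolding p(2) using p(1) a0(2) tc by (simp add: m_ac)
          moreover have "(p \<otimes> a0 [^] Suc (Suc k)) \<otimes> t \<in> (PIdl (a0 [^] Suc (Suc k))) \<cdot> ipow I r"
            using p(1) t by (intro ideal_prod.prod) (auto simp: cgenideal_def)
          ultimately show "s \<otimes> t \<in> {y \<in> carrier R. y \<otimes> a0 \<in> ?Y}"
            using YP p a0(2) tc by auto
        qed
        then have "v \<otimes> a0 \<in> ?Y" using uv(2) by blast
        then have "a0 \<otimes> v \<in> ?Y" using uc a0 by (simp add: m_comm)
        then show ?thesis using ideal.I_l_closed[OF Y _ x(2)] by blast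
      qed
      ultimately show "i \<otimes> j \<in> ?Y" using ideal_add_closed[OF Y] by simp
    qed
    then show ?case using reduction_ipow(1)[OF I(1) J r, of "Suc k"] by simp
  qed
  let ?W = "J' \<cdot> ipow I (r + D')"
  have "ipow I (r + D) \<subseteq> ?W <+> M \<cdot> ipow I (r + D)" (is "_ \<subseteq> ?Z")
  proof
    have Z: "ideal ?Z R" by (rule add_ideals[OF JI' MI])
    have ZW: "?W \<subseteq> ?Z"
    proof
      fix x assume x: "x \<in> ?W"
      then have "x = x \<oplus> \<zero>" using ideal.Icarr[OF JI'] by simp
      then show "x \<in> ?Z" using x ideal_zero_closed[OF MI] unfolding set_add_def' by blast
    qed
    have ZM: "M \<cdot> ipow I (r + D) \<subseteq> ?Z"
    proof
      fix x assume x: "x \<in> M \<cdot> ipow I (r + D)"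
      then have "x = \<zero> \<oplus> x" using ideal.Icarr[OF MI] by simp
      then show "x \<in> ?Z" using x ideal_zero_closed[OF JI'] unfolding set_add_def' by blast
    qed
    have "(PIdl (a0 [^] D)) \<cdot> ipow I r \<subseteq> ?Z"
    proof (rule ideal_prod_subset[OF Z])
      fix s t assume s: "s \<in> PIdl (a0 [^] D)" and t: "t \<in> ipow I r"
      have "s \<in> Y0" using cgenideal_minimal[OF Y0 a0Y0] s by blast
      then obtain u v where uv: "u \<in> J' \<cdot> ipow I D'" "v \<in> M \<cdot> ipow I D" "s = u \<oplus> v"
        unfolding Y0_def set_add_def' by blast
      have uc: "u \<in> carrier R" "v \<in> carrier R" "t \<in> carrier R"
        using ideal.Icarr[OF JI' uv(1)] ideal.Icarr[OF MI uv(2)] ideal.Icarr[OF IpD t] .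
      have "u \<otimes> t \<in> (J' \<cdot> ipow I D') \<cdot> ipow I r" by (rule ideal_prod.prod[OF uv(1) t])
      also have "\<dots> = ?W" using ideal_prod_assoc[OF J' IpD IpD] ipow_add[OF I(1), of D' r] by (simp add: add.commute)
      finally have 1: "u \<otimes> t \<in> ?Z" using ZW by blast
      have "v \<otimes> t \<in> (M \<cdot> ipow I D) \<cdot> ipow I r" by (rule ideal_prod.prod[OF uv(2) t])
      also have "\<dots> = M \<cdot> ipow I (r + D)"
        using ideal_prod_assoc[OF M_ideal IpD IpD] ipow_add[OF I(1), of D r] by (simp add: add.commute)
      finally have 2: "v \<otimes> t \<in> ?Z" using ZM by blast
      have "s \<otimes> t = u \<otimes> t \<oplus> v \<otimes> t" unfolding uv(3) using uc by algebra
      then show "s \<otimes> t \<in> ?Z" using ideal_add_closed[OF Z 1 2] by simp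
    qed
    moreover fix x assume "x \<in> ipow I (r + D)"
    then obtain u v where "u \<in> ?W" "v \<in> (PIdl (a0 [^] D)) \<cdot> ipow I r" "x = u \<oplus> v"
      using key[of D'] unfolding D' set_add_def' by blast
    ultimately show "x \<in> ?Z" using ZW ideal_add_closed[OF Z] by blast
  qed
  then have "ipow I (r + D) \<subseteq> ?W" by (rule nakayama_local[OF IpD JI'])
  moreover have "?W \<subseteq> ipow I (r + D)"
    using ideal_prod_mono[OF J'I order_refl, of "ipow I (r + D')"] ipow_Suc'[OF I(1), of "r + D'"] D' by simp
  ultimately have "ipow I (Suc (r + D')) = J' \<cdot> ipow I (r + D')" using D' by auto
  then have "reduction R I J'" using J' J'I unfolding reduction_iff by blast
  then show thesis
    using J'J a'I unfolding J_def J'_def by (intro that[OF i0(1), of a'])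
qed

end

section \<open>Multiplicity\<close>

text \<open>The discrete form of integrating \<open>x^s\<close>: by \<open>step\<close>, each
  increment of \<open>k^(s+1)\<close> is at most \<open>s+1\<close> times the new summand.\<close>

lemma sum_powers_ge: "k ^ Suc s \<le> Suc s * (\<Sum>i=1..k. i ^ s)" for k s :: nat
proof -
  have step: "k * Suc k ^ s \<le> k ^ Suc s + s * Suc k ^ s" for k
  proof (induction s)
    case (Suc s)
    have "k * Suc k ^ Suc s = k * Suc k ^ s + k * (k * Suc k ^ s)" by (simp add: algebra_simps)
    also have "\<dots> \<le> k * Suc k ^ s + k * (k ^ Suc s + s * Suc k ^ s)"
      using mult_le_mono2[OF Suc] by simp
    also have "\<dots> = k ^ Suc (Suc s) + Suc s * (k * Suc k ^ s)" by (simp add: algebra_simps)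
    also have "\<dots> \<le> k ^ Suc (Suc s) + Suc s * Suc k ^ Suc s"
      by (intro add_left_mono mult_le_mono2) simp
    finally show ?case .
  qed simp
  show ?thesis
  proof (induction k)
    case (Suc k)
    have "Suc k ^ Suc s = k * Suc k ^ s + Suc k ^ s" by simp
    also have "\<dots> \<le> k ^ Suc s + s * Suc k ^ s + Suc k ^ s" using step by simp
    also have "\<dots> \<le> Suc s * (\<Sum>i=1..k. i ^ s) + Suc s * Suc k ^ s" using Suc by simp
    also have "\<dots> = Suc s * (\<Sum>i=1..Suc k. i ^ s)" by (simp add: algebra_simps)
    finally show ?case .
  qed simp
qed

abbreviation small_multisets :: "'v set \<Rightarrow> nat \<Rightarrow> 'v multiset set" where
  "small_multisets A k \<equiv> {m. set_mset m \<subseteq> A \<and> size m < k}"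

lemma finite_small_multisets: "finite A \<Longrightarrow> finite (small_multisets A k)"
proof -
  assume "finite A"
  then have "finite (mset ` {xs. set xs \<subseteq> A \<and> length xs \<le> k})"
    by (intro finite_imageI finite_lists_length_le)
  moreover have "small_multisets A k \<subseteq> mset ` {xs. set xs \<subseteq> A \<and> length xs \<le> k}"
  proof
    fix m assume m: "m \<in> small_multisets A k"
    obtain xs where "m = mset xs" using ex_mset by metis
    then show "m \<in> mset ` {xs. set xs \<subseteq> A \<and> length xs \<le> k}" using m by auto
  qed
  ultimately show ?thesis by (rule rev_finite_subset)
qed

text \<open>With \<open>d = card A\<close> the count is the binomial coefficient of
  \<open>k - 1 + d\<close> over \<open>d\<close>, of which only the leading term is wanted.
  Splitting by the multiplicity of one element turns the claim into
  \<open>sum_powers_ge\<close>.\<close>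

lemma card_small_multisets_ge:
  fixes A :: "'v set"
  assumes "finite A" "1 \<le> k"
  shows "k ^ card A \<le> fact (card A) * card (small_multisets A k)"
  using assms
proof (induction A arbitrary: k rule: finite_induct)
  case empty
  then have "{#} \<in> small_multisets ({} :: 'v set) k" by simp
  then have "card (small_multisets ({} :: 'v set) k) \<noteq> 0"
    using finite_small_multisets[of "{} :: 'v set" k] by auto
  then show ?case unfolding card.empty power_0 fact_0 mult_1 by linarith
next
  case (insert a A)
  let ?S = "SIGMA j:{..<k}. small_multisets A (k - j)"
  let ?f = "\<lambda>(j, m). m + replicate_mset j a"
  have "inj_on ?f ?S"
  proof (rule inj_onI, clarify)
    fix j m j' m' assume A: "set_mset m \<subseteq> A" "set_mset m' \<subseteq> A"
      and eq: "m + replicate_mset j a = m' + replicate_mset j' a"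
    have "count m a = 0" "count m' a = 0" using A insert.hyps by (auto simp: not_in_iff[symmetric])
    then have "j = j'" using arg_cong[OF eq, of "\<lambda>m. count m a"] by simp
    then show "j = j' \<and> m = m'" using eq by simp
  qed
  moreover have "?f ` ?S \<subseteq> small_multisets (insert a A) k" by (auto split: if_splits)
  ultimately have "card ?S \<le> card (small_multisets (insert a A) k)"
    by (rule card_inj_on_le) (use finite_small_multisets[of "insert a A" k] insert.hyps in simp)
  moreover have "card ?S = (\<Sum>j<k. card (small_multisets A (k - j)))"
    using finite_small_multisets insert.hyps by (intro card_SigmaI) auto
  moreover have "(\<Sum>j<k. card (small_multisets A (k - j))) = (\<Sum>i=1..k. card (small_multisets A i))"
    by (rule sum.reindex_bij_witness[of _ "\<lambda>i. k - i" "\<lambda>j. k - j"]) auto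
  ultimately have c: "(\<Sum>i=1..k. card (small_multisets A i)) \<le> card (small_multisets (insert a A) k)" by simp
  have "k ^ card (insert a A) = k ^ Suc (card A)" using insert.hyps by simp
  also have "\<dots> \<le> Suc (card A) * (\<Sum>i=1..k. i ^ card A)" by (rule sum_powers_ge)
  also have "\<dots> \<le> Suc (card A) * (\<Sum>i=1..k. fact (card A) * card (small_multisets A i))"
    using insert.IH by (intro mult_le_mono2 sum_mono) simp
  also have "\<dots> = fact (Suc (card A)) * (\<Sum>i=1..k. card (small_multisets A i))"
    by (simp add: sum_distrib_left[symmetric] algebra_simps)
  also have "\<dots> \<le> fact (Suc (card A)) * card (small_multisets (insert a A) k)" using c by simp
  finally show ?case using insert.hyps by simp
qed

lemma sorted_list_of_small_multisets:
  assumes "finite A"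
  obtains ms where "set ms = small_multisets A k" "distinct ms" "sorted (map size ms)"
proof -
  obtain xs where "set xs = small_multisets A k" "distinct xs"
    using finite_distinct_list[OF finite_small_multisets[OF assms]] by blast
  then show ?thesis using that[of "sort_key size xs"] by simp
qed

lemma exists_larger_count:
  assumes "set_mset m' \<subseteq> A" "m' \<noteq> m" "size m \<le> size m'"
  shows "\<exists>i\<in>A. count m i < count m' i"
proof (rule ccontr)
  assume *: "\<not> (\<exists>i\<in>A. count m i < count m' i)"
  have "count m' i \<le> count m i" for i
  proof (cases "i \<in> A")
    case False
    then have "i \<notin># m'" using assms(1) by blast
    then show ?thesis by (simp add: not_in_iff)
  qed (use * in force)
  then have "m' \<subseteq># m" by (rule mset_subset_eqI)
  then have "m' \<subset># m" using assms(2) by (simp add: subset_mset.le_neq_trans)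
  then have "size m' < size m" by (rule mset_subset_size)
  then show False using assms(3) by simp
qed

context cring
begin

lemma Idl_insert_mem:
  assumes "S \<subseteq> carrier R" "b \<in> carrier R" "x \<in> Idl (insert b S)"
  shows "\<exists>q\<in>carrier R. \<exists>r\<in>Idl S. x = q \<otimes> b \<oplus> r"
proof -
  have "insert b S = {b} \<union> S" by simp
  have I: "ideal (PIdl b <+> Idl S) R" using add_ideals[OF cgenideal_ideal[OF assms(2)] genideal_ideal[OF assms(1)]] .
  have "b \<in> PIdl b <+> Idl S"
  proof -
    have "b = b \<oplus> \<zero>" using assms by simp
    then show ?thesis using cgenideal_self[OF assms(2)] ideal_zero_closed[OF genideal_ideal[OF assms(1)]]
      unfolding set_add_def' by blast
  qed
  moreover have "s \<in> PIdl b <+> Idl S" if "s \<in> S" for s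
  proof -
    have "s = \<zero> \<oplus> s" using that assms by auto
    then show ?thesis using ideal_zero_closed[OF cgenideal_ideal[OF assms(2)]] genideal_self[OF assms(1)] that
      unfolding set_add_def' by blast
  qed
  ultimately have "Idl (insert b S) \<subseteq> PIdl b <+> Idl S" by (intro genideal_minimal[OF I]) blast
  then show ?thesis using assms(3) unfolding set_add_def' cgenideal_def by blast
qed

end

section \<open>Independent elements and lower bounds for length\<close>

context local_noetherian_ring
begin

text \<open>Each layer \<open>lin (x # xs) W\<close> over \<open>lin xs W\<close> is cyclic with
  annihilator inside \<open>K\<close>, so it maps onto \<open>R/K\<close> and is at least as
  long.\<close>

fun indep :: "'a set \<Rightarrow> 'a set \<Rightarrow> 'a list \<Rightarrow> bool" where
  "indep K W [] \<longleftrightarrow> True"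
| "indep K W (x # xs) \<longleftrightarrow> indep K W xs \<and> x \<in> carrier R \<and>
     (\<forall>c\<in>carrier R. c \<otimes> x \<in> lin xs W \<longrightarrow> c \<in> K)"

text \<open>Inside each layer a chain \<open>C i\<close> above \<open>K\<close> gives the chain of
  the \<open>C i x + lin xs W\<close>. It stays strict, since a difference of coefficients that
  carries \<open>x\<close> into the lower layer lies in \<open>K\<close>.\<close>

lemma length_ge_indep:
  assumes K: "ideal K R" and W: "ideal W R" and L: "length_ge K (carrier R) L" and "indep K W xs"
  shows "length_ge W (lin xs W) (length xs * L)"
  using assms(4)
proof (induction xs)
  case Nil
  then show ?case using length_ge_0[OF W] by simp
next
  case (Cons x xs)
  have xs: "set xs \<subseteq> carrier R" if "indep K W xs" for xs using that by (induction xs) auto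
  have x: "x \<in> carrier R" "set xs \<subseteq> carrier R"
    and ind: "\<And>c. c \<in> carrier R \<Longrightarrow> c \<otimes> x \<in> lin xs W \<Longrightarrow> c \<in> K" using Cons.prems xs by auto
  let ?U = "lin xs W"
  have U: "ideal ?U R" using lin_ideal[OF W x(2)] .
  obtain C where C: "\<And>i. i \<le> L \<Longrightarrow> ideal (C i) R" "\<And>i. i < L \<Longrightarrow> C i \<subset> C (Suc i)" "K \<subseteq> C 0" "C L \<subseteq> carrier R"
    using L unfolding length_ge_def by blast
  have KC: "K \<subseteq> C i" if "i \<le> L" for i
    using that by (induction i) (use C in \<open>auto simp: Suc_le_eq dest: order.strict_implies_order\<close>)
  define E where "E i = {c \<otimes> x \<oplus> u |c u. c \<in> C i \<and> u \<in> ?U}" for i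
  have E: "ideal (E i) R" if i: "i \<le> L" for i
  proof -
    have "E i = ?U <+> C i \<cdot> (PIdl x)"
    proof
      show "E i \<subseteq> ?U <+> C i \<cdot> (PIdl x)"
      proof
        fix y assume "y \<in> E i"
        then obtain c u where c: "y = c \<otimes> x \<oplus> u" "c \<in> C i" "u \<in> ?U" by (auto simp: E_def)
        have "c \<otimes> x \<in> C i \<cdot> (PIdl x)" using c cgenideal_self[OF x(1)] by (intro ideal_prod.prod)
        moreover have "y = u \<oplus> c \<otimes> x"
          using c x ideal.Icarr[OF C(1)[OF i] c(2)] ideal.Icarr[OF U c(3)] by (simp add: a_comm)
        ultimately show "y \<in> ?U <+> C i \<cdot> (PIdl x)" using c unfolding set_add_def' by blast
      qed
      have P: "\<exists>c\<in>C i. y = c \<otimes> x" if "y \<in> C i \<cdot> (PIdl x)" for y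
        using that
      proof (induction rule: ideal_prod.induct)
        case (prod c y)
        then obtain q where q: "q \<in> carrier R" "y = q \<otimes> x" by (auto simp: cgenideal_def)
        then have "c \<otimes> y = (c \<otimes> q) \<otimes> x" using ideal.Icarr[OF C(1)[OF i] prod(1)] x by (simp add: m_assoc)
        then show ?case using ideal.I_r_closed[OF C(1)[OF i] prod(1) q(1)] by blast
      next
        case (sum s t)
        then obtain c c' where c: "c \<in> C i" "s = c \<otimes> x" "c' \<in> C i" "t = c' \<otimes> x" by blast
        then have "s \<oplus> t = (c \<oplus> c') \<otimes> x" using ideal.Icarr[OF C(1)[OF i]] x by (simp add: l_distr)
        then show ?case using ideal_add_closed[OF C(1)[OF i]] c by blast
      qed
      show "?U <+> C i \<cdot> (PIdl x) \<subseteq> E i"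
      proof
        fix y assume "y \<in> ?U <+> C i \<cdot> (PIdl x)"
        then obtain u v where u: "u \<in> ?U" "v \<in> C i \<cdot> (PIdl x)" "y = u \<oplus> v" unfolding set_add_def' by blast
        then obtain c where c: "c \<in> C i" "v = c \<otimes> x" using P by blast
        have "y = c \<otimes> x \<oplus> u"
          using u c x ideal.Icarr[OF C(1)[OF i] c(1)] ideal.Icarr[OF U u(1)] by (simp add: a_comm)
        then show "y \<in> E i" using u c by (auto simp: E_def)
      qed
    qed
    then show ?thesis
      using add_ideals[OF U ideal_prod_is_ideal[OF C(1)[OF i] cgenideal_ideal[OF x(1)]]] by simp
  qed
  have "E i \<subset> E (Suc i)" if i: "i < L" for i
  proof -
    have Ci: "ideal (C i) R" "ideal (C (Suc i)) R" using C(1) i by auto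
    obtain c where c: "c \<in> C (Suc i)" "c \<notin> C i" using C(2)[OF i] by blast
    have cc: "c \<in> carrier R" using ideal.Icarr[OF Ci(2) c(1)] .
    have "c \<otimes> x = c \<otimes> x \<oplus> \<zero>" using cc x by simp
    then have "c \<otimes> x \<in> E (Suc i)" using c(1) ideal_zero_closed[OF U] by (auto simp: E_def)
    moreover have "c \<otimes> x \<notin> E i"
    proof
      assume "c \<otimes> x \<in> E i"
      then obtain c' u where c': "c \<otimes> x = c' \<otimes> x \<oplus> u" "c' \<in> C i" "u \<in> ?U" by (auto simp: E_def)
      have cc': "c' \<in> carrier R" "u \<in> carrier R" using ideal.Icarr[OF Ci(1) c'(2)] ideal.Icarr[OF U c'(3)] .
      have "(c \<ominus> c') \<otimes> x = c \<otimes> x \<ominus> c' \<otimes> x" using cc cc' x(1) by algebra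
      also have "\<dots> = u" unfolding c'(1) using cc' x(1) by algebra
      finally have "c \<ominus> c' \<in> K" using ind[of "c \<ominus> c'"] c'(3) cc cc' by simp
      then have "(c \<ominus> c') \<oplus> c' \<in> C i" using KC[of i] i c'(2) ideal_add_closed[OF Ci(1)] by auto
      moreover have "(c \<ominus> c') \<oplus> c' = c" using cc cc' by algebra
      ultimately show False using c(2) by simp
    qed
    moreover have "E i \<subseteq> E (Suc i)" unfolding E_def using C(2)[OF i] by blast
    ultimately show ?thesis by blast
  qed
  moreover have "?U \<subseteq> E 0"
  proof
    fix u assume u: "u \<in> ?U"
    then have "u = \<zero> \<otimes> x \<oplus> u" using x ideal.Icarr[OF U] by simp
    then show "u \<in> E 0" using u ideal_zero_closed[OF C(1)[OF le0]] unfolding E_def by blast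
  qed
  moreover have "E L \<subseteq> lin (x # xs) W" unfolding E_def lin.simps using C(4) by blast
  ultimately have "length_ge ?U (lin (x # xs) W) L" unfolding length_ge_def using E by blast
  moreover have "length_ge W ?U (length xs * L)" using Cons by simp
  ultimately show ?case using length_ge_trans[of W ?U "length xs * L" "lin (x # xs) W" L]
    by (simp add: add.commute)
qed

lemma indep_carrier: "indep K W xs \<Longrightarrow> set xs \<subseteq> carrier R"
  by (induction xs) auto

lemma length_ge_indep':
  assumes "ideal K R" "ideal W R" "length_ge K (carrier R) L" "indep K W xs"
  shows "length_ge W (carrier R) (length xs * L)"
  using length_ge_indep[OF assms] lin_ideal[OF assms(2) indep_carrier[OF assms(4)]]
    length_ge_mono ideal_carrier by blast

subsection \<open>Systems of parameters\<close>

text \<open>Koszul homology of \<open>b # bs\<close> is \<open>M\<close>-torsion, hence vanishes in the presence of a regular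
  sequence of the same length in \<open>M\<close>.\<close>

lemma head_regular:
  assumes F: "regular_flag A z d" "A 0 = {\<zero>}" "\<And>i. i < d \<Longrightarrow> z i \<in> M"
    and bs: "set (b # bs) \<subseteq> carrier R" "length (b # bs) \<le> d"
    and nil: "\<And>m. m \<in> M \<Longrightarrow> \<exists>N::nat. m [^] N \<in> Idl (set (b # bs))"
    and x: "x \<in> carrier R" "b \<otimes> x \<in> Idl (set bs)"
  shows "x \<in> Idl (set bs)"
proof -
  have bs': "set bs \<subseteq> carrier R" and b: "b \<in> carrier R" using bs by auto
  note D = regular_flagD[OF F(1)]
  let ?F = "replicate (length bs) False"
  have "b \<otimes> x \<in> lin bs {\<zero>}" using x lin_zero_eq_Idl[OF bs'] by simp
  then obtain v where v: "chain v" "b \<otimes> x \<ominus> kd bs v ?F \<in> {\<zero>}"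
    using lin_kd[OF zeroideal bs'] by blast
  have k: "kd bs v ?F \<in> carrier R" using v bs' by simp
  have "kd bs v ?F = b \<otimes> x \<ominus> (b \<otimes> x \<ominus> kd bs v ?F)" using k b x(1) by algebra
  then have kv: "kd bs v ?F = b \<otimes> x" using v(2) b x(1) by (simp add: a_minus_def)
  \<comment> \<open>The relation \<open>b x = kd v\<close> over the tail, read as a cycle of degree
    1 over \<open>b # bs\<close>: value \<open>x\<close> at \<open>b\<close> and \<open>-v\<close>
    on the tail.\<close>
  define w where "w = (\<lambda>s. case s of [] \<Rightarrow> \<zero> | c # t \<Rightarrow> if c then x else \<ominus> v t)"
  have w: "chain w" using v(1) x(1) by (auto simp: w_def split: list.split)
  have wF: "(\<lambda>t. w (False # t)) = (\<lambda>t. \<ominus> v t)" and wT: "w (True # t) = x" for t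
    by (simp_all add: w_def)
  have "kd (b # bs) w (False # ?F) = \<zero>"
    using v(1) bs' b x(1) by (simp add: wF wT kd_uminus kv l_neg)
  then have cyc: "kcycle (b # bs) (A 0) (Suc 0) w"
    unfolding kcycle_def F(2) using w kpos_zero[of _ "b # bs"] by auto
  have "kbdry (b # bs) (A 0) (Suc 0) w"
  proof (rule koszul_acyclic[OF F(1) bs _ le0 cyc])
    fix i p w assume i: "i < d" and cyc: "kcycle (b # bs) (A i) (Suc p) w"
    have Ai: "ideal (A i) R" using D(1) i by simp
    have w: "chain w" using cyc by (simp add: kcycle_def)
    let ?C = "{c \<in> carrier R. kbdry (b # bs) (A i) (Suc p) (\<lambda>s. c \<otimes> w s)}"
    \<comment> \<open>Every entry annihilates the homology, hence so does the ideal they generate,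
      which contains a power of each \<open>z i\<close>.\<close>
    have "set (b # bs) \<subseteq> ?C" using koszul_homotopy[OF Ai bs(1) cyc] bs(1) by blast
    then have "Idl (set (b # bs)) \<subseteq> ?C" using genideal_minimal[OF kbdry_ideal[OF Ai bs(1) w]] by blast
    then show "\<exists>N::nat. kbdry (b # bs) (A i) (Suc p) (\<lambda>s. z i [^] N \<otimes> w s)"
      using nil[OF F(3)[OF i]] by blast
  qed simp
  then obtain u where u: "chain u" "\<And>s. kpos (b # bs) (Suc 0) s \<Longrightarrow> w s \<ominus> kd (b # bs) u s \<in> {\<zero>}"
    unfolding kbdry_def F(2) by blast
  \<comment> \<open>At the position of \<open>b\<close> the boundary of \<open>u\<close> involves
    only the tail, which puts \<open>x\<close> into the ideal of \<open>bs\<close>.\<close>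
  have "kpos (b # bs) (Suc 0) (True # ?F)" using kpos_zero[of ?F bs] by simp
  then have "w (True # ?F) \<ominus> kd (b # bs) u (True # ?F) \<in> {\<zero>}" by (rule u(2))
  then have z: "x \<ominus> \<ominus> kd bs (\<lambda>t. u (True # t)) ?F = \<zero>" by (simp add: wT)
  define y where "y = kd bs (\<lambda>t. u (True # t)) ?F"
  have y: "y \<in> carrier R" using u(1) bs' by (simp add: y_def)
  have "x = (x \<ominus> \<ominus> y) \<ominus> y" using x(1) y by algebra
  then have "x = \<ominus> y" using z y unfolding y_def[symmetric] by (simp add: a_minus_def)
  moreover have "y \<oplus> \<zero> \<in> lin bs {\<zero>}"
    unfolding y_def by (rule kd_replicate_False[OF zeroideal bs']) (use u(1) in auto)
  ultimately show ?thesis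
    using y lin_zero_eq_Idl[OF bs'] ideal_uminus_closed[OF lin_ideal[OF zeroideal bs']] by simp
qed

text \<open>The indices of \<open>Q\<close> are removed one at a time. For the removed
  \<open>j\<close>, a positive power of \<open>c j\<close> is regular modulo the other generators,
  which are powers of the remaining parameters; so the factor \<open>c j [^] \<alpha> j\<close> is
  cancelled and \<open>c j\<close> itself joins the ideal.\<close>

lemma monomial_colon:
  fixes \<alpha> :: "nat \<Rightarrow> nat"
  assumes F: "regular_flag A z d" "A 0 = {\<zero>}" "\<And>i. i < d \<Longrightarrow> z i \<in> M"
    and B: "finite B" "card B \<le> d" and c: "\<And>i. c i \<in> carrier R"
    and nil: "\<And>m. m \<in> M \<Longrightarrow> \<exists>N::nat. m [^] N \<in> Idl (c ` B)"
    and "Q \<subseteq> B" "y \<in> carrier R"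
    and "y \<otimes> (\<Otimes>i\<in>Q. c i [^] \<alpha> i) \<in> Idl (c ` (B - Q) \<union> (\<lambda>i. c i [^] Suc (\<alpha> i)) ` Q)"
  shows "y \<in> Idl (c ` B)"
proof -
  have "finite Q" using B(1) assms(8) finite_subset by blast
  from this assms(8-) show ?thesis
  proof (induction Q arbitrary: y rule: finite_induct)
    case empty
    then show ?case by simp
  next
    case (insert j Q)
    let ?p = "\<lambda>i. c i [^] Suc (\<alpha> i)"
    let ?S = "c ` (B - Q - {j}) \<union> ?p ` Q"
    have S: "?S \<subseteq> carrier R" using c by auto
    have SI: "ideal (Idl ?S) R" by (rule genideal_ideal[OF S])
    have j: "j \<in> B" "j \<notin> Q" "Q \<subseteq> B" using insert by auto
    have cj: "c j \<in> carrier R" using c .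
    define y' where "y' = y \<otimes> (\<Otimes>i\<in>Q. c i [^] \<alpha> i)"
    have y': "y' \<in> carrier R" using insert.prems c by (auto simp: y'_def intro!: finprod_closed)
    have "(\<Otimes>i\<in>insert j Q. c i [^] \<alpha> i) = c j [^] \<alpha> j \<otimes> (\<Otimes>i\<in>Q. c i [^] \<alpha> i)"
      using insert.hyps c by (intro finprod_insert) auto
    then have e: "y \<otimes> (\<Otimes>i\<in>insert j Q. c i [^] \<alpha> i) = y' \<otimes> c j [^] \<alpha> j"
      unfolding y'_def using insert.prems(2) c by (simp add: m_ac)
    have "c ` (B - insert j Q) \<union> ?p ` insert j Q = insert (?p j) ?S" by auto
    then have "y' \<otimes> c j [^] \<alpha> j \<in> Idl (insert (?p j) ?S)" using insert.prems(3) e by simp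
    then obtain q r where q: "q \<in> carrier R" "r \<in> Idl ?S" "y' \<otimes> c j [^] \<alpha> j = q \<otimes> ?p j \<oplus> r"
      using Idl_insert_mem[OF S, of "?p j"] cj by (meson nat_pow_closed)
    have rc: "r \<in> carrier R" using ideal.Icarr[OF SI q(2)] .
    define t where "t = y' \<ominus> q \<otimes> c j"
    have t: "t \<in> carrier R" using y' q(1) cj by (simp add: t_def)
    have pc: "c j [^] \<alpha> j \<in> carrier R" using cj by simp
    have "c j [^] \<alpha> j \<otimes> t = y' \<otimes> c j [^] \<alpha> j \<ominus> q \<otimes> ?p j"
      unfolding t_def nat_pow_Suc using y' q(1) cj pc by algebra
    also have "\<dots> = r" unfolding q(3) nat_pow_Suc using rc q(1) cj pc by algebra
    finally have ct: "c j [^] \<alpha> j \<otimes> t \<in> Idl ?S" using q(2) by simp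
    have tS: "t \<in> Idl ?S"
    proof (cases "\<alpha> j")
      \<comment> \<open>The power is 1 and not a parameter, but here nothing has to be
        cancelled.\<close>
      case 0
      then show ?thesis using ct t by simp
    next
      case (Suc a)
      have finS: "finite ?S" using B(1) insert.hyps by simp
      obtain bs where bs: "set bs = ?S" "length bs = card ?S" using finite_distinct_list[OF finS] distinct_card by metis
      have "card ?S \<le> card (B - Q - {j}) + card Q"
      proof (rule le_trans[OF card_Un_le])
        show "card (c ` (B - Q - {j})) + card (?p ` Q) \<le> card (B - Q - {j}) + card Q"
          by (intro add_mono card_image_le) (use B(1) insert.hyps in auto)
      qed
      also have "\<dots> = card ((B - Q - {j}) \<union> Q)"
        using B(1) insert.hyps by (intro card_Un_disjoint[symmetric]) auto
      also have "(B - Q - {j}) \<union> Q = B - {j}" using j by blast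
      finally have "card ?S < card B" using B(1) j(1) by (metis card_Diff1_less le_less_trans)
      then have len: "length (c j [^] \<alpha> j # bs) \<le> d" using bs B(2) by simp
      let ?T = "set (c j [^] \<alpha> j # bs)"
      have T: "?T \<subseteq> carrier R" using S bs cj by simp
      have TI: "ideal (Idl ?T) R" by (rule genideal_ideal[OF T])
      \<comment> \<open>The radical of \<open>Idl ?T\<close>. It contains every \<open>c i\<close>,
        so every element of \<open>M\<close> still has a power in \<open>Idl ?T\<close>, as
        \<open>head_regular\<close> requires.\<close>
      let ?L = "{x \<in> carrier R. \<exists>N::nat. x [^] N \<otimes> \<one> \<in> Idl ?T}"
      have L: "ideal ?L R" by (rule power_torsion_ideal[OF TI]) simp
      have "c i \<in> ?L" if "i \<in> B" for i
      proof -
        have "\<exists>N::nat. c i [^] N \<in> ?T"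
        proof (cases "i = j")
          case False
          show ?thesis
          proof (cases "i \<in> Q")
            case True
            then have "?p i \<in> ?T" using bs(1) by simp
            then show ?thesis by (rule exI)
          next
            case nQ: False
            then have "c i [^] Suc 0 \<in> ?T" using bs(1) that False c by simp
            then show ?thesis by (rule exI)
          qed
        qed auto
        then obtain N :: nat where "c i [^] N \<in> ?T" by blast
        then have "c i [^] N \<otimes> \<one> \<in> Idl ?T" using subsetD[OF genideal_self[OF T]] c by simp
        then show ?thesis using c[of i] by blast
      qed
      then have BL: "Idl (c ` B) \<subseteq> ?L" by (intro genideal_minimal[OF L]) auto
      have "\<exists>N::nat. m [^] N \<in> Idl ?T" if m: "m \<in> M" for m
      proof -
        obtain N N' :: nat where "(m [^] N) [^] N' \<otimes> \<one> \<in> Idl ?T" using nil[OF m] BL by blast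
        then have "m [^] (N * N') \<in> Idl ?T"
          using ideal.Icarr[OF M_ideal m] by (simp add: nat_pow_pow)
        then show ?thesis by blast
      qed
      then show ?thesis using head_regular[OF F T len _ t] ct bs(1) by simp
    qed
    have "Idl ?S \<subseteq> Idl (c ` (B - Q) \<union> ?p ` Q)" "c j \<in> Idl (c ` (B - Q) \<union> ?p ` Q)"
      "ideal (Idl (c ` (B - Q) \<union> ?p ` Q)) R"
    proof -
      have T: "c ` (B - Q) \<union> ?p ` Q \<subseteq> carrier R" using c by auto
      show "ideal (Idl (c ` (B - Q) \<union> ?p ` Q)) R" by (rule genideal_ideal[OF T])
      show "c j \<in> Idl (c ` (B - Q) \<union> ?p ` Q)" using genideal_self[OF T] j by auto
      show "Idl ?S \<subseteq> Idl (c ` (B - Q) \<union> ?p ` Q)" by (rule subset_Idl_subset[OF T]) auto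
    qed
    then have "t \<oplus> q \<otimes> c j \<in> Idl (c ` (B - Q) \<union> ?p ` Q)"
      (is "_ \<in> ?K")
    proof -
      assume K: "Idl ?S \<subseteq> ?K" "c j \<in> ?K" "ideal ?K R"
      have "t \<in> ?K" using K(1) tS by blast
      moreover have "q \<otimes> c j \<in> ?K" using ideal.I_l_closed[OF K(3,2) q(1)] .
      ultimately show ?thesis using ideal_add_closed[OF K(3)] by blast
    qed
    moreover have "t \<oplus> q \<otimes> c j = y'" unfolding t_def using y' q(1) cj by algebra
    ultimately show ?case using insert.IH[of y] insert.prems(2) j unfolding y'_def by simp
  qed
qed

lemma mon_replicate: "c i \<in> carrier R \<Longrightarrow> mon c (replicate_mset k i) = c i [^] k"
proof (induction k)
  case (Suc k)
  have "mon c (add_mset i (replicate_mset k i)) = mon c (replicate_mset k i) \<otimes> c i"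
    using Suc.prems by (intro mon_add_mset) (auto split: if_splits)
  then show ?case using Suc by simp
qed simp

text \<open>Quasi-regularity of a system of parameters. The later monomials in the sorted list, like
  those of size \<open>k\<close>, have some exponent exceeding that of \<open>m\<close>, so they lie
  in the ideal of the \<open>c i [^] Suc (count m i)\<close>; then \<open>monomial_colon\<close>
  with \<open>Q = B\<close> puts the coefficient of \<open>m\<close> into the ideal of the
  parameters.\<close>

lemma monomials_indep:
  fixes c :: "nat \<Rightarrow> 'a"
  assumes F: "regular_flag A z d" "A 0 = {\<zero>}" "\<And>i. i < d \<Longrightarrow> z i \<in> M"
    and B: "finite B" "card B \<le> d" and c: "\<And>i. c i \<in> carrier R"
    and nil: "\<And>m. m \<in> M \<Longrightarrow> \<exists>N::nat. m [^] N \<in> Idl (c ` B)"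
    and "distinct ms" "sorted (map size ms)" "set ms \<subseteq> small_multisets B k"
  shows "indep (Idl (c ` B)) (ipow (Idl (c ` B)) k) (map (mon c) ms)"
  using assms(8-)
proof (induction ms)
  case (Cons m ms)
  have cB: "c ` B \<subseteq> carrier R" using c by auto
  have J: "ideal (Idl (c ` B)) R" by (rule genideal_ideal[OF cB])
  have m: "set_mset m \<subseteq> B" "size m < k" using Cons.prems by auto
  let ?p = "\<lambda>i. c i [^] Suc (count m i)"
  have pS: "?p ` B \<subseteq> carrier R" using c by auto
  have N: "ideal (Idl (?p ` B)) R" by (rule genideal_ideal[OF pS])
  have big: "mon c m' \<in> Idl (?p ` B)" if m': "set_mset m' \<subseteq> B" "m' \<noteq> m" "size m \<le> size m'" for m'
  proof -
    obtain i where i: "i \<in> B" "count m i < count m' i" using exists_larger_count[OF m'] by blast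
    let ?r = "replicate_mset (Suc (count m i)) i"
    have "?r \<subseteq># m'" using i by (simp add: count_le_replicate_mset_subset_eq[symmetric] Suc_leI del: replicate_mset_Suc)
    then have "m' = (m' - ?r) + ?r" by (rule subset_mset.diff_add[symmetric])
    then have "mon c m' = mon c (m' - ?r) \<otimes> mon c ?r" using mon_add[of "m' - ?r" c ?r] c by metis
    also have "mon c ?r = ?p i" by (rule mon_replicate) (rule c)
    finally have "mon c m' = mon c (m' - ?r) \<otimes> ?p i" .
    moreover have "?p i \<in> Idl (?p ` B)" using genideal_self[OF pS] i by blast
    ultimately show ?thesis using ideal.I_l_closed[OF N, of "?p i" "mon c (m' - ?r)"] c by simp
  qed
  have "lin (map (mon c) ms) (ipow (Idl (c ` B)) k) \<subseteq> Idl (?p ` B)"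
  proof (rule lin_minimal[OF N])
    show "ipow (Idl (c ` B)) k \<subseteq> Idl (?p ` B)"
    proof (rule Idl_ipow_subset[OF N c])
      show "mon c m' \<in> Idl (?p ` B)" if "set_mset m' \<subseteq> B" "size m' = k" for m'
        by (rule big) (use that m in auto)
    qed
    show "set (map (mon c) ms) \<subseteq> Idl (?p ` B)"
    proof
      fix y assume "y \<in> set (map (mon c) ms)"
      then obtain m' where m': "m' \<in> set ms" "y = mon c m'" by auto
      then have "set_mset m' \<subseteq> B" "m' \<noteq> m" "size m \<le> size m'" using Cons.prems by auto
      then show "y \<in> Idl (?p ` B)" unfolding m'(2) by (rule big)
    qed
  qed
  then have "y \<in> Idl (c ` B)"
    if "y \<in> carrier R" "y \<otimes> mon c m \<in> lin (map (mon c) ms) (ipow (Idl (c ` B)) k)" for y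
    using that monomial_colon[OF F B c nil order_refl that(1), of "count m"] mon_superset[OF B(1) m(1) c]
    by auto
  then show ?case using Cons c by simp
qed simp

lemma M_power_in_reduction:
  assumes I: "ideal I R" and nil: "\<And>m. m \<in> M \<Longrightarrow> \<exists>N::nat. m [^] N \<in> I" and J: "reduction R I J" and m: "m \<in> M"
  shows "\<exists>N::nat. m [^] N \<in> J"
proof -
  obtain r where r: "ideal J R" "ipow I (Suc r) = J \<cdot> ipow I r" using J unfolding reduction_iff by blast
  obtain N :: nat where "m [^] N \<in> I" using nil[OF m] by blast
  then have "(m [^] N) [^] Suc r \<in> ipow I (Suc r)" by (rule pow_mem_ipow[OF I])
  also have "\<dots> \<subseteq> J" unfolding r(2) using ideal_prod_le(1)[OF r(1) ipow_ideal[OF I]] .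
  finally have "m [^] (N * Suc r) \<in> J" using ideal.Icarr[OF M_ideal m] nat_pow_pow by metis
  then show ?thesis by blast
qed

lemma length_ge_ipow_le:
  assumes I: "ideal I R" and nil: "\<And>m. m \<in> M \<Longrightarrow> \<exists>N::nat. m [^] N \<in> I"
    and "length_ge (ipow I k) (carrier R) n"
  shows "n \<le> the_enat (ring_length (R Quot ipow I k))"
proof (rule length_ge_le_ring_length[OF ipow_ideal[OF I] _ assms(3)])
  fix m assume m: "m \<in> M"
  obtain N :: nat where "m [^] N \<in> I" using nil[OF m] by blast
  then have "(m [^] N) [^] k \<in> ipow I k" by (rule pow_mem_ipow[OF I])
  then have "m [^] (N * k) \<in> ipow I k" using ideal.Icarr[OF M_ideal m] by (simp add: nat_pow_pow)
  then show "\<exists>N::nat. m [^] N \<in> ipow I k" by blast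
qed

text \<open>With \<open>J\<close> the ideal of the \<open>c i\<close>, \<open>I^(k+r)\<close> lies
  in \<open>J^k\<close>, and the monomials of size below \<open>k\<close> are independent modulo
  \<open>J^k\<close>. So the length of \<open>R/I^(k+r)\<close> is at least
  \<open>L k^d / d!\<close>; dividing by \<open>(k+r)^d\<close> and letting \<open>k\<close> grow
  gives the bound.\<close>

lemma length_le_multiplicity:
  fixes c :: "nat \<Rightarrow> 'a"
  assumes I: "ideal I R" and nil: "\<And>m. m \<in> M \<Longrightarrow> \<exists>N::nat. m [^] N \<in> I"
    and mult: "(\<lambda>k. fact d * real (the_enat (ring_length (R Quot ipow I k))) / real k ^ d) \<longlonglongrightarrow> e"
    and F: "regular_flag A z d" "A 0 = {\<zero>}" "\<And>i. i < d \<Longrightarrow> z i \<in> M"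
    and B: "finite B" "card B = d" and c: "\<And>i. c i \<in> carrier R"
    and red: "reduction R I (Idl (c ` B))" and L: "length_ge (Idl (c ` B)) (carrier R) L"
  shows "real L \<le> e"
proof -
  let ?J = "Idl (c ` B)"
  have J: "ideal ?J R" using red unfolding reduction_iff by blast
  obtain r where r: "ipow I (Suc r) = ?J \<cdot> ipow I r" using red unfolding reduction_iff by blast
  let ?l = "\<lambda>k. the_enat (ring_length (R Quot ipow I k))"
  have nat_bound: "k ^ d * L \<le> fact d * ?l (k + r)" if k: "1 \<le> k" for k
  proof -
    obtain ms :: "nat multiset list" where ms: "set ms = small_multisets B k" "distinct ms" "sorted (map size ms)"
      using sorted_list_of_small_multisets[OF B(1)] by blast
    have "indep ?J (ipow ?J k) (map (mon c) ms)"
      using monomials_indep[OF F B(1) _ c M_power_in_reduction[OF I nil red] ms(2,3)] B(2) ms(1) by auto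
    then have "length_ge (ipow ?J k) (carrier R) (length ms * L)"
      using length_ge_indep'[OF J ipow_ideal[OF J] L] by fastforce
    moreover have "ipow I (k + r) \<subseteq> ipow ?J k"
      using reduction_ipow(2)[OF I J r, of k] ideal_prod_le(1)[OF ipow_ideal[OF J] ipow_ideal[OF I]]
      by (simp add: add.commute)
    ultimately have "length ms * L \<le> ?l (k + r)"
      using length_ge_mono length_ge_ipow_le[OF I nil] by blast
    moreover have "length ms = card (small_multisets B k)" using ms distinct_card by metis
    moreover have "k ^ d \<le> fact d * card (small_multisets B k)"
      using card_small_multisets_ge[OF B(1) k] B(2) by simp
    ultimately have "k ^ d * L \<le> fact d * (length ms * L)" by (metis mult.assoc mult_le_mono1)
    also have "\<dots> \<le> fact d * ?l (k + r)" using \<open>length ms * L \<le> ?l (k + r)\<close> by simp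
    finally show ?thesis .
  qed
  have "(\<lambda>k. real r / real k) \<longlonglongrightarrow> 0" by (rule lim_const_over_n)
  then have "(\<lambda>k. real L * (1 / (1 + real r / real k)) ^ d) \<longlonglongrightarrow> real L * (1 / (1 + 0)) ^ d"
    by (intro tendsto_intros) auto
  then have lim: "(\<lambda>k. real L * (1 / (1 + real r / real k)) ^ d) \<longlonglongrightarrow> real L" by simp
  have "(\<lambda>k. fact d * real (?l (k + r)) / real (k + r) ^ d) \<longlonglongrightarrow> e"
    using LIMSEQ_ignore_initial_segment[OF mult, of r] .
  from lim this show ?thesis
  proof (rule LIMSEQ_le)
    have "real L * (1 / (1 + real r / real k)) ^ d \<le> fact d * real (?l (k + r)) / real (k + r) ^ d" if "k \<ge> 1" for k
    proof -
      have "1 / (1 + real r / real k) = real k / real (k + r)" using that by (simp add: field_simps)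
      then have "real L * (1 / (1 + real r / real k)) ^ d = real (k ^ d * L) / real (k + r) ^ d"
        by (simp add: power_divide)
      also have "\<dots> \<le> real (fact d * ?l (k + r)) / real (k + r) ^ d"
        using nat_bound[OF that] by (intro divide_right_mono) (simp_all only: of_nat_le_iff, simp)
      finally show ?thesis by simp
    qed
    then show "\<exists>N. \<forall>k\<ge>N. real L * (1 / (1 + real r / real k)) ^ d \<le> fact d * real (?l (k + r)) / real (k + r) ^ d"
      by blast
  qed
qed

text \<open>The chain consists of \<open>J\<close> plus the multiples of \<open>f^i\<close>, for
  \<open>i\<close> from \<open>Suc e\<close> down to 0. It is strict: if \<open>f^i\<close> lay in
  the next smaller ideal, a unit \<open>1 - q f\<close> would carry it into \<open>J\<close>. The
  step up to \<open>f^0 = 1\<close> is what makes the number of steps \<open>Suc e\<close>.\<close>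

lemma length_ge_of_power_notin:
  assumes J: "ideal J R" "f \<in> M" "f [^] (e::nat) \<notin> J"
  shows "length_ge J (carrier R) (Suc e)"
proof -
  have f: "f \<in> carrier R" using ideal.Icarr[OF M_ideal assms(2)] .
  define E where "E i = lin [f [^] i] J" for i :: nat
  have E: "ideal (E i) R" and JE: "J \<subseteq> E i" and fE: "f [^] i \<in> E i" for i
    using lin_ideal[OF J(1), of "[f [^] i]"] lin_superset[OF J(1), of "[f [^] i]"] f by (auto simp: E_def)
  have notin: "f [^] i \<notin> J" if "i \<le> e" for i
  proof
    assume "f [^] i \<in> J"
    then have "f [^] (e - i) \<otimes> f [^] i \<in> J" using f ideal.I_l_closed[OF J(1)] by simp
    then show False using J(3) that f by (simp add: nat_pow_mult)
  qed
  have step: "E (Suc i) \<subset> E i" if i: "i \<le> e" for i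
  proof -
    have "f [^] Suc i \<in> E i" using ideal.I_r_closed[OF E fE f] by simp
    then have "E (Suc i) \<subseteq> E i" unfolding E_def[of "Suc i"] by (intro lin_minimal E JE) auto
    moreover have "f [^] i \<notin> E (Suc i)"
    proof
      assume "f [^] i \<in> E (Suc i)"
      then obtain q r where q: "f [^] i = q \<otimes> f [^] Suc i \<oplus> r" "q \<in> carrier R" "r \<in> J"
        unfolding E_def by auto
      have rc: "r \<in> carrier R" using ideal.Icarr[OF J(1) q(3)] .
      have fi: "f [^] i \<in> carrier R" using f by simp
      have "\<one> \<ominus> q \<otimes> f \<notin> M"
      proof
        assume "\<one> \<ominus> q \<otimes> f \<in> M"
        then have "(\<one> \<ominus> q \<otimes> f) \<oplus> q \<otimes> f \<in> M"
          using ideal.I_l_closed[OF M_ideal J(2) q(2)] ideal_add_closed[OF M_ideal] by blast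
        moreover have "(\<one> \<ominus> q \<otimes> f) \<oplus> q \<otimes> f = \<one>" using f q(2) by algebra
        ultimately show False using M_proper by simp
      qed
      then have u: "\<one> \<ominus> q \<otimes> f \<in> Units R" using unit_iff_notin_M f q by simp
      have id: "(\<one> \<ominus> q \<otimes> f) \<otimes> t = t \<ominus> q \<otimes> (t \<otimes> f)" if "t \<in> carrier R" for t
        using that f q(2) by algebra
      have id2: "(a \<oplus> b) \<ominus> a = b" if "a \<in> carrier R" "b \<in> carrier R" for a b using that by algebra
      have "(\<one> \<ominus> q \<otimes> f) \<otimes> f [^] i = f [^] i \<ominus> q \<otimes> f [^] Suc i" using id[OF fi] by simp
      also have "\<dots> = (q \<otimes> f [^] Suc i \<oplus> r) \<ominus> q \<otimes> f [^] Suc i" using q(1) by simp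
      also have "\<dots> = r" using id2[of "q \<otimes> f [^] Suc i" r] f q(2) rc by simp
      finally have e: "(\<one> \<ominus> q \<otimes> f) \<otimes> f [^] i \<in> J" using q(3) by simp
      have "f [^] i = inv (\<one> \<ominus> q \<otimes> f) \<otimes> ((\<one> \<ominus> q \<otimes> f) \<otimes> f [^] i)"
        using u fi m_assoc[of "inv (\<one> \<ominus> q \<otimes> f)" "\<one> \<ominus> q \<otimes> f" "f [^] i"] f q(2) by simp
      then have "f [^] i \<in> J" using ideal.I_l_closed[OF J(1) e, of "inv (\<one> \<ominus> q \<otimes> f)"] u by simp
      then show False using notin[OF i] by simp
    qed
    ultimately show ?thesis using fE by blast
  qed
  have "length_ge J (E (Suc e - i)) i" if "i \<le> Suc e" for i
    using that
  proof (induction i)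
    case 0
    then show ?case using length_ge_0[OF J(1) JE] by simp
  next
    case (Suc i)
    then have "Suc e - i = Suc (Suc e - Suc i)" "Suc e - Suc i \<le> e" by auto
    then show ?case using length_ge_Suc[OF _ E step] Suc by (metis Suc_leD)
  qed
  from this[of "Suc e"] show ?thesis using length_ge_mono ideal_carrier[OF E] by blast
qed

subsection \<open>Existence of small reductions\<close>

text \<open>Turns a relation among monomials into a form of degree \<open>D\<close>: monomials of
  larger size lie in \<open>I^(D+1)\<close> and are dropped.\<close>

lemma lin_monomials_homogeneous:
  assumes I: "ideal I R" and a: "\<And>i. a i \<in> I" and W: "W \<subseteq> ipow I (Suc D)"
    and "\<And>m. m \<in> set ms \<Longrightarrow> D \<le> size m \<and> set_mset m \<subseteq> A"
    and "y \<in> lin (map (mon a) ms) W"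
  shows "\<exists>Q\<in>carrier (PR A). (\<forall>m. Q m \<noteq> \<zero> \<longrightarrow> size m = D \<and> m \<in> set ms) \<and> y \<ominus> peval a Q \<in> ipow I (Suc D)"
  using assms(4,5)
proof (induction ms arbitrary: y)
  have ac: "a i \<in> carrier R" for i using a ideal.Icarr[OF I] by auto
  case Nil
  then have y: "y \<in> ipow I (Suc D)" "y \<in> carrier R" using W ideal.Icarr[OF ipow_ideal[OF I]] by auto
  interpret T: cring "PR A" by (rule PR_cring)
  have "peval a \<zero>\<^bsub>PR A\<^esub> = \<zero>" using ac by (simp add: PR_simps)
  then have "y \<ominus> peval a \<zero>\<^bsub>PR A\<^esub> \<in> ipow I (Suc D)" using y by (simp add: a_minus_def)
  moreover have "\<zero>\<^bsub>PR A\<^esub> m = \<zero>" for m by (rule PR_zero_coeff)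
  ultimately show ?case using T.zero_closed by blast
next
  case (Cons m ms)
  interpret T: cring "PR A" by (rule PR_cring)
  have ac: "a i \<in> carrier R" for i using a ideal.Icarr[OF I] by auto
  have IpI: "ideal (ipow I k) R" for k using I by simp
  obtain q r where q: "y = q \<otimes> mon a m \<oplus> r" "q \<in> carrier R" "r \<in> lin (map (mon a) ms) W" using Cons.prems by auto
  obtain Q where Q: "Q \<in> carrier (PR A)" "\<And>m. Q m \<noteq> \<zero> \<Longrightarrow> size m = D \<and> m \<in> set ms"
    "r \<ominus> peval a Q \<in> ipow I (Suc D)" using Cons.IH[OF _ q(3)] Cons.prems(1) by auto
  have m: "set_mset m \<subseteq> A" "D \<le> size m" using Cons.prems(1) by auto
  have Wc: "ideal (lin (map (mon a) ms) (ipow I (Suc D))) R"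
    using ac by (intro lin_ideal IpI) auto
  have "lin (map (mon a) ms) W \<subseteq> lin (map (mon a) ms) (ipow I (Suc D))" for ms
    using W by (induction ms) auto
  then have rc: "r \<in> carrier R" using q(3) ideal.Icarr[OF Wc] by blast
  have pc: "peval a Q \<in> carrier R" "mon a m \<in> carrier R" using Q ac by auto
  show ?case
  proof (cases "size m = D")
    case True
    let ?t = "mterm q m"
    have t: "?t \<in> carrier (PR A)" unfolding PR_simps by (rule mterm_closed[OF q(2) m(1)])
    have "peval a ?t = (\<Oplus>k\<in>{m}. ?t k \<otimes> mon a k)"
      using ac q(2) by (intro peval_superset) (auto simp: mterm_def split: if_splits)
    then have pt: "peval a ?t = q \<otimes> mon a m" using q(2) pc by (simp add: mterm_def)
    have "y \<ominus> peval a (?t \<oplus>\<^bsub>PR A\<^esub> Q) = r \<ominus> peval a Q"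
      unfolding peval_add[OF t Q(1) ac] pt q(1) using q(2) pc rc by algebra
    moreover have "size k = D \<and> k \<in> set (m # ms)" if "(?t \<oplus>\<^bsub>PR A\<^esub> Q) k \<noteq> \<zero>" for k
      using that Q(2)[of k] Q(1) True unfolding PR_add_coeff mterm_def by (cases "k = m") auto
    ultimately show ?thesis using Q(3) t Q(1) by (intro bexI[of _ "?t \<oplus>\<^bsub>PR A\<^esub> Q"]) auto
  next
    case False
    then have "mon a m \<in> ipow I (Suc D)"
      using mon_mem_ipow[OF I, of m a] a m(2) ipow_mono[OF I, of "Suc D" "size m"] by auto
    then have "q \<otimes> mon a m \<oplus> (r \<ominus> peval a Q) \<in> ipow I (Suc D)"
      using Q(3) q(2) ideal_add_closed[OF IpI] ideal.I_l_closed[OF IpI] by blast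
    moreover have "y \<ominus> peval a Q = q \<otimes> mon a m \<oplus> (r \<ominus> peval a Q)"
      unfolding q(1) using q(2) pc rc by algebra
    ultimately show ?thesis using Q(1,2) by (intro bexI[of _ Q]) auto
  qed
qed

text \<open>Generators are dropped while there are more than \<open>d\<close>. If there were no
  relation for \<open>reduction_drop_generator\<close>, the monomials in the generators would be
  independent over the residue field, and the length of \<open>R/I^k\<close> would grow like
  \<open>k\<close> to the number of generators, faster than the limit allows.\<close>

theorem exists_small_reduction:
  fixes a :: "nat \<Rightarrow> 'a"
  assumes inf: "infinite (carrier (R Quot M))"
    and I: "ideal I R" "I \<subseteq> M" and nil: "\<And>m. m \<in> M \<Longrightarrow> \<exists>N::nat. m [^] N \<in> I"
    and mult: "(\<lambda>k. fact d * real (the_enat (ring_length (R Quot ipow I k))) / real k ^ d) \<longlonglongrightarrow> e"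
    and "finite A" "\<And>i. a i \<in> I" "reduction R I (Idl (a ` A))"
  shows "\<exists>(A' :: nat set) a'. finite A' \<and> card A' \<le> d \<and> (\<forall>i. a' i \<in> I) \<and> reduction R I (Idl (a' ` A')) \<and>
    Idl (a' ` A') \<subseteq> Idl (a ` (A :: nat set))"
  using assms(6-)
proof (induction "card A" arbitrary: A a rule: less_induct)
  case less
  note A = less.prems(1) and a = less.prems(2) and red = less.prems(3)
  show ?case
  proof (cases "card A \<le> d")
    case True
    then show ?thesis using A a red by (intro exI[of _ A] exI[of _ a]) simp
  next
    case False
    have ac: "a i \<in> carrier R" for i using a ideal.Icarr[OF I(1)] by auto
    have IpI: "ideal (ipow I k) R" for k using I(1) by simp
    let ?l = "\<lambda>k. the_enat (ring_length (R Quot ipow I k))"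
    have "\<exists>P D m0. P \<in> carrier (PR A) \<and> (\<forall>m. P m \<noteq> \<zero> \<longrightarrow> size m = D) \<and> P m0 \<notin> M \<and> peval a P \<in> M \<cdot> ipow I D"
    proof (rule ccontr)
      assume no: "\<not> ?thesis"
      have bound: "k ^ card A \<le> fact (card A) * ?l k" if k: "1 \<le> k" for k
      proof -
        obtain ms where ms: "set ms = small_multisets A k" "distinct ms" "sorted (map size ms)"
          using sorted_list_of_small_multisets[OF A] by blast
        have "indep M (ipow I k) (map (mon a) ms')"
          if "distinct ms'" "sorted (map size ms')" "set ms' \<subseteq> small_multisets A k" for ms'
          using that
        proof (induction ms')
          case (Cons m ms')
          interpret T: cring "PR A" by (rule PR_cring)
          have m: "set_mset m \<subseteq> A" "size m < k" "m \<notin> set ms'" using Cons.prems by auto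
          \<comment> \<open>A dependence whose coefficient \<open>y\<close> is outside
            \<open>M\<close>, cut down to degree \<open>size m\<close>, is a relation
            \<open>P\<close> of the excluded kind: its value lies in \<open>I^(size m + 1)\<close>,
            which is inside \<open>M I^(size m)\<close>.\<close>
          have "y \<in> M" if y: "y \<in> carrier R" "y \<otimes> mon a m \<in> lin (map (mon a) ms') (ipow I k)" for y
          proof (rule ccontr)
            assume yM: "y \<notin> M"
            obtain Q where Q: "Q \<in> carrier (PR A)" "\<And>m'. Q m' \<noteq> \<zero> \<Longrightarrow> size m' = size m \<and> m' \<in> set ms'"
              "y \<otimes> mon a m \<ominus> peval a Q \<in> ipow I (Suc (size m))"
            proof -
              have "size m \<le> size m' \<and> set_mset m' \<subseteq> A" if "m' \<in> set ms'" for m'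
                using Cons.prems that by auto
              moreover have "ipow I k \<subseteq> ipow I (Suc (size m))" using ipow_mono[OF I(1)] m(2) by simp
              ultimately show thesis
                using lin_monomials_homogeneous[OF I(1) a _ _ y(2), of "size m" A] that by blast
            qed
            let ?t = "mterm y m"
            have t: "?t \<in> carrier (PR A)" unfolding PR_simps by (rule mterm_closed[OF y(1) m(1)])
            have mc: "mon a m \<in> carrier R" using ac by simp
            have "peval a ?t = (\<Oplus>k\<in>{m}. ?t k \<otimes> mon a k)"
              using ac y(1) by (intro peval_superset) (auto simp: mterm_def split: if_splits)
            then have pt: "peval a ?t = y \<otimes> mon a m" using y(1) mc by (simp add: mterm_def)
            let ?P = "?t \<ominus>\<^bsub>PR A\<^esub> Q"
            have co: "?P k = ?t k \<ominus> Q k" for k using PR_minus_coeff[OF t Q(1)] .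
            have "Q m = \<zero>" using Q(2) m(3) by blast
            then have "?P m = y" unfolding co using y(1) by (simp add: mterm_def a_minus_def)
            then have 1: "?P m \<notin> M" using yM by simp
            have 2: "size k = size m" if "?P k \<noteq> \<zero>" for k
              using that[unfolded co] Q(2)[of k] Q(1)
              by (cases "k = m"; cases "Q k = \<zero>") (simp_all add: mterm_def a_minus_def)
            interpret h: ring_hom_cring "PR A" R "peval a" by unfold_locales (rule peval_hom[OF ac])
            have "peval a ?P = y \<otimes> mon a m \<ominus> peval a Q" using t Q(1) pt by (simp add: a_minus_def)
            then have "peval a ?P \<in> I \<cdot> ipow I (size m)" using Q(3) ipow_Suc'[OF I(1)] by simp
            then have 3: "peval a ?P \<in> M \<cdot> ipow I (size m)" using ideal_prod_mono[OF I(2) order_refl] by blast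
            have "?P \<in> carrier (PR A)" using t Q(1) by simp
            then show False using no 1 2 3 by blast
          qed
          then show ?case using Cons ac by simp
        qed simp
        then have ind: "indep M (ipow I k) (map (mon a) ms)" using ms by simp
        have "length_ge M (carrier R) (Suc 0)"
          using length_ge_Suc[OF length_ge_0[OF M_ideal order_refl] oneideal] ideal_carrier[OF M_ideal] M_proper by blast
        then have "length_ge (ipow I k) (carrier R) (length (map (mon a) ms) * Suc 0)"
          by (rule length_ge_indep'[OF M_ideal IpI _ ind])
        then have "length ms \<le> ?l k" using length_ge_ipow_le[OF I(1) nil] by auto
        moreover have "length ms = card (small_multisets A k)" using ms distinct_card by metis
        ultimately have "fact (card A) * card (small_multisets A k) \<le> fact (card A) * ?l k" by simp
        then show ?thesis using card_small_multisets_ge[OF A k] by linarith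
      qed
      let ?f = "\<lambda>k. fact d * real (?l k) / real k ^ d"
      have lower: "real k \<le> fact (card A) * ?f k" if k: "k \<ge> 1" for k
      proof -
        have "k ^ Suc d \<le> k ^ card A" using k False by (intro power_increasing) auto
        then have "k ^ Suc d \<le> fact (card A) * ?l k" using bound[OF k] by linarith
        then have "real (k ^ Suc d) \<le> real (fact (card A) * ?l k)" by (simp only: of_nat_le_iff)
        then have "real k * real k ^ d \<le> fact (card A) * real (?l k)" by simp
        then have "real k \<le> fact (card A) * real (?l k) / real k ^ d" using k by (simp add: field_simps)
        also have "\<dots> \<le> fact (card A) * ?f k"
        proof -
          have "real (?l k) \<le> fact d * real (?l k)" using mult_right_mono[OF fact_ge_1[of d, where 'a = real]] by fastforce
          then show ?thesis using k by (simp add: divide_right_mono mult_left_mono)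
        qed
        finally show ?thesis .
      qed
      \<comment> \<open>A convergent sequence is bounded, which contradicts the linear lower
        bound.\<close>
      obtain C where C: "norm (?f k) \<le> C" for k
        using BseqE[OF convergent_imp_Bseq[OF convergentI[OF mult]]] by blast
      obtain k :: nat where k: "max 1 (fact (card A) * C) < real k" using reals_Archimedean2 by blast
      then have "real k \<le> fact (card A) * ?f k" by (intro lower) simp
      also have "\<dots> \<le> fact (card A) * C" using C[of k] by (intro mult_left_mono) simp_all
      finally show False using k by simp
    qed
    then obtain P D m0 where P: "P \<in> carrier (PR A)" "\<And>m. P m \<noteq> \<zero> \<Longrightarrow> size m = D" "P m0 \<notin> M"
      "peval a P \<in> M \<cdot> ipow I D" by blast
    obtain i0 a' where a': "i0 \<in> A" "\<And>i. a' i \<in> I" "reduction R I (Idl (a' ` (A - {i0})))"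
      "Idl (a' ` (A - {i0})) \<subseteq> Idl (a ` A)"
      using reduction_drop_generator[OF inf I A a red P] by blast
    have "card (A - {i0}) < card A" by (rule card_Diff1_less[OF A a'(1)])
    then have "\<exists>(A'' :: nat set) a''. finite A'' \<and> card A'' \<le> d \<and> (\<forall>i. a'' i \<in> I) \<and> reduction R I (Idl (a'' ` A'')) \<and>
      Idl (a'' ` A'') \<subseteq> Idl (a' ` (A - {i0}))"
      using less.hyps[of "A - {i0}" a'] A a'(2,3) by blast
    then show ?thesis using a'(4) by (meson order_trans)
  qed
qed

end

section \<open>Specialisations of the generic ideal\<close>

context cring
begin

lemma add_diff: assumes "x \<in> carrier R" "y \<in> carrier R" shows "x \<oplus> (y \<ominus> x) = y"
  using assms by algebra

lemma diff_diff: assumes "x \<in> carrier R" "y \<in> carrier R" shows "x \<oplus> \<ominus> (x \<ominus> y) = y"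
  using assms by algebra

lemma add_mult_diff:
  assumes "x \<in> carrier R" "y \<in> carrier R" "b \<in> carrier R" "s \<in> carrier R" "p \<in> carrier R" "q \<in> carrier R"
  shows "(x \<otimes> b \<oplus> p) \<otimes> s \<ominus> (y \<otimes> b \<oplus> q) \<otimes> s = (x \<ominus> y) \<otimes> (b \<otimes> s) \<oplus> (p \<otimes> s \<ominus> q \<otimes> s)"
  using assms by algebra

lemma peval_ring_hom_cring:
  assumes "\<And>i. x i \<in> carrier R"
  shows "ring_hom_cring (PR V) R (peval x)"
proof -
  interpret T: cring "PR V" by (rule PR_cring)
  show ?thesis by (intro ring_hom_cringI peval_hom[OF assms] T.is_cring is_cring)
qed

lemma peval_vimage_ideal:
  assumes J: "ideal J R" and x: "\<And>i. x i \<in> carrier R"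
  shows "ideal {P \<in> carrier (PR V). peval x P \<in> J} (PR V)"
proof -
  interpret T: cring "PR V" by (rule PR_cring)
  interpret h: ring_hom_cring "PR V" R "peval x" by (rule peval_ring_hom_cring[OF x])
  show ?thesis
  proof (rule idealI[OF T.ring_axioms])
    show "subgroup {P \<in> carrier (PR V). peval x P \<in> J} (add_monoid (PR V))"
    proof (rule T.add.subgroupI)
      show "{P \<in> carrier (PR V). peval x P \<in> J} \<noteq> {}"
        using ideal_zero_closed[OF J] h.hom_zero T.zero_closed by force
    qed (use ideal_add_closed[OF J] ideal_uminus_closed[OF J] in \<open>auto simp flip: a_inv_def\<close>)
    fix P Q assume "P \<in> {P \<in> carrier (PR V). peval x P \<in> J}" "Q \<in> carrier (PR V)"
    then show "Q \<otimes>\<^bsub>PR V\<^esub> P \<in> {P \<in> carrier (PR V). peval x P \<in> J}"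
      "P \<otimes>\<^bsub>PR V\<^esub> Q \<in> {P \<in> carrier (PR V). peval x P \<in> J}"
      using ideal.I_l_closed[OF J] ideal.I_r_closed[OF J] h.hom_closed by auto
  qed
qed

lemma Idl_image_finsum:
  assumes "finite S" "g \<in> S \<rightarrow> carrier R" "x \<in> Idl (g ` S)"
  shows "\<exists>w. (\<forall>i. w i \<in> carrier R) \<and> x = (\<Oplus>i\<in>S. w i \<otimes> g i)"
  using assms
proof (induction S arbitrary: x)
  case empty
  have "Idl {} \<subseteq> {\<zero>}" by (rule genideal_minimal[OF zeroideal]) simp
  then show ?case using empty by (intro exI[of _ "\<lambda>_. \<zero>"]) auto
next
  case (insert i S)
  obtain q r where q: "q \<in> carrier R" "r \<in> Idl (g ` S)" "x = q \<otimes> g i \<oplus> r"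
    using Idl_insert_mem[of "g ` S" "g i" x] insert.prems by auto
  obtain w where w: "\<And>i. w i \<in> carrier R" "r = (\<Oplus>i\<in>S. w i \<otimes> g i)"
    using insert.IH[OF _ q(2)] insert.prems by auto
  have "(\<Oplus>k\<in>S. (w(i := q)) k \<otimes> g k) = r"
    unfolding w(2) using insert w(1) by (intro finsum_cong') auto
  then have "(\<Oplus>k\<in>insert i S. (w(i := q)) k \<otimes> g k) = x"
    unfolding q(3) using insert w(1) q(1) by (subst finsum_insert) auto
  then show ?case using w(1) q(1) by (intro exI[of _ "w(i := q)"]) auto
qed

text \<open>The value of the \<open>l\<close>-th generator of the generic ideal at \<open>X \<mapsto> y\<close>.\<close>

definition gvalue :: "nat \<Rightarrow> (nat \<Rightarrow> 'a) \<Rightarrow> (nat \<times> nat \<Rightarrow> 'a) \<Rightarrow> nat \<Rightarrow> 'a" where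
  "gvalue n g y l = (\<Oplus>j\<in>{1..n}. y (j, l) \<otimes> g j)"

lemma gvalue_closed:
  "g \<in> {1..n} \<rightarrow> carrier R \<Longrightarrow> (\<And>i. y i \<in> carrier R) \<Longrightarrow> gvalue n g y l \<in> carrier R"
  unfolding gvalue_def by (intro finsum_closed) auto

lemma gvalue_in_Idl:
  assumes "g \<in> {1..n} \<rightarrow> carrier R" "\<And>i. y i \<in> carrier R"
  shows "gvalue n g y l \<in> Idl (g ` {1..n})"
proof -
  have I: "ideal (Idl (g ` {1..n})) R" using assms by (intro genideal_ideal) auto
  have "g ` {1..n} \<subseteq> Idl (g ` {1..n})" using assms by (intro genideal_self) auto
  then show ?thesis unfolding gvalue_def
    using assms by (intro finsum_in_ideal[OF I] ideal.I_l_closed[OF I]) auto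
qed

lemma gform_in_generic_ideal:
  assumes g: "g \<in> {1..n} \<rightarrow> carrier R" and l: "l \<in> {1..d}"
  shows "gform n d g l \<in> generic_ideal R n g d"
proof -
  interpret T: cring "PR ({1..n} \<times> {1..d})" by (rule PR_cring)
  have "gform n d g l \<in> set (gforms n d g)" unfolding set_map by (rule imageI) (use l in auto)
  then show ?thesis unfolding generic_ideal_eq using T.genideal_self[OF gforms_closed[OF g]] by blast
qed

lemma generic_ideal_ideal:
  assumes g: "g \<in> {1..n} \<rightarrow> carrier R"
  shows "ideal (generic_ideal R n g d) (PR ({1..n} \<times> {1..d}))"
proof -
  interpret T: cring "PR ({1..n} \<times> {1..d})" by (rule PR_cring)
  show ?thesis unfolding generic_ideal_eq by (rule T.genideal_ideal[OF gforms_closed[OF g]])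
qed

lemma peval_gform:
  assumes g: "g \<in> {1..n} \<rightarrow> carrier R" and l: "l \<in> {1..d}" and y: "\<And>i. y i \<in> carrier R"
  shows "peval y (gform n d g l) = gvalue n g y l"
proof -
  interpret h: ring_hom_cring "PR ({1..n} \<times> {1..d})" R "peval y" by (rule peval_ring_hom_cring[OF y])
  have "peval y (gform n d g l) = (\<Oplus>j\<in>{1..n}. (peval y \<circ> (\<lambda>j. indexed_var (j, l)
      \<otimes>\<^bsub>PR ({1..n} \<times> {1..d})\<^esub> indexed_const (g j))) j)"
    unfolding gform_def using gform_term_closed[OF g _ l] by (subst h.hom_finsum) auto
  also have "\<dots> = gvalue n g y l" unfolding gvalue_def
  proof (intro finsum_cong')
    fix j assume j: "j \<in> {1..n}"
    then have v: "indexed_var (j, l) \<in> carrier (PR ({1..n} \<times> {1..d}))" "g j \<in> carrier R"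
      using l g by (auto intro: PR_var_closed)
    then show "(peval y \<circ> (\<lambda>j. indexed_var (j, l) \<otimes>\<^bsub>PR ({1..n} \<times> {1..d})\<^esub> indexed_const (g j))) j = y (j, l) \<otimes> g j"
      unfolding comp_def using h.hom_mult[OF v(1) PR_const_closed[OF v(2)]] y by simp
  qed (use g y in auto)
  finally show ?thesis .
qed

lemma peval_generic_ideal:
  assumes g: "g \<in> {1..n} \<rightarrow> carrier R" and y: "\<And>i. y i \<in> carrier R" and "b \<in> generic_ideal R n g d"
  shows "peval y b \<in> Idl (gvalue n g y ` {1..d})"
proof -
  interpret T: cring "PR ({1..n} \<times> {1..d})" by (rule PR_cring)
  have c: "gvalue n g y ` {1..d} \<subseteq> carrier R"
    using gvalue_closed[OF g y] by auto
  let ?L = "{P \<in> carrier (PR ({1..n} \<times> {1..d})). peval y P \<in> Idl (gvalue n g y ` {1..d})}"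
  have "generic_ideal R n g d \<subseteq> ?L" unfolding generic_ideal_eq
  proof (rule T.genideal_minimal[OF peval_vimage_ideal[OF genideal_ideal[OF c] y]])
    show "set (gforms n d g) \<subseteq> ?L"
      using gform_closed[OF g] peval_gform[OF g _ y] genideal_self[OF c] by auto
  qed
  then show ?thesis using assms by blast
qed

text \<open>Each constant \<open>gvalue n g y l\<close> differs from the form number
  \<open>l\<close> by an element of the kernel of evaluation, so all constants from the specialised
  ideal lie in the generic ideal plus that kernel.\<close>

lemma exists_generic_lift:
  assumes g: "g \<in> {1..n} \<rightarrow> carrier R" and y: "\<And>i. y i \<in> carrier R"
    and a: "a \<in> Idl (gvalue n g y ` {1..d})"
  shows "\<exists>b\<in>generic_ideal R n g d. peval y b = a"
proof -
  let ?V = "{1..n} \<times> {1..d}"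
  let ?N = "{P \<in> carrier (PR ?V). peval y P \<in> {\<zero>}}"
  interpret T: cring "PR ?V" by (rule PR_cring)
  interpret h: ring_hom_cring "PR ?V" R "peval y" by (rule peval_ring_hom_cring[OF y])
  have B: "ideal (generic_ideal R n g d) (PR ?V)"
    by (rule generic_ideal_ideal[OF g])
  have N: "ideal ?N (PR ?V)" by (rule peval_vimage_ideal[OF zeroideal y])
  have c: "gvalue n g y ` {1..d} \<subseteq> carrier R"
    using gvalue_closed[OF g y] by auto
  let ?L = "{c \<in> carrier R. indexed_const c \<in> generic_ideal R n g d <+>\<^bsub>PR ?V\<^esub> ?N}"
  have "Idl (gvalue n g y ` {1..d}) \<subseteq> ?L"
  proof (rule genideal_minimal[OF const_vimage_ideal[OF T.add_ideals[OF B N]]])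
    show "gvalue n g y ` {1..d} \<subseteq> ?L"
    proof (clarify, intro conjI)
      fix l assume l: "l \<in> {1..d}"
      then show vc: "gvalue n g y l \<in> carrier R" using c by auto
      let ?b = "gform n d g l" and ?v = "indexed_const (gvalue n g y l)"
      have b: "?b \<in> carrier (PR ?V)" by (rule gform_closed[OF g l])
      have "?b \<in> generic_ideal R n g d"
        by (rule gform_in_generic_ideal[OF g l])
      moreover have "?v \<ominus>\<^bsub>PR ?V\<^esub> ?b \<in> ?N"
        using b vc peval_gform[OF g l y] y by (simp add: a_minus_def r_neg)
      moreover have "?v = ?b \<oplus>\<^bsub>PR ?V\<^esub> (?v \<ominus>\<^bsub>PR ?V\<^esub> ?b)"
        using T.add_diff[OF b PR_const_closed[OF vc]] by simp
      ultimately show "?v \<in> generic_ideal R n g d <+>\<^bsub>PR ?V\<^esub> ?N"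
        unfolding set_add_def' by blast
    qed
  qed
  then obtain b \<nu> where b: "b \<in> generic_ideal R n g d" "\<nu> \<in> ?N" "indexed_const a = b \<oplus>\<^bsub>PR ?V\<^esub> \<nu>"
    and ac: "a \<in> carrier R"
    using a unfolding set_add_def' by blast
  have "a = peval y (indexed_const a)" using ac y by simp
  also have "\<dots> = peval y b" unfolding b(3) using b(2) ideal.Icarr[OF B b(1)] y by simp
  finally show ?thesis using b(1) by metis
qed

text \<open>The difference is the sum of the products \<open>(X_jl - y_jl) g_j s\<close>, whose
  first factors vanish at \<open>y\<close>. This congruence supplies the hypothesis of Nakayama's
  lemma over \<open>T\<close>.\<close>

lemma gform_const_congruence:
  assumes g: "g \<in> {1..n} \<rightarrow> carrier R" and l: "l \<in> {1..d}" and y: "\<And>i. y i \<in> carrier R" and s: "s \<in> carrier R"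
    and E: "ideal E (PR ({1..n} \<times> {1..d}))" "\<And>j. j \<in> {1..n} \<Longrightarrow> indexed_const (g j \<otimes> s) \<in> E"
  shows "gform n d g l \<otimes>\<^bsub>PR ({1..n} \<times> {1..d})\<^esub> indexed_const s \<ominus>\<^bsub>PR ({1..n} \<times> {1..d})\<^esub>
      indexed_const (gvalue n g y l \<otimes> s)
    \<in> {P \<in> carrier (PR ({1..n} \<times> {1..d})). peval y P \<in> {\<zero>}} \<cdot>\<^bsub>PR ({1..n} \<times> {1..d})\<^esub> E"
proof -
  let ?V = "{1..n} \<times> {1..d}"
  let ?N = "{P \<in> carrier (PR ?V). peval y P \<in> {\<zero>}}"
  interpret T: cring "PR ?V" by (rule PR_cring)
  interpret h: ring_hom_cring "PR ?V" R "peval y" by (rule peval_ring_hom_cring[OF y])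
  interpret c: ring_hom_cring R "PR ?V" indexed_const
    by (intro ring_hom_cringI is_cring T.is_cring indexed_const_hom)
  have N: "ideal ?N (PR ?V)" by (rule peval_vimage_ideal[OF zeroideal y])
  have NE: "ideal (?N \<cdot>\<^bsub>PR ?V\<^esub> E) (PR ?V)" by (rule T.ideal_prod_is_ideal[OF N E(1)])
  let ?S = "indexed_const s"
  let ?t = "\<lambda>j. indexed_var (j, l) \<otimes>\<^bsub>PR ?V\<^esub> indexed_const (g j)"
  let ?w = "\<lambda>j. y (j, l) \<otimes> g j"
  have sc: "?S \<in> carrier (PR ?V)" using s by simp
  have gc: "g j \<in> carrier R" "?t j \<in> carrier (PR ?V)" "?w j \<in> carrier R" if "j \<in> {1..n}" for j
    using funcset_mem[OF g that] y gform_term_closed[OF g that l] by auto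
  have "(\<Oplus>\<^bsub>PR ?V\<^esub>j\<in>S. ?t j) \<otimes>\<^bsub>PR ?V\<^esub> ?S \<ominus>\<^bsub>PR ?V\<^esub> indexed_const ((\<Oplus>j\<in>S. ?w j) \<otimes> s)
      \<in> ?N \<cdot>\<^bsub>PR ?V\<^esub> E" if "finite S" "S \<subseteq> {1..n}" for S
    using that
  proof (induction S)
    case empty
    have "\<zero>\<^bsub>PR ?V\<^esub> \<otimes>\<^bsub>PR ?V\<^esub> ?S \<ominus>\<^bsub>PR ?V\<^esub> \<zero>\<^bsub>PR ?V\<^esub> = \<zero>\<^bsub>PR ?V\<^esub>" using sc by (simp add: a_minus_def T.r_neg)
    then show ?case using T.ideal_zero_closed[OF NE] s c.hom_zero by (simp add: a_minus_def)
  next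
    case (insert j S)
    have j: "j \<in> {1..n}" using insert by simp
    define F where "F = (\<Oplus>\<^bsub>PR ?V\<^esub>j\<in>S. ?t j)"
    define G where "G = (\<Oplus>j\<in>S. ?w j)"
    have Fc: "F \<in> carrier (PR ?V)" unfolding F_def using insert gc by (intro T.finsum_closed) auto
    have Gc: "G \<in> carrier R" unfolding G_def using insert gc by (intro finsum_closed) auto
    have F: "(\<Oplus>\<^bsub>PR ?V\<^esub>j\<in>insert j S. ?t j) = ?t j \<oplus>\<^bsub>PR ?V\<^esub> F"
      unfolding F_def using insert gc by (intro T.finsum_insert) auto
    have G: "(\<Oplus>j\<in>insert j S. ?w j) = ?w j \<oplus> G"
      unfolding G_def using insert gc by (intro finsum_insert) auto
    have IH: "F \<otimes>\<^bsub>PR ?V\<^esub> ?S \<ominus>\<^bsub>PR ?V\<^esub> indexed_const (G \<otimes> s) \<in> ?N \<cdot>\<^bsub>PR ?V\<^esub> E"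
      unfolding F_def G_def using insert by simp
    let ?X = "indexed_var (j, l)" and ?Y = "indexed_const (y (j, l))" and ?gj = "indexed_const (g j)"
    have Xc: "?X \<in> carrier (PR ?V)" using j l by (intro PR_var_closed) auto
    have Yc: "?Y \<in> carrier (PR ?V)" "?gj \<in> carrier (PR ?V)" using y gc(1)[OF j] by simp_all
    have "?X \<ominus>\<^bsub>PR ?V\<^esub> ?Y \<in> ?N" using Xc Yc y by (simp add: a_minus_def r_neg)
    moreover have "?gj \<otimes>\<^bsub>PR ?V\<^esub> ?S \<in> E" using E(2)[OF j] c.hom_mult[OF gc(1)[OF j] s] by simp
    ultimately have new: "(?X \<ominus>\<^bsub>PR ?V\<^esub> ?Y) \<otimes>\<^bsub>PR ?V\<^esub> (?gj \<otimes>\<^bsub>PR ?V\<^esub> ?S) \<in> ?N \<cdot>\<^bsub>PR ?V\<^esub> E"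
      by (rule ideal_prod.prod)
    have e: "indexed_const ((?w j \<oplus> G) \<otimes> s) = (?Y \<otimes>\<^bsub>PR ?V\<^esub> ?gj \<oplus>\<^bsub>PR ?V\<^esub> indexed_const G) \<otimes>\<^bsub>PR ?V\<^esub> ?S"
      "indexed_const (G \<otimes> s) = indexed_const G \<otimes>\<^bsub>PR ?V\<^esub> ?S"
      using s Gc y gc[OF j] by simp_all
    show ?case unfolding F G e(1) T.add_mult_diff[OF Xc Yc sc Fc PR_const_closed[OF Gc]]
      using T.ideal_add_closed[OF NE new] IH e(2) by simp
  qed
  from this[of "{1..n}"] show ?thesis unfolding gform_def gvalue_def by simp
qed

end

text \<open>The dimension appears as the exponent \<open>d\<close> in the limit, and the
  Cohen-Macaulay property as a regular flag of length \<open>d\<close> inside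
  \<open>M\<close>.\<close>

locale generic_reductions = local_noetherian_ring +
  fixes I :: "'a set" and n d e :: nat and g :: "nat \<Rightarrow> 'a" and A :: "nat \<Rightarrow> 'a set" and z :: "nat \<Rightarrow> 'a"
  assumes residue_infinite: "infinite (carrier (R Quot M))"
    and g: "g \<in> {1..n} \<rightarrow> carrier R" and I_eq: "I = Idl (g ` {1..n})" and I_sub_M: "I \<subseteq> M"
    and M_nilpotent: "m \<in> M \<Longrightarrow> \<exists>N::nat. m [^] N \<in> I"
    and multiplicity: "(\<lambda>k. fact d * real (the_enat (ring_length (R Quot ipow I k))) / real k ^ d) \<longlonglongrightarrow> real e"
    and flag: "regular_flag A z d" "A 0 = {\<zero>}" and flag_in_M: "i < d \<Longrightarrow> z i \<in> M"
begin

abbreviation V :: "(nat \<times> nat) set" where "V \<equiv> {1..n} \<times> {1..d}"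
abbreviation T where "T \<equiv> PR V"
abbreviation \<B> where "\<B> \<equiv> generic_ideal R n g d"
abbreviation spec where "spec y \<equiv> Idl (gvalue n g y ` {1..d})"

lemma I_ideal: "ideal I R"
  unfolding I_eq using g by (intro genideal_ideal) auto

lemma g_in_I: "j \<in> {1..n} \<Longrightarrow> g j \<in> I"
  unfolding I_eq by (rule subsetD[OF genideal_self imageI]) (use g in auto)

lemma I_reduction: "reduction R I I"
  unfolding reduction_iff using I_ideal ipow_Suc'[OF I_ideal, of 0] by blast

lemma spec_ideal: "(\<And>i. y i \<in> carrier R) \<Longrightarrow> ideal (spec y) R"
  using gvalue_closed[OF g] by (intro genideal_ideal) auto

lemma spec_subset_I: "(\<And>i. y i \<in> carrier R) \<Longrightarrow> spec y \<subseteq> I"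
  using gvalue_in_Idl[OF g] I_eq by (intro genideal_minimal[OF I_ideal]) auto

lemma exists_generic_reduction:
  assumes J: "reduction R I J"
  shows "\<exists>y. (\<forall>i. y i \<in> carrier R) \<and> reduction R I (spec y) \<and> spec y \<subseteq> J"
proof -
  have J': "ideal J R" "J \<subseteq> I" using J by (auto simp: reduction_iff)
  obtain Z where Z: "finite Z" "Z \<subseteq> carrier R" "J = Idl Z" using ideal_finite_generators[OF J'(1)] .
  obtain h :: "nat \<Rightarrow> 'a" and m where h: "Z = h ` {i. i < m}"
    using finite_imp_nat_seg_image_inj_on[OF Z(1)] by auto
  define a where "a = (\<lambda>i. if i < m then h i else \<zero>)"
  have aZ: "a ` {i. i < m} = Z" unfolding h a_def by auto
  have "a i \<in> I" for i
    using genideal_self[OF Z(2)] Z(3) J'(2) ideal_zero_closed[OF I_ideal] h by (auto simp: a_def)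
  moreover have "reduction R I (Idl (a ` {i. i < m}))" using J Z(3) aZ by simp
  ultimately obtain A' :: "nat set" and a' where A': "finite A'" "card A' \<le> d" "\<And>i. a' i \<in> I"
    "reduction R I (Idl (a' ` A'))" "Idl (a' ` A') \<subseteq> J"
    using exists_small_reduction[OF residue_infinite I_ideal I_sub_M M_nilpotent multiplicity, of "{i. i < m}" a]
      Z(3) aZ by auto
  obtain b where b: "bij_betw b {1..card A'} A'" using ex_bij_betw_nat_finite_1[OF A'(1)] by blast
  \<comment> \<open>Padding with zeros brings the number of generators to exactly \<open>d\<close>,
    one for each generic form; their coefficients on the \<open>g j\<close> will be the coordinates
    of the point.\<close>
  define c where "c = (\<lambda>l. if l \<le> card A' then a' (b l) else \<zero>)"
  have cI: "c l \<in> I" for l using A'(3) ideal_zero_closed[OF I_ideal] by (simp add: c_def)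
  have a'c: "a' ` A' \<subseteq> carrier R" using A'(3) ideal_carrier[OF I_ideal] by auto
  have cc: "c ` {1..d} \<subseteq> carrier R" using cI ideal_carrier[OF I_ideal] by auto
  have "Idl (c ` {1..d}) = Idl (a' ` A')"
  proof
    have "c l \<in> Idl (a' ` A')" if "l \<in> {1..d}" for l
    proof (cases "l \<le> card A'")
      case True
      then have "b l \<in> A'" using b that by (auto simp: bij_betw_def)
      then show ?thesis using genideal_self[OF a'c] True by (auto simp: c_def)
    qed (simp add: c_def ideal_zero_closed[OF genideal_ideal[OF a'c]])
    then show "Idl (c ` {1..d}) \<subseteq> Idl (a' ` A')" by (intro genideal_minimal[OF genideal_ideal[OF a'c]]) auto
    have "a' i \<in> Idl (c ` {1..d})" if "i \<in> A'" for i
    proof -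
      have "i \<in> b ` {1..card A'}" using bij_betw_imp_surj_on[OF b] that by simp
      then obtain l where "l \<in> {1..card A'}" "i = b l" by (elim imageE)
      then have "a' i = c l" "l \<in> {1..d}" using A'(2) by (auto simp: c_def)
      then show ?thesis using genideal_self[OF cc] by auto
    qed
    then show "Idl (a' ` A') \<subseteq> Idl (c ` {1..d})" by (intro genideal_minimal[OF genideal_ideal[OF cc]]) auto
  qed
  moreover have "\<forall>l. \<exists>w. (\<forall>i. w i \<in> carrier R) \<and> c l = (\<Oplus>i\<in>{1..n}. w i \<otimes> g i)"
    using Idl_image_finsum[OF finite_atLeastAtMost g] cI unfolding I_eq by blast
  then obtain w where w: "\<And>l i. w l i \<in> carrier R" "\<And>l. c l = (\<Oplus>i\<in>{1..n}. w l i \<otimes> g i)"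
    by (auto dest!: choice)
  moreover have "gvalue n g (\<lambda>(j, l). w l j) = c" by (simp add: gvalue_def w(2) fun_eq_iff)
  ultimately show ?thesis using A'(4,5) by (intro exI[of _ "\<lambda>(j, l). w l j"]) auto
qed

lemma power_in_core:
  assumes f: "f \<in> M"
  shows "f [^] e \<in> core R I"
  unfolding core_def
proof (intro InterI, clarify)
  fix J assume "reduction R I J"
  then obtain y where y: "\<And>i. y i \<in> carrier R" "reduction R I (spec y)" "spec y \<subseteq> J"
    using exists_generic_reduction by blast
  have "f [^] e \<in> spec y"
  proof (rule ccontr)
    assume "f [^] e \<notin> spec y"
    then have "length_ge (spec y) (carrier R) (Suc e)"
      by (rule length_ge_of_power_notin[OF spec_ideal[OF y(1)] f])
    then have "real (Suc e) \<le> real e"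
      using length_le_multiplicity[OF I_ideal M_nilpotent multiplicity flag flag_in_M, of "{1..d}" "gvalue n g y" "Suc e"]
        gvalue_closed[OF g, where y = y, OF y(1)] y(2) by simp
    then show False by simp
  qed
  then show "f [^] e \<in> J" using y(3) by blast
qed

text \<open>The part of the generic ideal whose value at \<open>y\<close> lies in \<open>spec y\<close> times \<open>I\<close> to the power \<open>r\<close>.\<close>

definition specW :: "nat \<Rightarrow> ((nat \<times> nat) multiset \<Rightarrow> 'a) set" where
  "specW r = Idl\<^bsub>T\<^esub> {gform n d g l \<otimes>\<^bsub>T\<^esub> indexed_const s | l s. l \<in> {1..d} \<and> s \<in> ipow I r}"

lemma specW_gens_closed:
  "{gform n d g l \<otimes>\<^bsub>T\<^esub> indexed_const s | l s. l \<in> {1..d} \<and> s \<in> ipow I r} \<subseteq> carrier T"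
proof -
  interpret T: cring T by (rule PR_cring)
  have "s \<in> carrier R" if "s \<in> ipow I r" for s using that ideal_carrier[OF ipow_ideal[OF I_ideal]] by blast
  then show ?thesis using gform_closed[OF g] by auto
qed

lemma specW_ideal: "ideal (specW r) T"
proof -
  interpret T: cring T by (rule PR_cring)
  show ?thesis unfolding specW_def by (rule T.genideal_ideal[OF specW_gens_closed])
qed

lemma specW_minimal:
  assumes "ideal L T"
    and "\<And>l s. l \<in> {1..d} \<Longrightarrow> s \<in> ipow I r \<Longrightarrow> gform n d g l \<otimes>\<^bsub>T\<^esub> indexed_const s \<in> L"
  shows "specW r \<subseteq> L"
proof -
  interpret T: cring T by (rule PR_cring)
  show ?thesis unfolding specW_def by (rule T.genideal_minimal[OF assms(1)]) (use assms(2) in blast)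
qed

lemma specW_subset: "specW r \<subseteq> \<B>"
proof (rule specW_minimal[OF generic_ideal_ideal[OF g]])
  fix l s assume l: "l \<in> {1..d}" and s: "s \<in> ipow I r"
  have "s \<in> carrier R" using s ideal_carrier[OF ipow_ideal[OF I_ideal]] by blast
  then show "gform n d g l \<otimes>\<^bsub>T\<^esub> indexed_const s \<in> \<B>"
    using ideal.I_r_closed[OF generic_ideal_ideal[OF g] gform_in_generic_ideal[OF g l] PR_const_closed] by blast
qed

lemma peval_specW:
  assumes y: "\<And>i. y i \<in> carrier R" and P: "P \<in> specW r"
  shows "peval y P \<in> spec y \<cdot> ipow I r"
proof -
  interpret h: ring_hom_cring T R "peval y" by (rule peval_ring_hom_cring[OF y])
  have K: "ideal (spec y \<cdot> ipow I r) R" by (rule ideal_prod_is_ideal[OF spec_ideal[OF y] ipow_ideal[OF I_ideal]])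
  have "specW r \<subseteq> {P \<in> carrier T. peval y P \<in> spec y \<cdot> ipow I r}"
  proof (rule specW_minimal[OF peval_vimage_ideal[OF K y]])
    fix l s assume l: "l \<in> {1..d}" and s: "s \<in> ipow I r"
    have sc: "s \<in> carrier R" using s ideal_carrier[OF ipow_ideal[OF I_ideal]] by blast
    have bc: "gform n d g l \<in> carrier T" by (rule gform_closed[OF g l])
    have "gvalue n g y l \<in> spec y" by (rule subsetD[OF genideal_self imageI[OF l]]) (use gvalue_closed[OF g, where y = y] y in auto)
    then have "gvalue n g y l \<otimes> s \<in> spec y \<cdot> ipow I r" using s by (rule ideal_prod.prod)
    then show "gform n d g l \<otimes>\<^bsub>T\<^esub> indexed_const s \<in> {P \<in> carrier T. peval y P \<in> spec y \<cdot> ipow I r}"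
      using bc sc peval_gform[OF g l y] y by simp
  qed
  then show ?thesis using P by blast
qed

text \<open>With \<open>N\<close> the kernel of evaluation at \<open>y\<close>, the equation
  \<open>I^(r+1) = spec y I^r\<close> puts the constants from \<open>I^(r+1)\<close> into
  \<open>specW r\<close> plus \<open>N\<close> times their own extension, which is Nakayama's
  hypothesis. Landing in \<open>specW r\<close>, and not just in \<open>\<B>\<close>, lets the same
  \<open>u\<close> certify reductions at other points.\<close>

lemma exists_specialisation_witness:
  assumes y: "\<And>i. y i \<in> carrier R" and r: "ipow I (Suc r) = spec y \<cdot> ipow I r"
  shows "\<exists>u\<in>carrier T. peval y u = \<one> \<and> (\<forall>a\<in>ipow I (Suc r). u \<otimes>\<^bsub>T\<^esub> indexed_const a \<in> specW r)"
proof -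
  interpret T: cring T by (rule PR_cring)
  interpret h: ring_hom_cring T R "peval y" by (rule peval_ring_hom_cring[OF y])
  note W = specW_ideal[of r]
  have Ir: "ideal (ipow I r) R" by (rule ipow_ideal[OF I_ideal])
  have sc: "s \<in> carrier R" if "s \<in> ipow I r" for s using that ideal_carrier[OF Ir] by blast
  have vc: "gvalue n g y ` {1..d} \<subseteq> carrier R" using gvalue_closed[OF g y] by auto
  obtain Z where Z: "finite Z" "Z \<subseteq> carrier R" "ipow I (Suc r) = Idl Z"
    using ideal_finite_generators[OF ipow_ideal[OF I_ideal]] .
  let ?E = "Idl\<^bsub>T\<^esub> (indexed_const ` Z)" and ?N = "{P \<in> carrier T. peval y P \<in> {\<zero>}}"
  have Zc: "indexed_const ` Z \<subseteq> carrier T" using Z(2) by auto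
  have E: "ideal ?E T" by (rule T.genideal_ideal[OF Zc])
  have N: "ideal ?N T" by (rule peval_vimage_ideal[OF zeroideal y])
  have NE: "ideal (?N \<cdot>\<^bsub>T\<^esub> ?E) T" by (rule T.ideal_prod_is_ideal[OF N E])
  have X: "ideal (specW r <+>\<^bsub>T\<^esub> ?N \<cdot>\<^bsub>T\<^esub> ?E) T" by (rule T.add_ideals[OF W NE])
  have "Idl Z \<subseteq> {c \<in> carrier R. indexed_const c \<in> ?E}"
    using T.genideal_self[OF Zc] Z(2) by (intro genideal_minimal[OF const_vimage_ideal[OF E]]) auto
  then have gE: "indexed_const (g j \<otimes> s) \<in> ?E" if "j \<in> {1..n}" "s \<in> ipow I r" for j s
    using ideal_prod.prod[OF g_in_I that(2)] that(1) ipow_Suc'[OF I_ideal] Z(3) by blast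
  have "spec y \<cdot> ipow I r \<subseteq> {c \<in> carrier R. indexed_const c \<in> specW r <+>\<^bsub>T\<^esub> ?N \<cdot>\<^bsub>T\<^esub> ?E}"
  proof (rule Idl_prod_subset[OF const_vimage_ideal[OF X] vc ideal_carrier[OF Ir]])
    fix v s assume v: "v \<in> gvalue n g y ` {1..d}" and s: "s \<in> ipow I r"
    obtain l where l: "l \<in> {1..d}" "v = gvalue n g y l" using v by blast
    let ?b = "gform n d g l \<otimes>\<^bsub>T\<^esub> indexed_const s" and ?v = "indexed_const (v \<otimes> s)"
    have bc: "?b \<in> carrier T" using gform_closed[OF g l(1)] sc[OF s] by simp
    have vs: "v \<otimes> s \<in> carrier R" "?v \<in> carrier T" using v vc sc[OF s] by auto
    have "?b \<in> specW r" unfolding specW_def using T.genideal_self[OF specW_gens_closed] l(1) s by blast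
    moreover have "\<ominus>\<^bsub>T\<^esub> (?b \<ominus>\<^bsub>T\<^esub> ?v) \<in> ?N \<cdot>\<^bsub>T\<^esub> ?E"
      using T.ideal_uminus_closed[OF NE gform_const_congruence[OF g l(1) y sc[OF s] E gE[OF _ s]]] l(2) by simp
    moreover have "?v = ?b \<oplus>\<^bsub>T\<^esub> \<ominus>\<^bsub>T\<^esub> (?b \<ominus>\<^bsub>T\<^esub> ?v)" by (rule T.diff_diff[OF bc vs(2), symmetric])
    ultimately show "v \<otimes> s \<in> {c \<in> carrier R. indexed_const c \<in> specW r <+>\<^bsub>T\<^esub> ?N \<cdot>\<^bsub>T\<^esub> ?E}"
      using vs(1) unfolding set_add_def' by blast
  qed
  then have "c \<in> specW r <+>\<^bsub>T\<^esub> ?N \<cdot>\<^bsub>T\<^esub> ?E" if "c \<in> indexed_const ` Z" for c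
    using that genideal_self[OF Z(2)] r Z(3) by blast
  then obtain u where u: "u \<in> carrier T" "u \<ominus>\<^bsub>T\<^esub> \<one>\<^bsub>T\<^esub> \<in> ?N" "\<And>c. c \<in> indexed_const ` Z \<Longrightarrow> u \<otimes>\<^bsub>T\<^esub> c \<in> specW r"
    using T.nakayama[OF N W finite_imageI[OF Z(1)] Zc] by blast
  have "peval y (u \<ominus>\<^bsub>T\<^esub> \<one>\<^bsub>T\<^esub>) = peval y u \<ominus> \<one>" using u(1) by (simp add: a_minus_def)
  then have "peval y u = \<one>" using u(1,2) by simp
  have C: "ideal {c \<in> carrier R. indexed_const c \<in> {x \<in> carrier T. x \<otimes>\<^bsub>T\<^esub> u \<in> specW r}} R"
    by (rule const_vimage_ideal[OF T.colon_ideal[OF W u(1)]])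
  have "Idl Z \<subseteq> {c \<in> carrier R. indexed_const c \<in> {x \<in> carrier T. x \<otimes>\<^bsub>T\<^esub> u \<in> specW r}}"
  proof (rule genideal_minimal[OF C], clarify)
    fix c assume c: "c \<in> Z"
    then have cc: "c \<in> carrier R" "indexed_const c \<in> carrier T" using Z(2) by auto
    show "c \<in> carrier R \<and> indexed_const c \<in> {x \<in> carrier T. x \<otimes>\<^bsub>T\<^esub> u \<in> specW r}"
      using u(3)[of "indexed_const c"] T.m_comm[OF u(1) cc(2)] c cc by simp
  qed
  then have "u \<otimes>\<^bsub>T\<^esub> indexed_const a \<in> specW r" if "a \<in> ipow I (Suc r)" for a
    using that T.m_comm[OF u(1), of "indexed_const a"] unfolding Z(3) by auto
  then show ?thesis using u(1) \<open>peval y u = \<one>\<close> by blast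
qed

text \<open>Being a reduction is an open condition on the point: evaluating the witness at
  \<open>x\<close> puts \<open>peval x u \<otimes> a\<close> into
  \<open>spec x \<cdot> ipow I r\<close>, with a unit in front of \<open>a\<close>.\<close>

lemma reduction_at_good_point:
  assumes u: "u \<in> carrier T" "\<And>a. a \<in> ipow I (Suc r) \<Longrightarrow> u \<otimes>\<^bsub>T\<^esub> indexed_const a \<in> specW r"
    and x: "\<And>i. x i \<in> carrier R" and ux: "peval x u \<notin> M"
  shows "reduction R I (spec x)"
proof -
  interpret h: ring_hom_cring T R "peval x" by (rule peval_ring_hom_cring[OF x])
  have K: "ideal (spec x \<cdot> ipow I r) R" by (rule ideal_prod_is_ideal[OF spec_ideal[OF x] ipow_ideal[OF I_ideal]])
  have uc: "peval x u \<in> carrier R" using u(1) by simp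
  then have uU: "peval x u \<in> Units R" using unit_iff_notin_M ux by blast
  have "a \<in> spec x \<cdot> ipow I r" if a: "a \<in> ipow I (Suc r)" for a
  proof -
    have ac: "a \<in> carrier R" using a ideal_carrier[OF ipow_ideal[OF I_ideal]] by blast
    have "peval x u \<otimes> a \<in> spec x \<cdot> ipow I r"
      using peval_specW[where y = x, OF x u(2)[OF a]] u(1) ac x by simp
    then have "inv (peval x u) \<otimes> (peval x u \<otimes> a) \<in> spec x \<cdot> ipow I r"
      using ideal.I_l_closed[OF K] uU by simp
    then show ?thesis using uU uc ac by (simp flip: m_assoc)
  qed
  moreover have "spec x \<cdot> ipow I r \<subseteq> ipow I (Suc r)"
    using ideal_prod_mono[OF spec_subset_I[OF x] order_refl] ipow_Suc'[OF I_ideal] by simp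
  ultimately show ?thesis unfolding reduction_iff using spec_ideal[of x, OF x] spec_subset_I[of x, OF x] by blast
qed

end

section \<open>Regular flags from the depth\<close>

context local_noetherian_ring
begin

lemma regular_sequence_flag:
  assumes ys: "regular_sequence R ys" "set ys \<subseteq> M"
  shows "regular_flag (\<lambda>i. Idl (set (take i ys))) ((!) ys) (length ys)"
proof -
  have c: "set ys \<subseteq> carrier R" using ys(1) by (simp add: regular_sequence_def)
  have tc: "set (take i ys) \<subseteq> carrier R" for i using c set_take_subset by fast
  show ?thesis unfolding regular_flag_def
  proof (intro conjI allI impI ballI)
    fix i assume "i \<le> length ys"
    show "ideal (Idl (set (take i ys))) R" by (rule genideal_ideal[OF tc])
  next
    fix i assume i: "i < length ys"
    have s: "set (take (Suc i) ys) = insert (ys ! i) (set (take i ys))"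
      using i by (simp add: take_Suc_conv_app_nth)
    show "ys ! i \<in> Idl (set (take (Suc i) ys))" using genideal_self[OF tc[of "Suc i"]] s by auto
    show "Idl (set (take i ys)) \<subseteq> Idl (set (take (Suc i) ys))"
      using genideal_self[OF tc[of "Suc i"]] s by (intro genideal_minimal[OF genideal_ideal[OF tc]]) auto
    have yc: "ys ! i \<in> carrier R" using c i by (simp add: subsetD)
    fix x assume "x \<in> Idl (set (take (Suc i) ys))"
    then obtain q r where q: "q \<in> carrier R" "r \<in> Idl (set (take i ys))" "x = q \<otimes> ys ! i \<oplus> r"
      using Idl_insert_mem[OF tc yc] unfolding s by blast
    have rc: "r \<in> carrier R" using q(2) ideal_carrier[OF genideal_ideal[OF tc]] by blast
    have "x = r \<oplus> ys ! i \<otimes> q" unfolding q(3) using q(1) rc yc by (simp add: a_comm m_comm)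
    then show "\<exists>a\<in>Idl (set (take i ys)). \<exists>s\<in>carrier R. x = a \<oplus> ys ! i \<otimes> s" using q(1,2) by blast
  next
    fix i x assume "i < length ys" "x \<in> carrier R" "ys ! i \<otimes> x \<in> Idl (set (take i ys))"
    then show "x \<in> Idl (set (take i ys))" using ys(1) by (simp add: regular_sequence_def)
  qed
qed

lemma Idl_empty: "Idl {} = {\<zero>}"
  using genideal_minimal[OF zeroideal, of "{}"] ideal_zero_closed[OF genideal_ideal[of "{}"]] by auto

lemma exists_regular_flag:
  assumes "depth R M = enat d"
  shows "\<exists>A z. regular_flag A z d \<and> A 0 = {\<zero>} \<and> (\<forall>i<d. z i \<in> M)"
proof -
  \<comment> \<open>A supremum equal to 0 exhibits no sequence, so \<open>d = 0\<close> is kept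
    apart with the empty list; a positive finite supremum is attained.\<close>
  have "\<exists>ys. length ys = d \<and> (d = 0 \<or> regular_sequence R ys \<and> set ys \<subseteq> M)"
  proof (cases "d = 0")
    case False
    let ?S = "{enat (length xs) | xs. set xs \<subseteq> M \<and> regular_sequence R xs}"
    have "Sup ?S = enat d" using assms by (simp add: depth_def)
    then have "enat d \<in> ?S" using False Max_in[of ?S]
      by (auto simp: Sup_enat_def zero_enat_def split: if_splits)
    then show ?thesis by auto
  qed simp
  then obtain ys where ys: "length ys = d" "d = 0 \<or> regular_sequence R ys \<and> set ys \<subseteq> M" by blast
  have "regular_flag (\<lambda>i. Idl (set (take i ys))) ((!) ys) d"
  proof (cases "d = 0")
    case True
    then show ?thesis using zeroideal ys(1) by (simp add: regular_flag_def Idl_empty)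
  next
    case False
    then show ?thesis using regular_sequence_flag[of ys] ys by simp
  qed
  moreover have "\<forall>i<d. ys ! i \<in> M" using ys nth_mem[of _ ys] by force
  ultimately show ?thesis using Idl_empty
    by (intro exI[of _ "\<lambda>i. Idl (set (take i ys))"] exI[of _ "(!) ys"]) simp
qed

end

section \<open>The core as a contraction, and the double colon\<close>

context generic_reductions
begin

lemma core_imp_torsion:
  assumes a: "a \<in> core R I"
  shows "\<exists>v\<in>carrier T - coeff_ideal V M. v \<otimes>\<^bsub>T\<^esub> indexed_const a \<in> \<B>"
proof -
  interpret T: cring T by (rule PR_cring)
  note B = generic_ideal_ideal[OF g, of d]
  have aJ: "a \<in> J" if "reduction R I J" for J using a that by (auto simp: core_def)
  have ac: "a \<in> carrier R" using aJ[OF I_reduction] ideal_carrier[OF I_ideal] by blast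
  obtain y where y: "\<And>i. y i \<in> carrier R" "reduction R I (spec y)"
    using exists_generic_reduction[OF I_reduction] by blast
  obtain r where r: "ipow I (Suc r) = spec y \<cdot> ipow I r" using y(2) by (auto simp: reduction_iff)
  obtain u where u: "u \<in> carrier T" "peval y u = \<one>" "\<And>a. a \<in> ipow I (Suc r) \<Longrightarrow> u \<otimes>\<^bsub>T\<^esub> indexed_const a \<in> specW r"
    using exists_specialisation_witness[OF y(1) r] by blast
  have uM: "u \<in> carrier T - coeff_ideal V M"
    using u(1,2) peval_in_ideal[OF M_ideal, of u V y] y(1) M_proper by auto
  \<comment> \<open>This power serves two purposes: \<open>R\<close> modulo it has a composition
    series, so \<open>generic_membership\<close> applies to \<open>\<B>\<close> enlarged by its
    extension, and \<open>u\<close> carries that extension back into \<open>\<B>\<close>.\<close>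
  let ?K = "ipow I (Suc r)"
  have K: "ideal ?K R" by (rule ipow_ideal[OF I_ideal])
  have "\<exists>N::nat. m [^] N \<in> ?K" if m: "m \<in> M" for m
  proof -
    obtain N :: nat where "m [^] N \<in> I" using M_nilpotent[OF m] by blast
    then have "(m [^] N) [^] Suc r \<in> ?K" by (rule pow_mem_ipow[OF I_ideal])
    then show ?thesis using nat_pow_pow ideal.Icarr[OF M_ideal m] by metis
  qed
  then obtain ss where ss: "comp_series ?K ss" "lin ss ?K = carrier R" using exists_comp_series[OF K] by blast
  note cK = coeff_ideal_ideal[OF K, of V]
  let ?B = "\<B> <+>\<^bsub>T\<^esub> coeff_ideal V ?K"
  have B': "ideal ?B T" by (rule T.add_ideals[OF B cK])
  have KB: "coeff_ideal V ?K \<subseteq> ?B"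
  proof
    fix x assume x: "x \<in> coeff_ideal V ?K"
    then have "x = \<zero>\<^bsub>T\<^esub> \<oplus>\<^bsub>T\<^esub> x" using ideal.Icarr[OF cK] by simp
    then show "x \<in> ?B" unfolding set_add_def' using x T.ideal_zero_closed[OF B] by blast
  qed
  have full: "coeff_ideal V (carrier R) = carrier T" using PR_coeff[where V = V] by (auto simp: coeff_ideal_def)
  have pa: "indexed_const a \<in> carrier T" using ac by simp
  from generic_membership[OF K ss(1) B' KB, of "indexed_const a", unfolded ss(2) full, OF T.ideal_carrier[OF B'] pa]
  consider (mem) w where "w \<in> carrier T - coeff_ideal V M" "w \<otimes>\<^bsub>T\<^esub> indexed_const a \<in> ?B"
    | (gen) w where "w \<in> carrier T - coeff_ideal V M" "\<forall>x. (\<forall>i. x i \<in> carrier R) \<longrightarrow> peval x w \<notin> M \<longrightarrow>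
        (\<forall>b\<in>?B. peval x b \<noteq> peval x (indexed_const a))" by blast
  then show ?thesis
  proof cases
    case mem
    obtain b k where b: "b \<in> \<B>" "k \<in> coeff_ideal V ?K" "w \<otimes>\<^bsub>T\<^esub> indexed_const a = b \<oplus>\<^bsub>T\<^esub> k"
      using mem(2) unfolding set_add_def' by blast
    have bc: "b \<in> carrier T" "k \<in> carrier T" using b ideal.Icarr[OF B] ideal.Icarr[OF cK] by auto
    have "coeff_ideal V ?K \<subseteq> {x \<in> carrier T. x \<otimes>\<^bsub>T\<^esub> u \<in> \<B>}"
    proof (rule coeff_ideal_minimal[OF K T.colon_ideal[OF B u(1)]], clarify)
      fix c assume c: "c \<in> ?K"
      have cc: "indexed_const c \<in> carrier T" using ideal.Icarr[OF K c] by simp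
      show "indexed_const c \<in> carrier T \<and> indexed_const c \<otimes>\<^bsub>T\<^esub> u \<in> \<B>"
        using cc u(3)[OF c] specW_subset T.m_comm[OF cc u(1)] by auto
    qed
    then have "u \<otimes>\<^bsub>T\<^esub> k \<in> \<B>" using b(2) T.m_comm[OF u(1) bc(2)] by auto
    then have "u \<otimes>\<^bsub>T\<^esub> b \<oplus>\<^bsub>T\<^esub> u \<otimes>\<^bsub>T\<^esub> k \<in> \<B>" using T.ideal_add_closed[OF B] ideal.I_l_closed[OF B b(1) u(1)] by blast
    moreover have "(u \<otimes>\<^bsub>T\<^esub> w) \<otimes>\<^bsub>T\<^esub> indexed_const a = u \<otimes>\<^bsub>T\<^esub> b \<oplus>\<^bsub>T\<^esub> u \<otimes>\<^bsub>T\<^esub> k"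
      using T.m_assoc[OF u(1) _ PR_const_closed[OF ac]] mem(1) b(3) T.r_distr[OF bc u(1)] by simp
    ultimately have "(u \<otimes>\<^bsub>T\<^esub> w) \<otimes>\<^bsub>T\<^esub> indexed_const a \<in> \<B>" by simp
    then show ?thesis by (rule bexI[OF _ notin_coeff_ideal_M_mult[OF uM mem(1)]])
  next
    case gen
    \<comment> \<open>At a point where neither \<open>w\<close> nor \<open>u\<close> vanishes modulo
      \<open>M\<close>, \<open>spec x\<close> is a reduction and contains \<open>a\<close>; so
      \<open>a\<close> is the value of some \<open>b\<close> in \<open>\<B>\<close>, which the
      second alternative forbids.\<close>
    have wu: "w \<otimes>\<^bsub>T\<^esub> u \<in> carrier T - coeff_ideal V M" by (rule notin_coeff_ideal_M_mult[OF gen(1) uM])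
    then obtain m where "(w \<otimes>\<^bsub>T\<^esub> u) m \<notin> M" by (auto simp: coeff_ideal_def)
    then obtain x where x: "\<And>i. x i \<in> carrier R" "peval x (w \<otimes>\<^bsub>T\<^esub> u) \<notin> M"
      using exists_nonvanishing_point[OF M_prime residue_infinite, of V "w \<otimes>\<^bsub>T\<^esub> u"] wu
      by (metis DiffD1 finite_SigmaI finite_atLeastAtMost)
    have wT: "w \<in> carrier T" using gen(1) by blast
    have wc: "peval x w \<in> carrier R" "peval x u \<in> carrier R"
      by (rule peval_closed[OF wT x(1)]) (rule peval_closed[OF u(1) x(1)])
    have "peval x w \<otimes> peval x u \<notin> M" using x(2) unfolding peval_mult[OF wT u(1) x(1)] .
    then have nM: "peval x w \<notin> M" "peval x u \<notin> M"
      using ideal.I_l_closed[OF M_ideal] ideal.I_r_closed[OF M_ideal] wc by blast+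
    have "reduction R I (spec x)" by (rule reduction_at_good_point[OF u(1,3) x(1) nM(2)])
    then obtain b where b: "b \<in> \<B>" "peval x b = a" using exists_generic_lift[OF g, where y = x, OF x(1)] aJ by blast
    have "b = b \<oplus>\<^bsub>T\<^esub> \<zero>\<^bsub>T\<^esub>" using ideal.Icarr[OF B b(1)] by simp
    then have "b \<in> ?B" unfolding set_add_def' using b(1) T.ideal_zero_closed[OF cK] by blast
    then have "peval x b \<noteq> peval x (indexed_const a)" using gen(2) x(1) nM(1) by blast
    then show ?thesis using b(2) peval_const[where x = x, OF ac x(1)] by simp
  qed
qed

text \<open>In terms of primes: an associated prime of \<open>\<B>\<close> that contains
  \<open>I\<close> equals \<open>MT\<close>, so \<open>I\<close>-torsion modulo \<open>\<B>\<close>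
  has no torsion by elements outside \<open>MT\<close>.\<close>

lemma unmixed:
  assumes v: "v \<in> carrier T - coeff_ideal V M" and x: "x \<in> carrier T" "v \<otimes>\<^bsub>T\<^esub> x \<in> \<B>"
    and "\<And>j. j \<in> {1..n} \<Longrightarrow> \<exists>N::nat. indexed_const (g j) [^]\<^bsub>T\<^esub> N \<otimes>\<^bsub>T\<^esub> x \<in> \<B>"
  shows "x \<in> \<B>"
proof -
  obtain m0 where "v m0 \<notin> M" using v by (auto simp: coeff_ideal_def)
  then have "v m0 \<in> Units R" using unit_iff_notin_M v PR_coeff[where V = V] by auto
  then show ?thesis
    using generic_unmixed[OF g flag _ _ _ x assms(4)] M_nilpotent[OF flag_in_M] v unfolding I_eq by auto
qed

lemma torsion_imp_core:
  assumes a: "a \<in> carrier R" and v: "v \<in> carrier T - coeff_ideal V M" "v \<otimes>\<^bsub>T\<^esub> indexed_const a \<in> \<B>"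
  shows "a \<in> core R I"
  unfolding core_def
proof (intro InterI, clarify)
  fix J assume "reduction R I J"
  then obtain y where y: "\<And>i. y i \<in> carrier R" "reduction R I (spec y)" "spec y \<subseteq> J"
    using exists_generic_reduction by blast
  interpret T: cring T by (rule PR_cring)
  interpret h: ring_hom_cring T R "peval y" by (rule peval_ring_hom_cring[OF y(1)])
  note B = generic_ideal_ideal[OF g, of d]
  obtain r where r: "ipow I (Suc r) = spec y \<cdot> ipow I r" using y(2) by (auto simp: reduction_iff)
  obtain u where u: "u \<in> carrier T" "peval y u = \<one>" "\<And>a. a \<in> ipow I (Suc r) \<Longrightarrow> u \<otimes>\<^bsub>T\<^esub> indexed_const a \<in> specW r"
    using exists_specialisation_witness[OF y(1) r] by blast
  have ac: "indexed_const a \<in> carrier T" using a by simp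
  let ?P = "u \<otimes>\<^bsub>T\<^esub> indexed_const a"
  \<comment> \<open>\<open>v\<close> may vanish at \<open>y\<close> modulo \<open>M\<close>, so its
    relation is not evaluated there. Multiplying \<open>a\<close> by \<open>u\<close> makes it
    torsion for each \<open>g j\<close>, because \<open>u\<close> carries the power
    \<open>Suc r\<close> of \<open>g j\<close> into \<open>\<B>\<close>; then \<open>v\<close>
    cancels, and \<open>u\<close> has value 1 at \<open>y\<close>.\<close>
  have "?P \<in> \<B>"
  proof (rule unmixed[OF v(1)])
    have "v \<otimes>\<^bsub>T\<^esub> ?P = u \<otimes>\<^bsub>T\<^esub> (v \<otimes>\<^bsub>T\<^esub> indexed_const a)" using v(1) u(1) ac by (simp add: T.m_lcomm)
    then show "v \<otimes>\<^bsub>T\<^esub> ?P \<in> \<B>" using ideal.I_l_closed[OF B v(2) u(1)] by simp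
    fix j assume j: "j \<in> {1..n}"
    have gc: "g j \<in> carrier R" using funcset_mem[OF g j] .
    have pc: "indexed_const (g j [^] Suc r) \<in> carrier T" using gc by simp
    have "u \<otimes>\<^bsub>T\<^esub> indexed_const (g j [^] Suc r) \<in> \<B>"
      using u(3)[OF pow_mem_ipow[OF I_ideal g_in_I[OF j]]] specW_subset by blast
    then have "indexed_const a \<otimes>\<^bsub>T\<^esub> (u \<otimes>\<^bsub>T\<^esub> indexed_const (g j [^] Suc r)) \<in> \<B>"
      by (rule ideal.I_l_closed[OF B _ ac])
    moreover have "indexed_const a \<otimes>\<^bsub>T\<^esub> (u \<otimes>\<^bsub>T\<^esub> indexed_const (g j [^] Suc r))
        = indexed_const (g j) [^]\<^bsub>T\<^esub> Suc r \<otimes>\<^bsub>T\<^esub> ?P"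
      unfolding const_pow[OF gc] using ac u(1) pc by (simp only: T.m_ac T.m_closed)
    ultimately show "\<exists>N::nat. indexed_const (g j) [^]\<^bsub>T\<^esub> N \<otimes>\<^bsub>T\<^esub> ?P \<in> \<B>" by metis
  qed (use u(1) ac in simp)
  then have mem: "peval y ?P \<in> spec y" by (rule peval_generic_ideal[OF g y(1)])
  have "peval y ?P = a"
    unfolding h.hom_mult[OF u(1) ac] u(2) peval_const[OF a y(1)] by (rule l_one[OF a])
  with mem have "a \<in> spec y" by (simp only:)
  then show "a \<in> J" by (rule subsetD[OF y(3)])
qed

lemma pow_regular:
  assumes f: "f \<in> carrier R" "\<And>x. x \<in> carrier R \<Longrightarrow> f \<otimes> x = \<zero> \<Longrightarrow> x = \<zero>"
    and x: "x \<in> carrier R" "f [^] (k::nat) \<otimes> x = \<zero>"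
  shows "x = \<zero>"
  using x
proof (induction k arbitrary: x)
  case (Suc k)
  have "f [^] k \<otimes> (f \<otimes> x) = \<zero>" using Suc.prems f(1) by (simp add: m_assoc)
  then have "f \<otimes> x = \<zero>" by (rule Suc.IH[rotated]) (use f(1) Suc.prems(1) in simp)
  then show ?case by (rule f(2)[OF Suc.prems(1)])
qed simp

theorem core_eq:
  assumes f: "f \<in> M" "\<And>x. x \<in> carrier R \<Longrightarrow> f \<otimes> x = \<zero> \<Longrightarrow> x = \<zero>"
  shows "core R I = degree_zero_part R (colon T \<B> (colon T \<B> {indexed_const f [^]\<^bsub>T\<^esub> e}))"
proof -
  interpret T: cring T by (rule PR_cring)
  note B = generic_ideal_ideal[OF g, of d]
  have fc: "f \<in> carrier R" by (rule ideal.Icarr[OF M_ideal f(1)])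
  have F: "f [^] e \<in> carrier R" using fc by simp
  have reg: "x = \<zero>" if "x \<in> carrier R" "f [^] e \<otimes> x = \<zero>" for x
    by (rule pow_regular[OF fc _ that]) (rule f(2))
  have pow: "indexed_const f [^]\<^bsub>T\<^esub> e = indexed_const (f [^] e)" by (rule const_pow[OF fc])
  obtain u where u: "u \<in> carrier T - coeff_ideal V M" "u \<otimes>\<^bsub>T\<^esub> indexed_const (f [^] e) \<in> \<B>"
    using core_imp_torsion[OF power_in_core[OF f(1)]] by blast
  show ?thesis unfolding pow degree_zero_part_def colon_def
  proof (intro equalityI subsetI)
    fix a assume a: "a \<in> core R I"
    then have ac: "a \<in> carrier R" using I_reduction ideal_carrier[OF I_ideal] by (auto simp: core_def)
    obtain v where v: "v \<in> carrier T - coeff_ideal V M" "v \<otimes>\<^bsub>T\<^esub> indexed_const a \<in> \<B>"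
      using core_imp_torsion[OF a] by blast
    have cc: "indexed_const a \<in> carrier T" using ac by simp
    \<comment> \<open>\<open>t\<close> is torsion for each \<open>g j\<close> because its product
      with \<open>f^e\<close> is in \<open>\<B>\<close>; hence so is \<open>a t\<close>, while
      \<open>v\<close> carries \<open>a t\<close> into \<open>\<B>\<close>.\<close>
    have "indexed_const a \<otimes>\<^bsub>T\<^esub> t \<in> \<B>" if t: "t \<in> carrier T" "t \<otimes>\<^bsub>T\<^esub> indexed_const (f [^] e) \<in> \<B>" for t
    proof (rule unmixed[OF v(1)])
      have "v \<otimes>\<^bsub>T\<^esub> (indexed_const a \<otimes>\<^bsub>T\<^esub> t) = (v \<otimes>\<^bsub>T\<^esub> indexed_const a) \<otimes>\<^bsub>T\<^esub> t"
        using v(1) cc t(1) by (simp add: T.m_assoc)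
      then show "v \<otimes>\<^bsub>T\<^esub> (indexed_const a \<otimes>\<^bsub>T\<^esub> t) \<in> \<B>" using ideal.I_r_closed[OF B v(2) t(1)] by simp
      fix j assume j: "j \<in> {1..n}"
      obtain N :: nat where N: "indexed_const (g j) [^]\<^bsub>T\<^esub> N \<otimes>\<^bsub>T\<^esub> t \<in> \<B>"
        using generic_torsion[OF g j F reg t] by blast
      have pc: "indexed_const (g j) [^]\<^bsub>T\<^esub> N \<in> carrier T" using funcset_mem[OF g j] by simp
      have "indexed_const (g j) [^]\<^bsub>T\<^esub> N \<otimes>\<^bsub>T\<^esub> (indexed_const a \<otimes>\<^bsub>T\<^esub> t)
          = indexed_const a \<otimes>\<^bsub>T\<^esub> (indexed_const (g j) [^]\<^bsub>T\<^esub> N \<otimes>\<^bsub>T\<^esub> t)"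
        by (rule T.m_lcomm[OF pc cc t(1)])
      then show "\<exists>N::nat. indexed_const (g j) [^]\<^bsub>T\<^esub> N \<otimes>\<^bsub>T\<^esub> (indexed_const a \<otimes>\<^bsub>T\<^esub> t) \<in> \<B>"
        using ideal.I_l_closed[OF B N cc] by metis
    qed (use cc t(1) in simp)
    then show "a \<in> {a \<in> carrier R. indexed_const a \<in> {t \<in> carrier T.
        \<forall>s\<in>{t \<in> carrier T. \<forall>s\<in>{indexed_const (f [^] e)}. t \<otimes>\<^bsub>T\<^esub> s \<in> \<B>}. t \<otimes>\<^bsub>T\<^esub> s \<in> \<B>}}"
      using ac cc by simp
  next
    fix a assume a: "a \<in> {a \<in> carrier R. indexed_const a \<in> {t \<in> carrier T.
        \<forall>s\<in>{t \<in> carrier T. \<forall>s\<in>{indexed_const (f [^] e)}. t \<otimes>\<^bsub>T\<^esub> s \<in> \<B>}. t \<otimes>\<^bsub>T\<^esub> s \<in> \<B>}}"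
    then have ac: "a \<in> carrier R" "indexed_const a \<in> carrier T" by auto
    have uc: "u \<in> carrier T" using u(1) by simp
    \<comment> \<open>The multiplier \<open>u\<close> is itself an element of the inner colon, so
      the outer colon makes it a multiplier for \<open>a\<close>.\<close>
    have "indexed_const a \<otimes>\<^bsub>T\<^esub> u \<in> \<B>" using a u(2) uc by blast
    then have "u \<otimes>\<^bsub>T\<^esub> indexed_const a \<in> \<B>" using T.m_comm[OF ac(2) uc] by simp
    then show "a \<in> core R I" by (rule torsion_imp_core[OF ac(1) u(1)])
  qed
qed

end

theorem mainTheorem6:
  fixes R :: "('a, 'b) ring_scheme" and M I :: "'a set" and d e n :: nat
    and g :: "nat \<Rightarrow> 'a" and f :: 'a
  assumes "cohen_macaulay_local_ring R M"
    and "krull_dim R = enat d"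
    and "infinite (carrier (R Quot M))"
    and "primary_to R M I"
    and "has_multiplicity R I e"
    and "regular_element R f"
    and "g \<in> {1..n} \<rightarrow> carrier R"
    and "I = Idl\<^bsub>R\<^esub> (g ` {1..n})"
  defines "T \<equiv> generic_ring R n d"
    and "B \<equiv> generic_ideal R n g d"
  shows "core R I =
    degree_zero_part R (colon T B (colon T B {ring.indexed_const R f [^]\<^bsub>T\<^esub> e}))"
proof -
  have loc: "noetherian_local_ring R M" and dep: "depth R M = enat d"
    using assms(1,2) by (auto simp: cohen_macaulay_local_ring_def)
  interpret cring R using loc by (simp add: noetherian_local_ring_def)
  interpret local_noetherian_ring R M
    using loc unfolding noetherian_local_ring_def
    by (intro local_noetherian_ring.intro local_noetherian_ring_axioms.intro cring_axioms) blast+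
  have I: "ideal I R" "radical R I = M" "I \<noteq> carrier R"
    using assms(4) by (auto simp: primary_to_def primary_ideal_def)
  have I_sub: "I \<subseteq> M"
  proof
    fix a assume a: "a \<in> I"
    then have "a [^]\<^bsub>R\<^esub> (1::nat) \<in> I" "a \<in> carrier R" using ideal.Icarr[OF I(1)] by auto
    then show "a \<in> M" using I(2) unfolding radical_def by blast
  qed
  have nil: "\<exists>N::nat. m [^]\<^bsub>R\<^esub> N \<in> I" if "m \<in> M" for m using that I(2) by (auto simp: radical_def)
  have mult: "(\<lambda>k. fact d * real (the_enat (ring_length (R Quot ipow I k))) / real k ^ d) \<longlonglongrightarrow> real e"
    using assms(5) by (simp add: has_multiplicity_def Let_def assms(2) ipow_def)
  obtain A z where A: "regular_flag A z d" "A 0 = {\<zero>\<^bsub>R\<^esub>}" "\<And>i. i < d \<Longrightarrow> z i \<in> M"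
    using exists_regular_flag[OF dep] by blast
  interpret generic_reductions R M I n d e g A z
    by (intro generic_reductions.intro generic_reductions_axioms.intro local_noetherian_ring_axioms)
      (fact assms(3,7,8) I_sub nil mult A)+
  have f: "f \<in> carrier R" "Idl\<^bsub>R\<^esub> {f} \<noteq> carrier R" "\<And>x. x \<in> carrier R \<Longrightarrow> f \<otimes>\<^bsub>R\<^esub> x = \<zero>\<^bsub>R\<^esub> \<Longrightarrow> x = \<zero>\<^bsub>R\<^esub>"
    using assms(6) by (auto simp: regular_element_def regular_sequence_def Idl_empty)
  have "f \<in> M"
  proof (rule ccontr)
    assume "f \<notin> M"
    then have "f \<in> Units R" using unit_iff_notin_M f(1) by blast
    then have "\<one>\<^bsub>R\<^esub> \<in> Idl\<^bsub>R\<^esub> {f}"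
      using ideal.I_l_closed[OF genideal_ideal[of "{f}"], of f "inv\<^bsub>R\<^esub> f"] genideal_self[of "{f}"] f(1)
        Units_l_inv Units_inv_closed by (metis empty_subsetI insert_subset)
    then show False using f(1,2) ideal.one_imp_carrier[OF genideal_ideal[of "{f}"]] by simp
  qed
  then show ?thesis using core_eq f(3) by (simp add: T_def B_def generic_ring_def)
qed

end
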